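(* Let $H$ be a complex Hilbert space, $A:D(A)\subseteq H\to H$ maximal monotone and linear, and $c>0$. Let $C:[0,\infty)\to L(H)$ be weakly measurable with $t\mapsto\|C(t)\|$ measurable, and let $\nu_0>0$ with $\int_0^\infty\|C(t)\|e^{\nu_0t}\,\mathrm{d}t<1$. Assume (1) $C(t)$ is selfadjoint for a.e. $t$; (2) $C(t)$ and $C(s)$ commute for a.e. $t,s$; (3) $t\,\operatorname{Im}\hat C(t+\mathrm{i}\nu_0)\le0$ for all $t\in\mathbb{R}$. Let $\nu_1\in(0,\nu_0]$ satisfy $$\nu_1\Big(1-\int_0^\infty\|C(s)\|e^{\nu_1s}\,\mathrm{d}s\Big)^{-1}\le c.$$ Then for each $\rho>0$ the operator $\partial_{0,\rho}(1-C* )^{-1}+c+A$ on $H_{\rho,0}(\mathbb{R};H)$ has a boundedly invertible closure, and the solution operator $\big(\overline{\partial_{0,\rho}(1-C* )^{-1}+c+A}\big)^{-1}$ is exponentially stable with stability rate $\nu_1$.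
   Context: $\hat C(z):=\frac{1}{\sqrt{2\pi}}\int_0^\infty e^{-\mathrm{i}tz}C(t)\,\mathrm{d}t$ (weak integral) for $\operatorname{Im}z\le\nu_0$; $\operatorname{Im}T=\frac{1}{2\mathrm{i}}(T-T^* )$, and $S\le0$ for selfadjoint $S$ means $\langle Sx|x\rangle\le0$ for all $x$. $H_{\rho,0}(\mathbb{R};H)$ is the Hilbert space of (classes of) measurable $f:\mathbb{R}\to H$ with $\int|f(t)|^2e^{-2\rho t}\,\mathrm{d}t<\infty$; $\partial_{0,\rho}$ is the closure in it of the derivative on $C_c^\infty(\mathbb{R};H)$; $A$ and $c$ act pointwise in time. $C*$ denotes the convolution operator $u\mapsto\big(t\mapsto\int_{\mathbb{R}}C(t-s)u(s)\,\mathrm{d}s\big)$ (with $C(t)=0$ for $t<0$), which for $\rho\ge-\nu_0$ extends from simple functions to a bounded operator on $H_{\rho,0}(\mathbb{R};H)$ of norm at most $\int_0^\infty\|C(t)\|e^{\nu_0t}\,\mathrm{d}t<1$, so that $1-C*$ is boundedly invertible there. A solution operator $S_\rho\in L(H_{\rho,0}(\mathbb{R};H))$ is exponentially stable with stability rate $\nu_1>0$ if for each $0\le\nu<\nu_1$ and each $f\in H_{-\nu,0}(\mathbb{R};H)\cap H_{\rho,0}(\mathbb{R};H)$ one has $S_\rho f\in\bigcap_{-\nu<\mu\le\rho}H_{\mu,0}(\mathbb{R};H)$. *)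

theory Defs
  imports "HOL-Analysis.Analysis" "HOL-Library.Complex_Order"
begin

text \<open>HOL has no complex vector spaces; a complex Hilbert space is a real Banach space
  with a compatible complex scalar multiplication and a complex inner product (linear in
  the first argument) inducing the norm.\<close>

class chilbert = banach +
  fixes cscale :: "complex \<Rightarrow> 'a \<Rightarrow> 'a"  (infixr \<open>*\<^sub>C\<close> 75)
    and cinner :: "'a \<Rightarrow> 'a \<Rightarrow> complex"
  assumes cscale_of_real: "complex_of_real r *\<^sub>C x = r *\<^sub>R x"
    and cscale_add_right: "a *\<^sub>C (x + y) = a *\<^sub>C x + a *\<^sub>C y"
    and cscale_add_left: "(a + b) *\<^sub>C x = a *\<^sub>C x + b *\<^sub>C x"
    and cscale_cscale: "a *\<^sub>C (b *\<^sub>C x) = (a * b) *\<^sub>C x"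
    and cinner_commute: "cinner y x = cnj (cinner x y)"
    and cinner_add_left: "cinner (x + y) z = cinner x z + cinner y z"
    and cinner_cscale_left: "cinner (a *\<^sub>C x) y = a * cinner x y"
    and norm_cinner: "norm x = sqrt (Re (cinner x x))"

instantiation complex :: chilbert
begin
definition cscale_complex :: "complex \<Rightarrow> complex \<Rightarrow> complex" where "cscale_complex a x = a * x"
definition cinner_complex :: "complex \<Rightarrow> complex \<Rightarrow> complex" where "cinner_complex x y = x * cnj y"
instance
  by standard (auto simp: cscale_complex_def cinner_complex_def scaleR_conv_of_real
      algebra_simps complex_norm_square[symmetric])
end

definition bounded_clinear_op :: "('a::chilbert \<Rightarrow> 'a) \<Rightarrow> bool" where
  "bounded_clinear_op T \<longleftrightarrow> (\<forall>x y. T (x + y) = T x + T y) \<and> (\<forall>a x. T (a *\<^sub>C x) = a *\<^sub>C T x)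
     \<and> (\<exists>K. \<forall>x. norm (T x) \<le> K * norm x)"

definition selfadjoint_op :: "('a::chilbert \<Rightarrow> 'a) \<Rightarrow> bool" where
  "selfadjoint_op T \<longleftrightarrow> (\<forall>x y. cinner (T x) y = cinner x (T y))"

definition adjoint_op :: "('a::chilbert \<Rightarrow> 'a) \<Rightarrow> ('a \<Rightarrow> 'a)" where
  "adjoint_op T = (THE S. \<forall>x y. cinner (T x) y = cinner x (S y))"

definition Im_op :: "('a::chilbert \<Rightarrow> 'a) \<Rightarrow> ('a \<Rightarrow> 'a)" where
  "Im_op T = (\<lambda>x. (1 / (2 * \<i>)) *\<^sub>C (T x - adjoint_op T x))"

text \<open>\<open>S \<le> 0\<close> for a selfadjoint operator: \<open>\<langle>Sx|x\<rangle> \<le> 0\<close> for all \<open>x\<close>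
  (order on complex numbers from Complex_Order).\<close>
definition nonpos_op :: "('a::chilbert \<Rightarrow> 'a) \<Rightarrow> bool" where
  "nonpos_op S \<longleftrightarrow> (\<forall>x. cinner (S x) x \<le> 0)"

definition monotone_rel :: "('a::chilbert \<times> 'a) set \<Rightarrow> bool" where
  "monotone_rel B \<longleftrightarrow> (\<forall>(x,u)\<in>B. \<forall>(y,v)\<in>B. 0 \<le> Re (cinner (u - v) (x - y)))"

definition maximal_monotone_linear :: "'a::chilbert set \<Rightarrow> ('a \<Rightarrow> 'a) \<Rightarrow> bool" where
  "maximal_monotone_linear D A \<longleftrightarrow>
     0 \<in> D \<and> (\<forall>x\<in>D. \<forall>y\<in>D. \<forall>a b. a *\<^sub>C x + b *\<^sub>C y \<in> D \<and> A (a *\<^sub>C x + b *\<^sub>C y) = a *\<^sub>C A x + b *\<^sub>C A y)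
     \<and> monotone_rel {(x, A x) | x. x \<in> D}
     \<and> (\<forall>B. monotone_rel B \<and> {(x, A x) | x. x \<in> D} \<subseteq> B \<longrightarrow> B = {(x, A x) | x. x \<in> D})"

definition weak_integral :: "real set \<Rightarrow> (real \<Rightarrow> 'a::chilbert) \<Rightarrow> 'a" where
  "weak_integral S g = (THE y. \<forall>z. cinner y z = (LINT s:S|lebesgue. cinner (g s) z))"

definition Chat :: "(real \<Rightarrow> 'a::chilbert \<Rightarrow> 'a) \<Rightarrow> complex \<Rightarrow> ('a \<Rightarrow> 'a)" where
  "Chat C z = (\<lambda>x. (1 / complex_of_real (sqrt (2 * pi))) *\<^sub>C
       weak_integral {0..} (\<lambda>t. exp (- \<i> * complex_of_real t * z) *\<^sub>C C t x))"

definition Cz :: "(real \<Rightarrow> 'a::chilbert \<Rightarrow> 'a) \<Rightarrow> real \<Rightarrow> 'a \<Rightarrow> 'a" where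
  "Cz C t = (if t < 0 then (\<lambda>x. 0) else C t)"

definition simple_fn :: "(real \<Rightarrow> 'a::chilbert) \<Rightarrow> bool" where
  "simple_fn u \<longleftrightarrow> finite (range u) \<and> (\<forall>x. u -` {x} \<in> sets lebesgue)"

definition strongly_measurable :: "(real \<Rightarrow> 'a::chilbert) \<Rightarrow> bool" where
  "strongly_measurable f \<longleftrightarrow>
     (\<exists>s. (\<forall>n. simple_fn (s n)) \<and> (AE t in lebesgue. (\<lambda>n. s n t) \<longlonglongrightarrow> f t))"

definition L2w :: "real \<Rightarrow> (real \<Rightarrow> 'a::chilbert) set" where
  "L2w \<rho> = {f. strongly_measurable f \<and>
      (\<integral>\<^sup>+ t. ennreal ((norm (f t))\<^sup>2 * exp (- 2 * \<rho> * t)) \<partial>lebesgue) < \<infinity>}"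

definition nrm :: "real \<Rightarrow> (real \<Rightarrow> 'a::chilbert) \<Rightarrow> real" where
  "nrm \<rho> f = sqrt (enn2real (\<integral>\<^sup>+ t. ennreal ((norm (f t))\<^sup>2 * exp (- 2 * \<rho> * t)) \<partial>lebesgue))"

text \<open>Closure of a graph (relation) in \<open>H_{\<rho>,0} \<times> H_{\<rho>,0}\<close>. Elements of \<open>H_{\<rho>,0}\<close> are
  represented by functions; a.e.-equal functions have distance 0.\<close>
definition gclosure :: "real \<Rightarrow> ((real \<Rightarrow> 'a::chilbert) \<times> (real \<Rightarrow> 'a)) set
    \<Rightarrow> ((real \<Rightarrow> 'a) \<times> (real \<Rightarrow> 'a)) set" where
  "gclosure \<rho> G = {(u, v). u \<in> L2w \<rho> \<and> v \<in> L2w \<rho> \<and>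
     (\<exists>s. (\<forall>n. s n \<in> G \<and> fst (s n) \<in> L2w \<rho> \<and> snd (s n) \<in> L2w \<rho>) \<and>
          (\<lambda>n. nrm \<rho> (\<lambda>t. fst (s n) t - u t)) \<longlonglongrightarrow> 0 \<and>
          (\<lambda>n. nrm \<rho> (\<lambda>t. snd (s n) t - v t)) \<longlonglongrightarrow> 0)}"

definition dvec :: "(real \<Rightarrow> 'a::real_normed_vector) \<Rightarrow> real \<Rightarrow> 'a" where
  "dvec \<phi> = (\<lambda>t. vector_derivative \<phi> (at t))"

definition test_fn :: "(real \<Rightarrow> 'a::real_normed_vector) \<Rightarrow> bool" where
  "test_fn \<phi> \<longleftrightarrow> (\<forall>k t. (dvec ^^ k) \<phi> differentiable (at t)) \<and> compact (closure {t. \<phi> t \<noteq> 0})"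

definition deriv_graph :: "real \<Rightarrow> ((real \<Rightarrow> 'a::chilbert) \<times> (real \<Rightarrow> 'a)) set" where
  "deriv_graph \<rho> = gclosure \<rho> {(\<phi>, dvec \<phi>) | \<phi>. test_fn \<phi>}"

text \<open>Convolution \<open>C*u\<close> for simple \<open>u\<close> (with support of finite measure), pointwise as a
  weak integral, and its bounded extension to \<open>H_{\<rho>,0}\<close> (graph closure).\<close>
definition conv_simple :: "(real \<Rightarrow> 'a::chilbert \<Rightarrow> 'a) \<Rightarrow> (real \<Rightarrow> 'a) \<Rightarrow> real \<Rightarrow> 'a" where
  "conv_simple C u = (\<lambda>t. weak_integral UNIV (\<lambda>s. Cz C (t - s) (u s)))"

definition conv_graph :: "real \<Rightarrow> (real \<Rightarrow> 'a::chilbert \<Rightarrow> 'a) \<Rightarrow> ((real \<Rightarrow> 'a) \<times> (real \<Rightarrow> 'a)) set" where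
  "conv_graph \<rho> C = gclosure \<rho> {(u, conv_simple C u) | u.
      simple_fn u \<and> emeasure lebesgue {t. u t \<noteq> 0} < \<infinity>}"

text \<open>Graph of \<open>\<partial>_{0,\<rho>}(1 - C*)^{-1}\<close>: pairs \<open>((1 - C*)w, \<partial>_{0,\<rho>} w)\<close>.\<close>
definition dconv_graph :: "real \<Rightarrow> (real \<Rightarrow> 'a::chilbert \<Rightarrow> 'a) \<Rightarrow> ((real \<Rightarrow> 'a) \<times> (real \<Rightarrow> 'a)) set" where
  "dconv_graph \<rho> C = {(f, g) | f g. \<exists>w v. (w, v) \<in> conv_graph \<rho> C \<and> f = (\<lambda>t. w t - v t)
      \<and> (w, g) \<in> deriv_graph \<rho>}"

definition pointwise_graph :: "real \<Rightarrow> 'a::chilbert set \<Rightarrow> ('a \<Rightarrow> 'a) \<Rightarrow> ((real \<Rightarrow> 'a) \<times> (real \<Rightarrow> 'a)) set" where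
  "pointwise_graph \<rho> D A = {(u, v). u \<in> L2w \<rho> \<and> v \<in> L2w \<rho> \<and>
      (AE t in lebesgue. u t \<in> D \<and> v t = A (u t))}"

definition evo_graph :: "real \<Rightarrow> (real \<Rightarrow> 'a::chilbert \<Rightarrow> 'a) \<Rightarrow> real \<Rightarrow> 'a set \<Rightarrow> ('a \<Rightarrow> 'a)
    \<Rightarrow> ((real \<Rightarrow> 'a) \<times> (real \<Rightarrow> 'a)) set" where
  "evo_graph \<rho> C c D A = {(u, \<lambda>t. g t + c *\<^sub>R u t + a t) | u g a.
      (u, g) \<in> dconv_graph \<rho> C \<and> (u, a) \<in> pointwise_graph \<rho> D A}"

definition boundedly_invertible_graph :: "real \<Rightarrow> ((real \<Rightarrow> 'a::chilbert) \<times> (real \<Rightarrow> 'a)) set \<Rightarrow> bool" where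
  "boundedly_invertible_graph \<rho> T \<longleftrightarrow>
     (\<forall>u f f'. (u, f) \<in> T \<and> (u, f') \<in> T \<longrightarrow> nrm \<rho> (\<lambda>t. f t - f' t) = 0) \<and>
     (\<forall>f \<in> L2w \<rho>. \<exists>u. (u, f) \<in> T) \<and>
     (\<exists>K. \<forall>(u, f) \<in> T. nrm \<rho> u \<le> K * nrm \<rho> f)"

text \<open>Exponential stability of the solution operator \<open>S_\<rho> = T^{-1}\<close> with rate \<open>\<nu>\<^sub>1\<close>:
  \<open>S_\<rho> f\<close> is any \<open>u\<close> with \<open>(u,f) \<in> T\<close> (unique up to a.e. equality).\<close>
definition exp_stable_graph :: "real \<Rightarrow> ((real \<Rightarrow> 'a::chilbert) \<times> (real \<Rightarrow> 'a)) set \<Rightarrow> real \<Rightarrow> bool" where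
  "exp_stable_graph \<rho> T \<nu>1 \<longleftrightarrow>
     (\<forall>\<nu> f u. 0 \<le> \<nu> \<and> \<nu> < \<nu>1 \<and> f \<in> L2w (- \<nu>) \<and> f \<in> L2w \<rho> \<and> (u, f) \<in> T \<longrightarrow>
        (\<forall>\<mu>. - \<nu> < \<mu> \<and> \<mu> \<le> \<rho> \<longrightarrow> u \<in> L2w \<mu>))"

end

theory Submission
  imports Defs "HOL-Probability.Probability"
begin

text \<open>
  Multiplication by \<open>exp (- \<rho> t)\<close> moves the problem with weight \<open>\<rho> > - \<nu>\<^sub>1\<close> to the unweighted space
  \<open>L\<^sup>2(\<real>; H)\<close>, where the convolution becomes an operator \<open>K\<close> with \<open>\<parallel>K\<parallel> \<le> q < 1\<close> and the resolvents
  \<open>R\<^sub>\<epsilon> = (1 + \<epsilon> \<partial>)\<^sup>-\<^sup>1\<close> of the derivative become scalar convolutions. The sign condition on the imaginary part says that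
  the kernel has nonnegative sine transforms; this survives damping by exponentials, and Parseval's
  identity turns it into \<open>Re \<langle>(\<partial> - \<rho>) w | (1 - K) w\<rangle> \<ge> 0\<close>. Since \<open>0 \<le> Re \<langle>w | u\<rangle> \<le> \<parallel>u\<parallel>\<^sup>2 / (1 - q)\<close> for
  \<open>u = (1 - K) w\<close>, the bound on \<open>\<nu>\<^sub>1\<close> makes \<open>\<partial> (1 - K)\<^sup>-\<^sup>1 + c + A\<close> strictly accretive.

  Replacing \<open>\<partial>\<close> by \<open>(1 - R\<^sub>\<epsilon>) / \<epsilon>\<close> gives equations that are solved by a contraction; all operators commute
  with \<open>R\<^sub>\<epsilon>\<close>, so for smooth data the solutions converge as \<open>\<epsilon> \<rightarrow> 0\<close>. Each step of the construction respects
  the relation of being the same function in two differently weighted spaces, so the solution operators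
  for different weights agree on common data, which is exponential stability.
\<close>

lemmas bochner_cong = Bochner_Integration.integral_cong[OF refl]
  and bochner_bound = Bochner_Integration.integrable_bound

lemma cinner_add_right: "cinner x (y + z) = cinner x y + cinner x (z::'a::chilbert)"
  by (metis cinner_add_left cinner_commute complex_cnj_add)

lemma cinner_cscale_right: "cinner x (a *\<^sub>C y) = cnj a * cinner x (y::'a::chilbert)"
  by (metis cinner_commute cinner_cscale_left complex_cnj_mult)

lemma cinner_scaleR_left: "cinner (r *\<^sub>R x) y = of_real r * cinner x (y::'a::chilbert)"
  by (metis cinner_cscale_left cscale_of_real)

lemma cinner_scaleR_right: "cinner x (r *\<^sub>R y) = of_real r * cinner x (y::'a::chilbert)"
  by (metis cinner_cscale_right cscale_of_real complex_cnj_complex_of_real)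

lemma cscale_one [simp]: "1 *\<^sub>C x = (x::'a::chilbert)"
  by (metis cscale_of_real of_real_1 scaleR_one)

lemma cscale_zero_left [simp]: "0 *\<^sub>C x = (0::'a::chilbert)"
  by (metis cscale_of_real of_real_0 scaleR_zero_left)

lemma cscale_zero_right [simp]: "a *\<^sub>C 0 = (0::'a::chilbert)"
  by (metis cscale_add_right add_cancel_right_right)

lemma cscale_minus_one: "(-1) *\<^sub>C x = - (x::'a::chilbert)"
  by (metis cscale_of_real of_real_1 of_real_minus scaleR_minus1_left)

lemma cscale_scaleR: "a *\<^sub>C (r *\<^sub>R x) = r *\<^sub>R (a *\<^sub>C (x::'a::chilbert))"
  by (metis cscale_cscale cscale_of_real mult.commute)

lemma cinner_zero_left [simp]: "cinner 0 (x::'a::chilbert) = 0"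
  by (metis add_cancel_right_right cinner_add_left)

lemma cinner_zero_right [simp]: "cinner (x::'a::chilbert) 0 = 0"
  by (metis add_cancel_right_right cinner_add_right)

lemma cinner_minus_left: "cinner (- x) y = - cinner x (y::'a::chilbert)"
  by (metis add_eq_0_iff2 cinner_add_left cinner_zero_left add.right_inverse)

lemma cinner_minus_right: "cinner x (- y) = - cinner x (y::'a::chilbert)"
  by (metis add_eq_0_iff2 cinner_add_right cinner_zero_right add.right_inverse)

lemma cinner_diff_left: "cinner (x - y) z = cinner x z - cinner y (z::'a::chilbert)"
  by (metis add_uminus_conv_diff cinner_add_left cinner_minus_left)

lemma cinner_diff_right: "cinner x (y - z) = cinner x y - cinner x (z::'a::chilbert)"
  by (metis add_uminus_conv_diff cinner_add_right cinner_minus_right)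

lemmas cinner_simps = cinner_add_left cinner_add_right cinner_diff_left cinner_diff_right
  cinner_scaleR_left cinner_scaleR_right cinner_cscale_left cinner_cscale_right
  cinner_minus_left cinner_minus_right

lemma cinner_sum_left: "cinner (\<Sum>i\<in>I. f i) y = (\<Sum>i\<in>I. cinner (f i) (y::'a::chilbert))"
  by (induction I rule: infinite_finite_induct) (auto simp: cinner_add_left)

lemma cinner_sum_right: "cinner y (\<Sum>i\<in>I. f i) = (\<Sum>i\<in>I. cinner (y::'a::chilbert) (f i))"
  by (induction I rule: infinite_finite_induct) (auto simp: cinner_add_right)

lemma Re_cinner_commute: "Re (cinner y x) = Re (cinner x (y::'a::chilbert))"
  by (subst cinner_commute) simp

lemma Im_cinner_self [simp]: "Im (cinner x (x::'a::chilbert)) = 0"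
  using arg_cong[OF cinner_commute[of x x], of Im] by simp

lemma Re_cinner_self: "Re (cinner x x) = (norm (x::'a::chilbert))\<^sup>2"
proof -
  have "Re (cinner x x) \<ge> 0"
    by (metis norm_cinner norm_ge_zero real_sqrt_ge_0_iff)
  then show ?thesis by (simp add: norm_cinner)
qed

lemma cinner_self: "cinner x x = of_real ((norm (x::'a::chilbert))\<^sup>2)"
  by (simp add: complex_eq_iff Re_cinner_self)

lemma norm_cscale: "norm (a *\<^sub>C x) = cmod a * norm (x::'a::chilbert)"
proof -
  have "cinner (a *\<^sub>C x) (a *\<^sub>C x) = (a * cnj a) * cinner x x"
    by (simp add: cinner_cscale_left cinner_cscale_right)
  also have "\<dots> = of_real ((cmod a * norm x)\<^sup>2)"
    by (simp only: cinner_self complex_norm_square[symmetric] power_mult_distrib of_real_mult)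
  finally have "cinner (a *\<^sub>C x) (a *\<^sub>C x) = of_real ((cmod a * norm x)\<^sup>2)" .
  then have "(norm (a *\<^sub>C x))\<^sup>2 = (cmod a * norm x)\<^sup>2"
    by (metis Re_cinner_self Re_complex_of_real)
  then show ?thesis by (simp add: power2_eq_iff_nonneg)
qed

lemma norm_add_sq: "(norm (x + y))\<^sup>2 = (norm x)\<^sup>2 + 2 * Re (cinner x y) + (norm (y::'a::chilbert))\<^sup>2"
  using Re_cinner_commute[of x y] by (simp add: Re_cinner_self[symmetric] cinner_simps)

lemma norm_diff_sq: "(norm (x - y))\<^sup>2 = (norm x)\<^sup>2 - 2 * Re (cinner x y) + (norm (y::'a::chilbert))\<^sup>2"
  using norm_add_sq[of x "- y"] by (simp add: cinner_minus_right)

lemma Re_cinner_le: "Re (cinner x y) \<le> norm x * norm (y::'a::chilbert)"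
proof (cases "x = 0 \<or> y = 0")
  case True then show ?thesis by auto
next
  case False
  then have "0 \<le> (norm ((norm y) *\<^sub>R x - (norm x) *\<^sub>R y))\<^sup>2" by simp
  also have "\<dots> = 2 * (norm x * norm y) * (norm x * norm y - Re (cinner x y))"
    unfolding norm_diff_sq by (simp add: cinner_simps power2_eq_square algebra_simps)
  finally have "0 \<le> norm x * norm y - Re (cinner x y)"
    using False by (simp add: zero_le_mult_iff) (use False in \<open>auto simp: mult_le_0_iff\<close>)
  then show ?thesis by simp
qed

lemma norm_cinner_le: "cmod (cinner x y) \<le> norm x * norm (y::'a::chilbert)"
proof (cases "cinner x y = 0")
  case False
  define a where "a = cnj (cinner x y) / of_real (cmod (cinner x y))"
  have "cinner (a *\<^sub>C x) y = of_real (cmod (cinner x y))"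
    using False by (simp add: a_def cinner_cscale_left mult.commute[of "cnj _"]
        complex_norm_square[symmetric] power2_eq_square)
  moreover have "cmod a = 1" using False by (simp add: a_def norm_divide)
  ultimately show ?thesis
    using Re_cinner_le[of "a *\<^sub>C x" y] by (simp add: norm_cscale)
qed auto

lemma bounded_bilinear_cinner: "bounded_bilinear (cinner :: 'a::chilbert \<Rightarrow> 'a \<Rightarrow> complex)"
  by (standard; (simp add: cinner_simps scaleR_conv_of_real)?)
     (auto intro!: exI[of _ 1] norm_cinner_le)

interpretation cinner: bounded_bilinear "cinner :: 'a::chilbert \<Rightarrow> 'a \<Rightarrow> complex"
  by (rule bounded_bilinear_cinner)

lemma cinner_eqI: "(\<And>z. cinner x z = cinner y z) \<Longrightarrow> x = (y::'a::chilbert)"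
proof -
  assume "\<And>z. cinner x z = cinner y z"
  then have "cinner (x - y) (x - y) = 0" by (simp add: cinner_diff_left)
  then show ?thesis by (simp add: cinner_self)
qed

lemma parallelogram: "(norm (x + y))\<^sup>2 + (norm (x - y))\<^sup>2 = 2 * (norm x)\<^sup>2 + 2 * (norm (y::'a::chilbert))\<^sup>2"
  by (simp add: norm_add_sq norm_diff_sq)

lemma projection_exists:
  fixes S :: "'a::chilbert set"
  assumes S: "subspace S" "closed S"
  shows "\<exists>p\<in>S. \<forall>s\<in>S. Re (cinner (x - p) s) = 0"
proof -
  define d where "d = infdist x S"
  have ne: "S \<noteq> {}" using S(1) subspace_0 by auto
  have lb: "d \<le> norm (x - s)" if "s \<in> S" for s
    using infdist_le[OF that, of x] by (simp add: d_def dist_norm)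
  have d0: "d \<ge> 0" by (simp add: d_def infdist_nonneg)
  have "\<exists>s\<in>S. norm (x - s) < d + 1 / Suc n" for n
  proof (rule ccontr)
    assume "\<not> ?thesis"
    then have "d + 1 / Suc n \<le> infdist x S"
      unfolding infdist_def using ne by (auto intro!: cINF_greatest simp: dist_norm not_less)
    then show False by (simp add: d_def)
  qed
  then obtain s where s: "\<And>n. s n \<in> S" "\<And>n. norm (x - s n) < d + 1 / Suc n" by metis
  have key: "(norm (s m - s n))\<^sup>2 \<le> 2 * (norm (x - s m))\<^sup>2 + 2 * (norm (x - s n))\<^sup>2 - 4 * d\<^sup>2" for m n
  proof -
    have "(1/2) *\<^sub>R (s m + s n) \<in> S" using s(1) S(1) by (simp add: subspace_add subspace_scale)
    from lb[OF this] have "d \<le> norm ((1/2) *\<^sub>R ((x - s m) + (x - s n)))"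
      by (simp add: algebra_simps flip: scaleR_add_left)
    then have "2 * d \<le> norm ((x - s m) + (x - s n))" by simp
    then have "(2 * d)\<^sup>2 \<le> (norm ((x - s m) + (x - s n)))\<^sup>2" using d0 by (intro power_mono) auto
    then show ?thesis using parallelogram[of "x - s m" "x - s n"]
      by (simp add: norm_minus_commute power_mult_distrib)
  qed
  have "Cauchy s"
  proof (rule metric_CauchyI)
    fix e :: real assume e: "e > 0"
    have "(\<lambda>n. 4 * (d + 1 / Suc n)\<^sup>2 - 4 * d\<^sup>2) \<longlonglongrightarrow> 4 * (d + 0)\<^sup>2 - 4 * d\<^sup>2"
      by (intro tendsto_intros LIMSEQ_Suc lim_1_over_n)
    then have "\<forall>\<^sub>F n in sequentially. 4 * (d + 1 / Suc n)\<^sup>2 - 4 * d\<^sup>2 < e\<^sup>2"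
      using e by (intro order_tendstoD(2)) auto
    then obtain N where N: "4 * (d + 1 / Suc N)\<^sup>2 - 4 * d\<^sup>2 < e\<^sup>2"
      by (auto simp: eventually_sequentially)
    show "\<exists>M. \<forall>m\<ge>M. \<forall>n\<ge>M. dist (s m) (s n) < e"
    proof (intro exI allI impI)
      fix m n assume mn: "m \<ge> N" "n \<ge> N"
      have *: "(norm (x - s k))\<^sup>2 \<le> (d + 1 / Suc N)\<^sup>2" if "k \<ge> N" for k
      proof -
        have "1 / real (Suc k) \<le> 1 / Suc N" using that by (simp add: frac_le)
        then show ?thesis using s(2)[of k] by (intro power_mono) auto
      qed
      have "(norm (s m - s n))\<^sup>2 < e\<^sup>2" using key[of m n] *[OF mn(1)] *[OF mn(2)] N by linarith
      then show "dist (s m) (s n) < e" using e by (simp add: dist_norm power2_less_imp_less)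
    qed
  qed
  then obtain p where p: "s \<longlonglongrightarrow> p" using Cauchy_convergent convergent_def by blast
  have pS: "p \<in> S" using S(2) s(1) p closed_sequentially by blast
  have "norm (x - p) \<le> d"
  proof (rule LIMSEQ_le)
    show "(\<lambda>n. norm (x - s n)) \<longlonglongrightarrow> norm (x - p)" by (intro tendsto_intros p)
    show "(\<lambda>n. d + 1 / real (Suc n)) \<longlonglongrightarrow> d"
      using tendsto_add[OF tendsto_const LIMSEQ_Suc[OF lim_1_over_n], of d] by simp
  qed (use s(2) less_imp_le in blast)
  moreover have "Re (cinner (x - p) z) = 0" if z: "z \<in> S" and pd: "norm (x - p) \<le> d" for z
  proof (cases "z = 0")
    case False
    define t where "t = Re (cinner (x - p) z) / (norm z)\<^sup>2"
    have "p + t *\<^sub>R z \<in> S" using S(1) pS z by (simp add: subspace_add subspace_scale)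
    from lb[OF this] have "norm (x - p) \<le> norm ((x - p) - t *\<^sub>R z)" using pd by (simp add: algebra_simps)
    then have "(norm (x - p))\<^sup>2 \<le> (norm ((x - p) - t *\<^sub>R z))\<^sup>2" by (intro power_mono) auto
    then have "2 * t * Re (cinner (x - p) z) \<le> t\<^sup>2 * (norm z)\<^sup>2"
      unfolding norm_diff_sq[of "x - p" "t *\<^sub>R z"] by (simp add: cinner_simps power_mult_distrib)
    moreover have "Re (cinner (x - p) z) = t * (norm z)\<^sup>2" using False by (simp add: t_def)
    ultimately have "2 * (t\<^sup>2 * (norm z)\<^sup>2) \<le> t\<^sup>2 * (norm z)\<^sup>2" by (simp add: power2_eq_square algebra_simps)
    moreover have "0 \<le> t\<^sup>2 * (norm z)\<^sup>2" by simp
    ultimately have "t\<^sup>2 * (norm z)\<^sup>2 = 0" by linarith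
    then have "t = 0" using False by simp
    then show ?thesis using False by (simp add: t_def)
  qed auto
  ultimately show ?thesis using pS by blast
qed

lemma subspace_closure_normed:
  fixes S :: "'a::real_normed_vector set"
  assumes "subspace S" shows "subspace (closure S)"
  unfolding subspace_def
proof (intro conjI ballI allI)
  show "0 \<in> closure S" using assms subspace_0 closure_subset by blast
next
  fix x y assume "x \<in> closure S" "y \<in> closure S"
  then obtain f g where fg: "\<And>n. f n \<in> S" "f \<longlonglongrightarrow> x" "\<And>n. g n \<in> S" "g \<longlonglongrightarrow> y"
    unfolding closure_sequential by metis
  then show "x + y \<in> closure S" unfolding closure_sequential
    by (intro exI[of _ "\<lambda>n. f n + g n"]) (auto intro!: tendsto_add subspace_add assms)
next
  fix x :: 'a and c :: real assume "x \<in> closure S"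
  then obtain f where f: "\<And>n. f n \<in> S" "f \<longlonglongrightarrow> x" unfolding closure_sequential by metis
  then show "c *\<^sub>R x \<in> closure S" unfolding closure_sequential
    by (intro exI[of _ "\<lambda>n. c *\<^sub>R f n"]) (auto intro!: tendsto_scaleR subspace_scale assms)
qed

lemma dense_by_orthogonality:
  fixes S :: "'a::chilbert set"
  assumes S: "subspace S" and orth: "\<And>y. (\<forall>s\<in>S. Re (cinner y s) = 0) \<Longrightarrow> y = 0"
  shows "closure S = UNIV"
proof -
  have "x \<in> closure S" for x
  proof -
    obtain p where p: "p \<in> closure S" "\<forall>s\<in>closure S. Re (cinner (x - p) s) = 0"
      using projection_exists[OF subspace_closure_normed[OF S] closed_closure] by blast
    then have "x - p = 0" using closure_subset by (intro orth) blast
    then show ?thesis using p by simp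
  qed
  then show ?thesis by auto
qed

lemma riesz_real:
  fixes \<phi> :: "'a::chilbert \<Rightarrow> real"
  assumes "bounded_linear \<phi>"
  shows "\<exists>y. \<forall>z. Re (cinner y z) = \<phi> z"
proof (cases "\<forall>z. \<phi> z = 0")
  case True then show ?thesis by (intro exI[of _ 0]) auto
next
  case False
  interpret bounded_linear \<phi> by fact
  obtain x where x: "\<phi> x \<noteq> 0" using False by auto
  have sub: "subspace {z. \<phi> z = 0}" by (auto simp: subspace_def add scaleR zero)
  have cl: "closed {z. \<phi> z = 0}"
    by (intro closed_Collect_eq linear_continuous_on assms continuous_on_const)
  obtain p where p: "\<phi> p = 0" "\<And>s. \<phi> s = 0 \<Longrightarrow> Re (cinner (x - p) s) = 0"
    using projection_exists[OF sub cl, of x] by auto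
  define e where "e = x - p"
  have pe: "\<phi> e = \<phi> x" using p by (simp add: e_def diff)
  then have e0: "e \<noteq> 0" using x zero by auto
  show ?thesis
  proof (intro exI allI)
    fix z
    have "\<phi> (z - (\<phi> z / \<phi> e) *\<^sub>R e) = 0" using pe x by (simp add: diff scaleR)
    then have "Re (cinner e (z - (\<phi> z / \<phi> e) *\<^sub>R e)) = 0" using p(2) by (simp add: e_def)
    then have "Re (cinner e z) = (\<phi> z / \<phi> e) * (norm e)\<^sup>2" by (simp add: cinner_simps Re_cinner_self)
    then show "Re (cinner ((\<phi> e / (norm e)\<^sup>2) *\<^sub>R e) z) = \<phi> z"
      using e0 pe x by (simp add: cinner_simps)
  qed
qed

lemma riesz_complex:
  fixes F :: "'a::chilbert \<Rightarrow> complex"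
  assumes add: "\<And>x y. F (x + y) = F x + F y" and sc: "\<And>a x. F (a *\<^sub>C x) = cnj a * F x"
    and bd: "\<And>x. cmod (F x) \<le> B * norm x"
  shows "\<exists>!y. \<forall>z. cinner y z = F z"
proof -
  have "bounded_linear (\<lambda>z. Re (F z))"
  proof (rule bounded_linear_intro[where K = B])
    fix r x show "Re (F (r *\<^sub>R x)) = r *\<^sub>R Re (F x)"
      using sc[of "of_real r" x] by (simp add: cscale_of_real)
    show "norm (Re (F x)) \<le> norm x * B"
      using bd[of x] abs_Re_le_cmod[of "F x"] by (simp add: mult.commute)
  qed (simp add: add)
  then obtain y where y: "\<And>z. Re (cinner y z) = Re (F z)" using riesz_real by blast
  have "Im (cinner y z) = Im (F z)" for z
    using y[of "\<i> *\<^sub>C z"] by (simp add: cinner_cscale_right sc)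
  then have "\<forall>z. cinner y z = F z" using y by (simp add: complex_eq_iff)
  then show ?thesis by (metis cinner_eqI)
qed

lemma bounded_clinear_opD:
  assumes "bounded_clinear_op T"
  shows "bounded_linear T" "T (x + y) = T x + T y" "T (a *\<^sub>C x) = a *\<^sub>C T x"
    "T (r *\<^sub>R x) = r *\<^sub>R T x" "T (x - y) = T x - T y" "T 0 = 0"
proof -
  show bl: "bounded_linear T"
  proof -
    obtain K where "\<And>x. norm (T x) \<le> K * norm x" using assms by (auto simp: bounded_clinear_op_def)
    then show ?thesis using assms unfolding bounded_clinear_op_def
      by (intro bounded_linear_intro[of T K]) (simp_all add: cscale_of_real[symmetric] mult.commute)
  qed
  show "T (x + y) = T x + T y" "T (a *\<^sub>C x) = a *\<^sub>C T x"
    using assms by (auto simp: bounded_clinear_op_def)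
  show "T (r *\<^sub>R x) = r *\<^sub>R T x" "T (x - y) = T x - T y" "T 0 = 0"
    using bl by (auto simp: bounded_linear.linear linear_scale linear_diff linear_0)
qed

lemma bounded_clinear_opI:
  assumes "\<And>x y. T (x + y) = T x + T y" "\<And>a x. T (a *\<^sub>C x) = a *\<^sub>C T x"
    "\<And>x. norm (T x) \<le> K * norm x"
  shows "bounded_clinear_op T"
  using assms by (auto simp: bounded_clinear_op_def)

lemma adjoint_exists:
  assumes T: "bounded_clinear_op (T::'a::chilbert \<Rightarrow> 'a)"
  obtains S where "\<And>x y. cinner (T x) y = cinner x (S y)"
proof -
  obtain K where K: "\<And>x. norm (T x) \<le> norm x * K"
    using bounded_linear.bounded[OF bounded_clinear_opD(1)[OF T]] by blast
  have "\<exists>!s. \<forall>x. cinner s x = cinner y (T x)" for y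
  proof (rule riesz_complex[where B = "norm y * K"])
    show "cmod (cinner y (T x)) \<le> norm y * K * norm x" for x
      using order_trans[OF norm_cinner_le mult_left_mono[OF K norm_ge_zero], of y x] by (simp add: mult_ac)
  qed (simp_all add: bounded_clinear_opD[OF T] cinner_simps)
  then obtain S where "\<And>x y. cinner (S y) x = cinner y (T x)" by metis
  then have "cinner (T x) y = cinner x (S y)" for x y by (metis cinner_commute)
  then show ?thesis using that by blast
qed

lemma adjoint_op_eq:
  assumes "bounded_clinear_op T"
  shows "cinner (T x) y = cinner x (adjoint_op T y)"
proof -
  obtain S where S: "\<And>x y. cinner (T x) y = cinner x (S y)" using adjoint_exists[OF assms] by blast
  have "adjoint_op T = S" unfolding adjoint_op_def
  proof (rule the_equality)
    fix S' assume "\<forall>x y. cinner (T x) y = cinner x (S' y)"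
    then have "cinner (S' y) x = cinner (S y) x" for x y by (metis S cinner_commute)
    then show "S' = S" by (rule ext[OF cinner_eqI])
  qed (use S in auto)
  then show ?thesis using S by simp
qed

lemma weak_integral:
  fixes g :: "real \<Rightarrow> 'a::chilbert"
  assumes meas: "\<And>z. set_borel_measurable lebesgue S (\<lambda>s. cinner (g s) z)"
    and k: "set_integrable lebesgue S k"
    and bd: "AE s in lebesgue. s \<in> S \<longrightarrow> norm (g s) \<le> k s"
  shows "set_integrable lebesgue S (\<lambda>s. cinner (g s) z)"
    and "cinner (weak_integral S g) z = (LINT s:S|lebesgue. cinner (g s) z)"
    and "norm (weak_integral S g) \<le> (LINT s:S|lebesgue. k s)"
proof -
  have bz: "AE s in lebesgue. s \<in> S \<longrightarrow> norm (cinner (g s) z) \<le> k s * norm z" for z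
    using bd by eventually_elim (meson mult_right_mono norm_cinner_le norm_ge_zero order_trans)
  have si: "set_integrable lebesgue S (\<lambda>s. cinner (g s) z)" for z
    using bz[of z] unfolding set_integrable_def
    apply (intro bochner_bound[OF integrable_mult_left[OF k[unfolded set_integrable_def], of "norm z"]])
    subgoal using meas[of z] by (simp add: set_borel_measurable_def)
    subgoal by (auto simp: indicator_def elim!: eventually_mono)
    done
  then show "set_integrable lebesgue S (\<lambda>s. cinner (g s) z)" .
  define I where "I = (LINT s:S|lebesgue. k s)"
  have nb: "cmod (LINT s:S|lebesgue. cinner (g s) z) \<le> I * norm z" for z
  proof -
    have "cmod (LINT s:S|lebesgue. cinner (g s) z) \<le> (LINT s:S|lebesgue. cmod (cinner (g s) z))"
      using set_integral_norm_bound[OF si] by simp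
    also have "\<dots> \<le> (LINT s:S|lebesgue. k s * norm z)"
      using set_integrable_norm[OF si[of z]] k bz[of z]
      by (intro set_integral_mono_AE) (auto elim: eventually_mono)
    also have "\<dots> = I * norm z" by (simp add: I_def)
    finally show ?thesis .
  qed
  have "\<exists>!y. \<forall>z. cinner y z = (LINT s:S|lebesgue. cinner (g s) z)"
    by (rule riesz_complex[where B = I]) (auto simp: cinner_simps si set_integral_add nb)
  then have w: "\<And>z. cinner (weak_integral S g) z = (LINT s:S|lebesgue. cinner (g s) z)"
    unfolding weak_integral_def by (rule theI'[THEN spec])
  then show "cinner (weak_integral S g) z = (LINT s:S|lebesgue. cinner (g s) z)" .
  show "norm (weak_integral S g) \<le> (LINT s:S|lebesgue. k s)"
  proof (cases "weak_integral S g = 0")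
    case True
    have "0 \<le> (LINT s:S|lebesgue. k s)"
      unfolding set_lebesgue_integral_def using bd
      by (intro integral_nonneg_AE) (auto elim!: eventually_mono simp: indicator_def intro: order_trans[OF norm_ge_zero])
    then show ?thesis using True by simp
  next
    case False
    have "(norm (weak_integral S g))\<^sup>2 \<le> I * norm (weak_integral S g)"
      using nb[of "weak_integral S g"] unfolding w[symmetric] by (simp add: cinner_self norm_power)
    then show ?thesis using False by (simp add: power2_eq_square I_def)
  qed
qed

subsection \<open>Strong measurability\<close>

lemma simple_fn_measurable:
  fixes h :: "'a::chilbert \<Rightarrow> 'b::topological_space"
  assumes "simple_fn u"
  shows "(\<lambda>t. h (u t)) \<in> borel_measurable lebesgue"
proof (rule measurableI)
  fix B :: "'b set" assume "B \<in> sets borel"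
  have "(\<lambda>t. h (u t)) -` B \<inter> space lebesgue = (\<Union>x\<in>range u \<inter> h -` B. u -` {x})" by auto
  also have "\<dots> \<in> sets lebesgue"
    using assms by (intro sets.finite_UN) (auto simp: simple_fn_def)
  finally show "(\<lambda>t. h (u t)) -` B \<inter> space lebesgue \<in> sets lebesgue" .
qed auto

lemma simple_fn_comp2:
  assumes u: "simple_fn u" and v: "simple_fn v"
  shows "simple_fn (\<lambda>t. F (u t) (v t))"
proof -
  have "range (\<lambda>t. F (u t) (v t)) \<subseteq> (\<lambda>(a,b). F a b) ` (range u \<times> range v)" by auto
  then have "finite (range (\<lambda>t. F (u t) (v t)))"
    using u v by (elim finite_subset) (auto simp: simple_fn_def)
  moreover have "(\<lambda>t. F (u t) (v t)) -` {x} \<in> sets lebesgue" for x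
  proof -
    have "(\<lambda>t. F (u t) (v t)) -` {x} =
        (\<Union>p\<in>{p \<in> range u \<times> range v. F (fst p) (snd p) = x}. u -` {fst p} \<inter> v -` {snd p})"
      by (auto 0 3)
    also have "\<dots> \<in> sets lebesgue"
      using u v by (intro sets.finite_UN) (auto simp: simple_fn_def)
    finally show ?thesis .
  qed
  ultimately show ?thesis by (simp add: simple_fn_def)
qed

lemma simple_fn_comp: "simple_fn u \<Longrightarrow> simple_fn (\<lambda>t. F (u t))"
  using simple_fn_comp2[of u u "\<lambda>a b. F a"] by simp

lemma simple_fn_indicator:
  assumes "E \<in> sets lebesgue" shows "simple_fn (\<lambda>t. indicator E t *\<^sub>R (x::'a::chilbert))"
  unfolding simple_fn_def
proof (intro conjI allI)
  show "finite (range (\<lambda>t. indicator E t *\<^sub>R x))"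
    by (rule finite_subset[of _ "{0, x}"]) (auto simp: indicator_def)
  fix y show "(\<lambda>t. indicator E t *\<^sub>R x) -` {y} \<in> sets lebesgue"
  proof -
    have "(\<lambda>t. indicator E t *\<^sub>R x) -` {y} = (if x = y then E else {}) \<union> (if y = 0 then - E else {})"
      by (cases "y = 0") (auto split: split_indicator split_indicator_asm)
    then show ?thesis using assms by (auto simp: Compl_in_sets_lebesgue)
  qed
qed

lemma lebesgue_measurable_AE_lim:
  fixes f :: "nat \<Rightarrow> real \<Rightarrow> 'b::euclidean_space"
  assumes "\<And>n. f n \<in> borel_measurable lebesgue" "AE t in lebesgue. (\<lambda>n. f n t) \<longlonglongrightarrow> g t"
  shows "g \<in> borel_measurable lebesgue"
  by (rule borel_measurable_AE[OF borel_measurable_lim_metric[OF assms(1)]])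
     (use assms(2) in \<open>auto elim!: eventually_mono intro: limI\<close>)

lemma strongly_measurable_separable:
  assumes "strongly_measurable f"
  obtains y :: "nat \<Rightarrow> 'a::chilbert" where "AE t in lebesgue. f t \<in> closure (range y)"
proof -
  obtain s where s: "\<And>n. simple_fn (s n)" "AE t in lebesgue. (\<lambda>n. s n t) \<longlonglongrightarrow> f t"
    using assms by (auto simp: strongly_measurable_def)
  define Y where "Y = (\<Union>n. range (s n))"
  have Y: "countable Y" "Y \<noteq> {}" using s(1) by (auto simp: Y_def simple_fn_def countable_finite)
  have "AE t in lebesgue. f t \<in> closure (range (from_nat_into Y))"
    using s(2)
  proof eventually_elim
    case (elim t)
    then show ?case using Y unfolding closure_sequential
      by (intro exI[of _ "\<lambda>n. s n t"]) (auto simp: Y_def range_from_nat_into)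
  qed
  then show ?thesis by (rule that)
qed

lemma strongly_measurable_norm:
  assumes "strongly_measurable f"
  shows "(\<lambda>t. norm (f t - x)) \<in> borel_measurable lebesgue"
proof -
  obtain s where s: "\<And>n. simple_fn (s n)" "AE t in lebesgue. (\<lambda>n. s n t) \<longlonglongrightarrow> f t"
    using assms by (auto simp: strongly_measurable_def)
  show ?thesis
    by (rule lebesgue_measurable_AE_lim[of "\<lambda>n t. norm (s n t - x)"])
       (use s(2) in \<open>auto intro!: simple_fn_measurable[OF s(1), of "\<lambda>a. norm (a - x)"] tendsto_intros elim!: eventually_mono\<close>)
qed

lemma strongly_measurable_norm0:
  "strongly_measurable f \<Longrightarrow> (\<lambda>t. norm (f t)) \<in> borel_measurable lebesgue"
  using strongly_measurable_norm[of f 0] by simp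

lemma strongly_measurableI:
  fixes f :: "real \<Rightarrow> 'a::chilbert" and y :: "nat \<Rightarrow> 'a"
  assumes sep: "AE t in lebesgue. f t \<in> closure (range y)"
    and meas: "\<And>n. (\<lambda>t. norm (f t - y n)) \<in> borel_measurable lebesgue"
  shows "strongly_measurable f"
proof -
  define P where "P n k t \<longleftrightarrow> k \<le> n \<and> (\<forall>j\<in>{..n}. norm (f t - y k) \<le> norm (f t - y j))" for n k t
  define K where "K n t = (LEAST k. P n k t)" for n t
  have ex: "\<exists>k. P n k t" for n t
  proof -
    have "finite ((\<lambda>j. norm (f t - y j)) ` {..n})" "(\<lambda>j. norm (f t - y j)) ` {..n} \<noteq> {}" by auto
    from Min_in[OF this] obtain k where "k \<le> n" "norm (f t - y k) = Min ((\<lambda>j. norm (f t - y j)) ` {..n})"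
      by (metis (no_types, lifting) atMost_iff imageE)
    then show ?thesis unfolding P_def by (intro exI[of _ k]) auto
  qed
  have PK: "P n (K n t) t" for n t unfolding K_def by (rule LeastI_ex[OF ex])
  note [measurable] = meas
  have "Measurable.pred lebesgue (P n k)" for n k unfolding P_def by measurable
  then have KM: "K n \<in> measurable lebesgue (count_space UNIV)" for n
    unfolding K_def by (intro measurable_Least) auto
  have Kn: "K n t \<le> n" for n t using PK[of n t] by (simp add: P_def)
  have Kmin: "norm (f t - y (K n t)) \<le> norm (f t - y m)" if "m \<le> n" for m n t
    using PK[of n t] that by (simp add: P_def)
  have simp: "simple_fn (\<lambda>t. y (K n t))" for n
    unfolding simple_fn_def
  proof (intro conjI allI)
    show "finite (range (\<lambda>t. y (K n t)))"
      using Kn by (auto intro: finite_subset[of _ "y ` {..n}"])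
    fix x
    have "(\<lambda>t. y (K n t)) -` {x} = K n -` (y -` {x}) \<inter> space lebesgue" by auto
    also have "\<dots> \<in> sets lebesgue" by (rule measurable_sets[OF KM]) auto
    finally show "(\<lambda>t. y (K n t)) -` {x} \<in> sets lebesgue" .
  qed
  have "(\<lambda>n. y (K n t)) \<longlonglongrightarrow> f t" if ft: "f t \<in> closure (range y)" for t
  proof (rule metric_LIMSEQ_I)
    fix e :: real assume "e > 0"
    then obtain m where m: "norm (f t - y m) < e"
      using ft by (auto simp: closure_approachable dist_norm norm_minus_commute)
    have "dist (y (K n t)) (f t) < e" if "n \<ge> m" for n
      using Kmin[OF that, of t] m by (simp add: dist_norm norm_minus_commute)
    then show "\<exists>N. \<forall>n\<ge>N. dist (y (K n t)) (f t) < e" by blast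
  qed
  then show ?thesis unfolding strongly_measurable_def
    using simp sep by (intro exI[of _ "\<lambda>n t. y (K n t)"]) (auto elim!: eventually_mono)
qed

lemma strongly_measurable_lim:
  fixes f :: "nat \<Rightarrow> real \<Rightarrow> 'a::chilbert"
  assumes f: "\<And>n. strongly_measurable (f n)" and lim: "AE t in lebesgue. (\<lambda>n. f n t) \<longlonglongrightarrow> g t"
  shows "strongly_measurable g"
proof -
  have "\<exists>y::nat \<Rightarrow> 'a. AE t in lebesgue. f n t \<in> closure (range y)" for n
    using strongly_measurable_separable[OF f] by metis
  then obtain y :: "nat \<Rightarrow> nat \<Rightarrow> 'a" where y: "\<And>n. AE t in lebesgue. f n t \<in> closure (range (y n))" by metis
  define Y where "Y = (\<Union>n. range (y n))"
  have Y: "countable Y" "Y \<noteq> {}" by (auto simp: Y_def)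
  have "AE t in lebesgue. \<forall>n. f n t \<in> closure (range (y n))" using y by (simp add: AE_all_countable)
  with lim have "AE t in lebesgue. g t \<in> closure (range (from_nat_into Y))"
  proof eventually_elim
    case (elim t)
    have "f n t \<in> closure Y" for n
      using elim(2) closure_mono[of "range (y n)" Y] by (auto simp: Y_def)
    then have "g t \<in> closure Y" using closed_sequentially[OF closed_closure _ elim(1)] by blast
    then show ?case using Y by (simp add: range_from_nat_into)
  qed
  then show ?thesis
  proof (rule strongly_measurableI)
    show "(\<lambda>t. norm (g t - from_nat_into Y n)) \<in> borel_measurable lebesgue" for n
      by (rule lebesgue_measurable_AE_lim[of "\<lambda>k t. norm (f k t - from_nat_into Y n)"])
         (use lim in \<open>auto intro!: strongly_measurable_norm f tendsto_intros elim!: eventually_mono\<close>)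
  qed
qed

lemma strongly_measurable_cong_AE:
  "strongly_measurable f \<Longrightarrow> AE t in lebesgue. f t = g t \<Longrightarrow> strongly_measurable g"
  by (rule strongly_measurable_lim[of "\<lambda>_. f"]) (auto elim!: eventually_mono)

lemma strongly_measurable_simple: "simple_fn u \<Longrightarrow> strongly_measurable u"
  unfolding strongly_measurable_def by (intro exI[of _ "\<lambda>_. u"]) auto

lemma strongly_measurable_comp2:
  assumes f: "strongly_measurable f" and g: "strongly_measurable g"
    and F: "\<And>s a r b. s \<longlonglongrightarrow> a \<Longrightarrow> r \<longlonglongrightarrow> b \<Longrightarrow> (\<lambda>n. F (s n) (r n)) \<longlonglongrightarrow> F a b"
  shows "strongly_measurable (\<lambda>t. F (f t) (g t))"
proof -
  obtain s where s: "\<And>n. simple_fn (s n)" "AE t in lebesgue. (\<lambda>n. s n t) \<longlonglongrightarrow> f t"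
    using f by (auto simp: strongly_measurable_def)
  obtain r where r: "\<And>n. simple_fn (r n)" "AE t in lebesgue. (\<lambda>n. r n t) \<longlonglongrightarrow> g t"
    using g by (auto simp: strongly_measurable_def)
  have "AE t in lebesgue. (\<lambda>n. F (s n t) (r n t)) \<longlonglongrightarrow> F (f t) (g t)"
    using s(2) r(2) by eventually_elim (rule F)
  then show ?thesis unfolding strongly_measurable_def
    using simple_fn_comp2[OF s(1) r(1), of F] by (intro exI[of _ "\<lambda>n t. F (s n t) (r n t)"] conjI) auto
qed

lemma strongly_measurable_complex:
  fixes f :: "real \<Rightarrow> complex"
  assumes [measurable]: "f \<in> borel_measurable lebesgue"
  shows "strongly_measurable f"
proof -
  obtain Y :: "complex set" where Y: "countable Y" "UNIV \<subseteq> closure Y"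
    by (rule separable[of "UNIV :: complex set"]) blast
  then have "Y \<noteq> {}" by auto
  with Y have "f t \<in> closure (range (from_nat_into Y))" for t by (auto simp: range_from_nat_into)
  then show ?thesis by (intro strongly_measurableI[of f "from_nat_into Y"]) auto
qed

lemma bounded_bilinear_cscale: "bounded_bilinear (\<lambda>a (x::'a::chilbert). a *\<^sub>C x)"
  by (standard; (simp add: cscale_add_left cscale_add_right cscale_scaleR)?)
     (auto intro!: exI[of _ 1] simp: norm_cscale scaleR_conv_of_real cscale_cscale[symmetric] cscale_of_real)

lemma strongly_measurable_cscale:
  assumes "c \<in> borel_measurable lebesgue" "strongly_measurable (f :: real \<Rightarrow> 'a::chilbert)"
  shows "strongly_measurable (\<lambda>t. c t *\<^sub>C f t)"
  by (rule strongly_measurable_comp2[OF strongly_measurable_complex[OF assms(1)] assms(2)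
      bounded_bilinear.tendsto[OF bounded_bilinear_cscale]])

lemma strongly_measurable_scaleR:
  assumes "(c::real \<Rightarrow> real) \<in> borel_measurable lebesgue" "strongly_measurable (f :: real \<Rightarrow> 'a::chilbert)"
  shows "strongly_measurable (\<lambda>t. c t *\<^sub>R f t)"
  using strongly_measurable_cscale[of "\<lambda>t. of_real (c t)" f] assms by (simp add: cscale_of_real)

lemma strongly_measurable_add:
  "strongly_measurable f \<Longrightarrow> strongly_measurable g \<Longrightarrow> strongly_measurable (\<lambda>t. f t + g t)"
  by (rule strongly_measurable_comp2) (auto intro: tendsto_add)

lemma strongly_measurable_diff:
  "strongly_measurable f \<Longrightarrow> strongly_measurable g \<Longrightarrow> strongly_measurable (\<lambda>t. f t - g t)"
  by (rule strongly_measurable_comp2) (auto intro: tendsto_diff)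

lemma strongly_measurable_bounded_linear:
  assumes "bounded_linear T" "strongly_measurable f" shows "strongly_measurable (\<lambda>t. T (f t))"
  using strongly_measurable_comp2[OF assms(2) assms(2), of "\<lambda>a b. T a"]
  by (auto intro: bounded_linear.tendsto[OF assms(1)])

lemma strongly_measurable_cinner:
  assumes "strongly_measurable f" "strongly_measurable g"
  shows "(\<lambda>t. cinner (f t) (g t)) \<in> borel_measurable lebesgue"
proof -
  obtain s where s: "\<And>n. simple_fn (s n)" "AE t in lebesgue. (\<lambda>n. s n t) \<longlonglongrightarrow> f t"
    using assms by (auto simp: strongly_measurable_def)
  obtain r where r: "\<And>n. simple_fn (r n)" "AE t in lebesgue. (\<lambda>n. r n t) \<longlonglongrightarrow> g t"
    using assms by (auto simp: strongly_measurable_def)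
  have "AE t in lebesgue. (\<lambda>n. cinner (s n t) (r n t)) \<longlonglongrightarrow> cinner (f t) (g t)"
    using s(2) r(2) by eventually_elim (rule cinner.tendsto)
  then show ?thesis
    by (rule lebesgue_measurable_AE_lim[rotated])
       (rule simple_fn_measurable[OF simple_fn_comp2[OF s(1) r(1)], of "\<lambda>x. x"])
qed

lemma strongly_measurable_continuous:
  fixes f :: "real \<Rightarrow> 'a::chilbert"
  assumes "continuous_on UNIV f" shows "strongly_measurable f"
proof (rule strongly_measurableI[of f "\<lambda>n. f (from_nat_into \<rat> n)"])
  have "f ` closure \<rat> \<subseteq> closure (f ` \<rat>)"
    by (rule image_closure_subset) (auto simp: closure_subset intro: continuous_on_subset[OF assms])
  moreover have "range (\<lambda>n. f (from_nat_into \<rat> n)) = f ` \<rat>"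
    using range_from_nat_into[of "\<rat> :: real set"] countable_rat
    by (metis Rats_0 empty_iff image_image)
  ultimately show "AE t in lebesgue. f t \<in> closure (range (\<lambda>n. f (from_nat_into \<rat> n)))"
    by (auto simp: Rats_closure_real)
  show "(\<lambda>t. norm (f t - f (from_nat_into \<rat> n))) \<in> borel_measurable lebesgue" for n
    by (intro measurable_completion) (auto intro!: borel_measurable_continuous_onI continuous_intros assms)
qed

lemma lebesgue_shift_measurable: "(\<lambda>t::real. t - s) \<in> lebesgue \<rightarrow>\<^sub>M lebesgue"
  using lebesgue_affine_measurable[where c="\<lambda>_::real. 1" and t="-s"] by (simp add: algebra_simps)

lemma AE_lebesgue_shift:
  assumes "AE t in lebesgue. P t" shows "AE t in lebesgue. P (t - s :: real)"
proof -
  obtain N where N: "N \<in> null_sets lebesgue" "{t. \<not> P t} \<subseteq> N"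
    using assms by (auto simp: eventually_ae_filter)
  have "(\<integral>\<^sup>+t. indicator N t \<partial>lebesgue) = (\<integral>\<^sup>+t. indicator N (t - s) \<partial>lebesgue)"
    using nn_integral_real_affine_lebesgue[of "indicator N :: real \<Rightarrow> ennreal" 1 "-s"] N(1)
    by (auto simp: algebra_simps)
  moreover have "(\<lambda>t. indicator N (t - s) :: ennreal) = indicator ((\<lambda>t. t - s) -` N)"
    by (auto simp: indicator_def)
  moreover have "(\<lambda>t. t - s) -` N \<in> sets lebesgue"
    using measurable_sets[OF lebesgue_shift_measurable[of s], of N] N(1) by auto
  ultimately have "(\<lambda>t. t - s) -` N \<in> null_sets lebesgue" using N(1) by (auto simp: null_sets_def)
  then show ?thesis by (rule AE_I') (use N(2) in auto)
qed

lemma strongly_measurable_shift: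
  assumes "strongly_measurable f" shows "strongly_measurable (\<lambda>t. f (t - r))"
proof -
  obtain s where s: "\<And>n. simple_fn (s n)" "AE t in lebesgue. (\<lambda>n. s n t) \<longlonglongrightarrow> f t"
    using assms by (auto simp: strongly_measurable_def)
  have "simple_fn (\<lambda>t. s n (t - r))" for n
    unfolding simple_fn_def
  proof (intro conjI allI)
    show "finite (range (\<lambda>t. s n (t - r)))"
      using s(1)[of n] by (auto simp: simple_fn_def elim!: finite_subset[rotated])
    show "(\<lambda>t. s n (t - r)) -` {x} \<in> sets lebesgue" for x
      using measurable_sets[OF lebesgue_shift_measurable[of r], of "s n -` {x}"] s(1)[of n]
      by (simp add: simple_fn_def vimage_def)
  qed
  then show ?thesis unfolding strongly_measurable_def
    using AE_lebesgue_shift[OF s(2), of r] by (intro exI[of _ "\<lambda>n t. s n (t - r)"]) simp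
qed

subsection \<open>The Hilbert space of square-integrable functions\<close>

definition L2 :: "(real \<Rightarrow> 'a::chilbert) \<Rightarrow> bool" where
  "L2 f \<longleftrightarrow> strongly_measurable f \<and> integrable lebesgue (\<lambda>t. (norm (f t))\<^sup>2)"

definition l2rel :: "(real \<Rightarrow> 'a::chilbert) \<Rightarrow> (real \<Rightarrow> 'a) \<Rightarrow> bool" where
  "l2rel f g \<longleftrightarrow> L2 f \<and> L2 g \<and> (AE t in lebesgue. f t = g t)"

lemma L2_dominated:
  assumes "L2 f" "strongly_measurable g" "AE t in lebesgue. norm (g t) \<le> B * norm (f t)"
  shows "L2 g"
  unfolding L2_def
proof
  show "integrable lebesgue (\<lambda>t. (norm (g t))\<^sup>2)"
  proof (rule bochner_bound)
    show "integrable lebesgue (\<lambda>t. B\<^sup>2 * (norm (f t))\<^sup>2)" using assms(1) by (simp add: L2_def)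
    show "(\<lambda>t. (norm (g t))\<^sup>2) \<in> borel_measurable lebesgue"
      using strongly_measurable_norm0[OF assms(2)] by measurable
    show "AE t in lebesgue. norm ((norm (g t))\<^sup>2) \<le> norm (B\<^sup>2 * (norm (f t))\<^sup>2)"
      using assms(3)
    proof eventually_elim
      case (elim t)
      then have "(norm (g t))\<^sup>2 \<le> (B * norm (f t))\<^sup>2" by (intro power_mono) auto
      then show ?case by (simp add: power_mult_distrib)
    qed
  qed
qed fact

lemma L2_add:
  assumes "L2 f" "L2 g" shows "L2 (\<lambda>t. f t + g t)"
  unfolding L2_def
proof
  show sm: "strongly_measurable (\<lambda>t. f t + g t)" using assms by (auto simp: L2_def intro: strongly_measurable_add)
  show "integrable lebesgue (\<lambda>t. (norm (f t + g t))\<^sup>2)"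
  proof (rule bochner_bound)
    show "integrable lebesgue (\<lambda>t. 2 * (norm (f t))\<^sup>2 + 2 * (norm (g t))\<^sup>2)" using assms by (simp add: L2_def)
    show "(\<lambda>t. (norm (f t + g t))\<^sup>2) \<in> borel_measurable lebesgue"
      using strongly_measurable_norm0[OF sm] by measurable
    have "(norm (f t + g t))\<^sup>2 \<le> 2 * (norm (f t))\<^sup>2 + 2 * (norm (g t))\<^sup>2" for t
      using parallelogram[of "f t" "g t"] zero_le_power2[of "norm (f t - g t)"] by linarith
    then show "AE t in lebesgue. norm ((norm (f t + g t))\<^sup>2) \<le> norm (2 * (norm (f t))\<^sup>2 + 2 * (norm (g t))\<^sup>2)"
      by simp
  qed
qed

lemma L2_cscale: "L2 f \<Longrightarrow> L2 (\<lambda>t. a *\<^sub>C f t)"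
  by (rule L2_dominated[of f _ "cmod a"])
     (auto simp: norm_cscale L2_def intro!: strongly_measurable_cscale)

lemma L2_scaleR: "L2 f \<Longrightarrow> L2 (\<lambda>t. r *\<^sub>R f t)"
  using L2_cscale[of f "of_real r"] by (simp add: cscale_of_real)

lemma L2_minus: "L2 f \<Longrightarrow> L2 (\<lambda>t. - f t)"
  using L2_scaleR[of f "-1"] by simp

lemma L2_diff: "L2 f \<Longrightarrow> L2 g \<Longrightarrow> L2 (\<lambda>t. f t - g t)"
  using L2_add[OF _ L2_minus, of f g] by simp

lemma L2_zero: "L2 (\<lambda>t. 0)"
  by (auto simp: L2_def intro!: strongly_measurable_continuous)

lemma L2_cong_AE:
  assumes "L2 f" "AE t in lebesgue. f t = g t" shows "L2 g"
  by (rule L2_dominated[OF assms(1), of _ 1])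
     (use assms in \<open>auto simp: L2_def intro: strongly_measurable_cong_AE elim!: eventually_mono\<close>)

lemma L2_integrable_cinner:
  assumes "L2 f" "L2 g" shows "integrable lebesgue (\<lambda>t. cinner (f t) (g t))"
proof (rule bochner_bound)
  show "integrable lebesgue (\<lambda>t. (norm (f t))\<^sup>2 + (norm (g t))\<^sup>2)" using assms by (simp add: L2_def)
  show "(\<lambda>t. cinner (f t) (g t)) \<in> borel_measurable lebesgue"
    using assms by (auto simp: L2_def intro: strongly_measurable_cinner)
  have "cmod (cinner (f t) (g t)) \<le> (norm (f t))\<^sup>2 + (norm (g t))\<^sup>2" for t
    using norm_cinner_le[of "f t" "g t"] sum_squares_bound[of "norm (f t)" "norm (g t)"]
      mult_nonneg_nonneg[OF norm_ge_zero[of "f t"] norm_ge_zero[of "g t"]] by linarith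
  then show "AE t in lebesgue. cmod (cinner (f t) (g t)) \<le> norm ((norm (f t))\<^sup>2 + (norm (g t))\<^sup>2)" by simp
qed

quotient_type (overloaded) 'a l2 = "real \<Rightarrow> 'a::chilbert" / partial: l2rel
proof (rule part_equivpI)
  show "\<exists>x::real \<Rightarrow> 'a. l2rel x x" using L2_zero by (intro exI[of _ "\<lambda>t. 0"]) (auto simp: l2rel_def)
  show "symp (l2rel :: (real \<Rightarrow> 'a) \<Rightarrow> _)" by (auto simp: symp_def l2rel_def elim!: eventually_mono)
  show "transp (l2rel :: (real \<Rightarrow> 'a) \<Rightarrow> _)" unfolding transp_def l2rel_def
    by (auto elim: eventually_elim2)
qed

instantiation l2 :: (chilbert) real_vector
begin
lift_definition zero_l2 :: "'a l2" is "\<lambda>t. 0" by (simp add: l2rel_def L2_zero)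
lift_definition plus_l2 :: "'a l2 \<Rightarrow> 'a l2 \<Rightarrow> 'a l2" is "\<lambda>f g t. f t + g t"
  by (auto simp: l2rel_def L2_add elim: eventually_elim2)
lift_definition minus_l2 :: "'a l2 \<Rightarrow> 'a l2 \<Rightarrow> 'a l2" is "\<lambda>f g t. f t - g t"
  by (auto simp: l2rel_def L2_diff elim: eventually_elim2)
lift_definition uminus_l2 :: "'a l2 \<Rightarrow> 'a l2" is "\<lambda>f t. - f t"
  by (auto simp: l2rel_def L2_minus elim: eventually_mono)
lift_definition scaleR_l2 :: "real \<Rightarrow> 'a l2 \<Rightarrow> 'a l2" is "\<lambda>r f t. r *\<^sub>R f t"
  by (auto simp: l2rel_def L2_scaleR elim: eventually_mono)
instance
  by standard (transfer; auto simp: l2rel_def algebra_simps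
      intro!: L2_add L2_scaleR L2_minus L2_zero L2_diff)+
end

instantiation l2 :: (chilbert) real_normed_vector
begin
lift_definition norm_l2 :: "'a l2 \<Rightarrow> real" is "\<lambda>f. sqrt (LINT t|lebesgue. (norm (f t))\<^sup>2)"
  by (auto simp: l2rel_def L2_def elim!: eventually_mono intro!: integral_cong_AE)
definition dist_l2 :: "'a l2 \<Rightarrow> 'a l2 \<Rightarrow> real" where "dist_l2 a b = norm (a - b)"
definition sgn_l2 :: "'a l2 \<Rightarrow> 'a l2" where "sgn_l2 a = a /\<^sub>R norm a"
definition uniformity_l2 :: "('a l2 \<times> 'a l2) filter" where
  "uniformity_l2 = (INF e\<in>{0 <..}. principal {(x, y). dist x y < e})"
definition open_l2 :: "'a l2 set \<Rightarrow> bool" where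
  "open_l2 U \<longleftrightarrow> (\<forall>x\<in>U. eventually (\<lambda>(x', y). x' = x \<longrightarrow> y \<in> U) uniformity)"
instance
proof
  fix x y :: "'a l2" and r :: real
  show "dist x y = norm (x - y)" by (rule dist_l2_def)
  show "sgn x = x /\<^sub>R norm x" by (rule sgn_l2_def)
  show "(uniformity :: ('a l2 \<times> 'a l2) filter) = (INF e\<in>{0 <..}. principal {(x, y). dist x y < e})"
    by (rule uniformity_l2_def)
  show "open U \<longleftrightarrow> (\<forall>x\<in>U. eventually (\<lambda>(x', y). x' = x \<longrightarrow> y \<in> U) uniformity)" for U :: "'a l2 set"
    by (rule open_l2_def)
  show n0: "norm x = 0 \<longleftrightarrow> x = 0" for x :: "'a l2"
  proof (transfer, auto simp: l2rel_def L2_zero)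
    fix x :: "real \<Rightarrow> 'a" assume "L2 x" "(LINT t|lebesgue. (norm (x t))\<^sup>2) = 0"
    then show "AE t in lebesgue. x t = 0"
      using integral_nonneg_eq_0_iff_AE[of lebesgue "\<lambda>t. (norm (x t))\<^sup>2"] by (simp add: L2_def)
  next
    fix x :: "real \<Rightarrow> 'a" assume "L2 x" "AE t in lebesgue. x t = 0"
    then show "(LINT t|lebesgue. (norm (x t))\<^sup>2) = 0"
      by (intro integral_eq_zero_AE) (auto elim: eventually_mono)
  qed
  show "norm (r *\<^sub>R x) = \<bar>r\<bar> * norm x"
    by transfer (simp add: power_mult_distrib real_sqrt_mult)
  have nn: "0 \<le> norm x" for x :: "'a l2" by transfer simp
  have sq: "(norm x)\<^sup>2 = (LINT t|lebesgue. (norm (rep_l2 x t))\<^sup>2)" for x :: "'a l2"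
    by (simp add: norm_l2.rep_eq)
  show "norm (x + y) \<le> norm x + norm y"
  proof (cases "x = 0 \<or> y = 0")
    case True then show ?thesis using n0[of 0] by auto
  next
    case False
    define a b where "a = norm x" and "b = norm y"
    have ab: "a > 0" "b > 0" using False n0[of x] n0[of y] nn[of x] nn[of y] by (auto simp: a_def b_def)
    have "(norm (x + y))\<^sup>2 \<le> (a + b)\<^sup>2"
      using ab a_def b_def
    proof (transfer fixing: a b)
      fix x y :: "real \<Rightarrow> 'a" assume xy: "l2rel x x" "l2rel y y"
        and a: "0 < a" "a = sqrt (LINT t|lebesgue. (norm (x t))\<^sup>2)"
        and b: "0 < b" "b = sqrt (LINT t|lebesgue. (norm (y t))\<^sup>2)"
      have L: "L2 x" "L2 y" "L2 (\<lambda>t. x t + y t)" using xy by (auto simp: l2rel_def L2_add)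
      have "(norm (x t + y t))\<^sup>2 \<le> (1 + b / a) * (norm (x t))\<^sup>2 + (1 + a / b) * (norm (y t))\<^sup>2" for t
      proof -
        have "(norm (x t + y t))\<^sup>2 \<le> (norm (x t) + norm (y t))\<^sup>2" by (intro power_mono norm_triangle_ineq) auto
        also have "\<dots> = (norm (x t))\<^sup>2 + 2 * norm (x t) * norm (y t) + (norm (y t))\<^sup>2"
          by (simp add: power2_sum)
        also have "2 * norm (x t) * norm (y t) \<le> (b / a) * (norm (x t))\<^sup>2 + (a / b) * (norm (y t))\<^sup>2"
        proof -
          have "0 \<le> (b * norm (x t) - a * norm (y t))\<^sup>2 / (a * b)" using a b by simp
          also have "\<dots> = (b / a) * (norm (x t))\<^sup>2 + (a / b) * (norm (y t))\<^sup>2 - 2 * norm (x t) * norm (y t)"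
            using a(1) b(1) by (simp add: field_simps power2_eq_square)
          finally show ?thesis by simp
        qed
        finally show ?thesis by (simp add: algebra_simps)
      qed
      then have "(LINT t|lebesgue. (norm (x t + y t))\<^sup>2) \<le>
          (LINT t|lebesgue. (1 + b / a) * (norm (x t))\<^sup>2 + (1 + a / b) * (norm (y t))\<^sup>2)"
        using L by (intro integral_mono) (auto simp: L2_def)
      also have "\<dots> = (1 + b / a) * (LINT t|lebesgue. (norm (x t))\<^sup>2) + (1 + a / b) * (LINT t|lebesgue. (norm (y t))\<^sup>2)"
        using L by (subst Bochner_Integration.integral_add) (auto simp: L2_def)
      also have "(LINT t|lebesgue. (norm (x t))\<^sup>2) = a\<^sup>2" by (simp add: a(2))
      also have "(LINT t|lebesgue. (norm (y t))\<^sup>2) = b\<^sup>2" by (simp add: b(2))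
      also have "(1 + b / a) * a\<^sup>2 + (1 + a / b) * b\<^sup>2 = (a + b)\<^sup>2"
        using a(1) b(1) by (simp add: field_simps power2_eq_square)
      finally show "(sqrt (LINT t|lebesgue. (norm (x t + y t))\<^sup>2))\<^sup>2 \<le> (a + b)\<^sup>2" by simp
    qed
    then show ?thesis using nn[of x] nn[of y] by - (rule power2_le_imp_le, auto simp: a_def b_def)
  qed
qed
end

lemma L2_rep: "L2 (rep_l2 a)"
  using Quotient3_rep_reflp[OF Quotient3_l2, of a] by (simp add: l2rel_def)

lemma rep_abs_l2: "L2 f \<Longrightarrow> AE t in lebesgue. rep_l2 (abs_l2 f) t = f t"
  using rep_abs_rsp[OF Quotient3_l2, of f f] Quotient3_rel[OF Quotient3_l2] rep_abs_rsp_left[OF Quotient3_l2, of f f]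
  by (auto simp: l2rel_def)

lemma abs_rep_l2 [simp]: "abs_l2 (rep_l2 a) = a"
  by (rule Quotient3_abs_rep[OF Quotient3_l2])

lemma abs_l2_eq_iff: "L2 f \<Longrightarrow> L2 g \<Longrightarrow> abs_l2 f = abs_l2 g \<longleftrightarrow> (AE t in lebesgue. f t = g t)"
  using Quotient3_rel[OF Quotient3_l2, of f g] by (auto simp: l2rel_def)

lemma l2_eqI: "AE t in lebesgue. rep_l2 a t = rep_l2 b t \<Longrightarrow> a = b"
  using abs_l2_eq_iff[OF L2_rep L2_rep, of a b] by simp

lemma l2_eqI_abs: "L2 f \<Longrightarrow> AE t in lebesgue. rep_l2 a t = f t \<Longrightarrow> a = abs_l2 f"
  using abs_l2_eq_iff[OF L2_rep, of f a] by simp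

lemma abs_l2_add: "L2 f \<Longrightarrow> L2 g \<Longrightarrow> abs_l2 f + abs_l2 g = abs_l2 (\<lambda>t. f t + g t)"
  by (rule plus_l2.abs_eq) (auto simp: l2rel_def eq_onp_def)

lemma abs_l2_diff: "L2 f \<Longrightarrow> L2 g \<Longrightarrow> abs_l2 f - abs_l2 g = abs_l2 (\<lambda>t. f t - g t)"
  by (rule minus_l2.abs_eq) (auto simp: l2rel_def eq_onp_def)

lemma abs_l2_scaleR: "L2 f \<Longrightarrow> r *\<^sub>R abs_l2 f = abs_l2 (\<lambda>t. r *\<^sub>R f t)"
  by (rule scaleR_l2.abs_eq) (auto simp: l2rel_def eq_onp_def)

lemma norm_abs_l2: "L2 f \<Longrightarrow> norm (abs_l2 f) = sqrt (LINT t|lebesgue. (norm (f t))\<^sup>2)"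
  by (rule norm_l2.abs_eq) (auto simp: l2rel_def eq_onp_def)

lemma norm_l2_sq: "(norm a)\<^sup>2 = (LINT t|lebesgue. (norm (rep_l2 a t))\<^sup>2)"
  by (simp add: norm_l2.rep_eq)

lemma norm_diff_abs_l2: "L2 f \<Longrightarrow> (norm (abs_l2 f - a))\<^sup>2 = (LINT t|lebesgue. (norm (f t - rep_l2 a t))\<^sup>2)"
  using norm_abs_l2[OF L2_diff[OF _ L2_rep], of f a] abs_l2_diff[OF _ L2_rep, of f a] by simp

lemma rep_l2_diff: "AE t in lebesgue. rep_l2 (a - b) t = rep_l2 a t - rep_l2 b t"
  using rep_abs_l2[OF L2_diff[OF L2_rep L2_rep], of a b] abs_l2_diff[OF L2_rep L2_rep, of a b] by simp

lemma rep_l2_add: "AE t in lebesgue. rep_l2 (a + b) t = rep_l2 a t + rep_l2 b t"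
  using rep_abs_l2[OF L2_add[OF L2_rep L2_rep], of a b] abs_l2_add[OF L2_rep L2_rep, of a b] by simp

lemma rep_l2_scaleR: "AE t in lebesgue. rep_l2 (r *\<^sub>R a) t = r *\<^sub>R rep_l2 a t"
  using rep_abs_l2[OF L2_scaleR[OF L2_rep], of r a] abs_l2_scaleR[OF L2_rep, of r a] by simp

lemma l2_fast_Cauchy_convergent:
  fixes X :: "nat \<Rightarrow> 'a::chilbert l2"
  assumes X: "\<And>k. norm (X (Suc k) - X k) \<le> (1/2)^k"
  shows "convergent X"
proof -
  define f where "f k = rep_l2 (X k)" for k
  have Lf: "L2 (f k)" for k by (simp add: f_def L2_rep)
  have Xf: "X k = abs_l2 (f k)" for k by (simp add: f_def)
  define d where "d k t = (norm (f (Suc k) t - f k t))\<^sup>2" for k t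
  have di: "integrable lebesgue (d k)" for k
    using L2_diff[OF Lf Lf, of "Suc k" k] by (simp add: d_def[abs_def] L2_def)
  have d0: "d k t \<ge> 0" for k t by (simp add: d_def)
  have dI: "(LINT t|lebesgue. d k t) \<le> (1/4)^k" for k
  proof -
    have "(LINT t|lebesgue. d k t) = (norm (X (Suc k) - X k))\<^sup>2"
      using norm_diff_abs_l2[OF Lf, of "Suc k" "X k"] by (simp add: d_def f_def)
    also have "\<dots> \<le> ((1/2)^k)\<^sup>2" by (intro power_mono X) auto
    finally show ?thesis by (simp add: power2_eq_square flip: power_mult_distrib)
  qed
  have m: "(\<lambda>t. ennreal (2^k * d k t)) \<in> borel_measurable lebesgue" for k
    using di[of k] by measurable
  have "(\<integral>\<^sup>+t. (\<Sum>k. ennreal (2^k * d k t)) \<partial>lebesgue) = (\<Sum>k. \<integral>\<^sup>+t. ennreal (2^k * d k t) \<partial>lebesgue)"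
    by (rule nn_integral_suminf[OF m])
  also have "\<dots> \<le> (\<Sum>k. ennreal ((1/2)^k))"
  proof (intro suminf_le)
    fix k
    have "(\<integral>\<^sup>+t. ennreal (2^k * d k t) \<partial>lebesgue) = ennreal (LINT t|lebesgue. 2^k * d k t)"
      using di d0 by (intro nn_integral_eq_integral) auto
    also have "(LINT t|lebesgue. 2^k * d k t) \<le> 2^k * (1/4)^k"
      using dI[of k] by simp
    also have "2^k * (1/4)^k = (1/2::real)^k" by (simp flip: power_mult_distrib)
    finally show "(\<integral>\<^sup>+t. ennreal (2^k * d k t) \<partial>lebesgue) \<le> ennreal ((1/2)^k)" by (simp add: ennreal_leI)
  qed auto
  also have "\<dots> = ennreal (\<Sum>k. (1/2)^k)" by (rule suminf_ennreal2) (auto intro: summable_geometric)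
  also have "\<dots> < \<infinity>" by simp
  finally have "AE t in lebesgue. (\<Sum>k. ennreal (2^k * d k t)) \<noteq> \<infinity>"
    using m by (intro nn_integral_PInf_AE) auto
  then have conv: "AE t in lebesgue. convergent (\<lambda>k. f k t)"
  proof eventually_elim
    case (elim t)
    then have "summable (\<lambda>k. 2^k * d k t)"
      using d0 by (intro summable_suminf_not_top) (auto simp: top_ennreal_def infinity_ennreal_def)
    then have "bounded (range (\<lambda>k. 2^k * d k t))"
      using summable_LIMSEQ_zero convergent_imp_bounded by blast
    then obtain B where B: "\<And>k. 2^k * d k t \<le> B" "B > 0"
      unfolding bounded_pos by (force simp: abs_le_iff)
    have "norm (f (Suc k) t - f k t) \<le> sqrt B * (sqrt (1/2))^k" for k
    proof -
      have "d k t \<le> B * (1/2)^k" using B(1)[of k] by (simp add: field_simps power_divide)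
      then have "sqrt (d k t) \<le> sqrt (B * (1/2)^k)" by simp
      then show ?thesis by (simp add: d_def real_sqrt_mult real_sqrt_power)
    qed
    note bd = this
    have sm: "summable (\<lambda>k. sqrt B * (sqrt (1/2))^k)"
      by (intro summable_mult summable_geometric) (auto simp: real_sqrt_divide)
    have "summable (\<lambda>k. f (Suc k) t - f k t)"
      by (rule summable_comparison_test'[OF sm, of 0]) (rule bd)
    then have "convergent (\<lambda>n. \<Sum>k<n. f (Suc k) t - f k t)" by (simp add: summable_iff_convergent)
    then have "convergent (\<lambda>n. f n t - f 0 t)"
      using sum_lessThan_telescope[of "\<lambda>k. f k t"] by simp
    then show ?case using convergent_add[OF _ convergent_const, of "\<lambda>n. f n t - f 0 t" "f 0 t"] by simp
  qed
  define g where "g t = lim (\<lambda>k. f k t)" for t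
  have lim: "AE t in lebesgue. (\<lambda>k. f k t) \<longlonglongrightarrow> g t"
    using conv by eventually_elim (simp add: g_def convergent_LIMSEQ_iff)
  have smg: "strongly_measurable g"
    by (rule strongly_measurable_lim[OF _ lim]) (use Lf in \<open>simp add: L2_def\<close>)
  have tail: "norm (X m - X k) \<le> 2 * (1/2)^k" if "k \<le> m" for k m
  proof -
    have "norm (X (k + j) - X k) \<le> 2 * (1/2)^k - 2 * (1/2)^(k+j)" for j
    proof (induction j)
      case (Suc j)
      have "norm (X (k + Suc j) - X k) \<le> norm (X (Suc (k + j)) - X (k + j)) + norm (X (k + j) - X k)"
        using norm_triangle_ineq[of "X (Suc (k + j)) - X (k + j)" "X (k + j) - X k"] by simp
      then show ?case using Suc X[of "k + j"] by simp
    qed simp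
    from this[of "m - k"] that have "norm (X m - X k) \<le> 2 * (1/2)^k - 2 * (1/2)^m" by simp
    also have "\<dots> \<le> 2 * (1/2)^k" by simp
    finally show ?thesis .
  qed
  have fat: "(\<integral>\<^sup>+t. ennreal ((norm (g t - f k t))\<^sup>2) \<partial>lebesgue) \<le> ennreal ((2 * (1/2)^k)\<^sup>2)" for k
  proof -
    have "(\<integral>\<^sup>+t. ennreal ((norm (g t - f k t))\<^sup>2) \<partial>lebesgue) =
        (\<integral>\<^sup>+t. liminf (\<lambda>m. ennreal ((norm (f m t - f k t))\<^sup>2)) \<partial>lebesgue)"
      using lim by (intro nn_integral_cong_AE)
        (auto elim!: eventually_mono intro!: lim_imp_Liminf[symmetric] tendsto_intros)
    also have "\<dots> \<le> liminf (\<lambda>m. \<integral>\<^sup>+t. ennreal ((norm (f m t - f k t))\<^sup>2) \<partial>lebesgue)"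
      using L2_diff[OF Lf Lf, of _ k] by (intro nn_integral_liminf) (auto simp: L2_def)
    also have "\<dots> \<le> ennreal ((2 * (1/2)^k)\<^sup>2)"
    proof -
      have "(\<integral>\<^sup>+t. ennreal ((norm (f m t - f k t))\<^sup>2) \<partial>lebesgue) \<le> ennreal ((2 * (1/2)^k)\<^sup>2)" if "m \<ge> k" for m
      proof -
        have "(\<integral>\<^sup>+t. ennreal ((norm (f m t - f k t))\<^sup>2) \<partial>lebesgue) = ennreal (LINT t|lebesgue. (norm (f m t - f k t))\<^sup>2)"
          using L2_diff[OF Lf Lf, of m k] by (intro nn_integral_eq_integral) (auto simp: L2_def)
        also have "(LINT t|lebesgue. (norm (f m t - f k t))\<^sup>2) = (norm (X m - X k))\<^sup>2"
          using norm_diff_abs_l2[OF Lf, of m "X k"] by (simp add: f_def)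
        also have "\<dots> \<le> (2 * (1/2)^k)\<^sup>2" using tail[OF that] by (intro power_mono) auto
        finally show ?thesis by (simp add: ennreal_leI)
      qed
      then show ?thesis
        by (intro Liminf_le) (auto simp: eventually_sequentially)
    qed
    finally show ?thesis .
  qed
  have sqi: "integrable lebesgue (\<lambda>t. (norm (g t - f k t))\<^sup>2)" for k
  proof (rule integrableI_nonneg)
    show "(\<lambda>t. (norm (g t - f k t))\<^sup>2) \<in> borel_measurable lebesgue"
      using strongly_measurable_norm0[OF strongly_measurable_diff[OF smg, of "f k"]] Lf[of k]
      by (auto simp: L2_def)
    show "(\<integral>\<^sup>+t. ennreal ((norm (g t - f k t))\<^sup>2) \<partial>lebesgue) < \<infinity>"
      using fat[of k] by (rule le_less_trans) simp
  qed auto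
  then have "L2 (\<lambda>t. g t - f 0 t)" using smg Lf[of 0] by (auto simp: L2_def intro: strongly_measurable_diff)
  from L2_add[OF this Lf[of 0]] have Lg: "L2 g" by simp
  have "norm (X k - abs_l2 g) \<le> 2 * (1/2)^k" for k
  proof -
    have "ennreal (LINT t|lebesgue. (norm (g t - f k t))\<^sup>2) \<le> ennreal ((2 * (1/2)^k)\<^sup>2)"
      using fat[of k] nn_integral_eq_integral[OF sqi[of k]] by simp
    then have "(norm (abs_l2 g - X k))\<^sup>2 \<le> (2 * (1/2)^k)\<^sup>2"
      using norm_diff_abs_l2[OF Lg, of "X k"] by (simp add: f_def ennreal_le_iff)
    then show ?thesis by - (rule power2_le_imp_le, auto simp: norm_minus_commute)
  qed
  moreover have "(\<lambda>k. 2 * (1/2::real)^k) \<longlonglongrightarrow> 0"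
    by (intro tendsto_mult_right_zero LIMSEQ_realpow_zero) auto
  ultimately have "(\<lambda>k. X k - abs_l2 g) \<longlonglongrightarrow> 0"
    using Lim_null_comparison[of "\<lambda>k. X k - abs_l2 g" "\<lambda>k. 2 * (1/2)^k" sequentially] by simp
  then show ?thesis using LIM_zero_cancel convergentI by blast
qed

instance l2 :: (chilbert) complete_space
proof
  fix X :: "nat \<Rightarrow> 'a l2" assume C: "Cauchy X"
  have "\<exists>N. \<forall>m\<ge>N. \<forall>n\<ge>N. dist (X m) (X n) < (1/2)^k" for k
    using C by (auto simp: Cauchy_def)
  then obtain N where N: "\<And>k m n. m \<ge> N k \<Longrightarrow> n \<ge> N k \<Longrightarrow> dist (X m) (X n) < (1/2)^k" by metis
  define r where "r k = (\<Sum>i\<le>k. Suc (N i))" for k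
  have r: "strict_mono r" by (rule strict_monoI_Suc) (simp add: r_def)
  have rN: "r k \<ge> N k" for k unfolding r_def using member_le_sum[of k "{..k}" "\<lambda>i. Suc (N i)"] by simp
  have "norm ((X \<circ> r) (Suc k) - (X \<circ> r) k) \<le> (1/2)^k" for k
    using N[of k "r (Suc k)" "r k"] rN[of k] strict_monoD[OF r, of k "Suc k"] by (simp add: dist_norm)
  from l2_fast_Cauchy_convergent[OF this] obtain l where "(X \<circ> r) \<longlonglongrightarrow> l" unfolding convergent_def by blast
  then show "convergent X"
    using Cauchy_converges_subseq[OF C r] convergentI by blast
qed

instance l2 :: (chilbert) banach ..

instantiation l2 :: (chilbert) chilbert
begin
lift_definition cscale_l2 :: "complex \<Rightarrow> 'a l2 \<Rightarrow> 'a l2" is "\<lambda>a f t. a *\<^sub>C f t"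
  by (auto simp: l2rel_def L2_cscale elim: eventually_mono)
lift_definition cinner_l2 :: "'a l2 \<Rightarrow> 'a l2 \<Rightarrow> complex" is "\<lambda>f g. LINT t|lebesgue. cinner (f t) (g t)"
  by (rule integral_cong_AE) (auto simp: l2rel_def L2_def strongly_measurable_cinner elim: eventually_elim2)
instance
proof
  fix x y z :: "'a l2" and a b :: complex and r :: real
  show "complex_of_real r *\<^sub>C x = r *\<^sub>R x" by transfer (simp add: l2rel_def cscale_of_real L2_scaleR)
  show "a *\<^sub>C (x + y) = a *\<^sub>C x + a *\<^sub>C y" by transfer (auto simp: l2rel_def cscale_add_right intro!: L2_add L2_cscale)
  show "(a + b) *\<^sub>C x = a *\<^sub>C x + b *\<^sub>C x" by transfer (auto simp: l2rel_def cscale_add_left intro!: L2_add L2_cscale)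
  show "a *\<^sub>C (b *\<^sub>C x) = (a * b) *\<^sub>C x" by transfer (auto simp: l2rel_def cscale_cscale intro!: L2_cscale)
  show "cinner y x = cnj (cinner x y)"
    by transfer (simp add: cinner_commute[of "_ y" "_ x"] flip: integral_cnj, subst cinner_commute, simp)
  show "cinner (x + y) z = cinner x z + cinner y z"
    by transfer (auto simp: l2rel_def cinner_add_left L2_integrable_cinner)
  show "cinner (a *\<^sub>C x) y = a * cinner x y" by transfer (simp add: cinner_cscale_left)
  show "norm x = sqrt (Re (cinner x x))" by transfer (simp add: cinner_self del: of_real_power)
qed
end

lemma abs_l2_cscale: "L2 f \<Longrightarrow> a *\<^sub>C abs_l2 f = abs_l2 (\<lambda>t. a *\<^sub>C f t)"
  by (rule cscale_l2.abs_eq) (auto simp: l2rel_def eq_onp_def)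

lemma rep_l2_cscale: "AE t in lebesgue. rep_l2 (r *\<^sub>C a) t = r *\<^sub>C rep_l2 a t"
  using rep_abs_l2[OF L2_cscale[OF L2_rep], of r a] abs_l2_cscale[OF L2_rep, of r a] by simp

lemma cinner_abs_l2: "L2 f \<Longrightarrow> L2 g \<Longrightarrow> cinner (abs_l2 f) (abs_l2 g) = (LINT t|lebesgue. cinner (f t) (g t))"
  by (rule cinner_l2.abs_eq) (auto simp: l2rel_def eq_onp_def)

lemma cinner_l2_rep: "cinner a b = (LINT t|lebesgue. cinner (rep_l2 a t) (rep_l2 b t))"
  by (rule cinner_l2.rep_eq)

lemma cinner_l2_abs_right: "L2 g \<Longrightarrow> cinner a (abs_l2 g) = (LINT t|lebesgue. cinner (rep_l2 a t) (g t))"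
  using cinner_abs_l2[OF L2_rep, of g a] by simp

lemma measurable_indicator_scaleR:
  fixes f :: "real \<Rightarrow> 'b::euclidean_space"
  shows "f \<in> borel_measurable lebesgue \<Longrightarrow> S \<in> sets lebesgue \<Longrightarrow> (\<lambda>t. indicat_real S t *\<^sub>R f t) \<in> borel_measurable lebesgue"
  by (intro borel_measurable_scaleR borel_measurable_indicator)

lemma AE_zero_if_interval_integrals_zero:
  fixes f :: "real \<Rightarrow> real"
  assumes int: "\<And>a b. set_integrable lebesgue {a..<b} f"
    and zero: "\<And>a b. a < b \<Longrightarrow> (LINT t:{a..<b}|lebesgue. f t) = 0"
  shows "AE t in lebesgue. f t = 0"
proof -
  have fm: "f \<in> borel_measurable lebesgue"
  proof (rule lebesgue_measurable_AE_lim[of "\<lambda>n t. indicator {-real n..<real n} t *\<^sub>R f t"])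
    show "(\<lambda>t. indicator {- real n..<real n} t *\<^sub>R f t) \<in> borel_measurable lebesgue" for n
      using int[of "- real n" "real n"] by (auto simp: set_integrable_def)
    have "(\<lambda>n. indicator {-real n..<real n} t *\<^sub>R f t) \<longlonglongrightarrow> f t" for t
    proof -
      obtain N where N: "\<bar>t\<bar> < real N" using reals_Archimedean2 by blast
      have "\<forall>\<^sub>F n in sequentially. indicator {-real n..<real n} t *\<^sub>R f t = f t"
        using eventually_ge_at_top[of N] by eventually_elim (use N in \<open>auto simp: indicator_def\<close>)
      then show ?thesis by (rule tendsto_eventually)
    qed
    then show "AE t in lebesgue. (\<lambda>n. indicator {-real n..<real n} t *\<^sub>R f t) \<longlonglongrightarrow> f t" by simp
  qed
  obtain g where g [measurable]: "g \<in> borel_measurable lborel" and fg: "AE t in lborel. f t = g t"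
    using completion_ex_borel_measurable_real[OF fm] by blast
  have fg': "AE t in lebesgue. f t = g t" using fg by (rule AE_completion)
  have gm: "g \<in> borel_measurable lebesgue" using g by (rule measurable_completion)
  have eq: "(LINT t:{a..<b}|lborel. g t) = (LINT t:{a..<b}|lebesgue. f t)" for a b
  proof -
    have "(LINT t:{a..<b}|lborel. g t) = (LINT t:{a..<b}|lebesgue. g t)"
      unfolding set_lebesgue_integral_def by (rule integral_completion[symmetric]) measurable
    also have "\<dots> = (LINT t:{a..<b}|lebesgue. f t)"
      unfolding set_lebesgue_integral_def
      by (intro integral_cong_AE measurable_indicator_scaleR fm gm)
         (use fg' in \<open>auto elim!: eventually_mono\<close>)
    finally show ?thesis .
  qed
  have gint: "set_integrable lborel {a..<b} g" for a b
  proof -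
    have "integrable lebesgue (\<lambda>t. indicator {a..<b} t *\<^sub>R g t)"
      using int[of a b] unfolding set_integrable_def
      by (rule integrable_cong_AE_imp[OF _ measurable_indicator_scaleR[OF gm]])
         (use fg' in \<open>auto elim!: eventually_mono\<close>)
    then show ?thesis unfolding set_integrable_def by (subst (asm) integrable_completion) auto
  qed
  have "AE t in lborel. indicator {-real n..<real n} t *\<^sub>R g t = 0" for n
  proof (rule sigma_finite_measure.density_zero[OF sigma_finite_lborel])
    let ?h = "\<lambda>t. indicator {-real n..<real n} t *\<^sub>R g t"
    show hi: "integrable lborel ?h" using gint[of "- real n" "real n"] by (simp add: set_integrable_def)
    have hsi: "set_integrable lborel A ?h" if "A \<in> sets borel" for A
      unfolding set_integrable_def by (rule integrable_mult_indicator[OF _ hi]) (use that in simp)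
    fix A :: "real set" assume "A \<in> sets lborel"
    then have AS: "A \<in> sigma_sets UNIV (range (\<lambda>a. {..<a}))"
      by (simp add: borel_Iio)
    have "{..<a} \<inter> {..<b} = {..<min a b}" for a b :: real by auto
    then have IS: "Int_stable (range (\<lambda>a::real. {..<a}))"
      by (auto simp: Int_stable_def)
    have GP: "range (\<lambda>a::real. {..<a}) \<subseteq> Pow UNIV" by simp
    show "set_lebesgue_integral lborel A ?h = 0"
      using IS GP AS
    proof (induction rule: sigma_sets_induct_disjoint)
      case (basic A)
      then obtain a where A: "A = {..<a}" by auto
      have "(LINT t:A|lborel. ?h t) = (LINT t:{-real n..<min a (real n)}|lborel. g t)"
        unfolding set_lebesgue_integral_def A
        by (intro Bochner_Integration.integral_cong) (auto simp: indicator_def)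
      also have "\<dots> = 0"
      proof (cases "- real n < min a (real n)")
        case True then show ?thesis using eq zero by simp
      next
        case False
        then have e: "{-real n..<min a (real n)} = {}" by auto
        show ?thesis unfolding e set_lebesgue_integral_def by simp
      qed
      finally show ?case .
    next
      case (compl A)
      then have A: "A \<in> sets borel" by (simp add: borel_Iio)
      have "(LINT t:UNIV - A|lborel. ?h t) = (LINT t|lborel. ?h t) - (LINT t:A|lborel. ?h t)"
      proof -
        have "(LINT t:UNIV - A|lborel. ?h t) = (LINT t|lborel. ?h t - indicator A t *\<^sub>R ?h t)"
          unfolding set_lebesgue_integral_def
          by (intro Bochner_Integration.integral_cong) (auto simp: indicator_def)
        also have "\<dots> = (LINT t|lborel. ?h t) - (LINT t:A|lborel. ?h t)"
          unfolding set_lebesgue_integral_def using hi hsi[OF A]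
          by (intro Bochner_Integration.integral_diff) (auto simp: set_integrable_def)
        finally show ?thesis .
      qed
      moreover have "(LINT t|lborel. ?h t) = 0"
        using eq[of "- real n" "real n"] zero[of "- real n" "real n"]
        by (cases "n = 0") (auto simp: set_lebesgue_integral_def)
      ultimately show ?case using compl by simp
    next
      case (union A)
      then have A: "A i \<in> sets borel" for i by (auto simp: borel_Iio)
      have "(LINT t:(\<Union>i. A i)|lborel. ?h t) = (\<Sum>i. LINT t:A i|lborel. ?h t)"
        using union(1) A hsi[of "\<Union>i. A i"]
        by (intro lebesgue_integral_countable_add) (auto simp: disjoint_family_on_def)
      then show ?case using union by simp
    qed (simp add: set_lebesgue_integral_def)
  qed
  then have "AE t in lborel. \<forall>n. indicator {-real n..<real n} t *\<^sub>R g t = 0" unfolding AE_all_countable by blast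
  then have "AE t in lborel. g t = 0"
  proof eventually_elim
    case (elim t)
    obtain N where N: "\<bar>t\<bar> < real N" using reals_Archimedean2 by blast
    then show ?case using elim[rule_format, of N] by (auto simp: indicator_def)
  qed
  then have "AE t in lebesgue. g t = 0" by (rule AE_completion)
  with fg' show ?thesis by eventually_elim simp
qed

lemma strongly_measurable_zeroI:
  fixes h :: "real \<Rightarrow> 'a::chilbert"
  assumes h: "strongly_measurable h"
    and int: "\<And>a b x. set_integrable lebesgue {a..<b} (\<lambda>t. cinner (h t) x)"
    and zero: "\<And>a b x. a < b \<Longrightarrow> (LINT t:{a..<b}|lebesgue. cinner (h t) x) = 0"
  shows "AE t in lebesgue. h t = 0"
proof -
  obtain y :: "nat \<Rightarrow> 'a" where y: "AE t in lebesgue. h t \<in> closure (range y)"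
    using strongly_measurable_separable[OF h] .
  have re: "AE t in lebesgue. Re (cinner (h t) x) = 0" for x
  proof (rule AE_zero_if_interval_integrals_zero)
    fix a b :: real
    show "set_integrable lebesgue {a..<b} (\<lambda>t. Re (cinner (h t) x))"
      using int[of a b x] unfolding set_integrable_def
      by (drule_tac integrable_Re) (simp add: scaleR_conv_of_real)
    assume "a < b"
    have "(LINT t:{a..<b}|lebesgue. Re (cinner (h t) x)) = Re (LINT t:{a..<b}|lebesgue. cinner (h t) x)"
      unfolding set_lebesgue_integral_def
      using integral_Re[OF int[of a b x, unfolded set_integrable_def]] by (simp add: scaleR_conv_of_real)
    then show "(LINT t:{a..<b}|lebesgue. Re (cinner (h t) x)) = 0" using zero[OF \<open>a < b\<close>] by simp
  qed
  then have "AE t in lebesgue. \<forall>n. Re (cinner (h t) (y n)) = 0" by (simp add: AE_all_countable)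
  with y show ?thesis
  proof eventually_elim
    case (elim t)
    then obtain z where z: "\<And>n. z n \<in> range y" "z \<longlonglongrightarrow> h t" unfolding closure_sequential by blast
    have "(\<lambda>n. Re (cinner (h t) (z n))) \<longlonglongrightarrow> Re (cinner (h t) (h t))"
      by (intro tendsto_Re cinner.tendsto tendsto_const z(2))
    moreover have "Re (cinner (h t) (z n)) = 0" for n using z(1)[of n] elim(2) by auto
    ultimately have "Re (cinner (h t) (h t)) = 0" using LIMSEQ_unique[OF _ tendsto_const] by simp
    then show ?case by (simp add: Re_cinner_self)
  qed
qed

lemma L2_bounded_support:
  fixes f :: "real \<Rightarrow> 'a::chilbert"
  assumes "strongly_measurable f" "\<And>t. norm (f t) \<le> B" "\<And>t. t \<notin> {a..b} \<Longrightarrow> f t = 0"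
  shows "L2 f"
  unfolding L2_def
proof
  show "integrable lebesgue (\<lambda>t. (norm (f t))\<^sup>2)"
  proof (rule bochner_bound)
    show "integrable lebesgue (\<lambda>t. B\<^sup>2 * indicator {a..b} t)"
      by (intro integrable_mult_right integrable_real_indicator) (auto simp: emeasure_lborel_Icc_eq)
    show "(\<lambda>t. (norm (f t))\<^sup>2) \<in> borel_measurable lebesgue"
      using strongly_measurable_norm0[OF assms(1)] by measurable
    show "AE t in lebesgue. norm ((norm (f t))\<^sup>2) \<le> norm (B\<^sup>2 * indicator {a..b} t)"
      using assms(2,3) by (auto intro!: AE_I2 power_mono simp: indicator_def)
  qed
qed fact

definition box_fn :: "real \<Rightarrow> real \<Rightarrow> 'a \<Rightarrow> real \<Rightarrow> 'a::chilbert" where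
  "box_fn a b x = (\<lambda>t. indicator {a..<b} t *\<^sub>R x)"

definition box_l2 :: "real \<Rightarrow> real \<Rightarrow> 'a::chilbert \<Rightarrow> 'a l2" where
  "box_l2 a b x = abs_l2 (box_fn a b x)"

lemma simple_fn_box: "simple_fn (box_fn a b x)"
  unfolding box_fn_def by (rule simple_fn_indicator) simp

lemma L2_box: "L2 (box_fn a b x)"
  by (rule L2_bounded_support[of _ "norm x" a b])
     (auto intro: strongly_measurable_simple[OF simple_fn_box], auto simp: box_fn_def indicator_def)

lemma cinner_box: "cinner h (box_l2 a b x) = (LINT t:{a..<b}|lebesgue. cinner (rep_l2 h t) x)"
  unfolding box_l2_def cinner_l2_abs_right[OF L2_box]
  by (simp add: box_fn_def set_lebesgue_integral_def cinner_scaleR_right scaleR_conv_of_real)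

lemma L2_set_integrable_cinner:
  assumes "L2 h" shows "set_integrable lebesgue {a..<b} (\<lambda>t. cinner (h t) x)"
  using L2_integrable_cinner[OF assms L2_box[of a b x]]
  by (simp add: box_fn_def set_integrable_def cinner_scaleR_right scaleR_conv_of_real)

lemma l2_zeroI:
  assumes "\<And>a b x. a < b \<Longrightarrow> cinner h (box_l2 a b x) = 0" shows "h = 0"
proof -
  have "AE t in lebesgue. rep_l2 h t = 0"
    using assms L2_rep[of h]
    by (intro strongly_measurable_zeroI) (auto simp: cinner_box L2_set_integrable_cinner L2_def)
  then have "h = abs_l2 (\<lambda>t. 0)" by (rule l2_eqI_abs[OF L2_zero])
  then show ?thesis by (simp add: zero_l2_def)
qed

lemma l2_eq_boxI:
  assumes "\<And>a b x. a < b \<Longrightarrow> cinner g (box_l2 a b x) = cinner h (box_l2 a b x)" shows "g = h"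
  using l2_zeroI[of "g - h"] assms by (simp add: cinner_diff_left)

lemma box_scaleR: "r *\<^sub>R box_l2 a b x = box_l2 a b (r *\<^sub>R x)"
  unfolding box_l2_def by (simp add: abs_l2_scaleR[OF L2_box]) (simp add: box_fn_def mult.commute)

lemma box_cscale: "r *\<^sub>C box_l2 a b x = box_l2 a b (r *\<^sub>C x)"
  unfolding box_l2_def by (simp add: abs_l2_cscale[OF L2_box]) (simp add: box_fn_def cscale_scaleR)

lemma l2_box_induct [case_names box add lim]:
  fixes u :: "'a::chilbert l2"
  assumes box: "\<And>a b x. a < b \<Longrightarrow> P (box_l2 a b x)"
    and add: "\<And>u v. P u \<Longrightarrow> P v \<Longrightarrow> P (u + v)"
    and lim: "\<And>X u. (\<And>n. P (X n)) \<Longrightarrow> X \<longlonglongrightarrow> u \<Longrightarrow> P u"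
  shows "P u"
proof -
  define G where "G = {box_l2 a b x | a b (x::'a). a < b}"
  have b0: "box_l2 0 1 0 = (0::'a l2)" using box_scaleR[of 0 0 1 0] by simp
  have "closure (span G) = UNIV"
  proof (rule dense_by_orthogonality)
    fix y :: "'a l2" assume y: "\<forall>s\<in>span G. Re (cinner y s) = 0"
    show "y = 0"
    proof (rule l2_zeroI)
      fix a b :: real and x :: 'a assume "a < b"
      then have "box_l2 a b x \<in> G" "box_l2 a b (\<i> *\<^sub>C x) \<in> G" by (auto simp: G_def)
      then have "Re (cinner y (box_l2 a b x)) = 0" "Re (cinner y (\<i> *\<^sub>C box_l2 a b x)) = 0"
        using y span_base by (auto simp: box_cscale)
      then show "cinner y (box_l2 a b x) = 0" by (simp add: complex_eq_iff cinner_cscale_right)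
    qed
  qed simp
  then obtain X where X: "\<And>n. X n \<in> span G" "X \<longlonglongrightarrow> u"
    using closure_sequential[of u "span G"] by blast
  have "P v" if "v \<in> span G" for v
    using that
  proof (induction rule: span_induct_alt)
    case base show ?case using box[of 0 1 0] b0 by simp
  next
    case (step c x y)
    then show ?case using box add by (auto simp: G_def box_scaleR)
  qed
  then show ?thesis using X lim by blast
qed

subsection \<open>Translations and pointwise operators\<close>

definition shiftop :: "real \<Rightarrow> 'a::chilbert l2 \<Rightarrow> 'a l2" where
  "shiftop s a = abs_l2 (\<lambda>t. rep_l2 a (t - s))"

lemma integrable_lebesgue_shift:
  fixes f :: "real \<Rightarrow> 'b::euclidean_space"
  shows "integrable lebesgue f \<Longrightarrow> integrable lebesgue (\<lambda>t. f (t - s))"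
  using lebesgue_integrable_real_affine[of f 1 "- s"] by (simp add: algebra_simps)

lemma integral_lebesgue_shift:
  fixes f :: "real \<Rightarrow> 'b::euclidean_space"
  shows "(LINT t|lebesgue. f (t - s)) = (LINT t|lebesgue. f t)"
  using lebesgue_integral_real_affine[of 1 f "- s"] by (simp add: algebra_simps)

lemma L2_shift: "L2 f \<Longrightarrow> L2 (\<lambda>t. f (t - s))"
  unfolding L2_def by (auto intro: strongly_measurable_shift integrable_lebesgue_shift[of "\<lambda>t. (norm (f t))\<^sup>2"])

lemma rep_shiftop: "AE t in lebesgue. rep_l2 (shiftop s a) t = rep_l2 a (t - s)"
  unfolding shiftop_def by (rule rep_abs_l2[OF L2_shift[OF L2_rep]])

lemma shiftop_abs: "L2 f \<Longrightarrow> shiftop s (abs_l2 f) = abs_l2 (\<lambda>t. f (t - s))"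
  using AE_lebesgue_shift[OF rep_abs_l2[of f], of s]
  by (simp add: shiftop_def abs_l2_eq_iff L2_shift L2_rep)

lemma norm_shiftop [simp]: "norm (shiftop s a) = norm a"
  using integral_lebesgue_shift[of "\<lambda>t. (norm (rep_l2 a t))\<^sup>2" s]
  by (simp add: shiftop_def norm_abs_l2[OF L2_shift[OF L2_rep]] norm_l2.rep_eq[of a])

lemma shiftop_clinear: "bounded_clinear_op (shiftop s :: 'a::chilbert l2 \<Rightarrow> 'a l2)"
proof (rule bounded_clinear_opI[where K = 1])
  fix x y :: "'a l2" and a :: complex
  show "shiftop s (x + y) = shiftop s x + shiftop s y"
  proof (rule l2_eqI)
    show "AE t in lebesgue. rep_l2 (shiftop s (x + y)) t = rep_l2 (shiftop s x + shiftop s y) t"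
      using rep_shiftop[of s "x + y"] rep_shiftop[of s x] rep_shiftop[of s y]
        AE_lebesgue_shift[OF rep_l2_add[of x y], of s] rep_l2_add[of "shiftop s x" "shiftop s y"]
      by eventually_elim simp
  qed
  show "shiftop s (a *\<^sub>C x) = a *\<^sub>C shiftop s x"
  proof (rule l2_eqI)
    show "AE t in lebesgue. rep_l2 (shiftop s (a *\<^sub>C x)) t = rep_l2 (a *\<^sub>C shiftop s x) t"
      using rep_shiftop[of s "a *\<^sub>C x"] rep_shiftop[of s x]
        AE_lebesgue_shift[OF rep_l2_cscale[of a x], of s] rep_l2_cscale[of a "shiftop s x"]
      by eventually_elim simp
  qed
qed simp

lemma shiftop_shiftop: "shiftop s (shiftop r a) = shiftop (s + r) a"
proof (rule l2_eqI)
  show "AE t in lebesgue. rep_l2 (shiftop s (shiftop r a)) t = rep_l2 (shiftop (s + r) a) t"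
    using rep_shiftop[of s "shiftop r a"] AE_lebesgue_shift[OF rep_shiftop[of r a], of s] rep_shiftop[of "s + r" a]
    by eventually_elim (simp add: algebra_simps)
qed

definition ptop :: "('a \<Rightarrow> 'a) \<Rightarrow> 'a::chilbert l2 \<Rightarrow> 'a l2" where
  "ptop T a = abs_l2 (\<lambda>t. T (rep_l2 a t))"

lemma bounded_clinear_op_onorm: "bounded_clinear_op T \<Longrightarrow> norm (T x) \<le> onorm T * norm x"
  by (rule onorm) (rule bounded_clinear_opD)

lemma L2_pt: "bounded_clinear_op T \<Longrightarrow> L2 f \<Longrightarrow> L2 (\<lambda>t. T (f t))"
  by (rule L2_dominated[of f _ "onorm T"])
     (auto simp: L2_def intro: strongly_measurable_bounded_linear bounded_clinear_opD(1) bounded_clinear_op_onorm)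

lemma rep_ptop: "bounded_clinear_op T \<Longrightarrow> AE t in lebesgue. rep_l2 (ptop T a) t = T (rep_l2 a t)"
  unfolding ptop_def by (rule rep_abs_l2[OF L2_pt[OF _ L2_rep]])

lemma ptop_abs: "bounded_clinear_op T \<Longrightarrow> L2 f \<Longrightarrow> ptop T (abs_l2 f) = abs_l2 (\<lambda>t. T (f t))"
  using rep_abs_l2[of f] by (auto simp: ptop_def abs_l2_eq_iff L2_pt L2_rep elim: eventually_mono)

lemma norm_ptop_le:
  assumes T: "bounded_clinear_op T" and B: "\<And>x. norm (T x) \<le> B * norm x" "B \<ge> 0"
  shows "norm (ptop T a) \<le> B * norm a"
proof -
  have "(norm (ptop T a))\<^sup>2 = (LINT t|lebesgue. (norm (T (rep_l2 a t)))\<^sup>2)"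
    by (simp add: ptop_def norm_abs_l2 L2_pt[OF T L2_rep])
  also have "\<dots> \<le> (LINT t|lebesgue. (B * norm (rep_l2 a t))\<^sup>2)"
    using L2_pt[OF T L2_rep[of a]] L2_rep[of a] B
    by (intro integral_mono power_mono) (auto simp: L2_def power_mult_distrib)
  also have "\<dots> = (B * norm a)\<^sup>2" by (simp add: power_mult_distrib norm_l2_sq)
  finally show ?thesis using B by - (rule power2_le_imp_le, auto)
qed

lemma onorm_nonneg_clinear: "bounded_clinear_op T \<Longrightarrow> 0 \<le> onorm T"
  by (rule onorm_pos_le[OF bounded_clinear_opD(1)])

lemma ptop_clinear:
  fixes T :: "'a::chilbert \<Rightarrow> 'a"
  assumes T: "bounded_clinear_op T" shows "bounded_clinear_op (ptop T)"
proof (rule bounded_clinear_opI[where K = "onorm T"])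
  fix x y :: "'a l2" and a :: complex
  show "ptop T (x + y) = ptop T x + ptop T y"
  proof (rule l2_eqI)
    show "AE t in lebesgue. rep_l2 (ptop T (x + y)) t = rep_l2 (ptop T x + ptop T y) t"
      using rep_ptop[OF T, of "x + y"] rep_ptop[OF T, of x] rep_ptop[OF T, of y] rep_l2_add[of x y]
        rep_l2_add[of "ptop T x" "ptop T y"]
      by eventually_elim (simp add: bounded_clinear_opD[OF T])
  qed
  show "ptop T (a *\<^sub>C x) = a *\<^sub>C ptop T x"
  proof (rule l2_eqI)
    show "AE t in lebesgue. rep_l2 (ptop T (a *\<^sub>C x)) t = rep_l2 (a *\<^sub>C ptop T x) t"
      using rep_ptop[OF T, of "a *\<^sub>C x"] rep_ptop[OF T, of x] rep_l2_cscale[of a x] rep_l2_cscale[of a "ptop T x"]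
      by eventually_elim (simp add: bounded_clinear_opD[OF T])
  qed
  show "norm (ptop T x) \<le> onorm T * norm x"
    by (rule norm_ptop_le[OF T bounded_clinear_op_onorm[OF T] onorm_nonneg_clinear[OF T]])
qed

lemma ptop_shiftop:
  assumes T: "bounded_clinear_op T" shows "ptop T (shiftop s a) = shiftop s (ptop T a)"
proof (rule l2_eqI)
  show "AE t in lebesgue. rep_l2 (ptop T (shiftop s a)) t = rep_l2 (shiftop s (ptop T a)) t"
    using rep_ptop[OF T, of "shiftop s a"] rep_shiftop[of s a] rep_shiftop[of s "ptop T a"]
      AE_lebesgue_shift[OF rep_ptop[OF T, of a], of s]
    by eventually_elim simp
qed

subsection \<open>Convolution operators\<close>

definition adm :: "(real \<Rightarrow> 'a::chilbert \<Rightarrow> 'a) \<Rightarrow> bool" where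
  "adm K \<longleftrightarrow> (\<forall>s\<ge>0. bounded_clinear_op (K s)) \<and>
     (\<forall>x y. set_borel_measurable lebesgue {0..} (\<lambda>s. cinner (K s x) y)) \<and>
     set_integrable lebesgue {0..} (\<lambda>s. onorm (K s))"

definition kint :: "(real \<Rightarrow> 'a::chilbert \<Rightarrow> 'a) \<Rightarrow> real" where
  "kint K = (LINT s:{0..}|lebesgue. onorm (K s))"

definition convop :: "(real \<Rightarrow> 'a::chilbert \<Rightarrow> 'a) \<Rightarrow> 'a l2 \<Rightarrow> 'a l2" where
  "convop K u = weak_integral {0..} (\<lambda>s. ptop (K s) (shiftop s u))"

lemma ptop_shiftop_box:
  assumes "bounded_clinear_op T"
  shows "ptop T (shiftop s (box_l2 a b x)) = box_l2 (a + s) (b + s) (T x)"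
  unfolding box_l2_def shiftop_abs[OF L2_box] ptop_abs[OF assms L2_shift[OF L2_box]]
  by (rule arg_cong[of _ _ abs_l2])
     (auto simp: box_fn_def indicator_def bounded_clinear_opD[OF assms] algebra_simps)

lemma cinner_box_box:
  "cinner (box_l2 a b x) (box_l2 c d y) = of_real (max 0 (min b d - max a c)) * cinner x y"
proof -
  have "cinner (box_l2 a b x) (box_l2 c d y) = (LINT t|lebesgue. indicator {max a c..<min b d} t *\<^sub>R cinner x y)"
    unfolding box_l2_def cinner_abs_l2[OF L2_box L2_box]
    by (intro Bochner_Integration.integral_cong) (auto simp: indicator_def box_fn_def)
  also have "\<dots> = measure lebesgue {max a c..<min b d} *\<^sub>R cinner x y"
    by (subst Bochner_Integration.integral_scaleR_left)
       (use emeasure_bounded_finite[OF bounded_Ico[of "max a c" "min b d"]] in \<open>simp_all add: integrable_real_indicator\<close>)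
  also have "measure lebesgue {max a c..<min b d} = max 0 (min b d - max a c)"
  proof (cases "max a c \<le> min b d")
    case False
    then have "{max a c..<min b d} = {}" by (intro atLeastLessThan_empty) linarith
    moreover have "max 0 (min b d - max a c) = 0" using False by linarith
    ultimately show ?thesis by (simp only: measure_empty)
  qed (simp add: measure_def)
  finally show ?thesis by (simp add: scaleR_conv_of_real)
qed

lemma convop_integrand_measurable:
  fixes K :: "real \<Rightarrow> 'a::chilbert \<Rightarrow> 'a"
  assumes K: "adm K"
  shows "set_borel_measurable lebesgue {0..} (\<lambda>s. cinner (ptop (K s) (shiftop s u)) v)"
proof (induction u rule: l2_box_induct)
  note bK = K[unfolded adm_def, THEN conjunct1, rule_format]
  {
    case (box a b x)
    show ?case
    proof (induction v rule: l2_box_induct)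
      case (box c d y)
      have "set_borel_measurable lebesgue {0..} (\<lambda>s. of_real (max 0 (min (b + s) d - max (a + s) c)) * cinner (K s x) y)"
      proof -
        have "(\<lambda>s. of_real (max 0 (min (b + s) d - max (a + s) c)) * (indicat_real {0..} s *\<^sub>R cinner (K s x) y))
            \<in> borel_measurable lebesgue"
        proof (rule borel_measurable_times)
          show "(\<lambda>s. complex_of_real (max 0 (min (b + s) d - max (a + s) c))) \<in> borel_measurable lebesgue"
            by (rule measurable_completion) measurable
        qed (use K in \<open>simp add: adm_def set_borel_measurable_def\<close>)
        then show ?thesis by (simp add: set_borel_measurable_def scaleR_conv_of_real mult_ac)
      qed
      then show ?case unfolding set_borel_measurable_def
        by (rule measurable_cong[THEN iffD1, rotated])
           (auto simp: indicator_def ptop_shiftop_box[OF bK] cinner_box_box)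
    next
      case (add u v)
      then show ?case by (simp add: set_borel_measurable_def cinner_add_right scaleR_add_right)
    next
      case (lim X w)
      show ?case unfolding set_borel_measurable_def
      proof (rule borel_measurable_LIMSEQ_metric)
        show "(\<lambda>s. indicat_real {0..} s *\<^sub>R cinner (ptop (K s) (shiftop s (box_l2 a b x))) (X n)) \<in> borel_measurable lebesgue" for n
          using lim(1) by (simp add: set_borel_measurable_def)
        show "(\<lambda>n. indicat_real {0..} s *\<^sub>R cinner (ptop (K s) (shiftop s (box_l2 a b x))) (X n)) \<longlonglongrightarrow>
            indicat_real {0..} s *\<^sub>R cinner (ptop (K s) (shiftop s (box_l2 a b x))) w" for s
          by (intro tendsto_intros cinner.tendsto lim(2))
      qed
    qed
  next
    case (add u w)
    then have "(\<lambda>s. indicat_real {0..} s *\<^sub>R cinner (ptop (K s) (shiftop s u)) v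
        + indicat_real {0..} s *\<^sub>R cinner (ptop (K s) (shiftop s w)) v) \<in> borel_measurable lebesgue"
      by (simp add: set_borel_measurable_def)
    then show ?case unfolding set_borel_measurable_def
      by (rule measurable_cong[THEN iffD1, rotated])
         (auto simp: indicator_def bounded_clinear_opD[OF shiftop_clinear] bounded_clinear_opD[OF ptop_clinear[OF bK]] cinner_add_left)
  next
    case (lim X w)
    show ?case unfolding set_borel_measurable_def
    proof (rule borel_measurable_LIMSEQ_metric)
      show "(\<lambda>s. indicat_real {0..} s *\<^sub>R cinner (ptop (K s) (shiftop s (X n))) v) \<in> borel_measurable lebesgue" for n
        using lim(1) by (simp add: set_borel_measurable_def)
      show "(\<lambda>n. indicat_real {0..} s *\<^sub>R cinner (ptop (K s) (shiftop s (X n))) v) \<longlonglongrightarrow>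
          indicat_real {0..} s *\<^sub>R cinner (ptop (K s) (shiftop s w)) v" for s
      proof (cases "s \<ge> 0")
        case True
        show ?thesis
          by (intro tendsto_intros cinner.tendsto bounded_linear.tendsto[OF bounded_clinear_opD(1)[OF ptop_clinear[OF bK[OF True]]]]
              bounded_linear.tendsto[OF bounded_clinear_opD(1)[OF shiftop_clinear]] lim(2))
      qed auto
    qed
  }
qed

context
  fixes K :: "real \<Rightarrow> 'a::chilbert \<Rightarrow> 'a"
  assumes K: "adm K"
begin

lemma adm_bounded: "s \<ge> 0 \<Longrightarrow> bounded_clinear_op (K s)" using K by (simp add: adm_def)

lemma convop_bound:
  "set_integrable lebesgue {0..} (\<lambda>s. onorm (K s) * norm (u::'a l2))"
  "AE s in lebesgue. s \<in> {0..} \<longrightarrow> norm (ptop (K s) (shiftop s u)) \<le> onorm (K s) * norm u"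
proof -
  show "set_integrable lebesgue {0..} (\<lambda>s. onorm (K s) * norm u)" using K by (simp add: adm_def)
  show "AE s in lebesgue. s \<in> {0..} \<longrightarrow> norm (ptop (K s) (shiftop s u)) \<le> onorm (K s) * norm u"
    using norm_ptop_le[OF adm_bounded bounded_clinear_op_onorm[OF adm_bounded] onorm_nonneg_clinear[OF adm_bounded], of _ "shiftop _ u"]
    by auto
qed

lemma cinner_convop:
  "cinner (convop K u) v = (LINT s:{0..}|lebesgue. cinner (ptop (K s) (shiftop s u)) v)"
  unfolding convop_def by (rule weak_integral[OF convop_integrand_measurable[OF K] convop_bound])

lemma set_integrable_convop:
  "set_integrable lebesgue {0..} (\<lambda>s. cinner (ptop (K s) (shiftop s u)) v)"
  by (rule weak_integral[OF convop_integrand_measurable[OF K] convop_bound])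

lemma norm_convop_le: "norm (convop K u) \<le> kint K * norm u"
  using weak_integral(3)[OF convop_integrand_measurable[OF K] convop_bound, of u]
  by (simp add: convop_def kint_def)

lemma kint_nonneg: "0 \<le> kint K"
  unfolding kint_def set_lebesgue_integral_def
  by (intro integral_nonneg_AE AE_I2) (auto simp: indicator_def intro: onorm_nonneg_clinear adm_bounded)

lemma convop_commute:
  assumes B: "bounded_clinear_op B"
    and comm: "\<And>s u. s \<ge> 0 \<Longrightarrow> B (ptop (K s) (shiftop s u)) = ptop (K s) (shiftop s (B u))"
  shows "B (convop K u) = convop K (B u)"
proof (rule cinner_eqI)
  fix z
  have "cinner (B (convop K u)) z = (LINT s:{0..}|lebesgue. cinner (ptop (K s) (shiftop s u)) (adjoint_op B z))"
    by (simp add: adjoint_op_eq[OF B] cinner_convop)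
  also have "\<dots> = (LINT s:{0..}|lebesgue. cinner (ptop (K s) (shiftop s (B u))) z)"
    by (intro set_lebesgue_integral_cong) (auto simp: comm adjoint_op_eq[OF B, symmetric])
  finally show "cinner (B (convop K u)) z = cinner (convop K (B u)) z" by (simp add: cinner_convop)
qed

lemma convop_clinear: "bounded_clinear_op (convop K)"
proof (rule bounded_clinear_opI[where K = "kint K"])
  fix x y :: "'a l2" and a :: complex
  note D = bounded_clinear_opD[OF shiftop_clinear] bounded_clinear_opD[OF ptop_clinear[OF adm_bounded]]
  show "convop K (x + y) = convop K x + convop K y"
  proof (rule cinner_eqI)
    fix z
    have "cinner (convop K (x + y)) z = (LINT s:{0..}|lebesgue. cinner (ptop (K s) (shiftop s x)) z + cinner (ptop (K s) (shiftop s y)) z)"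
      unfolding cinner_convop by (intro set_lebesgue_integral_cong) (auto simp: D cinner_add_left)
    then show "cinner (convop K (x + y)) z = cinner (convop K x + convop K y) z"
      by (simp add: cinner_add_left cinner_convop set_integral_add set_integrable_convop)
  qed
  show "convop K (a *\<^sub>C x) = a *\<^sub>C convop K x"
    by (rule convop_commute[symmetric])
       (auto simp: D cscale_add_right cscale_cscale mult.commute norm_cscale intro!: bounded_clinear_opI[of _ "cmod a"])
qed (rule norm_convop_le)

end

definition wker :: "(real \<Rightarrow> real) \<Rightarrow> (real \<Rightarrow> 'a \<Rightarrow> 'a::chilbert) \<Rightarrow> real \<Rightarrow> 'a \<Rightarrow> 'a" where
  "wker k C = (\<lambda>s x. k s *\<^sub>R C s x)"

abbreviation expw :: "real \<Rightarrow> (real \<Rightarrow> 'a \<Rightarrow> 'a::chilbert) \<Rightarrow> real \<Rightarrow> 'a \<Rightarrow> 'a" where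
  "expw \<rho> C \<equiv> wker (\<lambda>s. exp (- \<rho> * s)) C"

lemma bounded_clinear_scaleR: "bounded_clinear_op T \<Longrightarrow> bounded_clinear_op (\<lambda>x. r *\<^sub>R T x)"
proof -
  assume T: "bounded_clinear_op T"
  show ?thesis
  proof (rule bounded_clinear_opI[where K = "\<bar>r\<bar> * onorm T"])
    show "norm (r *\<^sub>R T x) \<le> \<bar>r\<bar> * onorm T * norm x" for x
      using bounded_clinear_op_onorm[OF T, of x] by (simp add: mult.assoc mult_left_mono)
  qed (auto simp: bounded_clinear_opD[OF T] scaleR_add_right cscale_scaleR)
qed

lemma onorm_wker: "bounded_clinear_op (C s) \<Longrightarrow> onorm (wker k C s) = \<bar>k s\<bar> * onorm (C s)"
  unfolding wker_def by (rule onorm_scaleR[OF bounded_clinear_opD(1)])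

lemma adm_wkerI:
  assumes "\<And>s. s \<ge> 0 \<Longrightarrow> bounded_clinear_op (C s)"
    and "\<And>x y. set_borel_measurable lebesgue {0..} (\<lambda>s. cinner (C s x) y)"
    and k: "k \<in> borel_measurable lebesgue"
    and int: "set_integrable lebesgue {0..} (\<lambda>s. \<bar>k s\<bar> * onorm (C s))"
  shows "adm (wker k C)"
  unfolding adm_def
proof (intro conjI allI impI)
  show "bounded_clinear_op (wker k C s)" if "s \<ge> 0" for s
    unfolding wker_def by (rule bounded_clinear_scaleR[OF assms(1)[OF that]])
  show "set_borel_measurable lebesgue {0..} (\<lambda>s. cinner (wker k C s x) y)" for x y
  proof -
    have "(\<lambda>s. complex_of_real (k s) * (indicat_real {0..} s *\<^sub>R cinner (C s x) y)) \<in> borel_measurable lebesgue"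
    proof (rule borel_measurable_times)
      show "(\<lambda>s. complex_of_real (k s)) \<in> borel_measurable lebesgue" using k by measurable
    qed (rule assms(2)[unfolded set_borel_measurable_def])
    then show ?thesis
      by (simp only: wker_def set_borel_measurable_def cinner_scaleR_left scaleR_conv_of_real mult.left_commute)
  qed
  show "set_integrable lebesgue {0..} (\<lambda>s. onorm (wker k C s))"
    using int by (rule set_integrable_cong[THEN iffD1, rotated -1]) (auto simp: onorm_wker assms(1))
qed

lemma bounded_clinear_id: "bounded_clinear_op (\<lambda>x. x)"
  by (rule bounded_clinear_opI[where K = 1]) auto

lemma adm_scalar:
  assumes "k \<in> borel_measurable lebesgue" "set_integrable lebesgue {0..} k"
  shows "adm (wker k (\<lambda>s x. x :: 'a::chilbert))"
    and "kint (wker k (\<lambda>s x. x :: 'a)) \<le> (LINT s:{0..}|lebesgue. \<bar>k s\<bar>)"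
proof -
  have i: "set_integrable lebesgue {0..} (\<lambda>s. \<bar>k s\<bar>)" using set_integrable_abs[OF assms(2)] .
  show "adm (wker k (\<lambda>s x. x :: 'a))"
    by (rule adm_wkerI) (auto simp: bounded_clinear_id assms set_borel_measurable_def i intro!: measurable_indicator_scaleR)
  have "kint (wker k (\<lambda>s x. x :: 'a)) = (LINT s:{0..}|lebesgue. \<bar>k s\<bar> * onorm (\<lambda>x::'a. x))"
    unfolding kint_def using onorm_wker[of "\<lambda>s x. x :: 'a" _ k, OF bounded_clinear_id] by simp
  also have "\<dots> \<le> (LINT s:{0..}|lebesgue. \<bar>k s\<bar> * 1)"
    using onorm_id_le i by (intro set_integral_mono mult_left_mono) auto
  finally show "kint (wker k (\<lambda>s x. x :: 'a)) \<le> (LINT s:{0..}|lebesgue. \<bar>k s\<bar>)" by simp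
qed

lemma ptop_scaleR: "ptop (\<lambda>x. r *\<^sub>R x) u = r *\<^sub>R u"
  by (simp add: ptop_def abs_l2_scaleR[OF L2_rep, symmetric])

lemma scalar_convop_commute_ptop:
  fixes u :: "'a::chilbert l2"
  assumes "adm (wker k (\<lambda>s x. x :: 'a))" "bounded_clinear_op T"
  shows "ptop T (convop (wker k (\<lambda>s x. x)) u) = convop (wker k (\<lambda>s x. x)) (ptop T u)"
  by (rule convop_commute[OF assms(1) ptop_clinear[OF assms(2)]])
     (simp add: wker_def ptop_scaleR ptop_shiftop assms bounded_clinear_opD[OF ptop_clinear[OF assms(2)]])

lemma convop_commute_shiftop:
  assumes "adm K" shows "shiftop r (convop K u) = convop K (shiftop r u)"
  by (rule convop_commute[OF assms shiftop_clinear])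
     (simp add: ptop_shiftop[OF adm_bounded[OF assms], symmetric] shiftop_shiftop add.commute)

lemma scalar_convop_commute:
  fixes u :: "'a::chilbert l2"
  assumes k: "adm (wker k (\<lambda>s x. x :: 'a))" and K: "adm K"
  shows "convop (wker k (\<lambda>s x. x)) (convop K u) = convop K (convop (wker k (\<lambda>s x. x)) u)"
  by (rule convop_commute[OF K convop_clinear[OF k]])
     (simp add: convop_commute_shiftop[OF k, symmetric] scalar_convop_commute_ptop[OF k adm_bounded[OF K], symmetric])

subsection \<open>Elements representing the same function in two weighted spaces\<close>

definition compat :: "real \<Rightarrow> 'a::chilbert l2 \<Rightarrow> 'a l2 \<Rightarrow> bool" where
  "compat \<delta> a b \<longleftrightarrow> (AE t in lebesgue. rep_l2 b t = exp (\<delta> * t) *\<^sub>R rep_l2 a t)"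

definition wbox :: "real \<Rightarrow> real \<Rightarrow> real \<Rightarrow> 'a::chilbert \<Rightarrow> 'a l2" where
  "wbox \<delta> a b x = abs_l2 (\<lambda>t. exp (\<delta> * t) *\<^sub>R box_fn a b x t)"

lemma exp_bound_on:
  fixes t :: real assumes "t \<in> {a..b}" shows "exp (\<delta> * t) \<le> exp (\<bar>\<delta>\<bar> * (\<bar>a\<bar> + \<bar>b\<bar>))"
proof -
  have "\<delta> * t \<le> \<bar>\<delta>\<bar> * \<bar>t\<bar>" by (metis abs_ge_self abs_mult)
  also have "\<dots> \<le> \<bar>\<delta>\<bar> * (\<bar>a\<bar> + \<bar>b\<bar>)" using assms by (intro mult_left_mono) auto
  finally show ?thesis by simp
qed

lemma measurable_lebesgue_continuous:
  fixes f :: "real \<Rightarrow> 'b::topological_space"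
  assumes "continuous_on UNIV f" shows "f \<in> borel_measurable lebesgue"
  by (rule measurable_completion) (simp add: borel_measurable_continuous_onI assms)

lemma exp_measurable_lebesgue: "(\<lambda>t::real. exp (\<delta> * t)) \<in> borel_measurable lebesgue"
  by (intro measurable_lebesgue_continuous continuous_intros)

lemma L2_wbox: "L2 (\<lambda>t. exp (\<delta> * t) *\<^sub>R box_fn a b x t)"
proof (rule L2_bounded_support[of _ "exp (\<bar>\<delta>\<bar> * (\<bar>a\<bar> + \<bar>b\<bar>)) * norm x" a b])
  show "strongly_measurable (\<lambda>t. exp (\<delta> * t) *\<^sub>R box_fn a b x t)"
    by (rule strongly_measurable_scaleR[OF exp_measurable_lebesgue strongly_measurable_simple[OF simple_fn_box]])
  show "norm (exp (\<delta> * t) *\<^sub>R box_fn a b x t) \<le> exp (\<bar>\<delta>\<bar> * (\<bar>a\<bar> + \<bar>b\<bar>)) * norm x" for t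
    using exp_bound_on[of t a b \<delta>] by (auto simp: box_fn_def indicator_def intro!: mult_right_mono)
qed (auto simp: box_fn_def indicator_def)

lemma cinner_wbox:
  "cinner a (wbox \<delta> c d x) = (LINT t:{c..<d}|lebesgue. cinner (exp (\<delta> * t) *\<^sub>R rep_l2 a t) x)"
  unfolding wbox_def cinner_l2_abs_right[OF L2_wbox] set_lebesgue_integral_def
  by (intro Bochner_Integration.integral_cong)
     (auto simp: box_fn_def cinner_simps scaleR_conv_of_real)

lemma compat_iff: "compat \<delta> a b \<longleftrightarrow> (\<forall>c d x. cinner b (box_l2 c d x) = cinner a (wbox \<delta> c d x))"
proof
  assume c: "compat \<delta> a b"
  have "(LINT t:{c..<d}|lebesgue. cinner (rep_l2 b t) x) = (LINT t:{c..<d}|lebesgue. cinner (exp (\<delta> * t) *\<^sub>R rep_l2 a t) x)" for c d x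
  proof -
    have m: "(\<lambda>t. cinner (exp (\<delta> * t) *\<^sub>R rep_l2 a t) x) \<in> borel_measurable lebesgue"
      "(\<lambda>t. cinner (rep_l2 b t) x) \<in> borel_measurable lebesgue"
      using L2_rep[of a] L2_rep[of b]
      by (auto simp: L2_def intro!: strongly_measurable_cinner strongly_measurable_scaleR exp_measurable_lebesgue
          strongly_measurable_continuous[of "\<lambda>t. x"])
    show ?thesis unfolding set_lebesgue_integral_def
      using c m by (intro integral_cong_AE) (auto simp: compat_def intro!: measurable_indicator_scaleR elim!: eventually_mono)
  qed
  then show "\<forall>c d x. cinner b (box_l2 c d x) = cinner a (wbox \<delta> c d x)" by (simp add: cinner_wbox cinner_box)
next
  assume h: "\<forall>c d x. cinner b (box_l2 c d x) = cinner a (wbox \<delta> c d x)"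
  have sia: "set_integrable lebesgue {c..<d} (\<lambda>t. cinner (exp (\<delta> * t) *\<^sub>R rep_l2 a t) x)" for c d x
    using L2_integrable_cinner[OF L2_rep[of a] L2_wbox[of \<delta> c d x]]
    by (simp add: set_integrable_def box_fn_def cinner_simps scaleR_conv_of_real mult_ac)
  note sib = L2_set_integrable_cinner[OF L2_rep[of b]]
  have "AE t in lebesgue. rep_l2 b t - exp (\<delta> * t) *\<^sub>R rep_l2 a t = 0"
  proof (rule strongly_measurable_zeroI)
    show "strongly_measurable (\<lambda>t. rep_l2 b t - exp (\<delta> * t) *\<^sub>R rep_l2 a t)"
      using L2_rep[of a] L2_rep[of b]
      by (auto simp: L2_def intro!: strongly_measurable_diff strongly_measurable_scaleR exp_measurable_lebesgue)
    fix c d :: real and x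
    show "set_integrable lebesgue {c..<d} (\<lambda>t. cinner (rep_l2 b t - exp (\<delta> * t) *\<^sub>R rep_l2 a t) x)"
      unfolding cinner_diff_left by (rule set_integral_diff[OF sib sia])
    have "(LINT t:{c..<d}|lebesgue. cinner (rep_l2 b t - exp (\<delta> * t) *\<^sub>R rep_l2 a t) x) =
        cinner b (box_l2 c d x) - cinner a (wbox \<delta> c d x)"
      unfolding cinner_diff_left cinner_box cinner_wbox by (rule set_integral_diff[OF sib sia])
    then show "(LINT t:{c..<d}|lebesgue. cinner (rep_l2 b t - exp (\<delta> * t) *\<^sub>R rep_l2 a t) x) = 0"
      using h by simp
  qed
  then show "compat \<delta> a b" unfolding compat_def by eventually_elim simp
qed

lemma compat_lim:
  assumes "\<And>n. compat \<delta> (X n) (Y n)" "X \<longlonglongrightarrow> a" "Y \<longlonglongrightarrow> b" shows "compat \<delta> a b"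
  unfolding compat_iff
proof (intro allI)
  fix c d x
  have "(\<lambda>n. cinner (Y n) (box_l2 c d x)) \<longlonglongrightarrow> cinner b (box_l2 c d x)"
    "(\<lambda>n. cinner (X n) (wbox \<delta> c d x)) \<longlonglongrightarrow> cinner a (wbox \<delta> c d x)"
    by (intro cinner.tendsto assms tendsto_const)+
  moreover have "cinner (Y n) (box_l2 c d x) = cinner (X n) (wbox \<delta> c d x)" for n
    using assms(1) by (simp add: compat_iff)
  ultimately show "cinner b (box_l2 c d x) = cinner a (wbox \<delta> c d x)" using LIMSEQ_unique by auto
qed

lemma compat_add:
  assumes "compat \<delta> a b" "compat \<delta> a' b'" shows "compat \<delta> (a + a') (b + b')"
  using assms rep_l2_add[of a a'] rep_l2_add[of b b'] unfolding compat_def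
  by eventually_elim (simp add: scaleR_add_right)

lemma compat_scaleR:
  assumes "compat \<delta> a b" shows "compat \<delta> (r *\<^sub>R a) (r *\<^sub>R b)"
  using assms rep_l2_scaleR[of r a] rep_l2_scaleR[of r b] unfolding compat_def
  by eventually_elim (simp add: mult.commute)

lemma compat_ptop:
  assumes "compat \<delta> a b" and T: "bounded_clinear_op T" shows "compat \<delta> (ptop T a) (ptop T b)"
  using assms(1) rep_ptop[OF T, of a] rep_ptop[OF T, of b] unfolding compat_def
  by eventually_elim (simp add: bounded_clinear_opD[OF T])

lemma compat_convop:
  assumes c: "compat \<delta> a b" and K: "adm K" and K': "adm (wker (\<lambda>s. exp (\<delta> * s)) K)"
  shows "compat \<delta> (convop K a) (convop (wker (\<lambda>s. exp (\<delta> * s)) K) b)"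
  unfolding compat_iff
proof (intro allI)
  fix x y and z :: 'a
  have "compat \<delta> (ptop (K s) (shiftop s a)) (ptop (wker (\<lambda>s. exp (\<delta> * s)) K s) (shiftop s b))" if s: "s \<ge> 0" for s
    unfolding compat_def
    using rep_ptop[OF adm_bounded[OF K s], of "shiftop s a"] rep_ptop[OF adm_bounded[OF K' s], of "shiftop s b"]
      rep_shiftop[of s a] rep_shiftop[of s b] AE_lebesgue_shift[OF c[unfolded compat_def], of s]
    by eventually_elim (simp add: wker_def bounded_clinear_opD[OF adm_bounded[OF K s]] exp_add[symmetric] algebra_simps)
  then show "cinner (convop (wker (\<lambda>s. exp (\<delta> * s)) K) b) (box_l2 x y z) = cinner (convop K a) (wbox \<delta> x y z)"
    unfolding cinner_convop[OF K] cinner_convop[OF K']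
    by (intro set_lebesgue_integral_cong) (auto simp: compat_iff)
qed

subsection \<open>The weighted spaces and graph closures\<close>

definition emb :: "real \<Rightarrow> (real \<Rightarrow> 'a::chilbert) \<Rightarrow> 'a l2" where
  "emb \<rho> f = abs_l2 (\<lambda>t. exp (- \<rho> * t) *\<^sub>R f t)"

definition unemb :: "real \<Rightarrow> 'a::chilbert l2 \<Rightarrow> real \<Rightarrow> 'a" where
  "unemb \<rho> a = (\<lambda>t. exp (\<rho> * t) *\<^sub>R rep_l2 a t)"

lemma weighted_norm_sq: "(norm (f t))\<^sup>2 * exp (- 2 * \<rho> * t) = (norm (exp (- \<rho> * t) *\<^sub>R f t))\<^sup>2"
proof -
  have "exp (- 2 * \<rho> * t) = (exp (- \<rho> * t))\<^sup>2" by (simp add: power2_eq_square exp_add[symmetric])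
  then show ?thesis by (simp add: power_mult_distrib)
qed

lemma L2w_iff: "f \<in> L2w \<rho> \<longleftrightarrow> L2 (\<lambda>t. exp (- \<rho> * t) *\<^sub>R f t)"
proof -
  have 1: "strongly_measurable f \<longleftrightarrow> strongly_measurable (\<lambda>t. exp (- \<rho> * t) *\<^sub>R f t)"
  proof
    assume "strongly_measurable (\<lambda>t. exp (- \<rho> * t) *\<^sub>R f t)"
    from strongly_measurable_scaleR[OF exp_measurable_lebesgue[of \<rho>] this] show "strongly_measurable f"
      by (simp add: exp_add[symmetric])
  qed (rule strongly_measurable_scaleR[OF exp_measurable_lebesgue])
  have "(\<integral>\<^sup>+ t. ennreal ((norm (exp (- \<rho> * t) *\<^sub>R f t))\<^sup>2) \<partial>lebesgue) < \<infinity> \<longleftrightarrow>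
      integrable lebesgue (\<lambda>t. (norm (exp (- \<rho> * t) *\<^sub>R f t))\<^sup>2)"
    if "strongly_measurable (\<lambda>t. exp (- \<rho> * t) *\<^sub>R f t)"
    unfolding integrable_iff_bounded using strongly_measurable_norm0[OF that] by (auto simp del: norm_scaleR)
  with 1 show ?thesis unfolding L2w_def L2_def mem_Collect_eq weighted_norm_sq by blast
qed

lemma nrm_eq: "f \<in> L2w \<rho> \<Longrightarrow> nrm \<rho> f = norm (emb \<rho> f)"
  unfolding nrm_def emb_def L2w_iff weighted_norm_sq
  by (subst nn_integral_eq_integral) (auto simp: L2_def norm_abs_l2 simp del: norm_scaleR)

lemma L2w_diff: "f \<in> L2w \<rho> \<Longrightarrow> g \<in> L2w \<rho> \<Longrightarrow> (\<lambda>t. f t - g t) \<in> L2w \<rho>"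
  unfolding L2w_iff scaleR_diff_right by (rule L2_diff)

lemma emb_diff: "f \<in> L2w \<rho> \<Longrightarrow> g \<in> L2w \<rho> \<Longrightarrow> emb \<rho> (\<lambda>t. f t - g t) = emb \<rho> f - emb \<rho> g"
  unfolding L2w_iff emb_def by (simp add: abs_l2_diff scaleR_diff_right)

lemma L2w_add: "f \<in> L2w \<rho> \<Longrightarrow> g \<in> L2w \<rho> \<Longrightarrow> (\<lambda>t. f t + g t) \<in> L2w \<rho>"
  unfolding L2w_iff scaleR_add_right by (rule L2_add)

lemma emb_add: "f \<in> L2w \<rho> \<Longrightarrow> g \<in> L2w \<rho> \<Longrightarrow> emb \<rho> (\<lambda>t. f t + g t) = emb \<rho> f + emb \<rho> g"
  unfolding L2w_iff emb_def by (simp add: abs_l2_add scaleR_add_right)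

lemma L2w_scaleR: "f \<in> L2w \<rho> \<Longrightarrow> (\<lambda>t. r *\<^sub>R f t) \<in> L2w \<rho>"
  using L2_scaleR[of "\<lambda>t. exp (- \<rho> * t) *\<^sub>R f t" r] by (simp add: L2w_iff mult.commute)

lemma emb_scaleR: "f \<in> L2w \<rho> \<Longrightarrow> emb \<rho> (\<lambda>t. r *\<^sub>R f t) = r *\<^sub>R emb \<rho> f"
  unfolding L2w_iff emb_def by (simp add: abs_l2_scaleR mult.commute)

lemma rep_emb: "f \<in> L2w \<rho> \<Longrightarrow> AE t in lebesgue. rep_l2 (emb \<rho> f) t = exp (- \<rho> * t) *\<^sub>R f t"
  unfolding L2w_iff emb_def by (rule rep_abs_l2)

lemma unemb_L2w: "unemb \<rho> a \<in> L2w \<rho>"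
  unfolding L2w_iff unemb_def using L2_rep[of a] by (simp add: exp_add[symmetric])

lemma emb_unemb [simp]: "emb \<rho> (unemb \<rho> a) = a"
  unfolding emb_def unemb_def by (simp add: exp_add[symmetric])

lemma L2w_cong_AE:
  assumes "f \<in> L2w \<rho>" "AE t in lebesgue. f t = g t" shows "g \<in> L2w \<rho>"
  using assms unfolding L2w_iff by (rule_tac L2_cong_AE) (auto elim: eventually_mono)

lemma gclosure_iff:
  "(u, v) \<in> gclosure \<rho> G \<longleftrightarrow> u \<in> L2w \<rho> \<and> v \<in> L2w \<rho> \<and>
     (\<exists>s. (\<forall>n. s n \<in> G \<and> fst (s n) \<in> L2w \<rho> \<and> snd (s n) \<in> L2w \<rho>) \<and>
       (\<lambda>n. emb \<rho> (fst (s n))) \<longlonglongrightarrow> emb \<rho> u \<and> (\<lambda>n. emb \<rho> (snd (s n))) \<longlonglongrightarrow> emb \<rho> v)"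
proof -
  have *: "((\<lambda>n. nrm \<rho> (\<lambda>t. f n t - w t)) \<longlonglongrightarrow> 0) \<longleftrightarrow> ((\<lambda>n. emb \<rho> (f n)) \<longlonglongrightarrow> emb \<rho> w)"
    if "\<And>n. f n \<in> L2w \<rho>" "w \<in> L2w \<rho>" for f :: "nat \<Rightarrow> real \<Rightarrow> 'a" and w
    using that by (simp add: nrm_eq L2w_diff emb_diff tendsto_norm_zero_iff LIM_zero_iff)
  show ?thesis unfolding gclosure_def by (auto simp: *)
qed

subsection \<open>The convolution graph\<close>

lemma lebesgue_reflect_measurable: "(\<lambda>s::real. t - s) \<in> lebesgue \<rightarrow>\<^sub>M lebesgue"
  using lebesgue_affine_measurable[where c="\<lambda>_::real. -1" and t=t] by (simp add: algebra_simps)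

lemma AE_lebesgue_reflect:
  assumes "AE s in lebesgue. P s" shows "AE s in lebesgue. P (t - s :: real)"
proof -
  obtain N where N: "N \<in> null_sets lebesgue" "{s. \<not> P s} \<subseteq> N"
    using assms by (auto simp: eventually_ae_filter)
  have "(\<integral>\<^sup>+s. indicator N s \<partial>lebesgue) = (\<integral>\<^sup>+s. indicator N (t - s) \<partial>lebesgue)"
    using nn_integral_real_affine_lebesgue[of "indicator N :: real \<Rightarrow> ennreal" "-1" t] N(1)
    by (auto simp: algebra_simps)
  moreover have "(\<lambda>s. indicator N (t - s) :: ennreal) = indicator ((\<lambda>s. t - s) -` N)"
    by (auto simp: indicator_def)
  moreover have "(\<lambda>s. t - s) -` N \<in> sets lebesgue"
    using measurable_sets[OF lebesgue_reflect_measurable[of t], of N] N(1) by auto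
  ultimately have "(\<lambda>s. t - s) -` N \<in> null_sets lebesgue" using N(1) by (auto simp: null_sets_def)
  then show ?thesis by (rule AE_I') (use N(2) in auto)
qed

lemma integral_lebesgue_reflect:
  fixes f :: "real \<Rightarrow> 'b::euclidean_space"
  shows "(LINT s|lebesgue. f (t - s)) = (LINT s|lebesgue. f s)"
  using lebesgue_integral_real_affine[of "-1" f t] by simp

lemma integrable_lebesgue_reflect:
  fixes f :: "real \<Rightarrow> 'b::euclidean_space"
  shows "integrable lebesgue f \<Longrightarrow> integrable lebesgue (\<lambda>s. f (t - s))"
  using lebesgue_integrable_real_affine[of f "-1" t] by simp

lemma convolution_Fubini:
  fixes h :: "real \<Rightarrow> complex" and w :: "real \<Rightarrow> real"
  assumes E: "E \<in> sets lebesgue" and h: "integrable lebesgue h"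
    and wm [measurable]: "w \<in> borel_measurable borel" and w: "integrable lborel w"
  shows "integrable lebesgue (\<lambda>t. w t *\<^sub>R (LINT s|lebesgue. indicat_real E (t - s) *\<^sub>R h s))"
    and "integrable lebesgue (\<lambda>s. (LINT t|lebesgue. w t * indicat_real E (t - s)) *\<^sub>R h s)"
    and "(LINT t|lebesgue. w t *\<^sub>R (LINT s|lebesgue. indicat_real E (t - s) *\<^sub>R h s)) =
      (LINT s|lebesgue. (LINT t|lebesgue. w t * indicat_real E (t - s)) *\<^sub>R h s)"
proof -
  have hm: "h \<in> borel_measurable lebesgue" using h by auto
  obtain e0 where e0 [measurable]: "e0 \<in> borel_measurable lborel" "AE t in lborel. indicat_real E t = e0 t"
    using completion_ex_borel_measurable_real[of "indicat_real E" lborel] E by auto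
  define e where "e t = (if e0 t = 1 then 1 else 0 :: real)" for t
  have em [measurable]: "e \<in> borel_measurable borel" using e0(1) unfolding e_def by simp
  have eE: "AE t in lebesgue. indicat_real E t = e t"
    using AE_completion[OF e0(2)] by eventually_elim (simp add: e_def indicator_def of_bool_def split: if_splits)
  have e1: "\<bar>e t\<bar> \<le> 1" for t by (simp add: e_def)
  have "(\<lambda>s. Re (h s)) \<in> borel_measurable lebesgue" "(\<lambda>s. Im (h s)) \<in> borel_measurable lebesgue" using hm by auto
  then obtain p q where p [measurable]: "p \<in> borel_measurable lborel" "AE s in lborel. Re (h s) = p s"
    and q [measurable]: "q \<in> borel_measurable lborel" "AE s in lborel. Im (h s) = q s"
    using completion_ex_borel_measurable_real[of "\<lambda>s. Re (h s)" lborel]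
      completion_ex_borel_measurable_real[of "\<lambda>s. Im (h s)" lborel] by auto
  define k where "k s = Complex (p s) (q s)" for s
  have km [measurable]: "k \<in> borel_measurable borel"
    using p(1) q(1) unfolding k_def Complex_eq by simp
  have hk: "AE s in lebesgue. h s = k s"
    using AE_completion[OF p(2)] AE_completion[OF q(2)] by eventually_elim (auto simp: k_def complex_eq_iff)
  have kil: "integrable lebesgue k"
    by (rule integrable_cong_AE_imp[OF h _ hk]) (rule measurable_completion, simp)
  have ki: "integrable lborel k" using kil by (subst (asm) integrable_completion) auto
  have inner1: "(LINT s|lebesgue. indicat_real E (t - s) *\<^sub>R h s) = (LINT s|lborel. e (t - s) *\<^sub>R k s)" for t
  proof -
    have "(LINT s|lebesgue. indicat_real E (t - s) *\<^sub>R h s) = (LINT s|lebesgue. e (t - s) *\<^sub>R k s)"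
    proof (rule integral_cong_AE)
      show "(\<lambda>s. indicat_real E (t - s) *\<^sub>R h s) \<in> borel_measurable lebesgue"
        by (intro borel_measurable_scaleR measurable_compose[OF lebesgue_reflect_measurable[of t] borel_measurable_indicator[OF E]] hm)
      show "(\<lambda>s. e (t - s) *\<^sub>R k s) \<in> borel_measurable lebesgue" by (rule measurable_completion) simp
      show "AE s in lebesgue. indicat_real E (t - s) *\<^sub>R h s = e (t - s) *\<^sub>R k s"
        using hk AE_lebesgue_reflect[OF eE, of t] by eventually_elim simp
    qed
    then show ?thesis by (subst (asm) integral_completion) auto
  qed
  have inner2: "(LINT t|lebesgue. w t * indicat_real E (t - s)) = (LINT t|lborel. w t * e (t - s))" for s
  proof -
    have "(LINT t|lebesgue. w t * indicat_real E (t - s)) = (LINT t|lebesgue. w t * e (t - s))"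
    proof (rule integral_cong_AE)
      show "(\<lambda>t. w t * indicat_real E (t - s)) \<in> borel_measurable lebesgue"
        by (intro borel_measurable_times measurable_compose[OF lebesgue_shift_measurable[of s] borel_measurable_indicator[OF E]]
          measurable_completion[of w lborel]) simp
      show "(\<lambda>t. w t * e (t - s)) \<in> borel_measurable lebesgue" by (rule measurable_completion) simp
      show "AE t in lebesgue. w t * indicat_real E (t - s) = w t * e (t - s)"
        using AE_lebesgue_shift[OF eE, of s] by eventually_elim simp
    qed
    then show ?thesis by (subst (asm) integral_completion) auto
  qed
  let ?F = "\<lambda>(t, s). w t *\<^sub>R e (t - s) *\<^sub>R k s"
  have we: "\<bar>w t\<bar> * \<bar>e x\<bar> * cmod z \<le> \<bar>w t\<bar> * cmod z" for t x z
    by (intro mult_right_mono mult_left_le e1) auto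
  have ii: "integrable lborel (\<lambda>s. w t *\<^sub>R e (t - s) *\<^sub>R k s)" for t
    by (rule bochner_bound[OF integrable_scaleR_right[OF ki, of "w t"]])
       (use we in \<open>auto simp: abs_mult mult.assoc\<close>)
  have F: "integrable (lborel \<Otimes>\<^sub>M lborel) ?F"
  proof (rule lborel_pair.Fubini_integrable)
    show "?F \<in> borel_measurable (lborel \<Otimes>\<^sub>M lborel)" by measurable
    show "AE t in lborel. integrable lborel (\<lambda>s. ?F (t, s))" using ii by simp
    show "integrable lborel (\<lambda>t. LINT s|lborel. norm (?F (t, s)))"
    proof (rule bochner_bound)
      show "integrable lborel (\<lambda>t. w t * (LINT s|lborel. norm (k s)))" using w by simp
      show "(\<lambda>t. LINT s|lborel. norm (?F (t, s))) \<in> borel_measurable lborel" by measurable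
      show "AE t in lborel. norm (LINT s|lborel. norm (?F (t, s))) \<le> norm (w t * (LINT s|lborel. norm (k s)))"
      proof (rule AE_I2)
        fix t
        have "(LINT s|lborel. norm (?F (t, s))) \<le> (LINT s|lborel. \<bar>w t\<bar> * norm (k s))"
          using integrable_norm[OF ii[of t]] ki we
          by (intro integral_mono) (auto simp: abs_mult mult.assoc)
        moreover have "0 \<le> (LINT s|lborel. norm (?F (t, s)))" by simp
        moreover have "0 \<le> (LINT s|lborel. norm (k s))" by simp
        ultimately show "norm (LINT s|lborel. norm (?F (t, s))) \<le> norm (w t * (LINT s|lborel. norm (k s)))"
          by (simp add: abs_mult)
      qed
    qed
  qed
  have G: "integrable (lborel \<Otimes>\<^sub>M lborel) (\<lambda>(s, t). w t *\<^sub>R e (t - s) *\<^sub>R k s)"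
    using lborel_pair.integrable_product_swap[OF F] by simp
  have "(LINT t|lborel. LINT s|lborel. w t *\<^sub>R e (t - s) *\<^sub>R k s) = (LINT s|lborel. LINT t|lborel. w t *\<^sub>R e (t - s) *\<^sub>R k s)"
    using lborel_pair.Fubini_integral[OF F] by simp
  moreover have L: "(LINT s|lborel. w t *\<^sub>R e (t - s) *\<^sub>R k s) = w t *\<^sub>R (LINT s|lborel. e (t - s) *\<^sub>R k s)" for t
    by (rule integral_scaleR_right)
  moreover have Rr: "(LINT t|lborel. w t *\<^sub>R e (t - s) *\<^sub>R k s) = (LINT t|lborel. w t * e (t - s)) *\<^sub>R k s" for s
  proof (cases "k s = 0")
    case False
    have "integrable lborel (\<lambda>t. w t * e (t - s))"
      by (rule bochner_bound[OF w])
         (use e1 in \<open>auto simp: abs_mult intro!: AE_I2 mult_right_le_one_le\<close>)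
    then show ?thesis by simp
  qed simp
  ultimately have main: "(LINT t|lborel. w t *\<^sub>R (LINT s|lborel. e (t - s) *\<^sub>R k s)) =
      (LINT s|lborel. (LINT t|lborel. w t * e (t - s)) *\<^sub>R k s)" by simp
  have A1: "integrable lborel (\<lambda>t. w t *\<^sub>R (LINT s|lborel. e (t - s) *\<^sub>R k s))"
    using lborel_pair.integrable_fst[OF F] unfolding L .
  have A2: "integrable lborel (\<lambda>s. (LINT t|lborel. w t * e (t - s)) *\<^sub>R k s)"
    using lborel_pair.integrable_fst[OF G] unfolding Rr .
  show "integrable lebesgue (\<lambda>t. w t *\<^sub>R (LINT s|lebesgue. indicat_real E (t - s) *\<^sub>R h s))"
    unfolding inner1 by (subst integrable_completion) (use A1 in auto)
  have A2l: "integrable lebesgue (\<lambda>s. (LINT t|lborel. w t * e (t - s)) *\<^sub>R k s)"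
    by (subst integrable_completion) (use A2 in auto)
  have mm: "(\<lambda>s. (LINT t|lborel. w t * e (t - s))) \<in> borel_measurable lebesgue"
    by (rule measurable_completion) measurable
  show "integrable lebesgue (\<lambda>s. (LINT t|lebesgue. w t * indicat_real E (t - s)) *\<^sub>R h s)"
    unfolding inner2
    by (rule integrable_cong_AE_imp[OF A2l]) (use hm mm hk in \<open>auto elim!: eventually_mono\<close>)
  have "(LINT s|lebesgue. (LINT t|lborel. w t * e (t - s)) *\<^sub>R h s) = (LINT s|lebesgue. (LINT t|lborel. w t * e (t - s)) *\<^sub>R k s)"
    by (rule integral_cong_AE) (use hm mm hk A2l in \<open>auto elim!: eventually_mono\<close>)
  also have "\<dots> = (LINT s|lborel. (LINT t|lborel. w t * e (t - s)) *\<^sub>R k s)"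
    by (rule integral_completion) measurable
  also have "\<dots> = (LINT t|lborel. w t *\<^sub>R (LINT s|lborel. e (t - s) *\<^sub>R k s))" by (rule main[symmetric])
  also have "\<dots> = (LINT t|lebesgue. w t *\<^sub>R (LINT s|lborel. e (t - s) *\<^sub>R k s))"
    by (rule integral_completion[symmetric]) measurable
  finally show "(LINT t|lebesgue. w t *\<^sub>R (LINT s|lebesgue. indicat_real E (t - s) *\<^sub>R h s)) =
      (LINT s|lebesgue. (LINT t|lebesgue. w t * indicat_real E (t - s)) *\<^sub>R h s)"
    unfolding inner1 inner2 by simp
qed

lemma simple_fn_sum:
  fixes f :: "'a \<Rightarrow> 'b::real_vector"
  assumes "finite (range u)"
  shows "(\<Sum>x\<in>range u. indicat_real (u -` {x}) s *\<^sub>R f x) = f (u s)"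
proof -
  have "(\<Sum>x\<in>range u. indicat_real (u -` {x}) s *\<^sub>R f x) = (\<Sum>x\<in>range u. if x = u s then f x else 0)"
    by (rule sum.cong) (auto simp: indicator_def)
  also have "\<dots> = f (u s)" using assms by (subst sum.delta) auto
  finally show ?thesis .
qed

context
  fixes C :: "real \<Rightarrow> 'a::chilbert \<Rightarrow> 'a"
  assumes C: "adm C"
begin

lemma Cz_measurable: "(\<lambda>r. cinner (Cz C r x) y) \<in> borel_measurable lebesgue"
  using C by (subst measurable_cong[of _ _ "\<lambda>r. indicat_real {0..} r *\<^sub>R cinner (C r x) y"])
    (auto simp: Cz_def indicator_def adm_def set_borel_measurable_def)

lemma Cz_kappa: "integrable lebesgue (\<lambda>r. indicat_real {0..} r * onorm (C r))"
  using C by (simp add: adm_def set_integrable_def)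

lemma Cz_bound: "norm (Cz C r x) \<le> indicat_real {0..} r * onorm (C r) * norm x"
  using bounded_clinear_op_onorm[OF adm_bounded[OF C]] by (simp add: Cz_def)

lemma Cz_integrable: "integrable lebesgue (\<lambda>r. cinner (Cz C r x) y)"
proof (rule bochner_bound[OF integrable_mult_left[OF Cz_kappa, of "norm x * norm y"]])
  show "AE r in lebesgue. norm (cinner (Cz C r x) y) \<le> norm (indicat_real {0..} r * onorm (C r) * (norm x * norm y))"
  proof (rule AE_I2)
    fix r
    have "norm (cinner (Cz C r x) y) \<le> norm (Cz C r x) * norm y" by (rule norm_cinner_le)
    also have "\<dots> \<le> indicat_real {0..} r * onorm (C r) * norm x * norm y"
      by (rule mult_right_mono[OF Cz_bound norm_ge_zero])
    finally show "norm (cinner (Cz C r x) y) \<le> norm (indicat_real {0..} r * onorm (C r) * (norm x * norm y))"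
      using abs_ge_self[of "indicat_real {0..} r * onorm (C r) * (norm x * norm y)"] by (simp add: mult.assoc)
  qed
qed (rule Cz_measurable)

lemma conv_simple_weak:
  assumes u: "simple_fn u"
  shows "cinner (conv_simple C u t) y = (LINT s|lebesgue. cinner (Cz C (t - s) (u s)) y)"
    and "(\<And>s. norm (u s) \<le> indicat_real E s * M) \<Longrightarrow> E \<in> sets lebesgue \<Longrightarrow>
      norm (conv_simple C u t) \<le> (LINT s|lebesgue. indicat_real {0..} (t - s) * onorm (C (t - s)) * (indicat_real E s * M))"
proof -
  have fin: "finite (range u)" using u by (simp add: simple_fn_def)
  have meas: "set_borel_measurable lebesgue UNIV (\<lambda>s. cinner (Cz C (t - s) (u s)) z)" for z
  proof -
    have "(\<lambda>s. \<Sum>x\<in>range u. indicat_real (u -` {x}) s *\<^sub>R cinner (Cz C (t - s) x) z) \<in> borel_measurable lebesgue"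
      using u measurable_compose[OF lebesgue_reflect_measurable[of t] Cz_measurable]
      by (intro borel_measurable_sum measurable_indicator_scaleR) (auto simp: simple_fn_def)
    then show ?thesis
      using simple_fn_sum[OF fin, of _ "\<lambda>x. cinner (Cz C (t - _) x) z"] by (simp add: set_borel_measurable_def simple_fn_sum[OF fin])
  qed
  have kt: "integrable lebesgue (\<lambda>s. indicat_real {0..} (t - s) * onorm (C (t - s)))"
    by (rule integrable_lebesgue_reflect[OF Cz_kappa])
  obtain M0 where M0: "\<And>s. norm (u s) \<le> M0"
    using finite_imp_bounded[OF fin] by (auto simp: bounded_iff)
  have k0: "set_integrable lebesgue UNIV (\<lambda>s. indicat_real {0..} (t - s) * onorm (C (t - s)) * M0)"
    using kt by (simp add: set_integrable_def)
  have kpos: "0 \<le> indicat_real {0..} r * onorm (C r)" for r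
    using onorm_nonneg_clinear[OF adm_bounded[OF C]] by (simp add: indicator_def)
  have b0: "AE s in lebesgue. s \<in> UNIV \<longrightarrow> norm (Cz C (t - s) (u s)) \<le> indicat_real {0..} (t - s) * onorm (C (t - s)) * M0"
    by (intro AE_I2 impI order_trans[OF Cz_bound] mult_left_mono M0 kpos)
  show "cinner (conv_simple C u t) y = (LINT s|lebesgue. cinner (Cz C (t - s) (u s)) y)"
    using weak_integral(2)[OF meas k0 b0] by (simp add: conv_simple_def set_lebesgue_integral_def)
  assume uE: "\<And>s. norm (u s) \<le> indicat_real E s * M" and E: "E \<in> sets lebesgue"
  have k1: "set_integrable lebesgue UNIV (\<lambda>s. indicat_real {0..} (t - s) * onorm (C (t - s)) * (indicat_real E s * M))"
    using integrable_mult_left[OF integrable_mult_indicator[OF E kt], of M] by (simp add: set_integrable_def mult_ac)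
  have b1: "AE s in lebesgue. s \<in> UNIV \<longrightarrow> norm (Cz C (t - s) (u s)) \<le> indicat_real {0..} (t - s) * onorm (C (t - s)) * (indicat_real E s * M)"
    by (intro AE_I2 impI order_trans[OF Cz_bound] mult_left_mono uE kpos)
  show "norm (conv_simple C u t) \<le> (LINT s|lebesgue. indicat_real {0..} (t - s) * onorm (C (t - s)) * (indicat_real E s * M))"
    using weak_integral(3)[OF meas k1 b1] by (simp add: conv_simple_def set_lebesgue_integral_def)
qed

lemma conv_simple_integrable_term:
  assumes "E \<in> sets lebesgue"
  shows "integrable lebesgue (\<lambda>r. indicat_real E (t - r) *\<^sub>R cinner (Cz C r x) y)"
proof (rule bochner_bound[OF Cz_integrable[of x y]])
  show "(\<lambda>r. indicat_real E (t - r) *\<^sub>R cinner (Cz C r x) y) \<in> borel_measurable lebesgue"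
    using measurable_compose[OF lebesgue_reflect_measurable[of t] borel_measurable_indicator[OF assms]]
    by (intro borel_measurable_scaleR Cz_measurable) auto
qed (auto simp: indicator_def)

lemma conv_simple_cinner:
  assumes u: "simple_fn u"
  shows "cinner (conv_simple C u t) y =
    (\<Sum>x\<in>range u. (LINT r|lebesgue. indicat_real (u -` {x}) (t - r) *\<^sub>R cinner (Cz C r x) y))"
proof -
  have fin: "finite (range u)" using u by (simp add: simple_fn_def)
  have "cinner (conv_simple C u t) y = (LINT s|lebesgue. cinner (Cz C (t - s) (u s)) y)"
    by (rule conv_simple_weak(1)[OF u])
  also have "\<dots> = (LINT r|lebesgue. cinner (Cz C r (u (t - r))) y)"
    using integral_lebesgue_reflect[of "\<lambda>s. cinner (Cz C (t - s) (u s)) y" t] by simp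
  also have "\<dots> = (LINT r|lebesgue. (\<Sum>x\<in>range u. indicat_real (u -` {x}) (t - r) *\<^sub>R cinner (Cz C r x) y))"
    by (rule Bochner_Integration.integral_cong) (simp_all add: simple_fn_sum[OF fin])
  also have "\<dots> = (\<Sum>x\<in>range u. (LINT r|lebesgue. indicat_real (u -` {x}) (t - r) *\<^sub>R cinner (Cz C r x) y))"
    using u by (intro Bochner_Integration.integral_sum conv_simple_integrable_term) (auto simp: simple_fn_def)
  finally show ?thesis .
qed

lemma conv_simple_add:
  assumes "simple_fn u" "simple_fn v"
  shows "conv_simple C (\<lambda>t. u t + v t) t = conv_simple C u t + conv_simple C v t"
proof (rule cinner_eqI)
  fix y
  have uv: "simple_fn (\<lambda>t. u t + v t)" by (rule simple_fn_comp2[OF assms])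
  have i: "integrable lebesgue (\<lambda>s. cinner (Cz C (t - s) (u s)) y)" if u: "simple_fn u" for u
  proof -
    have fin: "finite (range u)" using u by (simp add: simple_fn_def)
    have "integrable lebesgue (\<lambda>r. \<Sum>x\<in>range u. indicat_real (u -` {x}) (t - r) *\<^sub>R cinner (Cz C r x) y)"
      using u by (intro Bochner_Integration.integrable_sum conv_simple_integrable_term) (auto simp: simple_fn_def)
    from integrable_lebesgue_reflect[OF this, of t] show ?thesis by (simp add: simple_fn_sum[OF fin])
  qed
  have "Cz C r (a + b) = Cz C r a + Cz C r b" for r a b
    using bounded_clinear_opD(2)[OF adm_bounded[OF C]] by (simp add: Cz_def)
  then show "cinner (conv_simple C (\<lambda>t. u t + v t) t) y = cinner (conv_simple C u t + conv_simple C v t) y"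
    by (simp add: conv_simple_weak(1)[OF uv] conv_simple_weak(1)[OF assms(1)] conv_simple_weak(1)[OF assms(2)]
        cinner_add_left i assms)
qed

lemma conv_simple_scaleR:
  assumes "simple_fn u"
  shows "conv_simple C (\<lambda>t. c *\<^sub>R u t) t = c *\<^sub>R conv_simple C u t"
proof (rule cinner_eqI)
  fix y
  have uv: "simple_fn (\<lambda>t. c *\<^sub>R u t)" by (rule simple_fn_comp[OF assms])
  have "Cz C r (c *\<^sub>R a) = c *\<^sub>R Cz C r a" for r a
    using bounded_clinear_opD(4)[OF adm_bounded[OF C]] by (simp add: Cz_def)
  then show "cinner (conv_simple C (\<lambda>t. c *\<^sub>R u t) t) y = cinner (c *\<^sub>R conv_simple C u t) y"
    by (simp add: conv_simple_weak(1)[OF uv] conv_simple_weak(1)[OF assms] cinner_scaleR_left)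
qed

lemma conv_simple_box_continuous: "continuous_on UNIV (conv_simple C (box_fn a b x))"
proof -
  have "isCont (conv_simple C (box_fn a b x)) t" for t
    unfolding continuous_at_sequentially
  proof (intro allI impI, unfold comp_def)
    fix T :: "nat \<Rightarrow> real" assume T: "T \<longlonglongrightarrow> t"
    have kpos: "0 \<le> indicat_real {0..} r * onorm (C r)" for r
      using onorm_nonneg_clinear[OF adm_bounded[OF C]] by (simp add: indicator_def)
    let ?k = "\<lambda>r. indicat_real {0..} r * onorm (C r)"
    let ?D = "\<lambda>n r. \<bar>indicat_real {a..<b} (T n - r) - indicat_real {a..<b} (t - r)\<bar>"
    have Dm: "?D n \<in> borel_measurable lebesgue" for n
      by (intro borel_measurable_abs borel_measurable_diff measurable_compose[OF lebesgue_reflect_measurable borel_measurable_indicator]) auto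
    have Di: "integrable lebesgue (\<lambda>r. ?k r * (?D n r * norm x))" for n
    proof (rule bochner_bound[OF integrable_mult_left[OF Cz_kappa, of "norm x"]])
      show "(\<lambda>r. ?k r * (?D n r * norm x)) \<in> borel_measurable lebesgue"
        by (rule borel_measurable_times[OF borel_measurable_integrable[OF Cz_kappa] borel_measurable_times[OF Dm]]) simp
      show "AE r in lebesgue. norm (?k r * (?D n r * norm x)) \<le> norm (?k r * norm x)"
        by (intro AE_I2) (auto simp: indicator_def abs_mult)
    qed
    have cb: "cinner (conv_simple C (box_fn a b x) t) y = (LINT r|lebesgue. indicat_real {a..<b} (t - r) *\<^sub>R cinner (Cz C r x) y)" for t y
    proof -
      have "cinner (conv_simple C (box_fn a b x) t) y = (LINT s|lebesgue. cinner (Cz C (t - s) (box_fn a b x s)) y)"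
        by (rule conv_simple_weak(1)[OF simple_fn_box])
      also have "\<dots> = (LINT r|lebesgue. cinner (Cz C r (box_fn a b x (t - r))) y)"
        using integral_lebesgue_reflect[of "\<lambda>s. cinner (Cz C (t - s) (box_fn a b x s)) y" t] by simp
      also have "\<dots> = (LINT r|lebesgue. indicat_real {a..<b} (t - r) *\<^sub>R cinner (Cz C r x) y)"
        using bounded_clinear_opD(6)[OF adm_bounded[OF C]]
        by (intro Bochner_Integration.integral_cong) (auto simp: box_fn_def indicator_def Cz_def)
      finally show ?thesis .
    qed
    have bd: "norm (conv_simple C (box_fn a b x) (T n) - conv_simple C (box_fn a b x) t) \<le> (LINT r|lebesgue. ?k r * (?D n r * norm x))" for n
    proof -
      define z where "z = conv_simple C (box_fn a b x) (T n) - conv_simple C (box_fn a b x) t"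
      define I where "I = (LINT r|lebesgue. ?k r * (?D n r * norm x))"
      have i: "integrable lebesgue (\<lambda>r. indicat_real {a..<b} (t - r) *\<^sub>R cinner (Cz C r x) z)" for t
        by (rule conv_simple_integrable_term) simp
      have z1: "cinner z z = (LINT r|lebesgue. indicat_real {a..<b} (T n - r) *\<^sub>R cinner (Cz C r x) z - indicat_real {a..<b} (t - r) *\<^sub>R cinner (Cz C r x) z)"
        by (subst Bochner_Integration.integral_diff[OF i i]) (simp add: z_def cinner_diff_left cb)
      have z2: "norm (cinner z z) \<le> (LINT r|lebesgue. ?k r * (?D n r * norm x) * norm z)"
        unfolding z1
      proof (rule Bochner_Integration.integral_norm_bound_integral)
        show "integrable lebesgue (\<lambda>r. indicat_real {a..<b} (T n - r) *\<^sub>R cinner (Cz C r x) z - indicat_real {a..<b} (t - r) *\<^sub>R cinner (Cz C r x) z)"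
          by (intro Bochner_Integration.integrable_diff i)
        show "integrable lebesgue (\<lambda>r. ?k r * (?D n r * norm x) * norm z)" using Di[of n] by simp
        fix r
        have "norm (indicat_real {a..<b} (T n - r) *\<^sub>R cinner (Cz C r x) z - indicat_real {a..<b} (t - r) *\<^sub>R cinner (Cz C r x) z)
            = ?D n r * norm (cinner (Cz C r x) z)"
          by (simp flip: scaleR_diff_left)
        also have "\<dots> \<le> ?D n r * ((?k r * norm x) * norm z)"
          by (intro mult_left_mono order_trans[OF norm_cinner_le] mult_right_mono Cz_bound) auto
        finally show "norm (indicat_real {a..<b} (T n - r) *\<^sub>R cinner (Cz C r x) z - indicat_real {a..<b} (t - r) *\<^sub>R cinner (Cz C r x) z)
            \<le> ?k r * (?D n r * norm x) * norm z" by (simp add: mult_ac)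
      qed
      have z3: "(LINT r|lebesgue. ?k r * (?D n r * norm x) * norm z) = I * norm z"
        unfolding I_def by (rule integral_mult_left_zero)
      from z2[unfolded z3] have "norm z * norm z \<le> I * norm z" by (simp add: cinner_self norm_mult power2_eq_square)
      moreover have "0 \<le> I" unfolding I_def by (intro integral_nonneg_AE AE_I2 mult_nonneg_nonneg kpos) auto
      ultimately show ?thesis unfolding z_def[symmetric] I_def[symmetric] by (cases "norm z = 0") auto
    qed
    have "(\<lambda>n. LINT r|lebesgue. ?k r * (?D n r * norm x)) \<longlonglongrightarrow> (LINT r::real|lebesgue. (0::real))"
    proof (rule Bochner_Integration.integral_dominated_convergence[where s = "\<lambda>n r. ?k r * (?D n r * norm x)"
          and w = "\<lambda>r. ?k r * norm x" and f = "\<lambda>r. 0::real" and M = lebesgue])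
      show "AE r in lebesgue. (\<lambda>n. ?k r * (?D n r * norm x)) \<longlonglongrightarrow> 0"
      proof -
        have "AE r in lebesgue. r \<notin> {t - a, t - b}"
          by (rule AE_completion, rule AE_not_in) (simp add: finite_imp_null_set_lborel)
        then show ?thesis
        proof eventually_elim
          case (elim r)
          have "\<forall>\<^sub>F n in sequentially. ?D n r = 0"
          proof -
            have *: "(\<lambda>n. T n - r) \<longlonglongrightarrow> t - r" by (intro tendsto_intros T)
            consider "t - r < a" | "a < t - r" "t - r < b" | "b < t - r" | "a < t - r" "b < t - r" using elim by fastforce
            then show ?thesis
            proof cases
              case 1 then show ?thesis using order_tendstoD(2)[OF * 1] by (auto simp: indicator_def elim: eventually_mono)
            next
              case 2 show ?thesis using order_tendstoD(1)[OF * 2(1)] order_tendstoD(2)[OF * 2(2)]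
                by eventually_elim (use 2 in \<open>auto simp: indicator_def\<close>)
            next
              case 3 then show ?thesis using order_tendstoD(1)[OF * 3] by (auto simp: indicator_def elim: eventually_mono)
            next
              case 4 then show ?thesis using order_tendstoD(1)[OF * 4(2)] by (auto simp: indicator_def elim: eventually_mono)
            qed
          qed
          then have "\<forall>\<^sub>F n in sequentially. ?k r * (?D n r * norm x) = 0" by eventually_elim simp
          then show ?case by (rule tendsto_eventually)
        qed
      qed
      show "integrable lebesgue (\<lambda>r. ?k r * norm x)" by (intro integrable_mult_left Cz_kappa)
      show "AE r in lebesgue. norm (?k r * (?D n r * norm x)) \<le> ?k r * norm x" for n
      proof (rule AE_I2)
        fix r
        have "?D n r \<le> 1" by (auto simp: indicator_def)
        then have "?k r * (?D n r * norm x) \<le> ?k r * (1 * norm x)" by (intro mult_left_mono mult_right_mono kpos) auto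
        moreover have "0 \<le> ?k r * (?D n r * norm x)" by (intro mult_nonneg_nonneg kpos) auto
        ultimately show "norm (?k r * (?D n r * norm x)) \<le> ?k r * norm x" by simp
      qed
    qed (use Di in auto)
    then have "(\<lambda>n. LINT r|lebesgue. ?k r * (?D n r * norm x)) \<longlonglongrightarrow> 0" by simp
    from Lim_null_comparison[OF always_eventually[OF allI[OF bd]] this]
    show "(\<lambda>n. conv_simple C (box_fn a b x) (T n)) \<longlonglongrightarrow> conv_simple C (box_fn a b x) t"
      by (rule LIM_zero_cancel)
  qed
  then show ?thesis by (simp add: continuous_at_imp_continuous_on)
qed

lemma conv_simple_convop:
  fixes \<rho> :: real
  defines "K \<equiv> expw \<rho> C"
  assumes K: "adm K" and u: "simple_fn u" and uL: "u \<in> L2w \<rho>"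
  shows "set_integrable lebesgue {c..<d} (\<lambda>t. cinner (exp (- \<rho> * t) *\<^sub>R conv_simple C u t) y)"
    and "(LINT t:{c..<d}|lebesgue. cinner (exp (- \<rho> * t) *\<^sub>R conv_simple C u t) y) = cinner (convop K (emb \<rho> u)) (box_l2 c d y)"
proof -
  have fin: "finite (range u)" and Es: "\<And>x. u -` {x} \<in> sets lebesgue" using u by (auto simp: simple_fn_def)
  define w where "w t = indicat_real {c..<d} t * exp (- \<rho> * t)" for t
  have wm [measurable]: "w \<in> borel_measurable borel" unfolding w_def by measurable
  have wi: "integrable lborel w"
  proof (rule bochner_bound)
    show "integrable lborel (\<lambda>t. exp (\<bar>- \<rho>\<bar> * (\<bar>c\<bar> + \<bar>d\<bar>)) * indicat_real {c..<d} t)"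
      by (intro integrable_mult_right integrable_real_indicator) (use emeasure_bounded_finite[OF bounded_Ico[of c d]] in auto)
    show "AE t in lborel. norm (w t) \<le> norm (exp (\<bar>- \<rho>\<bar> * (\<bar>c\<bar> + \<bar>d\<bar>)) * indicat_real {c..<d} t)"
    proof (rule AE_I2)
      fix t show "norm (w t) \<le> norm (exp (\<bar>- \<rho>\<bar> * (\<bar>c\<bar> + \<bar>d\<bar>)) * indicat_real {c..<d} t)"
        using exp_bound_on[of t c d "- \<rho>"] by (auto simp: w_def indicator_def)
    qed
  qed measurable
  note F = convolution_Fubini[OF Es Cz_integrable[of _ y] wm wi]
  have eqL: "indicat_real {c..<d} t *\<^sub>R cinner (exp (- \<rho> * t) *\<^sub>R conv_simple C u t) y =
      (\<Sum>x\<in>range u. w t *\<^sub>R (LINT r|lebesgue. indicat_real (u -` {x}) (t - r) *\<^sub>R cinner (Cz C r x) y))" for t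
    by (simp add: conv_simple_cinner[OF u] cinner_scaleR_left w_def scaleR_conv_of_real sum_distrib_left mult.assoc)
  show "set_integrable lebesgue {c..<d} (\<lambda>t. cinner (exp (- \<rho> * t) *\<^sub>R conv_simple C u t) y)"
    unfolding set_integrable_def eqL by (intro Bochner_Integration.integrable_sum F(1))
  have "(LINT t:{c..<d}|lebesgue. cinner (exp (- \<rho> * t) *\<^sub>R conv_simple C u t) y) =
      (\<Sum>x\<in>range u. (LINT t|lebesgue. w t *\<^sub>R (LINT r|lebesgue. indicat_real (u -` {x}) (t - r) *\<^sub>R cinner (Cz C r x) y)))"
    unfolding set_lebesgue_integral_def eqL by (intro Bochner_Integration.integral_sum F(1))
  also have "\<dots> = (\<Sum>x\<in>range u. (LINT r|lebesgue. (LINT t|lebesgue. w t * indicat_real (u -` {x}) (t - r)) *\<^sub>R cinner (Cz C r x) y))"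
    by (simp only: F(3))
  also have "\<dots> = (LINT r|lebesgue. (\<Sum>x\<in>range u. (LINT t|lebesgue. w t * indicat_real (u -` {x}) (t - r)) *\<^sub>R cinner (Cz C r x) y))"
    by (intro Bochner_Integration.integral_sum[symmetric] F(2))
  also have "\<dots> = (LINT r|lebesgue. indicat_real {0..} r *\<^sub>R cinner (ptop (K r) (shiftop r (emb \<rho> u))) (box_l2 c d y))"
  proof (rule bochner_cong)
    fix r
    show "(\<Sum>x\<in>range u. (LINT t|lebesgue. w t * indicat_real (u -` {x}) (t - r)) *\<^sub>R cinner (Cz C r x) y) =
        indicat_real {0..} r *\<^sub>R cinner (ptop (K r) (shiftop r (emb \<rho> u))) (box_l2 c d y)"
    proof (cases "r \<ge> 0")
      case False then show ?thesis by (simp add: Cz_def)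
    next
      case True
      have wl: "integrable lebesgue w" using wi by (subst integrable_completion) auto
      have i: "integrable lebesgue (\<lambda>t. w t * indicat_real (u -` {x}) (t - r))" for x
      proof (rule bochner_bound[OF wl])
        show "(\<lambda>t. w t * indicat_real (u -` {x}) (t - r)) \<in> borel_measurable lebesgue"
          using wl measurable_compose[OF lebesgue_shift_measurable[of r] borel_measurable_indicator[OF Es[of x]]]
          by (intro borel_measurable_times) auto
      qed (auto simp: indicator_def)
      have "(\<Sum>x\<in>range u. (LINT t|lebesgue. w t * indicat_real (u -` {x}) (t - r)) *\<^sub>R cinner (Cz C r x) y) =
          (\<Sum>x\<in>range u. (LINT t|lebesgue. (w t * indicat_real (u -` {x}) (t - r)) *\<^sub>R cinner (Cz C r x) y))"
        using i by (intro sum.cong refl integral_scaleR_left[symmetric]) auto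
      also have "\<dots> = (LINT t|lebesgue. (\<Sum>x\<in>range u. (w t * indicat_real (u -` {x}) (t - r)) *\<^sub>R cinner (Cz C r x) y))"
        using i by (intro Bochner_Integration.integral_sum[symmetric] integrable_scaleR_left) auto
      also have "\<dots> = (LINT t|lebesgue. w t *\<^sub>R cinner (C r (u (t - r))) y)"
      proof (rule bochner_cong)
        fix t
        have "(\<Sum>x\<in>range u. (w t * indicat_real (u -` {x}) (t - r)) *\<^sub>R cinner (Cz C r x) y) =
            w t *\<^sub>R (\<Sum>x\<in>range u. indicat_real (u -` {x}) (t - r) *\<^sub>R cinner (Cz C r x) y)"
          by (simp add: scaleR_sum_right)
        then show "(\<Sum>x\<in>range u. (w t * indicat_real (u -` {x}) (t - r)) *\<^sub>R cinner (Cz C r x) y) = w t *\<^sub>R cinner (C r (u (t - r))) y"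
          using True by (simp add: simple_fn_sum[OF fin] Cz_def)
      qed
      also have "\<dots> = (LINT t:{c..<d}|lebesgue. cinner (rep_l2 (ptop (K r) (shiftop r (emb \<rho> u))) t) y)"
        unfolding set_lebesgue_integral_def
      proof (rule integral_cong_AE)
        have bC: "bounded_clinear_op (C r)" using adm_bounded[OF C True] .
        show "(\<lambda>t. w t *\<^sub>R cinner (C r (u (t - r))) y) \<in> borel_measurable lebesgue"
          using wl strongly_measurable_cinner[OF strongly_measurable_bounded_linear[OF bounded_clinear_opD(1)[OF bC]
                strongly_measurable_shift[OF strongly_measurable_simple[OF u]]] strongly_measurable_continuous[of "\<lambda>t. y"]]
          by (intro borel_measurable_scaleR) auto
        show "(\<lambda>t. indicat_real {c..<d} t *\<^sub>R cinner (rep_l2 (ptop (K r) (shiftop r (emb \<rho> u))) t) y) \<in> borel_measurable lebesgue"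
          using L2_set_integrable_cinner[OF L2_rep[of "ptop (K r) (shiftop r (emb \<rho> u))"], of c d y] by (auto simp: set_integrable_def)
        show "AE t in lebesgue. w t *\<^sub>R cinner (C r (u (t - r))) y =
            indicat_real {c..<d} t *\<^sub>R cinner (rep_l2 (ptop (K r) (shiftop r (emb \<rho> u))) t) y"
          using rep_ptop[OF adm_bounded[OF K True], of "shiftop r (emb \<rho> u)"] rep_shiftop[of r "emb \<rho> u"]
            AE_lebesgue_shift[OF rep_emb[OF uL], of r]
        proof eventually_elim
          case (elim t)
          have "exp (- \<rho> * r) * exp (- \<rho> * (t - r)) = exp (- \<rho> * t)" by (simp add: exp_add[symmetric] algebra_simps)
          then show ?case using elim
            by (simp add: K_def wker_def w_def bounded_clinear_opD[OF bC] cinner_scaleR_left scaleR_conv_of_real of_real_mult[symmetric] mult.assoc[symmetric] del: of_real_mult)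
        qed
      qed
      also have "\<dots> = cinner (ptop (K r) (shiftop r (emb \<rho> u))) (box_l2 c d y)" by (rule cinner_box[symmetric])
      finally show ?thesis using True by simp
    qed
  qed
  also have "\<dots> = cinner (convop K (emb \<rho> u)) (box_l2 c d y)"
    by (simp add: cinner_convop[OF K] set_lebesgue_integral_def)
  finally show "(LINT t:{c..<d}|lebesgue. cinner (exp (- \<rho> * t) *\<^sub>R conv_simple C u t) y) = cinner (convop K (emb \<rho> u)) (box_l2 c d y)" .
qed

lemma emb_conv_simple:
  assumes K: "adm (expw \<rho> C)" and u: "simple_fn u" and uL: "u \<in> L2w \<rho>" and v: "conv_simple C u \<in> L2w \<rho>"
  shows "emb \<rho> (conv_simple C u) = convop (expw \<rho> C) (emb \<rho> u)"
proof (rule l2_eq_boxI)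
  fix a b :: real and x :: 'a
  have "cinner (emb \<rho> (conv_simple C u)) (box_l2 a b x) = (LINT t:{a..<b}|lebesgue. cinner (exp (- \<rho> * t) *\<^sub>R conv_simple C u t) x)"
    unfolding cinner_box set_lebesgue_integral_def
    by (rule integral_cong_AE)
       (use rep_emb[OF v] L2_set_integrable_cinner[OF L2_rep[of "emb \<rho> (conv_simple C u)"], of a b x]
         conv_simple_convop(1)[OF K u uL, of a b x] in \<open>auto simp: set_integrable_def elim!: eventually_mono\<close>)
  also have "\<dots> = cinner (convop (expw \<rho> C) (emb \<rho> u)) (box_l2 a b x)"
    by (rule conv_simple_convop(2)[OF K u uL])
  finally show "cinner (emb \<rho> (conv_simple C u)) (box_l2 a b x) = cinner (convop (expw \<rho> C) (emb \<rho> u)) (box_l2 a b x)" .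
qed

lemma box_fn_L2w: "box_fn a b x \<in> L2w \<rho>"
  unfolding L2w_iff by (rule L2_wbox)

lemma conv_simple_box_L2w:
  assumes K: "adm (expw \<rho> C)"
  shows "conv_simple C (box_fn a b x) \<in> L2w \<rho>"
proof -
  let ?v = "conv_simple C (box_fn a b x)"
  define k where "k = convop (expw \<rho> C) (emb \<rho> (box_fn a b x))"
  have sm: "strongly_measurable (\<lambda>t. exp (- \<rho> * t) *\<^sub>R ?v t)"
    by (rule strongly_measurable_scaleR[OF exp_measurable_lebesgue strongly_measurable_continuous[OF conv_simple_box_continuous]])
  note B = conv_simple_convop[OF K simple_fn_box[of a b x] box_fn_L2w[of a b x]]
  have "AE t in lebesgue. exp (- \<rho> * t) *\<^sub>R ?v t - rep_l2 k t = 0"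
  proof (rule strongly_measurable_zeroI)
    show "strongly_measurable (\<lambda>t. exp (- \<rho> * t) *\<^sub>R ?v t - rep_l2 k t)"
      using L2_rep[of k] by (intro strongly_measurable_diff sm) (simp add: L2_def)
    fix c d :: real and y
    note i = B(1)[of c d y] L2_set_integrable_cinner[OF L2_rep[of k], of c d y]
    show "set_integrable lebesgue {c..<d} (\<lambda>t. cinner (exp (- \<rho> * t) *\<^sub>R ?v t - rep_l2 k t) y)"
      unfolding cinner_diff_left by (rule set_integral_diff(1)[OF i])
    show "(LINT t:{c..<d}|lebesgue. cinner (exp (- \<rho> * t) *\<^sub>R ?v t - rep_l2 k t) y) = 0"
      unfolding cinner_diff_left set_integral_diff(2)[OF i] B(2) by (simp add: k_def cinner_box)
  qed
  then have "AE t in lebesgue. rep_l2 k t = exp (- \<rho> * t) *\<^sub>R ?v t" by eventually_elim simp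
  then show ?thesis unfolding L2w_iff by (rule L2_cong_AE[OF L2_rep])
qed

lemma conv_graph_iff:
  assumes K: "adm (expw \<rho> C)"
  shows "(w, v) \<in> conv_graph \<rho> C \<longleftrightarrow> w \<in> L2w \<rho> \<and> v \<in> L2w \<rho> \<and>
    emb \<rho> v = convop (expw \<rho> C) (emb \<rho> w)"
proof -
  define T where "T = convop (expw \<rho> C)"
  have T: "bounded_linear T" unfolding T_def by (rule bounded_clinear_opD(1)[OF convop_clinear[OF K]])
  define G where "G = {(u, conv_simple C u) | u. simple_fn u \<and> emeasure lebesgue {t. u t \<noteq> 0} < \<infinity>}"
  have "emb \<rho> v = T (emb \<rho> w)" if "(w, v) \<in> gclosure \<rho> G"
  proof -
    obtain s where s: "\<And>n. s n \<in> G \<and> fst (s n) \<in> L2w \<rho> \<and> snd (s n) \<in> L2w \<rho>"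
      "(\<lambda>n. emb \<rho> (fst (s n))) \<longlonglongrightarrow> emb \<rho> w" "(\<lambda>n. emb \<rho> (snd (s n))) \<longlonglongrightarrow> emb \<rho> v"
      using \<open>(w, v) \<in> gclosure \<rho> G\<close> unfolding gclosure_iff by blast
    have "emb \<rho> (snd (s n)) = T (emb \<rho> (fst (s n)))" for n
      using s(1)[of n] emb_conv_simple[OF K] by (auto simp: G_def T_def)
    then have "(\<lambda>n. emb \<rho> (snd (s n))) \<longlonglongrightarrow> T (emb \<rho> w)" using bounded_linear.tendsto[OF T s(2)] by simp
    then show ?thesis using s(3) LIMSEQ_unique by blast
  qed
  moreover have "(w, v) \<in> gclosure \<rho> G" if w: "w \<in> L2w \<rho>" and v: "v \<in> L2w \<rho>" and e: "emb \<rho> v = T (emb \<rho> w)"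
  proof -
    define B where "B = {wbox (- \<rho>) a b x | a b (x::'a). True}"
    have "closure (span B) = UNIV"
    proof (rule dense_by_orthogonality)
      fix h :: "'a l2" assume h: "\<forall>s\<in>span B. Re (cinner h s) = 0"
      have "cinner h (wbox (- \<rho>) a b x) = 0" for a b and x :: 'a
      proof -
        have ix: "wbox (- \<rho>) a b (\<i> *\<^sub>C x) = \<i> *\<^sub>C wbox (- \<rho>) a b x"
          unfolding wbox_def abs_l2_cscale[OF L2_wbox]
          by (rule arg_cong[of _ _ abs_l2]) (auto simp: box_fn_def cscale_scaleR)
        have "wbox (- \<rho>) a b x \<in> B" "wbox (- \<rho>) a b (\<i> *\<^sub>C x) \<in> B" by (auto simp: B_def)
        then have "Re (cinner h (wbox (- \<rho>) a b x)) = 0" "Re (cinner h (\<i> *\<^sub>C wbox (- \<rho>) a b x)) = 0"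
          using h span_base unfolding ix by blast+
        then show ?thesis by (simp add: complex_eq_iff cinner_cscale_right)
      qed
      then have "compat (- \<rho>) h 0" by (simp add: compat_iff)
      moreover have "AE t in lebesgue. rep_l2 (0::'a l2) t = 0"
        unfolding zero_l2_def by (rule rep_abs_l2[OF L2_zero])
      ultimately have "AE t in lebesgue. rep_l2 h t = rep_l2 0 t" unfolding compat_def by eventually_elim simp
      then show "h = 0" by (rule l2_eqI)
    qed simp
    then obtain X where X: "\<And>n. X n \<in> span B" "X \<longlonglongrightarrow> emb \<rho> w"
      using closure_sequential[of "emb \<rho> w" "span B"] by blast
    have good: "\<exists>u. simple_fn u \<and> emeasure lebesgue {t. u t \<noteq> 0} < \<infinity> \<and> u \<in> L2w \<rho> \<and> conv_simple C u \<in> L2w \<rho> \<and> emb \<rho> u = z"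
      if "z \<in> span B" for z
      using that
    proof (induction rule: span_induct_alt)
      case base
      have "emb \<rho> (box_fn 0 1 (0::'a)) = 0"
        by (simp add: emb_def box_fn_def zero_l2_def)
      then show ?case using simple_fn_box[of 0 1 "0::'a"] box_fn_L2w[of 0 1 0] conv_simple_box_L2w[OF K, of 0 1 0]
        by (intro exI[of _ "box_fn 0 1 0"]) (auto simp: box_fn_def)
    next
      case (step c x y)
      then obtain u a b z where u: "simple_fn u" "emeasure lebesgue {t. u t \<noteq> 0} < \<infinity>" "u \<in> L2w \<rho>" "conv_simple C u \<in> L2w \<rho>" "emb \<rho> u = y"
        and x: "x = wbox (- \<rho>) a b z" by (auto simp: B_def)
      let ?b = "\<lambda>t. c *\<^sub>R box_fn a b z t"
      let ?u = "\<lambda>t. ?b t + u t"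
      have sb: "simple_fn ?b" by (rule simple_fn_comp[OF simple_fn_box])
      have bL: "?b \<in> L2w \<rho>" by (rule L2w_scaleR[OF box_fn_L2w])
      have sets: "{t. u t \<noteq> 0} \<in> sets lebesgue"
      proof -
        have "{t. g t \<noteq> 0} \<in> sets lebesgue" if "simple_fn g" for g :: "real \<Rightarrow> 'a"
        proof -
          have "{t. g t \<noteq> 0} = - (g -` {0})" by auto
          then show ?thesis using that by (simp add: simple_fn_def Compl_in_sets_lebesgue)
        qed
        from this[OF u(1)] show ?thesis .
      qed
      have "emeasure lebesgue {t. ?u t \<noteq> 0} \<le> emeasure lebesgue ({a..<b} \<union> {t. u t \<noteq> 0})"
        using sets by (intro emeasure_mono) (auto simp: box_fn_def indicator_def split: if_splits)
      also have "\<dots> \<le> emeasure lebesgue {a..<b} + emeasure lebesgue {t. u t \<noteq> 0}"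
        using sets by (intro emeasure_subadditive) auto
      also have "\<dots> < \<infinity>" using u(2) emeasure_bounded_finite[OF bounded_Ico[of a b]] by (simp add: ennreal_add_less_top)
      finally have "emeasure lebesgue {t. ?u t \<noteq> 0} < \<infinity>" .
      moreover have "simple_fn ?u" by (rule simple_fn_comp2[OF sb u(1)])
      moreover have "?u \<in> L2w \<rho>" by (rule L2w_add[OF bL u(3)])
      moreover have "conv_simple C ?u = (\<lambda>t. c *\<^sub>R conv_simple C (box_fn a b z) t + conv_simple C u t)"
        by (rule ext) (simp add: conv_simple_add[OF sb u(1)] conv_simple_scaleR[OF simple_fn_box])
      then have "conv_simple C ?u \<in> L2w \<rho>"
        using L2w_add[OF L2w_scaleR[OF conv_simple_box_L2w[OF K]] u(4)] by simp
      moreover have "emb \<rho> ?u = c *\<^sub>R x + y"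
        unfolding emb_add[OF bL u(3)] emb_scaleR[OF box_fn_L2w] u(5) x by (simp add: emb_def wbox_def)
      ultimately show ?case by blast
    qed
    have "\<exists>u. \<forall>n. simple_fn (u n) \<and> emeasure lebesgue {t. u n t \<noteq> 0} < \<infinity> \<and> u n \<in> L2w \<rho> \<and>
        conv_simple C (u n) \<in> L2w \<rho> \<and> emb \<rho> (u n) = X n"
      by (rule choice) (use good X(1) in blast)
    then obtain u where u: "\<And>n. simple_fn (u n)" "\<And>n. emeasure lebesgue {t. u n t \<noteq> 0} < \<infinity>" "\<And>n. u n \<in> L2w \<rho>"
      "\<And>n. conv_simple C (u n) \<in> L2w \<rho>" "\<And>n. emb \<rho> (u n) = X n"
      by blast
    have "emb \<rho> (conv_simple C (u n)) = T (X n)" for n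
      using emb_conv_simple[OF K u(1) u(3) u(4)] by (simp add: T_def u(5))
    then have "(\<lambda>n. emb \<rho> (conv_simple C (u n))) \<longlonglongrightarrow> emb \<rho> v"
      using bounded_linear.tendsto[OF T X(2)] e by simp
    then show ?thesis unfolding gclosure_iff using w v u X(2)
      by (intro conjI exI[of _ "\<lambda>n. (u n, conv_simple C (u n))"]) (auto simp: G_def)
  qed
  ultimately show ?thesis unfolding conv_graph_def G_def[symmetric] T_def[symmetric]
    by (auto simp: gclosure_def)
qed

end

subsection \<open>Smooth functions\<close>

definition smooth :: "(real \<Rightarrow> 'a::real_normed_vector) \<Rightarrow> bool" where
  "smooth f \<longleftrightarrow> (\<forall>k t. (dvec ^^ k) f differentiable (at t))"

lemma dvec_eq: "(\<And>t. (f has_vector_derivative f' t) (at t)) \<Longrightarrow> dvec f = f'"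
  unfolding dvec_def by (rule ext) (rule vector_derivative_at)

lemma smoothD:
  assumes "smooth f"
  shows "(f has_vector_derivative dvec f t) (at t)" "smooth (dvec f)" "continuous_on UNIV f"
proof -
  have d: "f differentiable (at t)" for t using assms unfolding smooth_def by (metis funpow_0)
  then show "(f has_vector_derivative dvec f t) (at t)"
    unfolding dvec_def by (simp add: vector_derivative_works)
  show "smooth (dvec f)" unfolding smooth_def
  proof (intro allI)
    fix k t show "(dvec ^^ k) (dvec f) differentiable (at t)"
      using assms unfolding smooth_def by (metis funpow_Suc_right comp_apply)
  qed
  show "continuous_on UNIV f"
    using d differentiable_imp_continuous_within by (auto simp: continuous_on_eq_continuous_within)
qed

lemma smooth_coinduct:
  assumes step: "\<And>f. Q f \<Longrightarrow> \<exists>f'. (\<forall>t. (f has_vector_derivative f' t) (at t)) \<and> Q f'"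
    and f: "Q f"
  shows "smooth f"
  unfolding smooth_def
proof (intro allI)
  fix k t
  have "Q ((dvec ^^ k) f)" for k
  proof (induction k)
    case (Suc k)
    then obtain f' where "\<forall>t. ((dvec ^^ k) f has_vector_derivative f' t) (at t)" "Q f'" using step by blast
    then show ?case using dvec_eq[of "(dvec ^^ k) f" f'] by simp
  qed (use f in simp)
  then obtain f' where "\<forall>t. ((dvec ^^ k) f has_vector_derivative f' t) (at t)" using step by blast
  then show "(dvec ^^ k) f differentiable (at t)" by (auto intro: differentiableI_vector)
qed

lemma smooth_antiderivative:
  assumes d: "\<And>t. (f has_vector_derivative f' t) (at t)" and s: "smooth f'"
  shows "smooth f"
  by (rule smooth_coinduct[where Q = "\<lambda>g. g = f \<or> smooth g"]) (use d s smoothD in blast)+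

lemma smooth_add: "smooth f \<Longrightarrow> smooth g \<Longrightarrow> smooth (\<lambda>t. f t + g t)"
proof (rule smooth_coinduct[where Q = "\<lambda>h. \<exists>f g. h = (\<lambda>t. f t + g t) \<and> smooth f \<and> smooth g"])
  fix h :: "real \<Rightarrow> 'a" assume "\<exists>f g. h = (\<lambda>t. f t + g t) \<and> smooth f \<and> smooth g"
  then obtain f g where h: "h = (\<lambda>t. f t + g t)" "smooth f" "smooth g" by blast
  show "\<exists>f'. (\<forall>t. (h has_vector_derivative f' t) (at t)) \<and> (\<exists>f g. f' = (\<lambda>t. f t + g t) \<and> smooth f \<and> smooth g)"
    using h by (intro exI[of _ "\<lambda>t. dvec f t + dvec g t"] conjI exI[of _ "dvec f"] exI[of _ "dvec g"])
      (auto intro!: has_vector_derivative_add smoothD)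
qed auto

lemma smooth_const: "smooth (\<lambda>t. c)"
  by (rule smooth_coinduct[where Q = "\<lambda>f. \<exists>c. f = (\<lambda>t. c)"]) (auto intro!: exI has_vector_derivative_const)

lemma smooth_scaled_exp: "smooth (\<lambda>t. exp (k * t) :: real)"
proof (rule smooth_coinduct[where Q = "\<lambda>f. \<exists>r. f = (\<lambda>t. r * exp (k * t))"])
  fix f :: "real \<Rightarrow> real" assume "\<exists>r. f = (\<lambda>t. r * exp (k * t))"
  then obtain r where f: "f = (\<lambda>t. r * exp (k * t))" by blast
  have "(f has_vector_derivative (r * k) * exp (k * t)) (at t)" for t
    unfolding f has_real_derivative_iff_has_vector_derivative[symmetric]
    by (auto intro!: derivative_eq_intros)
  then show "\<exists>f'. (\<forall>t. (f has_vector_derivative f' t) (at t)) \<and> (\<exists>r. f' = (\<lambda>t. r * exp (k * t)))"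
    by (intro exI[of _ "\<lambda>t. (r * k) * exp (k * t)"]) auto
qed (rule exI[of _ 1], simp)

inductive prod_closure :: "(real \<Rightarrow> 'a::real_normed_vector) \<Rightarrow> bool" where
  prod: "smooth f \<Longrightarrow> smooth g \<Longrightarrow> prod_closure (\<lambda>t. (f t :: real) *\<^sub>R g t)"
| plus: "prod_closure u \<Longrightarrow> prod_closure v \<Longrightarrow> prod_closure (\<lambda>t. u t + v t)"

lemma prod_closure_deriv:
  "prod_closure u \<Longrightarrow> \<exists>u'. (\<forall>t. (u has_vector_derivative u' t) (at t)) \<and> prod_closure u'"
proof (induction rule: prod_closure.induct)
  case (prod f g)
  have f: "(f has_real_derivative dvec f t) (at t)" for t
    using smoothD(1)[OF prod(1)] by (simp add: has_real_derivative_iff_has_vector_derivative)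
  have "((\<lambda>t. f t *\<^sub>R g t) has_vector_derivative f t *\<^sub>R dvec g t + dvec f t *\<^sub>R g t) (at t)" for t
    by (rule has_vector_derivative_scaleR[OF f smoothD(1)[OF prod(2)]])
  then show ?case using prod smoothD(2)[OF prod(1)] smoothD(2)[OF prod(2)]
    by (intro exI[of _ "\<lambda>t. f t *\<^sub>R dvec g t + dvec f t *\<^sub>R g t"] conjI allI prod_closure.intros) auto
next
  case (plus u v)
  then obtain u' v' where "\<forall>t. (u has_vector_derivative u' t) (at t)" "prod_closure u'"
    "\<forall>t. (v has_vector_derivative v' t) (at t)" "prod_closure v'" by blast
  then show ?case
    by (intro exI[of _ "\<lambda>t. u' t + v' t"] conjI allI prod_closure.intros has_vector_derivative_add) auto
qed

lemma smooth_scaleR: "smooth f \<Longrightarrow> smooth g \<Longrightarrow> smooth (\<lambda>t. (f t :: real) *\<^sub>R g t)"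
  by (rule smooth_coinduct[where Q = prod_closure, OF prod_closure_deriv]) (auto intro: prod_closure.prod)

lemma smooth_affine:
  fixes f :: "real \<Rightarrow> real"
  assumes "smooth f" shows "smooth (\<lambda>t. f (\<alpha> * t + \<beta>))"
proof (rule smooth_coinduct[where Q = "\<lambda>h. \<exists>r f. h = (\<lambda>t. r * f (\<alpha> * t + \<beta>)) \<and> smooth f"])
  fix h :: "real \<Rightarrow> real" assume "\<exists>r f. h = (\<lambda>t. r * f (\<alpha> * t + \<beta>)) \<and> smooth f"
  then obtain r f where h: "h = (\<lambda>t. r * f (\<alpha> * t + \<beta>))" "smooth f" by blast
  have f: "(f has_real_derivative dvec f t) (at t)" for t
    using smoothD(1)[OF h(2)] by (simp add: has_real_derivative_iff_has_vector_derivative)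
  have "(h has_vector_derivative (r * \<alpha>) * dvec f (\<alpha> * t + \<beta>)) (at t)" for t
    unfolding h has_real_derivative_iff_has_vector_derivative[symmetric]
    by (auto intro!: derivative_eq_intros DERIV_chain2[OF f])
  then show "\<exists>f'. (\<forall>t. (h has_vector_derivative f' t) (at t)) \<and> (\<exists>r f. f' = (\<lambda>t. r * f (\<alpha> * t + \<beta>)) \<and> smooth f)"
    using smoothD(2)[OF h(2)] by (intro exI[of _ "\<lambda>t. (r * \<alpha>) * dvec f (\<alpha> * t + \<beta>)"] conjI allI) auto
next
  show "\<exists>r fa. (\<lambda>t. f (\<alpha> * t + \<beta>)) = (\<lambda>t. r * fa (\<alpha> * t + \<beta>)) \<and> smooth fa"
    using assms by (intro exI[of _ 1] exI[of _ f]) simp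
qed

definition flat :: "nat \<Rightarrow> real \<Rightarrow> real" where
  "flat k x = (if x > 0 then (1/x)^k * exp (- (1/x)) else 0)"

lemma flat_deriv: "(flat k has_real_derivative flat (k + 2) x - real k * flat (k + 1) x) (at x)"
proof -
  consider "x > 0" | "x < 0" | "x = 0" by linarith
  then show ?thesis
  proof cases
    case 1
    define u where "u = 1/x"
    have i: "((\<lambda>x. 1/x) has_real_derivative - u\<^sup>2) (at x)"
      using 1 by (auto intro!: derivative_eq_intros simp: u_def power2_eq_square)
    have "((\<lambda>x. (1/x)^k * exp (- (1/x))) has_real_derivative
        (real k * (- u\<^sup>2 * u^(k - Suc 0))) * exp (- u) + (exp (- u) * (- (- u\<^sup>2))) * u^k) (at x)"
      using DERIV_mult[OF DERIV_power[OF i, of k] DERIV_fun_exp[OF DERIV_minus[OF i]]] by (simp add: u_def)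
    also have "(real k * (- u\<^sup>2 * u^(k - Suc 0))) * exp (- u) + (exp (- u) * (- (- u\<^sup>2))) * u^k =
        flat (k + 2) x - real k * flat (k + 1) x"
      using 1 by (cases k) (simp_all add: flat_def u_def[symmetric] power2_eq_square algebra_simps)
    finally have "((\<lambda>x. (1/x)^k * exp (- (1/x))) has_real_derivative flat (k + 2) x - real k * flat (k + 1) x) (at x)" .
    then show ?thesis
      by (rule DERIV_cong_ev[OF refl _ refl, THEN iffD1, rotated])
         (use eventually_nhds_in_open[of "{0<..}" x] 1 in \<open>auto simp: flat_def elim!: eventually_mono\<close>)
  next
    case 2
    have "((\<lambda>x. 0) has_real_derivative flat (k + 2) x - real k * flat (k + 1) x) (at x)"
      using 2 by (simp add: flat_def)
    then show ?thesis
      by (rule DERIV_cong_ev[OF refl _ refl, THEN iffD1, rotated])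
         (use eventually_nhds_in_open[of "{..<0}" x] 2 in \<open>auto simp: flat_def elim!: eventually_mono\<close>)
  next
    case 3
    have "((\<lambda>h. flat k h / h) \<longlongrightarrow> 0) (at 0)"
    proof (rule filterlim_split_at)
      show "((\<lambda>h. flat k h / h) \<longlongrightarrow> 0) (at_left 0)"
        by (rule tendsto_eventually) (auto simp: eventually_at_left_field flat_def intro!: exI[of _ "-1"])
      have "((\<lambda>h. (inverse h)^(k+1) / exp (inverse h)) \<longlongrightarrow> (0::real)) (at_right 0)"
        by (rule filterlim_compose[OF tendsto_power_div_exp_0 filterlim_inverse_at_top_right])
      then show "((\<lambda>h. flat k h / h) \<longlongrightarrow> 0) (at_right 0)"
        by (rule Lim_transform_eventually)
           (auto simp: eventually_at_right_field flat_def field_simps exp_minus intro!: exI[of _ 1])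
    qed
    then show ?thesis using 3 by (simp add: DERIV_def flat_def)
  qed
qed

inductive flat_span :: "(real \<Rightarrow> real) \<Rightarrow> bool" where
  base: "flat_span (\<lambda>x. c * flat k x)"
| plus: "flat_span u \<Longrightarrow> flat_span v \<Longrightarrow> flat_span (\<lambda>x. u x + v x)"

lemma flat_span_deriv:
  "flat_span u \<Longrightarrow> \<exists>u'. (\<forall>t. (u has_vector_derivative u' t) (at t)) \<and> flat_span u'"
proof (induction rule: flat_span.induct)
  case (base c k)
  have "((\<lambda>x. c * flat k x) has_vector_derivative c * flat (k + 2) t + (- (c * real k)) * flat (k + 1) t) (at t)" for t
    unfolding has_real_derivative_iff_has_vector_derivative[symmetric]
    by (rule derivative_eq_intros flat_deriv refl)+ (simp add: algebra_simps)
  then show ?case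
    by (intro exI[of _ "\<lambda>t. c * flat (k + 2) t + (- (c * real k)) * flat (k + 1) t"] conjI allI flat_span.intros) auto
next
  case (plus u v)
  then obtain u' v' where "\<forall>t. (u has_vector_derivative u' t) (at t)" "flat_span u'"
    "\<forall>t. (v has_vector_derivative v' t) (at t)" "flat_span v'" by blast
  then show ?case
    by (intro exI[of _ "\<lambda>t. u' t + v' t"] conjI allI flat_span.intros has_vector_derivative_add) auto
qed

lemma smooth_flat: "smooth (flat 0)"
  using smooth_coinduct[where Q = flat_span, OF flat_span_deriv flat_span.base[of 1 0]] by simp

definition bump :: "real \<Rightarrow> real \<Rightarrow> nat \<Rightarrow> real \<Rightarrow> real" where
  "bump a b n t = flat 0 (real (Suc n) * t + - (real (Suc n) * a)) * flat 0 (- real (Suc n) * t + real (Suc n) * b)"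

lemma smooth_bump: "smooth (bump a b n)"
  using smooth_scaleR[OF smooth_affine[OF smooth_flat] smooth_affine[OF smooth_flat],
      of "real (Suc n)" "- (real (Suc n) * a)" "- real (Suc n)" "real (Suc n) * b"]
  by (simp add: bump_def[abs_def])

lemma flat_bounds: "0 \<le> flat 0 x" "flat 0 x \<le> 1" by (auto simp: flat_def)

lemma bump_bounds: "0 \<le> bump a b n t" "bump a b n t \<le> 1"
  unfolding bump_def using flat_bounds by (auto intro: mult_le_one)

lemma bump_support:
  assumes "t \<notin> {a<..<b}" shows "bump a b n t = 0"
proof -
  have "real (Suc n) * t + - (real (Suc n) * a) = real (Suc n) * (t - a)" by (simp add: algebra_simps)
  moreover have "- real (Suc n) * t + real (Suc n) * b = real (Suc n) * (b - t)" by (simp add: algebra_simps)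
  moreover have "real (Suc n) * (t - a) \<le> 0 \<or> real (Suc n) * (b - t) \<le> 0"
    using assms by (auto simp: mult_le_0_iff not_less)
  ultimately show ?thesis unfolding bump_def by (auto simp: flat_def)
qed

lemma bump_lim:
  assumes "t \<in> {a<..<b}" shows "(\<lambda>n. bump a b n t) \<longlonglongrightarrow> 1"
proof -
  have *: "(\<lambda>n. flat 0 (real (Suc n) * x)) \<longlonglongrightarrow> 1" if "x > 0" for x
  proof -
    have "(\<lambda>n. exp (- (1 / real (Suc n) * (1 / x)))) \<longlonglongrightarrow> exp (- (0 * (1/x)))"
      by (intro tendsto_intros LIMSEQ_Suc lim_1_over_n)
    moreover have "flat 0 (real (Suc n) * x) = exp (- (1 / real (Suc n) * (1 / x)))" for n
      using that by (simp add: flat_def)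
    ultimately show ?thesis by simp
  qed
  have "real (Suc n) * t + - (real (Suc n) * a) = real (Suc n) * (t - a)" for n by (simp add: algebra_simps)
  moreover have "- real (Suc n) * t + real (Suc n) * b = real (Suc n) * (b - t)" for n by (simp add: algebra_simps)
  ultimately show ?thesis
    using tendsto_mult[OF *[of "t - a"] *[of "b - t"]] assms unfolding bump_def by simp
qed

lemma test_fnI:
  assumes "smooth f" "\<And>t. t \<notin> {a..b} \<Longrightarrow> f t = 0" shows "test_fn f"
  unfolding test_fn_def
proof
  show "\<forall>k t. (dvec ^^ k) f differentiable (at t)" using assms(1) by (simp add: smooth_def)
  have "{t. f t \<noteq> 0} \<subseteq> {a..b}" using assms(2) by blast
  then have "bounded {t. f t \<noteq> 0}" using bounded_subset bounded_closed_interval by blast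
  then show "compact (closure {t. f t \<noteq> 0})" by (simp add: compact_closure)
qed

lemma test_fnD:
  assumes "test_fn f"
  obtains a b where "a < b" "\<And>t. t \<notin> {a..b} \<Longrightarrow> f t = 0" "\<And>t. t \<notin> {a..b} \<Longrightarrow> dvec f t = 0"
proof -
  have "bounded {t. f t \<noteq> 0}" using assms compact_closure by (auto simp: test_fn_def)
  then obtain B where B: "B > 0" "\<And>t. f t \<noteq> 0 \<Longrightarrow> \<bar>t\<bar> \<le> B" unfolding bounded_pos by auto
  have z: "f t = 0" if "t \<notin> {-B..B}" for t using B(2)[of t] that by fastforce
  have "dvec f t = 0" if "t \<notin> {-B..B}" for t
  proof -
    have "((\<lambda>t. 0) has_vector_derivative 0) (at t)" by (rule has_vector_derivative_const)
    moreover have "open (- {-B..B})" by auto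
    ultimately have "(f has_vector_derivative 0) (at t)"
      using that z by (rule_tac has_vector_derivative_transform_within_open[of _ _ _ "- {-B..B}"]) auto
    then show ?thesis unfolding dvec_def by (rule vector_derivative_at)
  qed
  with z B(1) show ?thesis by (intro that[of "-B" B]) auto
qed

lemma test_fn_smooth: "test_fn f \<Longrightarrow> smooth f" by (simp add: test_fn_def smooth_def)

lemma test_fn_dvec: "test_fn f \<Longrightarrow> test_fn (dvec f)"
  by (metis test_fnD test_fnI smoothD(2) test_fn_smooth)

lemma test_fn_add:
  assumes "test_fn f" "test_fn g" shows "test_fn (\<lambda>t. f t + g t)"
proof -
  obtain a b where 1: "\<And>t. t \<notin> {a..b} \<Longrightarrow> f t = 0" using test_fnD[OF assms(1)] by metis
  obtain c d where 2: "\<And>t. t \<notin> {c..d} \<Longrightarrow> g t = 0" using test_fnD[OF assms(2)] by metis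
  show ?thesis
  proof (rule test_fnI[of _ "min a c" "max b d"])
    show "smooth (\<lambda>t. f t + g t)" by (intro smooth_add test_fn_smooth assms)
    fix t assume "t \<notin> {min a c..max b d}"
    then have "t \<notin> {a..b}" "t \<notin> {c..d}" by auto
    then show "f t + g t = 0" by (simp add: 1 2)
  qed
qed

lemma test_fn_scaleR:
  assumes "test_fn (f :: real \<Rightarrow> real)" "smooth g" shows "test_fn (\<lambda>t. f t *\<^sub>R g t)"
proof -
  obtain a b where 1: "\<And>t. t \<notin> {a..b} \<Longrightarrow> f t = 0" using test_fnD[OF assms(1)] by metis
  show ?thesis
    by (rule test_fnI[of _ a b, OF smooth_scaleR[OF test_fn_smooth[OF assms(1)] assms(2)]]) (simp add: 1)
qed

lemma continuous_bounded_support: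
  fixes f :: "real \<Rightarrow> 'a::real_normed_vector"
  assumes "continuous_on UNIV f" "\<And>t. t \<notin> {a..b} \<Longrightarrow> f t = 0"
  obtains B where "B > 0" "\<And>t. norm (f t) \<le> B"
proof -
  have "compact (f ` {a..b})" by (intro compact_continuous_image continuous_on_subset[OF assms(1)]) auto
  then obtain B where B: "B > 0" "\<And>t. t \<in> {a..b} \<Longrightarrow> norm (f t) \<le> B"
    using compact_imp_bounded bounded_pos by (metis imageI)
  then show ?thesis using assms(2) by (intro that[of B]) (metis norm_zero less_imp_le)+
qed

lemma L2_continuous_support:
  fixes f :: "real \<Rightarrow> 'a::chilbert"
  assumes "continuous_on UNIV f" "\<And>t. t \<notin> {a..b} \<Longrightarrow> f t = 0"
  shows "L2 f"
proof -
  obtain B where "\<And>t. norm (f t) \<le> B" using continuous_bounded_support[OF assms] by metis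
  then show ?thesis
    by (intro L2_bounded_support[of f B a b] strongly_measurable_continuous assms) (use assms(2) in auto)
qed

lemma test_fn_L2w:
  fixes f :: "real \<Rightarrow> 'a::chilbert"
  assumes "test_fn f" shows "f \<in> L2w \<rho>"
proof -
  obtain a b where 1: "\<And>t. t \<notin> {a..b} \<Longrightarrow> f t = 0" using test_fnD[OF assms] by metis
  show ?thesis unfolding L2w_iff
    by (rule L2_continuous_support[of _ a b])
       (auto intro!: continuous_intros smoothD(3)[OF test_fn_smooth[OF assms]] simp: 1)
qed

lemma l2_dominated_lim:
  fixes f :: "nat \<Rightarrow> real \<Rightarrow> 'a::chilbert"
  assumes f: "\<And>n. L2 (f n)" and h: "L2 h"
    and lim: "AE t in lebesgue. (\<lambda>n. f n t) \<longlonglongrightarrow> h t"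
    and bd: "\<And>n t. norm (f n t) \<le> g t" and g: "integrable lebesgue (\<lambda>t. (g t)\<^sup>2)"
  shows "(\<lambda>n. abs_l2 (f n)) \<longlonglongrightarrow> abs_l2 h"
proof -
  have "(\<lambda>n. LINT t|lebesgue. (norm (f n t - h t))\<^sup>2) \<longlonglongrightarrow> (LINT t::real|lebesgue. (0::real))"
  proof (rule Bochner_Integration.integral_dominated_convergence[where s = "\<lambda>n t. (norm (f n t - h t))\<^sup>2" and w = "\<lambda>t. 4 * (g t)\<^sup>2"
        and f = "\<lambda>t. 0" and M = lebesgue])
    show "AE t in lebesgue. (\<lambda>n. (norm (f n t - h t))\<^sup>2) \<longlonglongrightarrow> 0"
      using lim
    proof eventually_elim
      case (elim t)
      have "(\<lambda>n. (norm (f n t - h t))\<^sup>2) \<longlonglongrightarrow> (norm (h t - h t))\<^sup>2" by (intro tendsto_intros elim)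
      then show ?case by simp
    qed
    show "AE t in lebesgue. norm ((norm (f n t - h t))\<^sup>2) \<le> 4 * (g t)\<^sup>2" for n
      using lim
    proof eventually_elim
      case (elim t)
      have "norm (h t) \<le> g t"
        by (rule LIMSEQ_le_const2[OF tendsto_norm[OF elim]]) (use bd in auto)
      then have "norm (f n t - h t) \<le> 2 * g t" using bd[of n t] norm_triangle_ineq4[of "f n t" "h t"] by linarith
      then have "(norm (f n t - h t))\<^sup>2 \<le> (2 * g t)\<^sup>2" by (intro power_mono) auto
      then show ?case by (simp add: power_mult_distrib)
    qed
    show "(\<lambda>t. (norm (f n t - h t))\<^sup>2) \<in> borel_measurable lebesgue" for n
      using L2_diff[OF f h, of n] by (auto simp: L2_def)
  qed (use g in auto)
  then have "(\<lambda>n. sqrt (LINT t|lebesgue. (norm (f n t - h t))\<^sup>2)) \<longlonglongrightarrow> sqrt 0" by (intro tendsto_real_sqrt) simp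
  then have "(\<lambda>n. norm (abs_l2 (f n) - abs_l2 h)) \<longlonglongrightarrow> 0"
    by (simp add: abs_l2_diff[OF f h] norm_abs_l2[OF L2_diff[OF f h]])
  then show ?thesis using LIM_zero_cancel tendsto_norm_zero_iff by blast
qed

lemma integral_eq_zero_on:
  fixes f :: "real \<Rightarrow> real"
  assumes "\<And>t. t \<in> S \<Longrightarrow> f t = 0" shows "integral S f = 0"
  using integral_cong[of S f "\<lambda>t. 0"] assms by simp

subsection \<open>The resolvent of the derivative\<close>

definition rker :: "real \<Rightarrow> real \<Rightarrow> real \<Rightarrow> real" where
  "rker \<epsilon> \<rho> s = (1/\<epsilon>) * exp (- (1/\<epsilon> + \<rho>) * s)"

definition Rop :: "real \<Rightarrow> real \<Rightarrow> 'a::chilbert l2 \<Rightarrow> 'a l2" where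
  "Rop \<epsilon> \<rho> = convop (wker (rker \<epsilon> \<rho>) (\<lambda>s x. x))"

lemma exp_decay_integral:
  assumes "a > 0"
  shows "set_integrable lebesgue {0..} (\<lambda>s::real. exp (- a * s))" "(LINT s:{0..}|lebesgue. exp (- a * s)) = 1 / a"
proof -
  have h: "((\<lambda>s. exp (- a * s)) has_integral 1 / a) {0..}"
    using has_integral_exp_minus_to_infinity[OF assms, of 0] by simp
  then show 1: "set_integrable lebesgue {0..} (\<lambda>s. exp (- a * s))"
    by (intro nonnegative_absolutely_integrable_1) (auto simp: integrable_on_def)
  show "(LINT s:{0..}|lebesgue. exp (- a * s)) = 1 / a"
    using set_lebesgue_integral_eq_integral(2)[OF 1] h by (simp add: integral_unique)
qed

lemma pair_integrable_dominated:
  fixes F :: "real \<times> real \<Rightarrow> complex"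
  assumes m [measurable]: "F \<in> borel_measurable (lborel \<Otimes>\<^sub>M lborel)" and a: "integrable lborel a" and b: "integrable lborel b"
    and bd: "\<And>t s. norm (F (t, s)) \<le> a t * b s"
  shows "integrable (lborel \<Otimes>\<^sub>M lborel) F"
proof (rule lborel_pair.Fubini_integrable[OF m])
  have i: "integrable lborel (\<lambda>s. F (t, s))" for t
    by (rule bochner_bound[OF integrable_mult_right[OF b, of "a t"]])
       (use bd abs_ge_self order_trans in \<open>auto intro!: AE_I2 measurable_compose[OF _ m] simp del: abs_mult, blast?\<close>)
  then show "AE t in lborel. integrable lborel (\<lambda>s. F (t, s))" by simp
  show "integrable lborel (\<lambda>t. LINT s|lborel. norm (F (t, s)))"
  proof (rule bochner_bound)
    show "integrable lborel (\<lambda>t. a t * (LINT s|lborel. b s))" using a by simp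
    show "(\<lambda>t. LINT s|lborel. norm (F (t, s))) \<in> borel_measurable lborel" by measurable
    show "AE t in lborel. norm (LINT s|lborel. norm (F (t, s))) \<le> norm (a t * (LINT s|lborel. b s))"
    proof (rule AE_I2)
      fix t
      have "(LINT s|lborel. norm (F (t, s))) \<le> (LINT s|lborel. a t * b s)"
        by (intro integral_mono integrable_norm i integrable_mult_right b bd)
      also have "\<dots> = a t * (LINT s|lborel. b s)" by simp
      finally show "norm (LINT s|lborel. norm (F (t, s))) \<le> norm (a t * (LINT s|lborel. b s))"
        by (simp add: abs_mult) (metis abs_ge_self abs_mult order_trans)
    qed
  qed
qed

context
  fixes \<epsilon> \<rho> :: real
  assumes eps: "\<epsilon> > 0" "1 + \<epsilon> * \<rho> > 0"
begin

lemma rate_pos: "1/\<epsilon> + \<rho> > 0"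
  using eps by (simp add: field_simps)

lemma adm_rker: "adm (wker (rker \<epsilon> \<rho>) (\<lambda>s x. x :: 'a::chilbert))"
  and kint_rker: "kint (wker (rker \<epsilon> \<rho>) (\<lambda>s x. x :: 'a::chilbert)) \<le> 1 / (1 + \<epsilon> * \<rho>)"
proof -
  have m: "rker \<epsilon> \<rho> \<in> borel_measurable lebesgue"
    unfolding rker_def by (intro measurable_lebesgue_continuous continuous_intros)
  have i: "set_integrable lebesgue {0..} (rker \<epsilon> \<rho>)"
    unfolding rker_def by (intro set_integrable_mult_right exp_decay_integral rate_pos)
  show "adm (wker (rker \<epsilon> \<rho>) (\<lambda>s x. x :: 'a))" by (rule adm_scalar(1)[OF m i])
  have "(LINT s:{0..}|lebesgue. \<bar>rker \<epsilon> \<rho> s\<bar>) = (LINT s:{0..}|lebesgue. (1/\<epsilon>) * exp (- (1/\<epsilon> + \<rho>) * s))"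
    using eps by (simp add: rker_def)
  also have "\<dots> = (1/\<epsilon>) * (1 / (1/\<epsilon> + \<rho>))"
    unfolding set_integral_mult_right exp_decay_integral(2)[OF rate_pos] ..
  also have "\<dots> = 1 / (1 + \<epsilon> * \<rho>)" using eps rate_pos by (simp add: field_simps)
  finally show "kint (wker (rker \<epsilon> \<rho>) (\<lambda>s x. x :: 'a)) \<le> 1 / (1 + \<epsilon> * \<rho>)"
    using adm_scalar(2)[OF m i, where 'a='a] by simp
qed

lemma Rop_clinear: "bounded_clinear_op (Rop \<epsilon> \<rho> :: 'a::chilbert l2 \<Rightarrow> 'a l2)"
  unfolding Rop_def by (rule convop_clinear[OF adm_rker])

lemma norm_Rop_le: "norm (Rop \<epsilon> \<rho> (u :: 'a::chilbert l2)) \<le> 1 / (1 + \<epsilon> * \<rho>) * norm u"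
  using norm_convop_le[OF adm_rker, of u] mult_right_mono[OF kint_rker[where 'a='a] norm_ge_zero[of u]]
  by (simp add: Rop_def)

lemma scalar_resolvent:
  fixes p p' :: "real \<Rightarrow> complex"
  assumes d: "\<And>t. (p has_vector_derivative p' t) (at t)" and c: "continuous_on UNIV p'"
    and z: "\<And>t. t \<notin> {a..b} \<Longrightarrow> p t = 0" "\<And>t. t \<notin> {a..b} \<Longrightarrow> p' t = 0"
  shows "(LINT s|lborel. indicat_real {0..} s *\<^sub>R (((1/\<epsilon>) * exp (- s / \<epsilon>)) *\<^sub>R (p (t - s) + \<epsilon> *\<^sub>R p' (t - s)))) = p t"
proof -
  have cp: "continuous_on UNIV p"
    using d by (auto simp: continuous_on_eq_continuous_within intro: has_vector_derivative_continuous)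
  define B where "B = max 0 (t - a) + 1"
  have B: "0 \<le> B" "t - B < a" by (auto simp: B_def)
  define f where "f s = ((1/\<epsilon>) * exp (- s / \<epsilon>)) *\<^sub>R (p (t - s) + \<epsilon> *\<^sub>R p' (t - s))" for s
  have "(LINT s|lborel. indicat_real {0..} s *\<^sub>R f s) = (LINT s|lborel. indicat_real {0..B} s *\<^sub>R f s)"
  proof (rule bochner_cong)
    fix s show "indicat_real {0..} s *\<^sub>R f s = indicat_real {0..B} s *\<^sub>R f s"
      using z B by (cases "s \<le> B") (auto simp: f_def indicator_def)
  qed
  also have "\<dots> = (- exp (- B / \<epsilon>) *\<^sub>R p (t - B)) - (- exp (- 0 / \<epsilon>) *\<^sub>R p (t - 0))"
  proof (rule integral_FTC_atLeastAtMost[of 0 B "\<lambda>s. - exp (- s / \<epsilon>) *\<^sub>R p (t - s)" f])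
    show "0 \<le> B" by fact
    fix s
    have p: "((\<lambda>s. p (t - s)) has_vector_derivative - p' (t - s)) (at s)"
      using vector_diff_chain_at[of "\<lambda>s. t - s" "-1" s p "p' (t - s)"] d
        has_vector_derivative_diff[OF has_vector_derivative_const[of t] has_vector_derivative_id[of "at s"]]
      by (simp add: comp_def)
    have e: "((\<lambda>s. - exp (- s / \<epsilon>)) has_real_derivative (1/\<epsilon>) * exp (- s / \<epsilon>)) (at s)"
      using eps by (auto intro!: derivative_eq_intros)
    have "((\<lambda>s. - exp (- s / \<epsilon>) *\<^sub>R p (t - s)) has_vector_derivative
        - exp (- s / \<epsilon>) *\<^sub>R (- p' (t - s)) + ((1/\<epsilon>) * exp (- s / \<epsilon>)) *\<^sub>R p (t - s)) (at s)"
      by (rule has_vector_derivative_scaleR[OF e p])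
    moreover have "- exp (- s / \<epsilon>) *\<^sub>R (- p' (t - s)) + ((1/\<epsilon>) * exp (- s / \<epsilon>)) *\<^sub>R p (t - s) = f s"
      using eps by (simp add: f_def scaleR_add_right)
    ultimately show "((\<lambda>s. - exp (- s / \<epsilon>) *\<^sub>R p (t - s)) has_vector_derivative f s) (at s within {0..B})"
      by (simp add: has_vector_derivative_at_within)
  next
    have "continuous_on UNIV (\<lambda>s. p (t - s))" "continuous_on UNIV (\<lambda>s. p' (t - s))"
      by (intro continuous_on_compose2[OF cp] continuous_on_compose2[OF c] continuous_intros; simp)+
    then have "continuous_on UNIV f" unfolding f_def using eps by (intro continuous_intros) auto
    then show "continuous_on {0..B} f" by (rule continuous_on_subset) auto
  qed
  also have "\<dots> = p t" using z(1)[of "t - B"] B by simp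
  finally show ?thesis by (simp add: f_def)
qed

lemma Rop_test_fn:
  fixes \<phi> :: "real \<Rightarrow> 'a::chilbert"
  assumes t: "test_fn \<phi>"
  shows "Rop \<epsilon> \<rho> (emb \<rho> \<phi> + \<epsilon> *\<^sub>R emb \<rho> (dvec \<phi>)) = emb \<rho> \<phi>"
proof (rule l2_eq_boxI)
  fix c d :: real and y :: 'a
  obtain a b where ab: "a < b" "\<And>t. t \<notin> {a..b} \<Longrightarrow> \<phi> t = 0" "\<And>t. t \<notin> {a..b} \<Longrightarrow> dvec \<phi> t = 0"
    using test_fnD[OF t] by metis
  define p where "p t = cinner (\<phi> t) y" for t
  define p' where "p' t = cinner (dvec \<phi> t) y" for t
  have pd: "(p has_vector_derivative p' t) (at t)" for t
    unfolding p_def p'_def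
    using bounded_linear.has_vector_derivative[OF cinner.bounded_linear_left smoothD(1)[OF test_fn_smooth[OF t]]] .
  have pc: "continuous_on UNIV p'" "continuous_on UNIV p"
    unfolding p_def p'_def
    by (intro cinner.continuous_on continuous_on_const smoothD(3) smoothD(2) test_fn_smooth t)+
  have pz: "p t = 0" "p' t = 0" if "t \<notin> {a..b}" for t using ab that by (auto simp: p_def p'_def)
  define z where "z t = \<phi> t + \<epsilon> *\<^sub>R dvec \<phi> t" for t
  have zL: "z \<in> L2w \<rho>" unfolding z_def by (intro L2w_add L2w_scaleR test_fn_L2w test_fn_dvec t)
  have ze: "emb \<rho> \<phi> + \<epsilon> *\<^sub>R emb \<rho> (dvec \<phi>) = emb \<rho> z"
    unfolding z_def using t by (simp add: emb_add emb_scaleR L2w_scaleR test_fn_L2w test_fn_dvec)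
  define q where "q t = p t + \<epsilon> *\<^sub>R p' t" for t
  have qc: "continuous_on UNIV q" unfolding q_def by (intro continuous_intros pc)
  obtain M where M: "M > 0" "\<And>t. norm (q t) \<le> M"
    by (rule continuous_bounded_support[OF qc, of a b]) (auto simp: q_def pz)
  define F where "F = (\<lambda>(t, s). indicat_real {c..<d} t *\<^sub>R (exp (- \<rho> * t) *\<^sub>R (indicat_real {0..} s *\<^sub>R (((1/\<epsilon>) * exp (- s / \<epsilon>)) *\<^sub>R q (t - s)))))"
  have qm [measurable]: "q \<in> borel_measurable borel" by (rule borel_measurable_continuous_onI[OF qc])
  have Fm [measurable]: "F \<in> borel_measurable (lborel \<Otimes>\<^sub>M lborel)" unfolding F_def by measurable
  have Fi: "integrable (lborel \<Otimes>\<^sub>M lborel) F"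
  proof (rule pair_integrable_dominated[OF Fm])
    show "integrable lborel (\<lambda>t. exp (\<bar>- \<rho>\<bar> * (\<bar>c\<bar> + \<bar>d\<bar>)) * indicat_real {c..<d} t)"
      by (intro integrable_mult_right integrable_real_indicator) (use emeasure_bounded_finite[OF bounded_Ico[of c d]] in auto)
    have "integrable lebesgue (\<lambda>s. indicat_real {0..} s *\<^sub>R exp (- (1/\<epsilon>) * s))"
      using exp_decay_integral(1)[of "1/\<epsilon>"] eps by (simp add: set_integrable_def)
    then have "integrable lborel (\<lambda>s. indicat_real {0..} s *\<^sub>R exp (- (1/\<epsilon>) * s))"
      by (subst (asm) integrable_completion) auto
    from integrable_mult_right[OF this, of "M / \<epsilon>"]
    show "integrable lborel (\<lambda>s. (M / \<epsilon>) * (indicat_real {0..} s * exp (- s / \<epsilon>)))" by simp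
    fix t s
    have iA: "indicat_real {c..<d} t * exp (- \<rho> * t) \<le> exp (\<bar>- \<rho>\<bar> * (\<bar>c\<bar> + \<bar>d\<bar>)) * indicat_real {c..<d} t"
      using exp_bound_on[of t c d "- \<rho>"] by (auto split: split_indicator)
    have "norm (F (t, s)) = (indicat_real {c..<d} t * exp (- \<rho> * t)) * ((indicat_real {0..} s * exp (- s / \<epsilon>) / \<epsilon>) * norm (q (t - s)))"
      using eps by (simp add: F_def abs_mult)
    also have "\<dots> \<le> (exp (\<bar>- \<rho>\<bar> * (\<bar>c\<bar> + \<bar>d\<bar>)) * indicat_real {c..<d} t) * ((indicat_real {0..} s * exp (- s / \<epsilon>) / \<epsilon>) * M)"
      by (rule mult_mono[OF iA mult_left_mono[OF M(2)]]) (use eps in auto)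
    finally show "norm (F (t, s)) \<le> (exp (\<bar>- \<rho>\<bar> * (\<bar>c\<bar> + \<bar>d\<bar>)) * indicat_real {c..<d} t) * ((M / \<epsilon>) * (indicat_real {0..} s * exp (- s / \<epsilon>)))"
      by (simp add: field_simps)
  qed
  have sh: "cinner (shiftop s (emb \<rho> z)) (box_l2 c d y) =
      (LINT t|lborel. indicat_real {c..<d} t *\<^sub>R (exp (- \<rho> * (t - s)) *\<^sub>R q (t - s)))" for s
  proof -
    have "cinner (shiftop s (emb \<rho> z)) (box_l2 c d y) = (LINT t|lebesgue. cinner (exp (- \<rho> * (t - s)) *\<^sub>R z (t - s)) (box_fn c d y t))"
      unfolding emb_def shiftop_abs[OF zL[unfolded L2w_iff]] box_l2_def
      by (rule cinner_abs_l2[OF L2_shift[OF zL[unfolded L2w_iff]] L2_box])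
    also have "\<dots> = (LINT t|lebesgue. indicat_real {c..<d} t *\<^sub>R (exp (- \<rho> * (t - s)) *\<^sub>R q (t - s)))"
      by (rule bochner_cong)
         (simp add: box_fn_def z_def q_def p_def p'_def cinner_simps scaleR_conv_of_real algebra_simps)
    also have "\<dots> = (LINT t|lborel. indicat_real {c..<d} t *\<^sub>R (exp (- \<rho> * (t - s)) *\<^sub>R q (t - s)))"
      by (rule integral_completion) measurable
    finally show ?thesis .
  qed
  have "cinner (Rop \<epsilon> \<rho> (emb \<rho> z)) (box_l2 c d y) =
      (LINT s:{0..}|lebesgue. cinner (ptop (wker (rker \<epsilon> \<rho>) (\<lambda>s x. x) s) (shiftop s (emb \<rho> z))) (box_l2 c d y))"
    unfolding Rop_def by (rule cinner_convop[OF adm_rker])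
  also have "\<dots> = (LINT s|lebesgue. (LINT t|lborel. F (t, s)))"
    unfolding set_lebesgue_integral_def
  proof (rule bochner_cong)
    fix s
    have e: "rker \<epsilon> \<rho> s * exp (- \<rho> * (t - s)) = exp (- \<rho> * t) * ((1/\<epsilon>) * exp (- s / \<epsilon>))" for t
      by (simp add: rker_def exp_add[symmetric] algebra_simps)
    have "indicat_real {0..} s *\<^sub>R cinner (ptop (wker (rker \<epsilon> \<rho>) (\<lambda>s x. x) s) (shiftop s (emb \<rho> z))) (box_l2 c d y) =
        (indicat_real {0..} s * rker \<epsilon> \<rho> s) *\<^sub>R (LINT t|lborel. indicat_real {c..<d} t *\<^sub>R (exp (- \<rho> * (t - s)) *\<^sub>R q (t - s)))"
      by (simp add: wker_def ptop_scaleR cinner_scaleR_left sh scaleR_conv_of_real)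
    also have "\<dots> = (LINT t|lborel. (indicat_real {0..} s * rker \<epsilon> \<rho> s) *\<^sub>R (indicat_real {c..<d} t *\<^sub>R (exp (- \<rho> * (t - s)) *\<^sub>R q (t - s))))"
      by (rule integral_scaleR_right[symmetric])
    also have "\<dots> = (LINT t|lborel. F (t, s))"
    proof (rule bochner_cong)
      fix t
      have "(indicat_real {0..} s * rker \<epsilon> \<rho> s) *\<^sub>R (indicat_real {c..<d} t *\<^sub>R (exp (- \<rho> * (t - s)) *\<^sub>R q (t - s)))
          = (indicat_real {0..} s * indicat_real {c..<d} t * (rker \<epsilon> \<rho> s * exp (- \<rho> * (t - s)))) *\<^sub>R q (t - s)"
        by (simp add: mult_ac)
      then show "(indicat_real {0..} s * rker \<epsilon> \<rho> s) *\<^sub>R (indicat_real {c..<d} t *\<^sub>R (exp (- \<rho> * (t - s)) *\<^sub>R q (t - s))) = F (t, s)"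
        unfolding e by (simp add: F_def mult_ac)
    qed
    finally show "indicat_real {0..} s *\<^sub>R cinner (ptop (wker (rker \<epsilon> \<rho>) (\<lambda>s x. x) s) (shiftop s (emb \<rho> z))) (box_l2 c d y) = (LINT t|lborel. F (t, s))" .
  qed
  also have "\<dots> = (LINT s|lborel. (LINT t|lborel. F (t, s)))"
    by (rule integral_completion) measurable
  also have "\<dots> = (LINT t|lborel. (LINT s|lborel. F (t, s)))"
    using lborel_pair.Fubini_integral[of "\<lambda>t s. F (t, s)"] Fi by simp
  also have "\<dots> = (LINT t|lborel. indicat_real {c..<d} t *\<^sub>R (exp (- \<rho> * t) *\<^sub>R p t))"
  proof (rule bochner_cong)
    fix t
    have "(LINT s|lborel. F (t, s)) = indicat_real {c..<d} t *\<^sub>R (exp (- \<rho> * t) *\<^sub>R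
        (LINT s|lborel. indicat_real {0..} s *\<^sub>R (((1/\<epsilon>) * exp (- s / \<epsilon>)) *\<^sub>R (p (t - s) + \<epsilon> *\<^sub>R p' (t - s)))))"
      unfolding F_def prod.case integral_scaleR_right q_def ..
    also have "(LINT s|lborel. indicat_real {0..} s *\<^sub>R (((1/\<epsilon>) * exp (- s / \<epsilon>)) *\<^sub>R (p (t - s) + \<epsilon> *\<^sub>R p' (t - s)))) = p t"
      by (rule scalar_resolvent[where a = a and b = b, OF pd pc(1)]) (use pz in blast)+
    finally show "(LINT s|lborel. F (t, s)) = indicat_real {c..<d} t *\<^sub>R (exp (- \<rho> * t) *\<^sub>R p t)" .
  qed
  also have "\<dots> = (LINT t|lebesgue. indicat_real {c..<d} t *\<^sub>R (exp (- \<rho> * t) *\<^sub>R p t))"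
    using borel_measurable_continuous_onI[OF pc(2)] by (intro integral_completion[symmetric]) measurable
  also have "\<dots> = cinner (emb \<rho> \<phi>) (box_l2 c d y)"
    unfolding emb_def box_l2_def cinner_abs_l2[OF test_fn_L2w[OF t, unfolded L2w_iff] L2_box]
    by (rule bochner_cong) (simp add: box_fn_def p_def cinner_simps scaleR_conv_of_real)
  finally show "cinner (Rop \<epsilon> \<rho> (emb \<rho> \<phi> + \<epsilon> *\<^sub>R emb \<rho> (dvec \<phi>))) (box_l2 c d y) = cinner (emb \<rho> \<phi>) (box_l2 c d y)"
    unfolding ze .
qed


lemma test_orthogonal_zero:
  fixes h :: "'a::chilbert l2"
  assumes orth: "\<And>(\<phi>::real \<Rightarrow> real) x. test_fn \<phi> \<Longrightarrow>
    cinner h (emb \<rho> (\<lambda>t. \<phi> t *\<^sub>R x) + \<epsilon> *\<^sub>R emb \<rho> (\<lambda>t. dvec \<phi> t *\<^sub>R x)) = 0"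
  shows "h = 0"
proof -
  define \<kappa> where "\<kappa> = 1/\<epsilon> + \<rho>"
  have \<kappa>: "\<kappa> > 0" using rate_pos by (simp add: \<kappa>_def)
  have main: "cinner h (wbox (- \<kappa>) a b x) = 0" if ab: "a < b" for a b x
  proof -
    define W where "W n = abs_l2 (\<lambda>t. exp (- \<kappa> * t) *\<^sub>R (bump a b n t *\<^sub>R x))" for n
    have WL: "L2 (\<lambda>t. exp (- \<kappa> * t) *\<^sub>R (bump a b n t *\<^sub>R x))" for n
      by (rule L2_continuous_support[of _ a b])
         (auto intro!: continuous_intros smoothD(3)[OF smooth_bump] simp: bump_support)
    have Wlim: "W \<longlonglongrightarrow> wbox (- \<kappa>) a b x"
      unfolding W_def wbox_def
    proof (rule l2_dominated_lim[where g = "\<lambda>t. exp (\<bar>- \<kappa>\<bar> * (\<bar>a\<bar> + \<bar>b\<bar>)) * norm x * indicat_real {a..b} t"])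
      show "integrable lebesgue (\<lambda>t. (exp (\<bar>- \<kappa>\<bar> * (\<bar>a\<bar> + \<bar>b\<bar>)) * norm x * indicat_real {a..b} t)\<^sup>2)"
      proof -
        have "(indicat_real {a..b} t)\<^sup>2 = indicat_real {a..b} t" for t by (simp add: indicator_def)
        then show ?thesis unfolding power_mult_distrib
          by (simp only:) (intro integrable_mult_right integrable_real_indicator, auto simp: emeasure_lborel_Icc_eq)
      qed
      show "norm (exp (- \<kappa> * t) *\<^sub>R (bump a b n t *\<^sub>R x)) \<le> exp (\<bar>- \<kappa>\<bar> * (\<bar>a\<bar> + \<bar>b\<bar>)) * norm x * indicat_real {a..b} t" for n t
      proof (cases "t \<in> {a..b}")
        case True
        have "exp (- \<kappa> * t) * (bump a b n t * norm x) \<le> exp (\<bar>- \<kappa>\<bar> * (\<bar>a\<bar> + \<bar>b\<bar>)) * (1 * norm x)"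
          using exp_bound_on[OF True, of "- \<kappa>"] bump_bounds[of a b n t] by (intro mult_mono mult_right_mono mult_nonneg_nonneg) auto
        then show ?thesis using True bump_bounds[of a b n t] by simp
      next
        case False
        then have "t \<notin> {a<..<b}" by auto
        then show ?thesis using False by (simp add: bump_support)
      qed
      have "(\<lambda>n. bump a b n t *\<^sub>R x) \<longlonglongrightarrow> box_fn a b x t" if "t \<noteq> a" for t
      proof (cases "t \<in> {a<..<b}")
        case True
        have "(\<lambda>n. bump a b n t *\<^sub>R x) \<longlonglongrightarrow> 1 *\<^sub>R x" by (intro tendsto_scaleR bump_lim True tendsto_const)
        then show ?thesis using True by (simp add: box_fn_def)
      next
        case False
        then show ?thesis using that by (auto simp: box_fn_def bump_support indicator_def)
      qed
      moreover have "AE t in lebesgue. t \<noteq> a"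
        by (rule AE_completion, rule AE_lborel_singleton)
      ultimately have "AE t in lebesgue. (\<lambda>n. bump a b n t *\<^sub>R x) \<longlonglongrightarrow> box_fn a b x t" by (auto elim!: eventually_mono)
      then show "AE t in lebesgue. (\<lambda>n. exp (- \<kappa> * t) *\<^sub>R (bump a b n t *\<^sub>R x)) \<longlonglongrightarrow> exp (- \<kappa> * t) *\<^sub>R box_fn a b x t"
        by eventually_elim (rule tendsto_scaleR[OF tendsto_const])
    qed (rule WL, rule L2_wbox)
    have shift_eq: "cinner h (W n) = exp (- \<kappa> * L) * cinner h (shiftop L (W n))" if L: "L > 0" for n L
    proof -
      define P where "P t = integral {a - 1..t} (bump a b n)" for t
      have bc: "continuous_on S (bump a b n)" for S using continuous_on_subset[OF smoothD(3)[OF smooth_bump]] by blast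
      have P0: "P t = 0" if "t < a" for t
        unfolding P_def by (rule integral_eq_zero_on) (use that in \<open>auto intro: bump_support\<close>)
      have P1: "P t = P b" if "t \<ge> b" for t
      proof -
        have "integral {a - 1..b} (bump a b n) + integral {b..t} (bump a b n) = integral {a - 1..t} (bump a b n)"
          by (rule Henstock_Kurzweil_Integration.integral_combine) (use ab that bc in \<open>auto intro!: integrable_continuous_real\<close>)
        moreover have "integral {b..t} (bump a b n) = 0" by (rule integral_eq_zero_on) (auto intro: bump_support)
        ultimately show ?thesis by (simp add: P_def)
      qed
      have Pd: "(P has_vector_derivative bump a b n t) (at t)" for t
      proof (cases "t < a")
        case True
        have "((\<lambda>t. 0) has_vector_derivative 0) (at t)" by (rule has_vector_derivative_const)
        then have "(P has_vector_derivative 0) (at t)"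
          using True P0 by (rule_tac has_vector_derivative_transform_within_open[of _ _ _ "{..<a}"]) auto
        then show ?thesis using True by (simp add: bump_support)
      next
        case False
        have "(P has_vector_derivative bump a b n t) (at t within {a - 1..t + 1})"
          unfolding P_def by (rule integral_has_vector_derivative[OF bc]) (use False in auto)
        moreover have "at t within {a - 1..t + 1} = at t"
          by (rule at_within_interior) (use False in auto)
        ultimately show ?thesis by simp
      qed
      define \<theta> where "\<theta> t = P t - P (t - L)" for t
      define \<theta>' where "\<theta>' t = bump a b n t - bump a b n (t - L)" for t
      have \<theta>d: "(\<theta> has_vector_derivative \<theta>' t) (at t)" for t
      proof -
        have "((\<lambda>t. P (t - L)) has_vector_derivative bump a b n (t - L)) (at t)"
          using vector_diff_chain_at[of "\<lambda>s. s - L" 1 t P "bump a b n (t - L)"] Pd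
            has_vector_derivative_diff[OF has_vector_derivative_id[of "at t"] has_vector_derivative_const[of L]]
          by (simp add: comp_def)
        then show ?thesis unfolding \<theta>_def \<theta>'_def by (intro has_vector_derivative_diff Pd)
      qed
      have s\<theta>': "smooth \<theta>'"
        using smooth_add[OF smooth_bump smooth_scaleR[OF smooth_const[of "-1"] smooth_affine[OF smooth_bump[of a b n], of 1 "- L"]], of a b n]
        by (simp add: \<theta>'_def[abs_def])
      have s\<theta>: "smooth \<theta>" by (rule smooth_antiderivative[OF \<theta>d s\<theta>'])
      define \<phi> where "\<phi> t = exp ((- 1/\<epsilon>) * t) *\<^sub>R \<theta> t" for t
      have t\<phi>: "test_fn \<phi>"
      proof (rule test_fnI[of \<phi> a "b + L"])
        show "smooth \<phi>" unfolding \<phi>_def by (rule smooth_scaleR[OF smooth_scaled_exp s\<theta>])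
        fix t assume "t \<notin> {a..b + L}"
        then consider "t < a" | "t > b + L" by fastforce
        then show "\<phi> t = 0"
        proof cases
          case 1 then show ?thesis using L by (simp add: \<phi>_def \<theta>_def P0)
        next
          case 2 then show ?thesis using L P1[of t] P1[of "t - L"] by (simp add: \<phi>_def \<theta>_def)
        qed
      qed
      have d\<phi>: "dvec \<phi> = (\<lambda>t. exp ((- 1/\<epsilon>) * t) *\<^sub>R \<theta>' t + ((- 1/\<epsilon>) * exp ((- 1/\<epsilon>) * t)) *\<^sub>R \<theta> t)"
      proof (rule dvec_eq)
        fix t
        have e: "((\<lambda>t. exp ((- 1/\<epsilon>) * t)) has_real_derivative (- 1/\<epsilon>) * exp ((- 1/\<epsilon>) * t)) (at t)"
          using eps by (auto intro!: derivative_eq_intros)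
        show "(\<phi> has_vector_derivative exp ((- 1/\<epsilon>) * t) *\<^sub>R \<theta>' t + ((- 1/\<epsilon>) * exp ((- 1/\<epsilon>) * t)) *\<^sub>R \<theta> t) (at t)"
          unfolding \<phi>_def by (rule has_vector_derivative_scaleR[OF e \<theta>d])
      qed
      have key: "\<phi> t + \<epsilon> * dvec \<phi> t = \<epsilon> * (exp ((- 1/\<epsilon>) * t) * \<theta>' t)" for t
      proof -
        have "\<epsilon> \<noteq> 0" using eps by simp
        then show ?thesis unfolding d\<phi> by (simp add: \<phi>_def field_simps)
      qed
      have L1: "(\<lambda>t. \<phi> t *\<^sub>R x) \<in> L2w \<rho>" "(\<lambda>t. dvec \<phi> t *\<^sub>R x) \<in> L2w \<rho>"
        by (intro test_fn_L2w test_fn_scaleR test_fn_dvec t\<phi> smooth_const)+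
      have "emb \<rho> (\<lambda>t. \<phi> t *\<^sub>R x) + \<epsilon> *\<^sub>R emb \<rho> (\<lambda>t. dvec \<phi> t *\<^sub>R x) = emb \<rho> (\<lambda>t. \<phi> t *\<^sub>R x + \<epsilon> *\<^sub>R (dvec \<phi> t *\<^sub>R x))"
        using L1 by (simp add: emb_add emb_scaleR[symmetric] L2w_scaleR del: scaleR_scaleR)
      also have "\<dots> = emb \<rho> (\<lambda>t. (\<epsilon> * (exp ((- 1/\<epsilon>) * t) * \<theta>' t)) *\<^sub>R x)"
        by (simp only: scaleR_scaleR scaleR_add_left[symmetric] key)
      also have "\<dots> = abs_l2 (\<lambda>t. \<epsilon> *\<^sub>R (exp (- \<kappa> * t) *\<^sub>R (bump a b n t *\<^sub>R x) - exp (- \<kappa> * L) *\<^sub>R (exp (- \<kappa> * (t - L)) *\<^sub>R (bump a b n (t - L) *\<^sub>R x))))"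
        unfolding emb_def
      proof (rule arg_cong[of _ _ abs_l2], rule ext)
        fix t
        have e1: "exp (- \<rho> * t) * exp ((- 1/\<epsilon>) * t) = exp (- \<kappa> * t)" by (simp add: \<kappa>_def exp_add[symmetric] algebra_simps)
        have e2: "exp (- \<kappa> * L) * exp (- \<kappa> * (t - L)) = exp (- \<kappa> * t)" by (simp add: exp_add[symmetric] algebra_simps)
        have "exp (- \<rho> * t) *\<^sub>R (\<epsilon> * (exp ((- 1/\<epsilon>) * t) * \<theta>' t)) *\<^sub>R x = (\<epsilon> * ((exp (- \<rho> * t) * exp ((- 1/\<epsilon>) * t)) * \<theta>' t)) *\<^sub>R x"
          by (simp add: mult_ac)
        also have "\<dots> = \<epsilon> *\<^sub>R (exp (- \<kappa> * t) *\<^sub>R (bump a b n t *\<^sub>R x) - (exp (- \<kappa> * L) * exp (- \<kappa> * (t - L))) *\<^sub>R (bump a b n (t - L) *\<^sub>R x))"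
          unfolding e1 e2 by (simp add: \<theta>'_def algebra_simps)
        finally show "exp (- \<rho> * t) *\<^sub>R (\<epsilon> * (exp ((- 1/\<epsilon>) * t) * \<theta>' t)) *\<^sub>R x =
          \<epsilon> *\<^sub>R (exp (- \<kappa> * t) *\<^sub>R (bump a b n t *\<^sub>R x) - exp (- \<kappa> * L) *\<^sub>R (exp (- \<kappa> * (t - L)) *\<^sub>R (bump a b n (t - L) *\<^sub>R x)))"
          by simp
      qed
      also have "\<dots> = \<epsilon> *\<^sub>R (W n - exp (- \<kappa> * L) *\<^sub>R shiftop L (W n))"
        unfolding W_def shiftop_abs[OF WL] abs_l2_scaleR[OF L2_shift[OF WL]]
          abs_l2_diff[OF WL L2_scaleR[OF L2_shift[OF WL]]] abs_l2_scaleR[OF L2_diff[OF WL L2_scaleR[OF L2_shift[OF WL]]]] ..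
      finally have "cinner h (\<epsilon> *\<^sub>R (W n - exp (- \<kappa> * L) *\<^sub>R shiftop L (W n))) = 0" using orth[OF t\<phi>, of x] by simp
      then show ?thesis using eps by (simp add: cinner_simps)
    qed
    have lim_eq: "cinner h (wbox (- \<kappa>) a b x) = exp (- \<kappa> * L) * cinner h (shiftop L (wbox (- \<kappa>) a b x))" if L: "L > 0" for L
    proof (rule LIMSEQ_unique)
      show "(\<lambda>n. cinner h (W n)) \<longlonglongrightarrow> cinner h (wbox (- \<kappa>) a b x)" by (intro cinner.tendsto tendsto_const Wlim)
      show "(\<lambda>n. cinner h (W n)) \<longlonglongrightarrow> exp (- \<kappa> * L) * cinner h (shiftop L (wbox (- \<kappa>) a b x))"
        unfolding shift_eq[OF L]
        by (intro tendsto_mult cinner.tendsto tendsto_const bounded_linear.tendsto[OF bounded_clinear_opD(1)[OF shiftop_clinear]] Wlim)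
    qed
    define N where "N = norm h * norm (wbox (- \<kappa>) a b x)"
    have bnd: "norm (cinner h (wbox (- \<kappa>) a b x)) \<le> exp (- \<kappa> * real (Suc n)) * N" for n
    proof -
      have "norm (cinner h (wbox (- \<kappa>) a b x)) = exp (- \<kappa> * real (Suc n)) * norm (cinner h (shiftop (real (Suc n)) (wbox (- \<kappa>) a b x)))"
        by (subst lim_eq[of "real (Suc n)"]) (simp_all add: norm_mult)
      also have "\<dots> \<le> exp (- \<kappa> * real (Suc n)) * N"
        unfolding N_def by (intro mult_left_mono order_trans[OF norm_cinner_le]) auto
      finally show ?thesis .
    qed
    have "(\<lambda>n. exp (- \<kappa> * real (Suc n)) * N) \<longlonglongrightarrow> 0 * N"
    proof (intro tendsto_mult tendsto_const)
      have "(\<lambda>n. (exp (- \<kappa>)) ^ Suc n) \<longlonglongrightarrow> 0"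
        using \<kappa> by (intro LIMSEQ_Suc LIMSEQ_realpow_zero) auto
      then show "(\<lambda>n. exp (- \<kappa> * real (Suc n))) \<longlonglongrightarrow> 0"
        by (simp add: exp_of_nat_mult[symmetric] mult.commute del: power_Suc of_nat_Suc)
    qed
    then have "(\<lambda>n. exp (- \<kappa> * real (Suc n)) * N) \<longlonglongrightarrow> 0" by simp
    from LIMSEQ_le_const[OF this, of "norm (cinner h (wbox (- \<kappa>) a b x))"] bnd
    show ?thesis by auto
  qed
  have "cinner 0 (box_l2 c d x) = cinner h (wbox (- \<kappa>) c d x)" for c d and x :: 'a
  proof (cases "c < d")
    case False
    then have "box_fn c d x = (\<lambda>t. 0)" by (auto simp: box_fn_def)
    then have "wbox (- \<kappa>) c d x = 0" by (simp add: wbox_def zero_l2_def)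
    then show ?thesis by simp
  qed (simp add: main)
  then have "compat (- \<kappa>) h 0" by (simp add: compat_iff)
  moreover have "AE t in lebesgue. rep_l2 (0::'a l2) t = 0"
    unfolding zero_l2_def by (rule rep_abs_l2[OF L2_zero])
  ultimately have "AE t in lebesgue. rep_l2 h t = rep_l2 0 t" unfolding compat_def by eventually_elim simp
  then show "h = 0" by (rule l2_eqI)
qed

end

definition tsum :: "((real \<Rightarrow> real) \<times> 'a) list \<Rightarrow> real \<Rightarrow> 'a::real_vector" where
  "tsum xs t = (\<Sum>p\<leftarrow>xs. fst p t *\<^sub>R snd p)"

definition dl :: "((real \<Rightarrow> real) \<times> 'a) list \<Rightarrow> ((real \<Rightarrow> real) \<times> 'a) list" where
  "dl xs = map (\<lambda>p. (dvec (fst p), snd p)) xs"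

definition tests :: "((real \<Rightarrow> real) \<times> 'a) list \<Rightarrow> bool" where
  "tests xs \<longleftrightarrow> (\<forall>p\<in>set xs. test_fn (fst p))"

lemma tests_append: "tests (xs @ ys) \<longleftrightarrow> tests xs \<and> tests ys"
  unfolding tests_def by (simp only: set_append) blast

lemma tests_dl: "tests xs \<Longrightarrow> tests (dl xs)"
  by (auto simp: tests_def dl_def intro: test_fn_dvec)

lemma test_fn_tsum: "tests xs \<Longrightarrow> test_fn (tsum xs)"
proof (induction xs)
  case Nil
  have "test_fn (\<lambda>t. 0 :: 'a)" by (rule test_fnI[of _ 0 0]) (auto intro: smooth_const)
  then show ?case by (simp add: tsum_def[abs_def])
next
  case (Cons p xs)
  then show ?case using test_fn_add[OF test_fn_scaleR[OF _ smooth_const[of "snd p"]], of "fst p" "tsum xs"]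
    by (simp add: tests_def tsum_def[abs_def])
qed

lemma dvec_tsum:
  assumes "tests xs" shows "dvec (tsum xs) = tsum (dl xs)"
proof (rule dvec_eq)
  fix t
  show "(tsum xs has_vector_derivative tsum (dl xs) t) (at t)"
    using assms
  proof (induction xs)
    case Nil then show ?case by (simp add: tsum_def[abs_def] dl_def)
  next
    case (Cons p xs)
    have f: "(fst p has_real_derivative dvec (fst p) t) (at t)"
      using smoothD(1)[OF test_fn_smooth, of "fst p"] Cons by (simp add: tests_def has_real_derivative_iff_has_vector_derivative)
    have "((\<lambda>t. fst p t *\<^sub>R snd p + tsum xs t) has_vector_derivative (fst p t *\<^sub>R 0 + dvec (fst p) t *\<^sub>R snd p) + tsum (dl xs) t) (at t)"
      by (intro has_vector_derivative_add has_vector_derivative_scaleR[OF f] has_vector_derivative_const)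
         (use Cons in \<open>simp add: tests_def\<close>)
    then show ?case by (simp add: tsum_def[abs_def] dl_def)
  qed
qed

lemma resolvent_range_dense:
  assumes eps: "\<epsilon> > 0" "1 + \<epsilon> * \<rho> > 0"
  shows "closure {emb \<rho> (tsum xs) + \<epsilon> *\<^sub>R emb \<rho> (tsum (dl xs)) | xs. tests xs} = (UNIV :: 'a::chilbert l2 set)"
    (is "closure ?S = UNIV")
proof (rule dense_by_orthogonality)
  have L: "(tsum xs :: real \<Rightarrow> 'a) \<in> L2w \<rho>" if "tests xs" for xs by (rule test_fn_L2w[OF test_fn_tsum[OF that]])
  have app: "emb \<rho> (tsum (xs @ ys)) = emb \<rho> (tsum xs) + emb \<rho> (tsum ys :: real \<Rightarrow> 'a)" if "tests xs" "tests ys" for xs ys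
    using emb_add[OF L[OF that(1)] L[OF that(2)]] by (simp add: tsum_def[abs_def])
  have sc: "tsum (map (\<lambda>p. (fst p, c *\<^sub>R snd p)) xs) = (\<lambda>t. c *\<^sub>R (tsum xs t :: 'a))" for c xs
    by (rule ext, induction xs) (simp_all add: tsum_def scaleR_add_right mult.commute)
  have scl: "emb \<rho> (tsum (map (\<lambda>p. (fst p, c *\<^sub>R snd p)) xs)) = c *\<^sub>R emb \<rho> (tsum xs :: real \<Rightarrow> 'a)" if "tests xs" for c xs
    unfolding sc by (rule emb_scaleR[OF L[OF that]])
  show "subspace ?S"
    unfolding subspace_def
  proof (intro conjI ballI allI)
    have "emb \<rho> (tsum ([] :: ((real \<Rightarrow> real) \<times> 'a) list)) = 0" by (simp add: emb_def tsum_def zero_l2_def)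
    then show "0 \<in> ?S" by (auto intro!: exI[of _ "[]"] simp: tests_def dl_def)
  next
    fix x y assume "x \<in> ?S" "y \<in> ?S"
    then obtain xs ys where x: "x = emb \<rho> (tsum xs) + \<epsilon> *\<^sub>R emb \<rho> (tsum (dl xs))" "tests xs"
      and y: "y = emb \<rho> (tsum ys) + \<epsilon> *\<^sub>R emb \<rho> (tsum (dl ys))" "tests ys" by auto
    have "dl (xs @ ys) = dl xs @ dl ys" by (simp add: dl_def)
    then have "x + y = emb \<rho> (tsum (xs @ ys)) + \<epsilon> *\<^sub>R emb \<rho> (tsum (dl (xs @ ys)))"
      using x y by (simp add: app tests_dl scaleR_add_right)
    then show "x + y \<in> ?S" using x y by (auto intro!: exI[of _ "xs @ ys"] simp: tests_append)
  next
    fix c :: real and x assume "x \<in> ?S"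
    then obtain xs where x: "x = emb \<rho> (tsum xs) + \<epsilon> *\<^sub>R emb \<rho> (tsum (dl xs))" "tests xs" by auto
    let ?ys = "map (\<lambda>p. (fst p, c *\<^sub>R snd p)) xs"
    have d: "dl ?ys = map (\<lambda>p. (fst p, c *\<^sub>R snd p)) (dl xs)" by (simp add: dl_def)
    have "c *\<^sub>R x = emb \<rho> (tsum ?ys) + \<epsilon> *\<^sub>R emb \<rho> (tsum (dl ?ys))"
      unfolding d scl[OF x(2)] scl[OF tests_dl[OF x(2)]] by (simp add: x(1) scaleR_add_right mult.commute)
    moreover have "tests ?ys" using x(2) unfolding tests_def by (simp only: set_map) auto
    ultimately show "c *\<^sub>R x \<in> ?S" by blast
  qed
  fix h :: "'a l2" assume h: "\<forall>s\<in>?S. Re (cinner h s) = 0"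
  show "h = 0"
  proof (rule test_orthogonal_zero[OF eps])
    fix \<phi> :: "real \<Rightarrow> real" and x :: 'a assume t: "test_fn \<phi>"
    define v where "v x = emb \<rho> (\<lambda>t. \<phi> t *\<^sub>R x) + \<epsilon> *\<^sub>R emb \<rho> (\<lambda>t. dvec \<phi> t *\<^sub>R x)" for x :: 'a
    have vS: "v x \<in> ?S" for x
      using t by (auto intro!: exI[of _ "[(\<phi>, x)]"] simp: v_def tsum_def[abs_def] dl_def tests_def)
    have "L2 (\<lambda>t. exp (- \<rho> * t) *\<^sub>R (\<phi> t *\<^sub>R x))" "L2 (\<lambda>t. exp (- \<rho> * t) *\<^sub>R (dvec \<phi> t *\<^sub>R x))"
      using test_fn_L2w[OF test_fn_scaleR[OF t smooth_const[of x]], of \<rho>]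
        test_fn_L2w[OF test_fn_scaleR[OF test_fn_dvec[OF t] smooth_const[of x]], of \<rho>] by (auto simp: L2w_iff)
    then have "v (\<i> *\<^sub>C x) = \<i> *\<^sub>C v x"
      by (simp add: v_def emb_def cscale_add_right cscale_scaleR abs_l2_cscale del: scaleR_scaleR)
    then have "Re (cinner h (v x)) = 0" "Re (cinner h (\<i> *\<^sub>C v x)) = 0" using h vS[of x] vS[of "\<i> *\<^sub>C x"] by auto
    then show "cinner h (v x) = 0" by (simp add: complex_eq_iff cinner_cscale_right)
  qed
qed

lemma deriv_graph_iff:
  fixes w g :: "real \<Rightarrow> 'a::chilbert"
  assumes eps: "\<epsilon> > 0" "1 + \<epsilon> * \<rho> > 0"
  shows "(w, g) \<in> deriv_graph \<rho> \<longleftrightarrow> w \<in> L2w \<rho> \<and> g \<in> L2w \<rho> \<and> emb \<rho> w = Rop \<epsilon> \<rho> (emb \<rho> w + \<epsilon> *\<^sub>R emb \<rho> g)"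
proof -
  have R: "bounded_linear (Rop \<epsilon> \<rho> :: 'a l2 \<Rightarrow> 'a l2)" by (rule bounded_clinear_opD(1)[OF Rop_clinear[OF eps]])
  define G where "G = {(\<phi>, dvec \<phi>) | \<phi>::real \<Rightarrow> 'a. test_fn \<phi>}"
  have "emb \<rho> w = Rop \<epsilon> \<rho> (emb \<rho> w + \<epsilon> *\<^sub>R emb \<rho> g)" if wg: "(w, g) \<in> gclosure \<rho> G"
  proof -
    obtain s where s: "\<And>n. s n \<in> G \<and> fst (s n) \<in> L2w \<rho> \<and> snd (s n) \<in> L2w \<rho>"
      "(\<lambda>n. emb \<rho> (fst (s n))) \<longlonglongrightarrow> emb \<rho> w" "(\<lambda>n. emb \<rho> (snd (s n))) \<longlonglongrightarrow> emb \<rho> g"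
      using wg unfolding gclosure_iff by blast
    have "(\<lambda>n. Rop \<epsilon> \<rho> (emb \<rho> (fst (s n)) + \<epsilon> *\<^sub>R emb \<rho> (snd (s n)))) \<longlonglongrightarrow> Rop \<epsilon> \<rho> (emb \<rho> w + \<epsilon> *\<^sub>R emb \<rho> g)"
      by (intro bounded_linear.tendsto[OF R] tendsto_intros s)
    moreover have "Rop \<epsilon> \<rho> (emb \<rho> (fst (s n)) + \<epsilon> *\<^sub>R emb \<rho> (snd (s n))) = emb \<rho> (fst (s n))" for n
      using s(1)[of n] Rop_test_fn[OF eps] by (auto simp: G_def)
    ultimately show ?thesis using s(2) LIMSEQ_unique by auto
  qed
  moreover have "(w, g) \<in> gclosure \<rho> G" if w: "w \<in> L2w \<rho>" and g: "g \<in> L2w \<rho>" and e: "emb \<rho> w = Rop \<epsilon> \<rho> (emb \<rho> w + \<epsilon> *\<^sub>R emb \<rho> g)"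
  proof -
    define z where "z = emb \<rho> w + \<epsilon> *\<^sub>R emb \<rho> g"
    have "z \<in> closure {emb \<rho> (tsum xs) + \<epsilon> *\<^sub>R emb \<rho> (tsum (dl xs)) | xs. tests xs}"
      unfolding resolvent_range_dense[OF eps] by simp
    then obtain X where X: "\<And>n. X n \<in> {emb \<rho> (tsum xs) + \<epsilon> *\<^sub>R emb \<rho> (tsum (dl xs)) | xs. tests xs}" "X \<longlonglongrightarrow> z"
      unfolding closure_sequential by blast
    have "\<exists>xs. \<forall>n. X n = emb \<rho> (tsum (xs n)) + \<epsilon> *\<^sub>R emb \<rho> (tsum (dl (xs n))) \<and> tests (xs n)"
      by (rule choice) (use X(1) in blast)
    then obtain xs where xs: "\<And>n. X n = emb \<rho> (tsum (xs n)) + \<epsilon> *\<^sub>R emb \<rho> (tsum (dl (xs n)))" "\<And>n. tests (xs n)" by blast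
    have RX: "Rop \<epsilon> \<rho> (X n) = emb \<rho> (tsum (xs n))" for n
      using Rop_test_fn[OF eps test_fn_tsum[OF xs(2)[of n]]] by (simp add: xs(1) dvec_tsum[OF xs(2)])
    have "(\<lambda>n. Rop \<epsilon> \<rho> (X n)) \<longlonglongrightarrow> emb \<rho> w"
      using bounded_linear.tendsto[OF R X(2)] e by (simp add: z_def)
    then have l1: "(\<lambda>n. emb \<rho> (tsum (xs n))) \<longlonglongrightarrow> emb \<rho> w" by (simp add: RX)
    have "(\<lambda>n. (1/\<epsilon>) *\<^sub>R (X n - emb \<rho> (tsum (xs n)))) \<longlonglongrightarrow> (1/\<epsilon>) *\<^sub>R (z - emb \<rho> w)"
      by (intro tendsto_intros X(2) l1)
    then have l2: "(\<lambda>n. emb \<rho> (tsum (dl (xs n)))) \<longlonglongrightarrow> emb \<rho> g"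
      using eps by (simp add: z_def xs(1))
    have "(tsum (xs n), tsum (dl (xs n))) \<in> G" for n
      using test_fn_tsum[OF xs(2)[of n]] dvec_tsum[OF xs(2)[of n]] by (auto simp: G_def)
    then show ?thesis unfolding gclosure_iff using w g l1 l2
      by (intro conjI exI[of _ "\<lambda>n. (tsum (xs n), tsum (dl (xs n)))"])
         (auto intro!: test_fn_L2w test_fn_tsum tests_dl xs(2))
  qed
  ultimately show ?thesis unfolding deriv_graph_def G_def[symmetric]
    by (auto simp: gclosure_def)
qed

subsection \<open>Gaussian summation of Fourier integrals\<close>

definition ft :: "(real \<Rightarrow> complex) \<Rightarrow> real \<Rightarrow> complex" where
  "ft a \<tau> = (LINT u|lborel. a u * iexp (- (\<tau> * u)))"

lemma iexp_add: "iexp (x + y) = iexp x * iexp y"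
  by (simp add: exp_add distrib_left)

abbreviation flt :: "(real \<Rightarrow> complex) \<Rightarrow> real \<Rightarrow> complex" where
  "flt k \<tau> \<equiv> (LINT s|lebesgue. k s * iexp (\<tau> * s))"

lemma iexp_lebesgue: "(\<lambda>s::real. iexp (\<tau> * s)) \<in> borel_measurable lebesgue"
  by (rule measurable_completion) simp

lemma integrable_std_normal: "integrable lborel std_normal_density"
  using integrable_std_normal_moment[of 0] by simp

lemma integral_std_normal: "(LINT r|lborel. std_normal_density r) = 1"
  using integral_std_normal_moment_even[of 0] by simp

lemma std_normal_fourier: "(LINT \<sigma>|lborel. std_normal_density \<sigma> *\<^sub>R iexp (t * \<sigma>)) = of_real (exp (- t\<^sup>2 / 2))"
  using fun_cong[OF char_std_normal_distribution, of t] unfolding char_def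
  by (subst (asm) integral_density) auto

lemma ft_measurable [measurable]:
  assumes [measurable]: "a \<in> borel_measurable borel" shows "ft a \<in> borel_measurable borel"
  unfolding ft_def by measurable

lemma norm_ft_le:
  assumes "integrable lborel a" shows "norm (ft a \<tau>) \<le> (LINT u|lborel. norm (a u))"
proof -
  have "norm (ft a \<tau>) \<le> (LINT u|lborel. norm (a u * iexp (- (\<tau> * u))))"
    unfolding ft_def by (rule integral_norm_bound)
  then show ?thesis by (simp add: norm_mult)
qed

lemma gauss_inversion:
  fixes a :: "real \<Rightarrow> complex"
  assumes am [measurable]: "a \<in> borel_measurable borel" and ai: "integrable lborel a" and \<eta>: "\<eta> > 0"
  shows "(\<eta> / sqrt (2 * pi)) *\<^sub>R (LINT \<sigma>|lborel. std_normal_density \<sigma> *\<^sub>R (iexp (\<eta> * \<sigma> * s) * ft a (\<eta> * \<sigma>))) =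
    (LINT r|lborel. std_normal_density r *\<^sub>R a (s + r / \<eta>))"
proof -
  define F where "F = (\<lambda>(\<sigma>, u). std_normal_density \<sigma> *\<^sub>R (a u * iexp (\<eta> * (s - u) * \<sigma>)))"
  have Fm [measurable]: "F \<in> borel_measurable (lborel \<Otimes>\<^sub>M lborel)" unfolding F_def by measurable
  have Fi: "integrable (lborel \<Otimes>\<^sub>M lborel) F"
    by (rule pair_integrable_dominated[OF Fm integrable_std_normal integrable_norm[OF ai]])
       (simp add: F_def norm_mult)
  have "(LINT \<sigma>|lborel. std_normal_density \<sigma> *\<^sub>R (iexp (\<eta> * \<sigma> * s) * ft a (\<eta> * \<sigma>))) = (LINT \<sigma>|lborel. (LINT u|lborel. F (\<sigma>, u)))"
  proof (rule bochner_cong)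
    fix \<sigma>
    have "iexp (\<eta> * \<sigma> * s) * ft a (\<eta> * \<sigma>) = (LINT u|lborel. iexp (\<eta> * \<sigma> * s) * (a u * iexp (- (\<eta> * \<sigma> * u))))"
      unfolding ft_def by (rule integral_mult_right_zero[symmetric])
    also have "\<dots> = (LINT u|lborel. a u * iexp (\<eta> * (s - u) * \<sigma>))"
    proof (rule bochner_cong)
      fix u
      have "iexp (\<eta> * (s - u) * \<sigma>) = iexp (\<eta> * \<sigma> * s) * iexp (- (\<eta> * \<sigma> * u))"
        unfolding iexp_add[symmetric] by (simp add: algebra_simps)
      then show "iexp (\<eta> * \<sigma> * s) * (a u * iexp (- (\<eta> * \<sigma> * u))) = a u * iexp (\<eta> * (s - u) * \<sigma>)" by simp
    qed
    finally show "std_normal_density \<sigma> *\<^sub>R (iexp (\<eta> * \<sigma> * s) * ft a (\<eta> * \<sigma>)) = (LINT u|lborel. F (\<sigma>, u))"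
      unfolding F_def prod.case by simp
  qed
  also have "\<dots> = (LINT u|lborel. (LINT \<sigma>|lborel. F (\<sigma>, u)))"
    using lborel_pair.Fubini_integral[of "\<lambda>\<sigma> u. F (\<sigma>, u)"] Fi by simp
  also have "\<dots> = (LINT u|lborel. a u * of_real (exp (- (\<eta> * (s - u))\<^sup>2 / 2)))"
  proof (rule bochner_cong)
    fix u
    have "(LINT \<sigma>|lborel. F (\<sigma>, u)) = (LINT \<sigma>|lborel. a u * (std_normal_density \<sigma> *\<^sub>R iexp (\<eta> * (s - u) * \<sigma>)))"
      by (simp add: F_def)
    then show "(LINT \<sigma>|lborel. F (\<sigma>, u)) = a u * of_real (exp (- (\<eta> * (s - u))\<^sup>2 / 2))"
      unfolding integral_mult_right_zero std_normal_fourier .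
  qed
  also have "\<dots> = (1 / \<eta>) *\<^sub>R (LINT r|lborel. a (s + r / \<eta>) * of_real (exp (- r\<^sup>2 / 2)))"
    using lborel_integral_real_affine[of "1 / \<eta>" "\<lambda>u. a u * of_real (exp (- (\<eta> * (s - u))\<^sup>2 / 2))" s] \<eta> by simp
  finally have "(\<eta> / sqrt (2 * pi)) *\<^sub>R (LINT \<sigma>|lborel. std_normal_density \<sigma> *\<^sub>R (iexp (\<eta> * \<sigma> * s) * ft a (\<eta> * \<sigma>))) =
      (1 / sqrt (2 * pi)) *\<^sub>R (LINT r|lborel. a (s + r / \<eta>) * of_real (exp (- r\<^sup>2 / 2)))"
    using \<eta> by simp
  also have "\<dots> = (LINT r|lborel. std_normal_density r *\<^sub>R a (s + r / \<eta>))"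
    unfolding integral_scaleR_right[symmetric]
    by (rule bochner_cong)
       (simp add: std_normal_density_def scaleR_conv_of_real mult_ac)
  finally show ?thesis .
qed

lemma lebesgue_borel_version:
  fixes h :: "real \<Rightarrow> complex"
  assumes h: "integrable lebesgue h"
  obtains k where "k \<in> borel_measurable borel" "integrable lborel k" "AE s in lebesgue. h s = k s"
proof -
  have "(\<lambda>s. Re (h s)) \<in> borel_measurable lebesgue" "(\<lambda>s. Im (h s)) \<in> borel_measurable lebesgue" using h by auto
  then obtain p q where p [measurable]: "p \<in> borel_measurable lborel" "AE s in lborel. Re (h s) = p s"
    and q [measurable]: "q \<in> borel_measurable lborel" "AE s in lborel. Im (h s) = q s"
    using completion_ex_borel_measurable_real[of "\<lambda>s. Re (h s)" lborel]
      completion_ex_borel_measurable_real[of "\<lambda>s. Im (h s)" lborel] by auto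
  define k where "k s = Complex (p s) (q s)" for s
  have km [measurable]: "k \<in> borel_measurable borel"
    using p(1) q(1) unfolding k_def Complex_eq by simp
  have hk: "AE s in lebesgue. h s = k s"
    using AE_completion[OF p(2)] AE_completion[OF q(2)] by eventually_elim (auto simp: k_def complex_eq_iff)
  have kil: "integrable lebesgue k"
    by (rule integrable_cong_AE_imp[OF h _ hk]) (rule measurable_completion, simp)
  have ki: "integrable lborel k" using kil by (subst (asm) integrable_completion) auto
  show ?thesis by (rule that[OF km ki hk])
qed

lemma lebesgue_fourier_borel:
  fixes k :: "real \<Rightarrow> complex"
  assumes k: "integrable lebesgue k"
  shows "(\<lambda>\<tau>. flt k \<tau>) \<in> borel_measurable borel"
    and "norm (flt k \<tau>) \<le> (LINT s|lebesgue. norm (k s))"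
proof -
  obtain l where l [measurable]: "l \<in> borel_measurable borel" and li: "integrable lborel l" and kl: "AE s in lebesgue. k s = l s"
    using lebesgue_borel_version[OF k] by metis
  have lml: "l \<in> borel_measurable lebesgue" by (rule measurable_completion) simp
  have "(flt k \<tau>) = (LINT s|lborel. l s * iexp (\<tau> * s))" for \<tau>
  proof -
    have m: "(\<lambda>s. iexp (\<tau> * s)) \<in> borel_measurable lebesgue" by (rule measurable_completion) simp
    have "(flt k \<tau>) = (LINT s|lebesgue. l s * iexp (\<tau> * s))"
      by (rule integral_cong_AE) (use k m lml kl in \<open>auto intro!: borel_measurable_times elim!: eventually_mono\<close>)
    then show ?thesis by (subst (asm) integral_completion) auto
  qed
  then show "(\<lambda>\<tau>. flt k \<tau>) \<in> borel_measurable borel" by simp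
  have "norm (flt k \<tau>) \<le> (LINT s|lebesgue. norm (k s * iexp (\<tau> * s)))"
    by (rule integral_norm_bound)
  then show "norm (flt k \<tau>) \<le> (LINT s|lebesgue. norm (k s))" by (simp add: norm_mult)
qed

lemma gauss_parseval_integrable:
  fixes k a :: "real \<Rightarrow> complex"
  assumes k: "integrable lebesgue k" and am [measurable]: "a \<in> borel_measurable borel" and ai: "integrable lborel a"
  shows "integrable lborel (\<lambda>\<sigma>. std_normal_density \<sigma> *\<^sub>R ((flt k (\<eta> * \<sigma>)) * ft a (\<eta> * \<sigma>)))"
proof (rule bochner_bound[OF integrable_mult_left[OF integrable_std_normal,
        of "(LINT s|lebesgue. norm (k s)) * (LINT u|lborel. norm (a u))"]])
  note [measurable] = lebesgue_fourier_borel(1)[OF k]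
  have "(\<lambda>\<sigma>. flt k (\<eta> * \<sigma>)) \<in> borel_measurable borel"
    using measurable_compose[OF _ lebesgue_fourier_borel(1)[OF k], of "\<lambda>\<sigma>. \<eta> * \<sigma>" borel] by simp
  then show "(\<lambda>\<sigma>. std_normal_density \<sigma> *\<^sub>R ((flt k (\<eta> * \<sigma>)) * ft a (\<eta> * \<sigma>))) \<in> borel_measurable lborel"
    by measurable
  show "AE \<sigma> in lborel. norm (std_normal_density \<sigma> *\<^sub>R ((flt k (\<eta> * \<sigma>)) * ft a (\<eta> * \<sigma>)))
      \<le> norm (std_normal_density \<sigma> * ((LINT s|lebesgue. norm (k s)) * (LINT u|lborel. norm (a u))))"
  proof (rule AE_I2)
    fix \<sigma>
    have "norm (flt k (\<eta> * \<sigma>)) * norm (ft a (\<eta> * \<sigma>)) \<le> (LINT s|lebesgue. norm (k s)) * (LINT u|lborel. norm (a u))"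
      by (intro mult_mono lebesgue_fourier_borel(2)[OF k] norm_ft_le[OF ai]) auto
    then have "std_normal_density \<sigma> * (norm (flt k (\<eta> * \<sigma>)) * norm (ft a (\<eta> * \<sigma>))) \<le>
        std_normal_density \<sigma> * ((LINT s|lebesgue. norm (k s)) * (LINT u|lborel. norm (a u)))"
      by (rule mult_left_mono) simp
    also have "\<dots> \<le> norm (std_normal_density \<sigma> * ((LINT s|lebesgue. norm (k s)) * (LINT u|lborel. norm (a u))))" by simp
    finally show "norm (std_normal_density \<sigma> *\<^sub>R ((flt k (\<eta> * \<sigma>)) * ft a (\<eta> * \<sigma>)))
      \<le> norm (std_normal_density \<sigma> * ((LINT s|lebesgue. norm (k s)) * (LINT u|lborel. norm (a u))))"
      by (simp add: norm_mult)
  qed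
qed

lemma gauss_parseval:
  fixes k a :: "real \<Rightarrow> complex"
  assumes k: "integrable lebesgue k" and ac: "continuous_on UNIV a" and ai: "integrable lborel a"
    and ab: "\<And>u. norm (a u) \<le> B"
  shows "(\<lambda>n. (real (Suc n) / sqrt (2 * pi)) *\<^sub>R (LINT \<sigma>|lborel. std_normal_density \<sigma> *\<^sub>R
      ((LINT s|lebesgue. k s * iexp (real (Suc n) * \<sigma> * s)) * ft a (real (Suc n) * \<sigma>)))) \<longlonglongrightarrow> (LINT s|lebesgue. k s * a s)"
proof -
  have am [measurable]: "a \<in> borel_measurable borel" by (rule borel_measurable_continuous_onI[OF ac])
  have aml: "a \<in> borel_measurable lebesgue" by (rule measurable_completion) simp
  obtain l where l [measurable]: "l \<in> borel_measurable borel" and li: "integrable lborel l" and kl: "AE s in lebesgue. k s = l s"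
    using lebesgue_borel_version[OF k] by metis
  have lml: "l \<in> borel_measurable lebesgue" by (rule measurable_completion) simp
  have conv: "(LINT s|lebesgue. k s * m s) = (LINT s|lborel. l s * m s)" if [measurable]: "m \<in> borel_measurable borel" for m
  proof -
    have mm: "m \<in> borel_measurable lebesgue" by (rule measurable_completion) simp
    have "(LINT s|lebesgue. k s * m s) = (LINT s|lebesgue. l s * m s)"
      by (rule integral_cong_AE) (use k mm lml kl in \<open>auto intro!: borel_measurable_times elim!: eventually_mono\<close>)
    then show ?thesis by (subst (asm) integral_completion) auto
  qed
  define A where "A n s = (LINT r|lborel. std_normal_density r *\<^sub>R a (s + r / real (Suc n)))" for n s
  have eq: "(real (Suc n) / sqrt (2 * pi)) *\<^sub>R (LINT \<sigma>|lborel. std_normal_density \<sigma> *\<^sub>R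
      ((LINT s|lebesgue. k s * iexp (real (Suc n) * \<sigma> * s)) * ft a (real (Suc n) * \<sigma>))) = (LINT s|lborel. l s * A n s)" for n
  proof -
    define \<eta> where "\<eta> = real (Suc n)"
    have \<eta>: "\<eta> > 0" by (simp add: \<eta>_def)
    define F where "F = (\<lambda>(s, \<sigma>). l s * (std_normal_density \<sigma> *\<^sub>R (iexp (\<eta> * \<sigma> * s) * ft a (\<eta> * \<sigma>))))"
    have Fm [measurable]: "F \<in> borel_measurable (lborel \<Otimes>\<^sub>M lborel)" unfolding F_def by measurable
    have Fi: "integrable (lborel \<Otimes>\<^sub>M lborel) F"
    proof (rule pair_integrable_dominated[OF Fm integrable_norm[OF li] integrable_mult_left[OF integrable_std_normal, of "LINT u|lborel. norm (a u)"]])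
      fix s \<sigma>
      have "norm (F (s, \<sigma>)) = norm (l s) * (std_normal_density \<sigma> * norm (ft a (\<eta> * \<sigma>)))" by (simp add: F_def norm_mult)
      also have "\<dots> \<le> norm (l s) * (std_normal_density \<sigma> * (LINT u|lborel. norm (a u)))"
        by (intro mult_left_mono norm_ft_le[OF ai]) auto
      finally show "norm (F (s, \<sigma>)) \<le> norm (l s) * (std_normal_density \<sigma> * (LINT u|lborel. norm (a u)))" .
    qed
    have "(LINT \<sigma>|lborel. std_normal_density \<sigma> *\<^sub>R ((flt k (\<eta> * \<sigma>)) * ft a (\<eta> * \<sigma>))) =
        (LINT \<sigma>|lborel. (LINT s|lborel. F (s, \<sigma>)))"
    proof (rule bochner_cong)
      fix \<sigma>
      have "(flt k (\<eta> * \<sigma>)) = (LINT s|lborel. l s * iexp (\<eta> * \<sigma> * s))" by (rule conv) simp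
      moreover have "(LINT s|lborel. F (s, \<sigma>)) = (LINT s|lborel. (l s * iexp (\<eta> * \<sigma> * s)) * (std_normal_density \<sigma> *\<^sub>R ft a (\<eta> * \<sigma>)))"
        by (simp add: F_def mult_ac)
      ultimately show "std_normal_density \<sigma> *\<^sub>R ((flt k (\<eta> * \<sigma>)) * ft a (\<eta> * \<sigma>)) = (LINT s|lborel. F (s, \<sigma>))"
        unfolding integral_mult_left_zero by simp
    qed
    also have "\<dots> = (LINT s|lborel. (LINT \<sigma>|lborel. F (s, \<sigma>)))"
      using lborel_pair.Fubini_integral[of "\<lambda>s \<sigma>. F (s, \<sigma>)"] Fi by simp
    also have "\<dots> = (LINT s|lborel. l s * (LINT \<sigma>|lborel. std_normal_density \<sigma> *\<^sub>R (iexp (\<eta> * \<sigma> * s) * ft a (\<eta> * \<sigma>))))"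
      unfolding F_def prod.case integral_mult_right_zero ..
    finally have "(\<eta> / sqrt (2 * pi)) *\<^sub>R (LINT \<sigma>|lborel. std_normal_density \<sigma> *\<^sub>R ((flt k (\<eta> * \<sigma>)) * ft a (\<eta> * \<sigma>)))
        = (LINT s|lborel. (\<eta> / sqrt (2 * pi)) *\<^sub>R (l s * (LINT \<sigma>|lborel. std_normal_density \<sigma> *\<^sub>R (iexp (\<eta> * \<sigma> * s) * ft a (\<eta> * \<sigma>)))))"
      unfolding integral_scaleR_right by simp
    also have "\<dots> = (LINT s|lborel. l s * A n s)"
    proof (rule bochner_cong)
      fix s
      have "A n s = (\<eta> / sqrt (2 * pi)) *\<^sub>R (LINT \<sigma>|lborel. std_normal_density \<sigma> *\<^sub>R (iexp (\<eta> * \<sigma> * s) * ft a (\<eta> * \<sigma>)))"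
        unfolding A_def \<eta>_def[symmetric] by (rule gauss_inversion[OF am ai \<eta>, symmetric])
      then show "(\<eta> / sqrt (2 * pi)) *\<^sub>R (l s * (LINT \<sigma>|lborel. std_normal_density \<sigma> *\<^sub>R (iexp (\<eta> * \<sigma> * s) * ft a (\<eta> * \<sigma>)))) = l s * A n s"
        by simp
    qed
    finally show ?thesis unfolding \<eta>_def .
  qed
  have Ai: "integrable lborel (\<lambda>r. std_normal_density r *\<^sub>R a (s + r / real (Suc n)))" for s n
    by (rule bochner_bound[OF integrable_mult_left[OF integrable_std_normal, of B]])
       (auto intro!: AE_I2 mult_left_mono order_trans[OF ab abs_ge_self] simp: abs_mult)
  have Alim: "(\<lambda>n. A n s) \<longlonglongrightarrow> a s" for s
  proof -
    have "(\<lambda>n. LINT r|lborel. std_normal_density r *\<^sub>R a (s + r / real (Suc n))) \<longlonglongrightarrow> (LINT r|lborel. std_normal_density r *\<^sub>R a s)"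
    proof (rule Bochner_Integration.integral_dominated_convergence[where w = "\<lambda>r. std_normal_density r * B"])
      show "AE r in lborel. (\<lambda>n. std_normal_density r *\<^sub>R a (s + r / real (Suc n))) \<longlonglongrightarrow> std_normal_density r *\<^sub>R a s"
      proof (rule AE_I2)
        fix r
        have "(\<lambda>n. s + r * (1 / real (Suc n))) \<longlonglongrightarrow> s + r * 0" by (intro tendsto_intros LIMSEQ_Suc lim_1_over_n)
        then have "(\<lambda>n. s + r / real (Suc n)) \<longlonglongrightarrow> s" by simp
        from continuous_on_tendsto_compose[OF ac this]
        show "(\<lambda>n. std_normal_density r *\<^sub>R a (s + r / real (Suc n))) \<longlonglongrightarrow> std_normal_density r *\<^sub>R a s"
          by (intro tendsto_intros) auto
      qed
      show "integrable lborel (\<lambda>r. std_normal_density r * B)" by (intro integrable_mult_left integrable_std_normal)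
      show "AE r in lborel. norm (std_normal_density r *\<^sub>R a (s + r / real (Suc n))) \<le> std_normal_density r * B" for n
        by (intro AE_I2) (auto intro!: mult_left_mono ab)
    qed measurable
    moreover have "(LINT r|lborel. std_normal_density r *\<^sub>R a s) = a s"
      using integrable_std_normal by (simp add: integral_std_normal)
    ultimately show ?thesis by (simp add: A_def)
  qed
  have Abd: "norm (A n s) \<le> B" for n s
  proof -
    have "norm (A n s) \<le> (LINT r|lborel. std_normal_density r * B)"
      unfolding A_def
      by (rule Bochner_Integration.integral_norm_bound_integral[OF Ai integrable_mult_left[OF integrable_std_normal]])
         (auto intro!: mult_left_mono ab)
    then show ?thesis by (simp add: integral_std_normal)
  qed
  have Am [measurable]: "A n \<in> borel_measurable borel" for n unfolding A_def by measurable
  have "(\<lambda>n. LINT s|lborel. l s * A n s) \<longlonglongrightarrow> (LINT s|lborel. l s * a s)"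
  proof (rule Bochner_Integration.integral_dominated_convergence[where w = "\<lambda>s. norm (l s) * B"])
    show "AE s in lborel. (\<lambda>n. l s * A n s) \<longlonglongrightarrow> l s * a s" by (intro AE_I2 tendsto_intros Alim)
    show "integrable lborel (\<lambda>s. norm (l s) * B)" using li by simp
    show "AE s in lborel. norm (l s * A n s) \<le> norm (l s) * B" for n
      by (intro AE_I2) (auto simp: norm_mult intro!: mult_left_mono Abd)
  qed measurable
  then show ?thesis unfolding eq conv[OF am] .
qed

subsection \<open>Shifting the height\<close>

lemma exp_integral_complex:
  assumes z: "Re z > 0"
  shows "integrable lborel (\<lambda>u. indicat_real {0..} u *\<^sub>R exp (- z * complex_of_real u))"
    and "(LINT u|lborel. indicat_real {0..} u *\<^sub>R exp (- z * complex_of_real u)) = 1 / z"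
proof -
  let ?f = "\<lambda>u. exp (- z * complex_of_real u)"
  have "integrable lebesgue (\<lambda>u. indicat_real {0..} u *\<^sub>R exp (- Re z * u))"
    using exp_decay_integral(1)[OF z] by (simp add: set_integrable_def)
  then have e: "integrable lborel (\<lambda>u. indicat_real {0..} u *\<^sub>R exp (- Re z * u))"
    by (subst (asm) integrable_completion) auto
  show i: "integrable lborel (\<lambda>u. indicat_real {0..} u *\<^sub>R ?f u)"
    by (rule bochner_bound[OF e]) (auto simp: norm_exp_eq_Re)
  define F where "F u = - exp (- z * complex_of_real u) / z" for u
  have z0: "z \<noteq> 0" using z by auto
  have ev: "\<forall>\<^sub>F y in at_top. (LINT u|lborel. indicat_real {..y} u *\<^sub>R (indicat_real {0..} u *\<^sub>R ?f u)) = F y - F 0"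
    using eventually_ge_at_top[of 0]
  proof eventually_elim
    case (elim y)
    have "(LINT u|lborel. indicat_real {..y} u *\<^sub>R (indicat_real {0..} u *\<^sub>R ?f u)) = (LINT u|lborel. indicat_real {0..y} u *\<^sub>R ?f u)"
      by (rule Bochner_Integration.integral_cong) (auto simp: indicator_def)
    also have "\<dots> = F y - F 0"
    proof (rule integral_FTC_atLeastAtMost[OF elim])
      fix u
      have "((\<lambda>w. - exp (- z * w) / z) has_field_derivative ?f u) (at (complex_of_real u))"
        using z0 by (auto intro!: derivative_eq_intros)
      from field_vector_diff_chain_at[OF has_vector_derivative_of_real[OF DERIV_ident] this]
      show "(F has_vector_derivative ?f u) (at u within {0..y})"
        by (simp add: F_def[abs_def] comp_def has_vector_derivative_at_within)
    qed (intro continuous_intros)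
    finally show ?case .
  qed
  have tl: "((\<lambda>y. F y - F 0) \<longlongrightarrow> 0 - F 0) at_top"
  proof (intro tendsto_intros)
    have "((\<lambda>y. exp (- Re z * y) / norm z) \<longlongrightarrow> 0) at_top"
    proof -
      have "((\<lambda>y. exp (- Re z * y)) \<longlongrightarrow> 0) at_top"
        using z by (intro filterlim_compose[OF exp_at_bot] filterlim_tendsto_neg_mult_at_bot[OF tendsto_const _ filterlim_ident]) auto
      from tendsto_divide[OF this tendsto_const[of "norm z"]] z0 show ?thesis by simp
    qed
    then show "(F \<longlongrightarrow> 0) at_top"
      by (rule Lim_null_comparison[rotated]) (simp add: F_def norm_divide norm_exp_eq_Re)
  qed
  have "((\<lambda>y. LINT u|lborel. indicat_real {..y} u *\<^sub>R (indicat_real {0..} u *\<^sub>R ?f u)) \<longlongrightarrow> 0 - F 0) at_top"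
    by (rule tendsto_cong[OF ev, THEN iffD2, OF tl])
  moreover have "((\<lambda>y. LINT u|lborel. indicat_real {..y} u *\<^sub>R (indicat_real {0..} u *\<^sub>R ?f u)) \<longlongrightarrow> (LINT u|lborel. indicat_real {0..} u *\<^sub>R ?f u)) at_top"
    by (rule tendsto_integral_at_top[OF _ i]) simp
  ultimately have "(LINT u|lborel. indicat_real {0..} u *\<^sub>R ?f u) = 0 - F 0"
    using tendsto_unique[OF trivial_limit_at_top_linorder] by blast
  then show "(LINT u|lborel. indicat_real {0..} u *\<^sub>R ?f u) = 1 / z" by (simp add: F_def)
qed

lemma ft_exp_abs:
  assumes l: "\<omega> > 0"
  shows "integrable lborel (\<lambda>u. complex_of_real (exp (- \<omega> * \<bar>u\<bar>)))"
    and "ft (\<lambda>u. complex_of_real (exp (- \<omega> * \<bar>u\<bar>))) \<tau> = of_real (2 * \<omega> / (\<omega>\<^sup>2 + \<tau>\<^sup>2))"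
proof -
  define p where "p \<tau> u = indicat_real {0..} u *\<^sub>R exp (- (of_real \<omega> + \<i> * of_real \<tau>) * complex_of_real u)" for \<tau> u
  have pi: "integrable lborel (p \<tau>)" and pI: "(LINT u|lborel. p \<tau> u) = 1 / (of_real \<omega> + \<i> * of_real \<tau>)" for \<tau>
    unfolding p_def using exp_integral_complex[of "of_real \<omega> + \<i> * of_real \<tau>"] l by auto
  have pri: "integrable lborel (\<lambda>u. p \<tau> (- u))" for \<tau>
    using lborel_integrable_real_affine[OF pi[of \<tau>], of "-1" 0] by simp
  have pR: "(LINT u|lborel. p \<tau> (- u)) = (LINT u|lborel. p \<tau> u)" for \<tau>
    using lborel_integral_real_affine[of "-1" "p \<tau>" 0] by simp
  have eq: "complex_of_real (exp (- \<omega> * \<bar>u\<bar>)) * iexp (- (\<tau> * u)) = p \<tau> u + p (- \<tau>) (- u)" if "u \<noteq> 0" for u \<tau>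
    using that by (cases "u > 0") (auto simp: p_def exp_of_real[symmetric] exp_add[symmetric] algebra_simps)
  have ae: "AE u in lborel. p \<tau> u + p (- \<tau>) (- u) = complex_of_real (exp (- \<omega> * \<bar>u\<bar>)) * iexp (- (\<tau> * u))" for \<tau>
    using AE_lborel_singleton[of 0] by eventually_elim (rule eq[symmetric])
  have m: "(\<lambda>u. complex_of_real (exp (- \<omega> * \<bar>u\<bar>)) * iexp (- (\<tau> * u))) \<in> borel_measurable lborel" for \<tau> by measurable
  have s: "integrable lborel (\<lambda>u. p \<tau> u + p (- \<tau>) (- u))" for \<tau> by (intro Bochner_Integration.integrable_add pi pri)
  show "integrable lborel (\<lambda>u. complex_of_real (exp (- \<omega> * \<bar>u\<bar>)))"
    using integrable_cong_AE_imp[OF s m ae, of 0] by simp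
  have "ft (\<lambda>u. complex_of_real (exp (- \<omega> * \<bar>u\<bar>))) \<tau> = (LINT u|lborel. p \<tau> u + p (- \<tau>) (- u))"
    unfolding ft_def by (rule integral_cong_AE[OF m borel_measurable_integrable[OF s]]) (rule eventually_mono[OF ae[of \<tau>]], rule sym)
  also have "\<dots> = 1 / (of_real \<omega> + \<i> * of_real \<tau>) + 1 / (of_real \<omega> + \<i> * of_real (- \<tau>))"
    by (subst Bochner_Integration.integral_add[OF pi pri]) (simp only: pR pI)
  also have "\<dots> = of_real (2 * \<omega> / (\<omega>\<^sup>2 + \<tau>\<^sup>2))"
  proof -
    have nz: "of_real \<omega> + \<i> * of_real \<tau> \<noteq> 0" "of_real \<omega> - \<i> * of_real \<tau> \<noteq> 0"
      using l by (auto simp: complex_eq_iff)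
    have "(of_real \<omega> + \<i> * of_real \<tau>) * (of_real \<omega> - \<i> * of_real \<tau>) = of_real (\<omega>\<^sup>2 + \<tau>\<^sup>2)"
      by (simp add: algebra_simps power2_eq_square)
    then show ?thesis using nz by (simp add: add_frac_eq mult_2[symmetric])
  qed
  finally show "ft (\<lambda>u. complex_of_real (exp (- \<omega> * \<bar>u\<bar>))) \<tau> = of_real (2 * \<omega> / (\<omega>\<^sup>2 + \<tau>\<^sup>2))" .
qed

text \<open>Reflecting \<open>\<sigma>\<close> about the zero of \<open>t\<^sub>0 + \<eta> \<sigma>\<close> pairs every negative value of the odd function \<open>f\<close>
  with a positive one of larger weight.\<close>

lemma odd_against_decreasing_weight:
  fixes f m :: "real \<Rightarrow> real"
  assumes odd: "\<And>t. f (- t) = - f t" and pos: "\<And>t. t > 0 \<Longrightarrow> f t \<ge> 0"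
    and mdec: "\<And>x y. \<bar>x\<bar> \<le> \<bar>y\<bar> \<Longrightarrow> m y \<le> m x"
    and t0: "t0 > 0" and \<eta>: "\<eta> > 0"
    and i: "integrable lborel (\<lambda>\<sigma>. m \<sigma> * f (t0 + \<eta> * \<sigma>))"
  shows "0 \<le> (LINT \<sigma>|lborel. m \<sigma> * f (t0 + \<eta> * \<sigma>))"
proof -
  define I where "I = (LINT \<sigma>|lborel. m \<sigma> * f (t0 + \<eta> * \<sigma>))"
  define c where "c = t0 / \<eta>"
  have c: "c > 0" using t0 \<eta> by (simp add: c_def)
  have fz: "f 0 = 0" using odd[of 0] by simp
  have even: "m (- x) = m x" for x using mdec[of x "- x"] mdec[of "- x" x] by simp
  have ref: "m (- 2 * c + - 1 * \<sigma>) * f (t0 + \<eta> * (- 2 * c + - 1 * \<sigma>)) = - (m (\<sigma> + 2 * c) * f (t0 + \<eta> * \<sigma>))" for \<sigma>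
  proof -
    have "t0 + \<eta> * (- 2 * c + - 1 * \<sigma>) = - (t0 + \<eta> * \<sigma>)" using \<eta> by (simp add: c_def algebra_simps)
    moreover have "- 2 * c + - 1 * \<sigma> = - (\<sigma> + 2 * c)" by simp
    ultimately show ?thesis by (simp only: odd even)
  qed
  have "I = (LINT \<sigma>|lborel. m (- 2 * c + - 1 * \<sigma>) * f (t0 + \<eta> * (- 2 * c + - 1 * \<sigma>)))"
    unfolding I_def using lborel_integral_real_affine[of "-1" "\<lambda>\<sigma>. m \<sigma> * f (t0 + \<eta> * \<sigma>)" "- 2 * c"] by simp
  then have I1: "I = (LINT \<sigma>|lborel. - (m (\<sigma> + 2 * c) * f (t0 + \<eta> * \<sigma>)))" unfolding ref .
  have i2: "integrable lborel (\<lambda>\<sigma>. - (m (\<sigma> + 2 * c) * f (t0 + \<eta> * \<sigma>)))"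
    using lborel_integrable_real_affine[OF i, of "-1" "- 2 * c"] unfolding ref by simp
  have "I + I = (LINT \<sigma>|lborel. m \<sigma> * f (t0 + \<eta> * \<sigma>) + - (m (\<sigma> + 2 * c) * f (t0 + \<eta> * \<sigma>)))"
    unfolding Bochner_Integration.integral_add[OF i i2] I1[symmetric] by (simp add: I_def)
  also have "\<dots> \<ge> 0"
  proof (rule integral_nonneg_AE, rule AE_I2)
    fix \<sigma>
    have sq: "(\<sigma> + 2 * c)\<^sup>2 - \<sigma>\<^sup>2 = 4 * c * (\<sigma> + c)" by (simp add: power2_eq_square algebra_simps)
    have t: "t0 + \<eta> * \<sigma> = \<eta> * (\<sigma> + c)" using \<eta> by (simp add: c_def algebra_simps)
    have "0 \<le> (m \<sigma> - m (\<sigma> + 2 * c)) * f (t0 + \<eta> * \<sigma>)"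
    proof (cases "\<sigma> + c \<ge> 0")
      case True
      then have "\<sigma>\<^sup>2 \<le> (\<sigma> + 2 * c)\<^sup>2" using sq c by (smt (verit) mult_nonneg_nonneg)
      then have "m (\<sigma> + 2 * c) \<le> m \<sigma>" by (intro mdec) (simp add: abs_le_square_iff)
      moreover have "f (t0 + \<eta> * \<sigma>) \<ge> 0" using True \<eta> pos[of "t0 + \<eta> * \<sigma>"] fz unfolding t
        by (cases "\<sigma> + c = 0") (auto simp: zero_less_mult_iff)
      ultimately show ?thesis by simp
    next
      case False
      then have "4 * c * (\<sigma> + c) \<le> 0" using c by (simp add: mult_le_0_iff)
      then have "(\<sigma> + 2 * c)\<^sup>2 \<le> \<sigma>\<^sup>2" using sq by linarith
      then have "m \<sigma> \<le> m (\<sigma> + 2 * c)" by (intro mdec) (simp add: abs_le_square_iff)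
      moreover have "0 < - (t0 + \<eta> * \<sigma>)" using False \<eta> unfolding t by (simp add: mult_less_0_iff)
      then have "f (t0 + \<eta> * \<sigma>) \<le> 0" using pos[of "- (t0 + \<eta> * \<sigma>)"] odd[of "t0 + \<eta> * \<sigma>"] by simp
      ultimately show ?thesis by (simp add: mult_nonpos_nonpos)
    qed
    then show "0 \<le> m \<sigma> * f (t0 + \<eta> * \<sigma>) + - (m (\<sigma> + 2 * c) * f (t0 + \<eta> * \<sigma>))" by (simp add: algebra_simps)
  qed
  finally show ?thesis by (simp add: I_def)
qed

lemma sine_transform_damped_nonneg:
  fixes \<kappa> :: "real \<Rightarrow> real"
  assumes \<kappa>: "integrable lebesgue \<kappa>" and pos: "\<And>\<tau>. \<tau> > 0 \<Longrightarrow> 0 \<le> (LINT s|lebesgue. \<kappa> s * sin (\<tau> * s))"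
    and supp: "\<And>s. s < 0 \<Longrightarrow> \<kappa> s = 0"
    and l: "\<omega> > 0" and t0: "t0 > 0"
  shows "0 \<le> (LINT s|lebesgue. \<kappa> s * exp (- \<omega> * s) * sin (t0 * s))"
proof -
  define f where "f \<tau> = (LINT s|lebesgue. \<kappa> s * sin (\<tau> * s))" for \<tau>
  define k where "k s = complex_of_real (\<kappa> s * sin (t0 * s))" for s
  define a where "a u = complex_of_real (exp (- \<omega> * \<bar>u\<bar>))" for u
  have trig_m: "(\<lambda>s::real. sin (\<tau> * s)) \<in> borel_measurable lebesgue" "(\<lambda>s::real. cos (\<tau> * s)) \<in> borel_measurable lebesgue" for \<tau>
    by (intro measurable_lebesgue_continuous continuous_intros)+
  have bnd: "integrable lebesgue (\<lambda>s. \<kappa> s * g s)" if "g \<in> borel_measurable lebesgue" "\<And>s. \<bar>g s\<bar> \<le> 1" for g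
    by (rule bochner_bound[OF \<kappa>])
       (use that \<kappa> in \<open>auto intro!: borel_measurable_times AE_I2 mult_left_le simp: abs_mult\<close>)
  have si: "integrable lebesgue (\<lambda>s. \<kappa> s * sin (\<tau> * s))" for \<tau> by (rule bnd[OF trig_m(1)]) simp
  have ki: "integrable lebesgue k" unfolding k_def by (rule integrable_of_real[OF si])
  have odd: "f (- \<tau>) = - f \<tau>" for \<tau> by (simp add: f_def)
  have ac: "continuous_on UNIV a" unfolding a_def by (intro continuous_intros)
  have ab: "norm (a u) \<le> 1" for u using l by (simp add: a_def)
  have am [measurable]: "a \<in> borel_measurable borel" by (rule borel_measurable_continuous_onI[OF ac])
  have ai: "integrable lborel a" unfolding a_def by (rule ft_exp_abs(1)[OF l])
  have fa: "ft a \<tau> = of_real (2 * \<omega> / (\<omega>\<^sup>2 + \<tau>\<^sup>2))" for \<tau> unfolding a_def by (rule ft_exp_abs(2)[OF l])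
  have Rek: "Re (flt k \<tau>) = (f (t0 + \<tau>) + f (t0 + - \<tau>)) / 2" for \<tau>
  proof -
    have i: "integrable lebesgue (\<lambda>s. k s * iexp (\<tau> * s))"
      by (rule bochner_bound[OF ki])
         (rule borel_measurable_times[OF borel_measurable_integrable[OF ki] iexp_lebesgue], simp add: norm_mult)
    have "Re (flt k \<tau>) = (LINT s|lebesgue. Re (k s * iexp (\<tau> * s)))"
      by (rule integral_Re[OF i, symmetric])
    also have "\<dots> = (LINT s|lebesgue. (\<kappa> s * sin ((t0 + \<tau>) * s) + \<kappa> s * sin ((t0 + - \<tau>) * s)) / 2)"
    proof (rule bochner_cong)
      fix s
      have "sin ((t0 + \<tau>) * s) + sin ((t0 + - \<tau>) * s) = 2 * (sin (t0 * s) * cos (\<tau> * s))"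
        by (simp add: distrib_right left_diff_distrib sin_add sin_diff)
      then have "\<kappa> s * sin ((t0 + \<tau>) * s) + \<kappa> s * sin ((t0 + - \<tau>) * s) = 2 * (\<kappa> s * sin (t0 * s) * cos (\<tau> * s))"
        by (metis (no_types, opaque_lifting) distrib_left mult.assoc mult.left_commute)
      then show "Re (k s * iexp (\<tau> * s)) = (\<kappa> s * sin ((t0 + \<tau>) * s) + \<kappa> s * sin ((t0 + - \<tau>) * s)) / 2"
        by (simp add: k_def Re_exp)
    qed
    also have "\<dots> = (f (t0 + \<tau>) + f (t0 + - \<tau>)) / 2"
      unfolding f_def by (subst integral_divide_zero) (simp add: Bochner_Integration.integral_add[OF si si])
    finally show ?thesis .
  qed
  have term_nonneg: "0 \<le> Re ((\<eta> / sqrt (2 * pi)) *\<^sub>R (LINT \<sigma>|lborel. std_normal_density \<sigma> *\<^sub>R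
      ((flt k (\<eta> * \<sigma>)) * ft a (\<eta> * \<sigma>))))" if \<eta>: "\<eta> > 0" for \<eta>
  proof -
    define m where "m \<sigma> = std_normal_density \<sigma> * (2 * \<omega> / (\<omega>\<^sup>2 + (\<eta> * \<sigma>)\<^sup>2))" for \<sigma>
    have mdec: "m y \<le> m x" if "\<bar>x\<bar> \<le> \<bar>y\<bar>" for x y
    proof -
      have sq: "x\<^sup>2 \<le> y\<^sup>2" using that by (simp add: abs_le_square_iff)
      have "std_normal_density y \<le> std_normal_density x" using sq by (simp add: std_normal_density_def divide_right_mono)
      moreover have "2 * \<omega> / (\<omega>\<^sup>2 + (\<eta> * y)\<^sup>2) \<le> 2 * \<omega> / (\<omega>\<^sup>2 + (\<eta> * x)\<^sup>2)"
        using sq l \<eta> by (intro divide_left_mono add_left_mono mult_pos_pos add_pos_nonneg) (auto simp: power_mult_distrib mult_left_mono)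
      ultimately show ?thesis unfolding m_def using l by (intro mult_mono) auto
    qed
    have even: "m (- x) = m x" for x using mdec[of x "- x"] mdec[of "- x" x] by simp
    have gi: "integrable lborel (\<lambda>\<sigma>. std_normal_density \<sigma> *\<^sub>R ((flt k (\<eta> * \<sigma>)) * ft a (\<eta> * \<sigma>)))"
      by (rule gauss_parseval_integrable[OF ki am ai])
    have fm: "f \<in> borel_measurable borel"
    proof -
      have "f \<tau> = Im (LINT s|lebesgue. complex_of_real (\<kappa> s) * iexp (\<tau> * s))" for \<tau>
      proof -
        have i: "integrable lebesgue (\<lambda>s. complex_of_real (\<kappa> s) * iexp (\<tau> * s))"
          by (rule bochner_bound[OF \<kappa>])
             (rule borel_measurable_times[OF measurable_compose[OF borel_measurable_integrable[OF \<kappa>] borel_measurable_of_real] iexp_lebesgue], simp add: norm_mult)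
        show ?thesis unfolding f_def integral_Im[OF i, symmetric] by (simp add: Im_exp)
      qed
      then have feq: "f = (\<lambda>\<tau>. Im (LINT s|lebesgue. complex_of_real (\<kappa> s) * iexp (\<tau> * s)))" by (rule ext)
      note [measurable] = lebesgue_fourier_borel(1)[OF integrable_of_real[OF \<kappa>]]
      show ?thesis unfolding feq by measurable
    qed
    have fb: "\<bar>f \<tau>\<bar> \<le> (LINT s|lebesgue. \<bar>\<kappa> s\<bar>)" for \<tau>
    proof -
      have "norm (f \<tau>) \<le> (LINT s|lebesgue. norm (\<kappa> s * sin (\<tau> * s)))" unfolding f_def by (rule integral_norm_bound)
      also have "\<dots> \<le> (LINT s|lebesgue. \<bar>\<kappa> s\<bar>)"
        by (rule integral_mono[OF integrable_norm[OF si] integrable_abs[OF \<kappa>]]) (simp add: abs_mult mult_left_le)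
      finally show ?thesis by simp
    qed
    have mb: "0 \<le> m \<sigma>" "m \<sigma> \<le> std_normal_density \<sigma> * (2 / \<omega>)" for \<sigma>
    proof -
      show "0 \<le> m \<sigma>" using l by (simp add: m_def)
      have "2 * \<omega> / (\<omega>\<^sup>2 + (\<eta> * \<sigma>)\<^sup>2) \<le> 2 * \<omega> / \<omega>\<^sup>2"
        using l by (intro divide_left_mono) (auto intro!: mult_pos_pos add_pos_nonneg)
      also have "\<dots> = 2 / \<omega>" using l by (simp add: power2_eq_square)
      finally show "m \<sigma> \<le> std_normal_density \<sigma> * (2 / \<omega>)" unfolding m_def by (intro mult_left_mono) auto
    qed
    have mfi: "integrable lborel (\<lambda>\<sigma>. m \<sigma> * f (t0 + \<eta> * \<sigma>))"
    proof (rule bochner_bound[OF integrable_mult_left[OF integrable_std_normal, of "2 / \<omega> * (LINT s|lebesgue. \<bar>\<kappa> s\<bar>)"]])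
      show "(\<lambda>\<sigma>. m \<sigma> * f (t0 + \<eta> * \<sigma>)) \<in> borel_measurable lborel" using fm unfolding m_def by measurable
      show "AE \<sigma> in lborel. norm (m \<sigma> * f (t0 + \<eta> * \<sigma>)) \<le> norm (std_normal_density \<sigma> * (2 / \<omega> * (LINT s|lebesgue. \<bar>\<kappa> s\<bar>)))"
      proof (rule AE_I2)
        fix \<sigma>
        have "norm (m \<sigma> * f (t0 + \<eta> * \<sigma>)) = m \<sigma> * \<bar>f (t0 + \<eta> * \<sigma>)\<bar>" using mb(1) by (simp add: abs_mult)
        also have "\<dots> \<le> (std_normal_density \<sigma> * (2 / \<omega>)) * (LINT s|lebesgue. \<bar>\<kappa> s\<bar>)"
          using l by (intro mult_mono mb fb) auto
        also have "\<dots> \<le> norm (std_normal_density \<sigma> * (2 / \<omega> * (LINT s|lebesgue. \<bar>\<kappa> s\<bar>)))" using l by (simp add: mult.assoc)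
        finally show "norm (m \<sigma> * f (t0 + \<eta> * \<sigma>)) \<le> norm (std_normal_density \<sigma> * (2 / \<omega> * (LINT s|lebesgue. \<bar>\<kappa> s\<bar>)))" .
      qed
    qed
    have mfi': "integrable lborel (\<lambda>\<sigma>. m \<sigma> * f (t0 + - (\<eta> * \<sigma>)))"
      using lborel_integrable_real_affine[OF mfi, of "-1" 0] by (simp add: even)
    have flip: "(LINT \<sigma>|lborel. m \<sigma> * f (t0 + - (\<eta> * \<sigma>))) = (LINT \<sigma>|lborel. m \<sigma> * f (t0 + \<eta> * \<sigma>))"
      using lborel_integral_real_affine[of "-1" "\<lambda>\<sigma>. m \<sigma> * f (t0 + \<eta> * \<sigma>)" 0] by (simp add: even)
    have "Re (LINT \<sigma>|lborel. std_normal_density \<sigma> *\<^sub>R ((flt k (\<eta> * \<sigma>)) * ft a (\<eta> * \<sigma>))) =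
        (LINT \<sigma>|lborel. Re (std_normal_density \<sigma> *\<^sub>R ((flt k (\<eta> * \<sigma>)) * ft a (\<eta> * \<sigma>))))"
      by (rule integral_Re[OF gi, symmetric])
    also have "\<dots> = (LINT \<sigma>|lborel. (m \<sigma> * f (t0 + \<eta> * \<sigma>) + m \<sigma> * f (t0 + - (\<eta> * \<sigma>))) / 2)"
    proof (rule bochner_cong)
      fix \<sigma>
      have "Re (std_normal_density \<sigma> *\<^sub>R ((flt k (\<eta> * \<sigma>)) * ft a (\<eta> * \<sigma>))) =
          std_normal_density \<sigma> * (Re (flt k (\<eta> * \<sigma>)) * (2 * \<omega> / (\<omega>\<^sup>2 + (\<eta> * \<sigma>)\<^sup>2)))"
        unfolding fa by (simp del: of_real_divide of_real_mult of_real_add of_real_power)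
      moreover have "p * ((x + y) / 2 * D) = (p * D * x + p * D * y) / 2" for p x y D :: real by (simp add: algebra_simps)
      ultimately show "Re (std_normal_density \<sigma> *\<^sub>R ((flt k (\<eta> * \<sigma>)) * ft a (\<eta> * \<sigma>))) =
          (m \<sigma> * f (t0 + \<eta> * \<sigma>) + m \<sigma> * f (t0 + - (\<eta> * \<sigma>))) / 2"
        unfolding Rek m_def by (simp only:)
    qed
    also have "\<dots> = (LINT \<sigma>|lborel. m \<sigma> * f (t0 + \<eta> * \<sigma>))"
      unfolding integral_divide_zero Bochner_Integration.integral_add[OF mfi mfi'] flip by simp
    also have "\<dots> \<ge> 0"
      by (rule odd_against_decreasing_weight[OF odd _ mdec t0 \<eta> mfi]) (use pos in \<open>auto simp: f_def\<close>)
    finally show ?thesis using \<eta> by (simp add: zero_le_divide_iff zero_le_mult_iff)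
  qed
  have "(\<lambda>n. Re ((real (Suc n) / sqrt (2 * pi)) *\<^sub>R (LINT \<sigma>|lborel. std_normal_density \<sigma> *\<^sub>R
      ((LINT s|lebesgue. k s * iexp (real (Suc n) * \<sigma> * s)) * ft a (real (Suc n) * \<sigma>))))) \<longlonglongrightarrow> Re (LINT s|lebesgue. k s * a s)"
    by (rule tendsto_Re[OF gauss_parseval[OF ki ac ai ab]])
  then have "0 \<le> Re (LINT s|lebesgue. k s * a s)"
    by (rule LIMSEQ_le_const) (intro exI allI impI term_nonneg, simp)
  also have "(LINT s|lebesgue. k s * a s) = (LINT s|lebesgue. complex_of_real (\<kappa> s * exp (- \<omega> * s) * sin (t0 * s)))"
  proof (rule bochner_cong)
    fix s show "k s * a s = complex_of_real (\<kappa> s * exp (- \<omega> * s) * sin (t0 * s))"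
      using supp[of s] by (cases "s < 0") (auto simp: k_def a_def)
  qed
  also have "Re \<dots> = (LINT s|lebesgue. \<kappa> s * exp (- \<omega> * s) * sin (t0 * s))"
    unfolding integral_complex_of_real by simp
  finally show ?thesis .
qed

definition sine_pos :: "(real \<Rightarrow> 'a::chilbert \<Rightarrow> 'a) \<Rightarrow> bool" where
  "sine_pos K \<longleftrightarrow> (\<forall>\<tau> x. 0 \<le> \<tau> * Im (LINT s|lebesgue. cinner (Cz K s x) x * iexp (\<tau> * s)))"

lemma integrable_times_iexp:
  assumes "integrable lebesgue k" shows "integrable lebesgue (\<lambda>s. k s * iexp (\<tau> * s))"
  by (rule bochner_bound[OF assms])
     (rule borel_measurable_times[OF borel_measurable_integrable[OF assms] iexp_lebesgue], simp add: norm_mult)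

lemma sine_pos_damped:
  fixes K :: "real \<Rightarrow> 'a::chilbert \<Rightarrow> 'a"
  assumes K: "adm K" and sa: "AE s in lebesgue. s \<ge> 0 \<longrightarrow> selfadjoint_op (K s)"
    and sp: "sine_pos K" and w: "\<omega> > 0" and K': "adm (expw \<omega> K)"
  shows "sine_pos (expw \<omega> K)"
proof -
  define \<kappa> where "\<kappa> x s = Re (cinner (Cz K s x) x)" for x s
  have \<kappa>i: "integrable lebesgue (\<kappa> x)" for x
    unfolding \<kappa>_def by (intro integrable_Re Cz_integrable[OF K])
  have real: "AE s in lebesgue. cinner (Cz K s x) x = of_real (\<kappa> x s)" for x
    using sa
  proof eventually_elim
    case (elim s)
    show ?case
    proof (cases "s < 0")
      case False
      then have "cinner (K s x) x = cinner x (K s x)" using elim by (simp add: selfadjoint_op_def)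
      also have "\<dots> = cnj (cinner (K s x) x)" by (rule cinner_commute)
      finally have "Im (cinner (K s x) x) = 0" by (metis cnj.simps(2) neg_equal_zero)
      then show ?thesis using False by (simp add: \<kappa>_def Cz_def complex_eq_iff)
    qed (simp add: \<kappa>_def Cz_def)
  qed
  have tm: "(\<lambda>s::real. sin (\<tau> * s)) \<in> borel_measurable lebesgue" for \<tau>
    by (intro measurable_lebesgue_continuous continuous_intros)
  have ImF: "Im (LINT s|lebesgue. cinner (Cz L s x) x * iexp (\<tau> * s)) = (LINT s|lebesgue. e s * \<kappa> x s * sin (\<tau> * s))"
    if L: "adm L" and eL: "\<And>s. cinner (Cz L s x) x = of_real (e s) * cinner (Cz K s x) x" and em: "e \<in> borel_measurable lebesgue" for L e x \<tau>
  proof -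
    have "Im (LINT s|lebesgue. cinner (Cz L s x) x * iexp (\<tau> * s)) = (LINT s|lebesgue. Im (cinner (Cz L s x) x * iexp (\<tau> * s)))"
      by (rule integral_Im[OF integrable_times_iexp[OF Cz_integrable[OF L]], symmetric])
    also have "\<dots> = (LINT s|lebesgue. e s * \<kappa> x s * sin (\<tau> * s))"
    proof (rule integral_cong_AE)
      show "(\<lambda>s. Im (cinner (Cz L s x) x * iexp (\<tau> * s))) \<in> borel_measurable lebesgue"
        using integrable_Im[OF integrable_times_iexp[OF Cz_integrable[OF L, of x x], of \<tau>]] by (rule borel_measurable_integrable)
      show "(\<lambda>s. e s * \<kappa> x s * sin (\<tau> * s)) \<in> borel_measurable lebesgue"
        by (intro borel_measurable_times em tm borel_measurable_integrable[OF \<kappa>i])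
      show "AE s in lebesgue. Im (cinner (Cz L s x) x * iexp (\<tau> * s)) = e s * \<kappa> x s * sin (\<tau> * s)"
        using real[of x] by eventually_elim (simp add: eL Im_exp)
    qed
    finally show ?thesis .
  qed
  have pos: "0 \<le> (LINT s|lebesgue. \<kappa> x s * sin (\<tau> * s))" if "\<tau> > 0" for x \<tau>
    using sp[unfolded sine_pos_def, rule_format, of \<tau> x] that ImF[OF K, of x "\<lambda>s. 1" \<tau>]
    by (simp add: zero_le_mult_iff)
  have damped: "0 \<le> (LINT s|lebesgue. \<kappa> x s * exp (- \<omega> * s) * sin (\<tau> * s))" if "\<tau> > 0" for x \<tau>
    by (rule sine_transform_damped_nonneg[OF \<kappa>i pos _ w that]) (simp_all add: \<kappa>_def Cz_def)
  show ?thesis unfolding sine_pos_def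
  proof (intro allI)
    fix \<tau> x
    have *: "Im (LINT s|lebesgue. cinner (Cz (expw \<omega> K) s x) x * iexp (\<tau> * s)) =
        (LINT s|lebesgue. \<kappa> x s * exp (- \<omega> * s) * sin (\<tau> * s))"
      by (subst ImF[OF K', of x "\<lambda>s. exp (- \<omega> * s)"])
         (simp add: Cz_def wker_def cinner_scaleR_left, rule exp_measurable_lebesgue, simp add: mult_ac)
    show "0 \<le> \<tau> * Im (LINT s|lebesgue. cinner (Cz (expw \<omega> K) s x) x * iexp (\<tau> * s))"
      unfolding *
    proof (cases "\<tau> > 0")
      case True then show "0 \<le> \<tau> * (LINT s|lebesgue. \<kappa> x s * exp (- \<omega> * s) * sin (\<tau> * s))" using damped by simp
    next
      case False
      let ?I = "\<lambda>\<tau>. LINT s|lebesgue. \<kappa> x s * exp (- \<omega> * s) * sin (\<tau> * s)"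
      have "?I (- \<tau>) = - ?I \<tau>"
        unfolding Bochner_Integration.integral_minus[symmetric] by (rule Bochner_Integration.integral_cong) simp_all
      moreover have "0 \<le> (- \<tau>) * ?I (- \<tau>)"
      proof (cases "\<tau> = 0")
        case False then show ?thesis using damped[of "- \<tau>" x] \<open>\<not> \<tau> > 0\<close> by (intro mult_nonneg_nonneg) linarith+
      qed simp
      ultimately show "0 \<le> \<tau> * ?I \<tau>" by (metis minus_mult_minus)
    qed
  qed
qed

subsection \<open>Positivity of the derivative composed with the convolution\<close>

lemma integral_derivative_zero:
  fixes f f' :: "real \<Rightarrow> complex"
  assumes d: "\<And>t. (f has_vector_derivative f' t) (at t)" and c: "continuous_on UNIV f'"
    and z: "\<And>t. t \<notin> {a..b} \<Longrightarrow> f t = 0" "\<And>t. t \<notin> {a..b} \<Longrightarrow> f' t = 0" and ab: "a \<le> b"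
  shows "(LINT t|lborel. f' t) = 0"
proof -
  have "(LINT t|lborel. f' t) = (LINT t|lborel. indicat_real {a - 1..b + 1} t *\<^sub>R f' t)"
  proof (rule bochner_cong)
    fix t show "f' t = indicat_real {a - 1..b + 1} t *\<^sub>R f' t"
      using z(2)[of t] by (auto simp: indicator_def)
  qed
  also have "\<dots> = f (b + 1) - f (a - 1)"
    by (rule integral_FTC_atLeastAtMost)
       (use ab d in \<open>auto intro: has_vector_derivative_at_within continuous_on_subset[OF c]\<close>)
  also have "\<dots> = 0" using z(1)[of "b + 1"] z(1)[of "a - 1"] by simp
  finally show ?thesis .
qed

lemma ft_derivative:
  fixes g g' :: "real \<Rightarrow> real"
  assumes d: "\<And>t. (g has_real_derivative g' t) (at t)" and c: "continuous_on UNIV g" "continuous_on UNIV g'"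
    and z: "\<And>t. t \<notin> {a..b} \<Longrightarrow> g t = 0" "\<And>t. t \<notin> {a..b} \<Longrightarrow> g' t = 0" and ab: "a \<le> b"
  shows "ft (\<lambda>t. of_real (g' t)) \<tau> = \<i> * of_real \<tau> * ft (\<lambda>t. of_real (g t)) \<tau>"
proof -
  have i: "integrable lborel (\<lambda>t. complex_of_real (h t) * iexp (- (\<tau> * t)))"
    if "continuous_on UNIV h" "\<And>t. t \<notin> {a..b} \<Longrightarrow> h t = 0" for h
  proof -
    have "integrable lborel (\<lambda>t. indicat_real {a..b} t *\<^sub>R (complex_of_real (h t) * iexp (- (\<tau> * t))))"
      by (rule borel_integrable_compact) (auto intro!: continuous_intros continuous_on_subset[OF that(1)])
    moreover have "indicat_real {a..b} t *\<^sub>R (complex_of_real (h t) * iexp (- (\<tau> * t))) = complex_of_real (h t) * iexp (- (\<tau> * t))" for t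
      using that(2)[of t] by (auto simp: indicator_def)
    ultimately show ?thesis by simp
  qed
  have "(LINT t|lborel. of_real (g' t) * iexp (- (\<tau> * t)) - \<i> * of_real \<tau> * (of_real (g t) * iexp (- (\<tau> * t)))) = 0"
  proof (rule integral_derivative_zero[of "\<lambda>t. of_real (g t) * iexp (- (\<tau> * t))" _ a b])
    fix t
    have 1: "((\<lambda>t. complex_of_real (g t)) has_vector_derivative of_real (g' t)) (at t)"
      by (rule has_vector_derivative_of_real[OF d])
    have 2: "((\<lambda>t. iexp (- (\<tau> * t))) has_vector_derivative (- \<tau>) *\<^sub>R (\<i> * iexp (- (\<tau> * t)))) (at t)"
      using vector_diff_chain_at[OF _ has_vector_derivative_iexp, of "\<lambda>t. - (\<tau> * t)" "- \<tau>" t]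
        has_vector_derivative_mult_right[OF has_vector_derivative_id, of "- \<tau>" "at t"] by (simp add: comp_def)
    have "((\<lambda>t. of_real (g t) * iexp (- (\<tau> * t))) has_vector_derivative
        of_real (g t) * ((- \<tau>) *\<^sub>R (\<i> * iexp (- (\<tau> * t)))) + of_real (g' t) * iexp (- (\<tau> * t))) (at t)"
      by (rule has_vector_derivative_mult[OF 1 2])
    then show "((\<lambda>t. of_real (g t) * iexp (- (\<tau> * t))) has_vector_derivative
        of_real (g' t) * iexp (- (\<tau> * t)) - \<i> * of_real \<tau> * (of_real (g t) * iexp (- (\<tau> * t)))) (at t)"
      by (simp add: scaleR_conv_of_real algebra_simps)
  next
    show "continuous_on UNIV (\<lambda>t. of_real (g' t) * iexp (- (\<tau> * t)) - \<i> * of_real \<tau> * (of_real (g t) * iexp (- (\<tau> * t))))"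
      by (intro continuous_intros c)
  qed (use z ab in auto)
  moreover have "(LINT t|lborel. of_real (g' t) * iexp (- (\<tau> * t)) - \<i> * of_real \<tau> * (of_real (g t) * iexp (- (\<tau> * t)))) =
      ft (\<lambda>t. of_real (g' t)) \<tau> - \<i> * of_real \<tau> * ft (\<lambda>t. of_real (g t)) \<tau>"
    unfolding ft_def integral_mult_right_zero[symmetric]
    by (rule Bochner_Integration.integral_diff[OF i[OF c(2) z(2)] integrable_mult_right[OF i[OF c(1) z(1)]]])
  ultimately show ?thesis by simp
qed

definition corr :: "(real \<Rightarrow> real) \<Rightarrow> (real \<Rightarrow> real) \<Rightarrow> real \<Rightarrow> complex" where
  "corr g h s = (LINT t|lborel. of_real (g (t - s) * h t))"

lemma corr_props:
  fixes g h :: "real \<Rightarrow> real"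
  assumes gc: "continuous_on UNIV g" and hc: "continuous_on UNIV h"
    and gz: "\<And>t. t \<notin> {a..b} \<Longrightarrow> g t = 0" and hz: "\<And>t. t \<notin> {c..d} \<Longrightarrow> h t = 0"
  shows "continuous_on UNIV (corr g h)" "integrable lborel (corr g h)" "\<exists>B. \<forall>s. norm (corr g h s) \<le> B"
    "ft (corr g h) \<tau> = ft (\<lambda>t. of_real (h t)) \<tau> * cnj (ft (\<lambda>t. of_real (g t)) \<tau>)"
proof -
  obtain G where G: "G > 0" "\<And>t. \<bar>g t\<bar> \<le> G" using continuous_bounded_support[OF gc gz] by (metis real_norm_def)
  obtain H where H: "H > 0" "\<And>t. \<bar>h t\<bar> \<le> H" using continuous_bounded_support[OF hc hz] by (metis real_norm_def)
  have gm [measurable]: "g \<in> borel_measurable borel" and hm [measurable]: "h \<in> borel_measurable borel"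
    using gc hc by (auto intro: borel_measurable_continuous_onI)
  have ind: "integrable lborel (\<lambda>t. r * indicat_real {p..q} t)" for r p q :: real
    by (intro integrable_mult_right integrable_real_indicator) (auto simp: emeasure_lborel_Icc_eq)
  have bd: "\<bar>g (t - s) * h t\<bar> \<le> G * H * indicat_real {c..d} t" for s t
    using G(2)[of "t - s"] H(2)[of t] hz[of t] G(1) by (cases "t \<in> {c..d}") (auto simp: abs_mult intro!: mult_mono)
  have bd2: "\<bar>g (t - s) * h t\<bar> \<le> indicat_real {c - b..d - a} s * (G * H * indicat_real {c..d} t)" for s t
  proof (cases "s \<in> {c - b..d - a}")
    case True then show ?thesis using bd[of t s] by simp
  next
    case False
    then have "t - s \<notin> {a..b} \<or> t \<notin> {c..d}" by auto
    then show ?thesis using False gz hz by (auto simp: indicator_def)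
  qed
  show "\<exists>B. \<forall>s. norm (corr g h s) \<le> B"
  proof (intro exI allI)
    fix s
    show "norm (corr g h s) \<le> (LINT t|lborel. G * H * indicat_real {c..d} t)"
      unfolding corr_def
    proof (rule Bochner_Integration.integral_norm_bound_integral)
      show "integrable lborel (\<lambda>t. complex_of_real (g (t - s) * h t))"
        by (rule bochner_bound[OF ind[of "G * H" c d]])
           (simp_all add: norm_of_real order_trans[OF bd abs_ge_self] del: of_real_mult abs_mult)
    qed (use ind bd in \<open>auto simp: norm_of_real simp del: of_real_mult\<close>)
  qed
  have "isCont (corr g h) s" for s
    unfolding continuous_at_sequentially
  proof (intro allI impI, unfold comp_def)
    fix S :: "nat \<Rightarrow> real" assume S: "S \<longlonglongrightarrow> s"
    show "(\<lambda>n. corr g h (S n)) \<longlonglongrightarrow> corr g h s"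
      unfolding corr_def
    proof (rule Bochner_Integration.integral_dominated_convergence[where w = "\<lambda>t. G * H * indicat_real {c..d} t"])
      show "AE t in lborel. (\<lambda>n. complex_of_real (g (t - S n) * h t)) \<longlonglongrightarrow> complex_of_real (g (t - s) * h t)"
      proof (rule AE_I2)
        fix t
        have "(\<lambda>n. g (t - S n)) \<longlonglongrightarrow> g (t - s)"
          by (rule continuous_on_tendsto_compose[OF gc]) (auto intro!: tendsto_intros S)
        then show "(\<lambda>n. complex_of_real (g (t - S n) * h t)) \<longlonglongrightarrow> complex_of_real (g (t - s) * h t)"
          by (intro tendsto_intros)
      qed
    qed (use ind bd in \<open>auto simp: norm_of_real simp del: of_real_mult\<close>)
  qed
  then show "continuous_on UNIV (corr g h)" by (simp add: continuous_at_imp_continuous_on)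
  define F where "F = (\<lambda>(s, t). complex_of_real (g (t - s) * h t) * iexp (- (\<tau> * s)))"
  define F0 where "F0 = (\<lambda>(s, t). complex_of_real (g (t - s) * h t))"
  have [measurable]: "F \<in> borel_measurable (lborel \<Otimes>\<^sub>M lborel)" "F0 \<in> borel_measurable (lborel \<Otimes>\<^sub>M lborel)"
    unfolding F_def F0_def by measurable
  have Fi: "integrable (lborel \<Otimes>\<^sub>M lborel) F" "integrable (lborel \<Otimes>\<^sub>M lborel) F0"
    by (rule pair_integrable_dominated[OF _ ind[of 1 "c - b" "d - a", simplified] ind[of "G * H" c d]];
        use bd2 in \<open>simp add: F_def F0_def norm_mult norm_of_real del: of_real_mult\<close>)+
  show "integrable lborel (corr g h)"
    using lborel_pair.integrable_fst[OF Fi(2)[unfolded F0_def]] by (simp add: F0_def corr_def[abs_def] del: of_real_mult)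
  have cf: "cnj (ft (\<lambda>t. of_real (g t)) \<tau>) = (LINT u|lborel. of_real (g u) * iexp (\<tau> * u))"
    unfolding ft_def Bochner_Integration.integral_cnj[symmetric]
    by (rule Bochner_Integration.integral_cong) (simp_all add: exp_cnj)
  have "ft (corr g h) \<tau> = (LINT s|lborel. (LINT t|lborel. F (s, t)))"
    unfolding ft_def corr_def F_def prod.case integral_mult_left_zero ..
  also have "\<dots> = (LINT t|lborel. (LINT s|lborel. F (s, t)))"
    using lborel_pair.Fubini_integral[of "\<lambda>s t. F (s, t)"] Fi(1) by simp
  also have "\<dots> = (LINT t|lborel. (of_real (h t) * iexp (- (\<tau> * t))) * cnj (ft (\<lambda>t. of_real (g t)) \<tau>))"
  proof (rule bochner_cong)
    fix t
    have "(LINT s|lborel. F (s, t)) = (LINT u|lborel. F (t - u, t))"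
      using lborel_integral_real_affine[of "-1" "\<lambda>s. F (s, t)" t] by simp
    also have "\<dots> = (LINT u|lborel. (of_real (h t) * iexp (- (\<tau> * t))) * (of_real (g u) * iexp (\<tau> * u)))"
    proof (rule bochner_cong)
      fix u
      have "iexp (- (\<tau> * (t - u))) = iexp (- (\<tau> * t)) * iexp (\<tau> * u)"
        unfolding iexp_add[symmetric] by (simp add: algebra_simps)
      then show "F (t - u, t) = (of_real (h t) * iexp (- (\<tau> * t))) * (of_real (g u) * iexp (\<tau> * u))"
        unfolding F_def prod.case by simp
    qed
    also have "\<dots> = (of_real (h t) * iexp (- (\<tau> * t))) * cnj (ft (\<lambda>t. of_real (g t)) \<tau>)"
      unfolding integral_mult_right_zero cf ..
    finally show "(LINT s|lborel. F (s, t)) = (of_real (h t) * iexp (- (\<tau> * t))) * cnj (ft (\<lambda>t. of_real (g t)) \<tau>)" .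
  qed
  also have "\<dots> = ft (\<lambda>t. of_real (h t)) \<tau> * cnj (ft (\<lambda>t. of_real (g t)) \<tau>)"
    unfolding integral_mult_left_zero by (simp add: ft_def)
  finally show "ft (corr g h) \<tau> = ft (\<lambda>t. of_real (h t)) \<tau> * cnj (ft (\<lambda>t. of_real (g t)) \<tau>)" .
qed

lemma tsum_nth: "tsum xs t = (\<Sum>i<length xs. fst (xs ! i) t *\<^sub>R snd (xs ! i))"
  by (simp add: tsum_def sum_list_sum_nth atLeast0LessThan)

lemma derivative_convolution_positive_core:
  fixes K :: "real \<Rightarrow> 'a::chilbert \<Rightarrow> 'a" and \<rho> :: real
  assumes K: "adm K" and sp: "sine_pos K" and xs: "tests xs"
  defines "A \<equiv> emb \<rho> (tsum xs)" and "B \<equiv> emb \<rho> (tsum (dl xs))"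
  shows "0 \<le> Re (cinner (B - \<rho> *\<^sub>R A) (A - convop K A))"
proof -
  define n where "n = length xs"
  define x where "x i = snd (xs ! i)" for i
  define g where "g i t = exp (- \<rho> * t) * fst (xs ! i) t" for i t
  define g' where "g' i t = exp (- \<rho> * t) * (dvec (fst (xs ! i)) t - \<rho> * fst (xs ! i) t)" for i t
  have tf: "test_fn (fst (xs ! i))" if "i < n" for i using xs that by (simp add: tests_def n_def)
  have gd: "(g i has_real_derivative g' i t) (at t)" if "i < n" for i t
  proof -
    have f: "(fst (xs ! i) has_real_derivative dvec (fst (xs ! i)) t) (at t)"
      using smoothD(1)[OF test_fn_smooth[OF tf[OF that]]] by (simp add: has_real_derivative_iff_has_vector_derivative)
    show ?thesis unfolding g_def g'_def by (auto intro!: derivative_eq_intros f simp: algebra_simps)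
  qed
  have gc: "continuous_on UNIV (g i)" "continuous_on UNIV (g' i)" if "i < n" for i
    unfolding g_def g'_def
    by (intro continuous_intros smoothD(3) smoothD(2) test_fn_smooth tf that)+
  have "\<exists>a b. a < b \<and> (\<forall>t. t \<notin> {a..b} \<longrightarrow> g i t = 0 \<and> g' i t = 0)" if i: "i < n" for i
  proof -
    obtain a b where "a < b" "\<And>t. t \<notin> {a..b} \<Longrightarrow> fst (xs ! i) t = 0" "\<And>t. t \<notin> {a..b} \<Longrightarrow> dvec (fst (xs ! i)) t = 0"
      using test_fnD[OF tf[OF i]] by metis
    then show ?thesis by (intro exI[of _ a] exI[of _ b]) (simp add: g_def g'_def)
  qed
  then obtain lo hi where gz: "\<And>i. i < n \<Longrightarrow> lo i < hi i" "\<And>i t. i < n \<Longrightarrow> t \<notin> {lo i..hi i} \<Longrightarrow> g i t = 0"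
    "\<And>i t. i < n \<Longrightarrow> t \<notin> {lo i..hi i} \<Longrightarrow> g' i t = 0" by metis
  define \<psi> where "\<psi> t = exp (- \<rho> * t) *\<^sub>R tsum xs t" for t
  define \<psi>' where "\<psi>' t = exp (- \<rho> * t) *\<^sub>R (tsum (dl xs) t - \<rho> *\<^sub>R tsum xs t)" for t
  have \<psi>s: "\<psi> t = (\<Sum>i<n. g i t *\<^sub>R x i)" for t
    unfolding \<psi>_def tsum_nth n_def by (simp add: scaleR_sum_right g_def x_def)
  have \<psi>'s: "\<psi>' t = (\<Sum>i<n. g' i t *\<^sub>R x i)" for t
  proof -
    have "tsum (dl xs) t = (\<Sum>i<n. dvec (fst (xs ! i)) t *\<^sub>R x i)"
      unfolding tsum_nth n_def by (rule sum.cong) (auto simp: dl_def x_def)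
    then show ?thesis
      unfolding \<psi>'_def tsum_nth[of xs] n_def
      by (simp add: scaleR_sum_right g'_def x_def sum_subtractf[symmetric] scaleR_diff_left[symmetric])
  qed
  have L: "tsum xs \<in> L2w \<rho>" "tsum (dl xs) \<in> L2w \<rho>"
    by (intro test_fn_L2w test_fn_tsum xs tests_dl)+
  have \<psi>L: "L2 \<psi>" using L(1) unfolding L2w_iff \<psi>_def .
  have \<psi>'L: "L2 \<psi>'" unfolding \<psi>'_def using L2w_diff[OF L(2) L2w_scaleR[OF L(1), of \<rho>]] by (simp add: L2w_iff)
  have A: "A = abs_l2 \<psi>" by (simp add: A_def emb_def \<psi>_def[abs_def])
  have BA: "B - \<rho> *\<^sub>R A = abs_l2 \<psi>'"
    unfolding A_def B_def emb_scaleR[OF L(1), symmetric] emb_diff[OF L(2) L2w_scaleR[OF L(1)], symmetric]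
    by (simp add: emb_def \<psi>'_def[abs_def])
  have skew: "Re (cinner (abs_l2 \<psi>') (abs_l2 \<psi>)) = 0"
  proof -
    have tt: "test_fn (tsum xs)" by (rule test_fn_tsum[OF xs])
    obtain a b where ab: "a < b" "\<And>t. t \<notin> {a..b} \<Longrightarrow> tsum xs t = 0" "\<And>t. t \<notin> {a..b} \<Longrightarrow> dvec (tsum xs) t = 0"
      using test_fnD[OF tt] by metis
    have td: "(tsum xs has_vector_derivative tsum (dl xs) t) (at t)" for t
      using smoothD(1)[OF test_fn_smooth[OF tt]] by (simp add: dvec_tsum[OF xs])
    have e: "((\<lambda>t. exp (- \<rho> * t)) has_real_derivative - \<rho> * exp (- \<rho> * t)) (at t)" for t
      by (auto intro!: derivative_eq_intros)
    have \<psi>d: "(\<psi> has_vector_derivative \<psi>' t) (at t)" for t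
    proof -
      have "(\<psi> has_vector_derivative exp (- \<rho> * t) *\<^sub>R tsum (dl xs) t + (- \<rho> * exp (- \<rho> * t)) *\<^sub>R tsum xs t) (at t)"
        unfolding \<psi>_def by (rule has_vector_derivative_scaleR[OF e td])
      then show ?thesis by (simp add: \<psi>'_def scaleR_diff_right mult.commute)
    qed
    have \<psi>c: "continuous_on UNIV \<psi>" "continuous_on UNIV \<psi>'"
      unfolding \<psi>_def \<psi>'_def
      by (intro continuous_intros smoothD(3) test_fn_smooth test_fn_tsum xs tests_dl)+
    have \<psi>z: "\<psi> t = 0" "\<psi>' t = 0" if "t \<notin> {a..b}" for t
      using ab(2,3)[OF that] by (simp_all add: \<psi>_def \<psi>'_def dvec_tsum[OF xs])
    have "(LINT t|lborel. cinner (\<psi> t) (\<psi>' t) + cinner (\<psi>' t) (\<psi> t)) = 0"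
      by (rule integral_derivative_zero[of "\<lambda>t. cinner (\<psi> t) (\<psi> t)" _ a b])
         (use ab(1) \<psi>z in \<open>auto intro!: bounded_bilinear.has_vector_derivative[OF bounded_bilinear_cinner] \<psi>d continuous_intros cinner.continuous_on \<psi>c\<close>)
    moreover have "(LINT t|lborel. cinner (\<psi> t) (\<psi>' t) + cinner (\<psi>' t) (\<psi> t)) = (LINT t|lebesgue. cinner (\<psi> t) (\<psi>' t) + cinner (\<psi>' t) (\<psi> t))"
      by (rule integral_completion[symmetric])
         (auto intro!: borel_measurable_continuous_onI continuous_intros cinner.continuous_on \<psi>c)
    moreover have "\<dots> = cinner (abs_l2 \<psi>) (abs_l2 \<psi>') + cinner (abs_l2 \<psi>') (abs_l2 \<psi>)"
      unfolding cinner_abs_l2[OF \<psi>L \<psi>'L] cinner_abs_l2[OF \<psi>'L \<psi>L]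
      by (rule Bochner_Integration.integral_add[OF L2_integrable_cinner[OF \<psi>L \<psi>'L] L2_integrable_cinner[OF \<psi>'L \<psi>L]])
    ultimately have "Re (cinner (abs_l2 \<psi>) (abs_l2 \<psi>') + cinner (abs_l2 \<psi>') (abs_l2 \<psi>)) = 0" by simp
    then show ?thesis using Re_cinner_commute[of "abs_l2 \<psi>" "abs_l2 \<psi>'"] by simp
  qed
  define k where "k i j s = cinner (Cz K s (x i)) (x j)" for i j s
  have ki: "integrable lebesgue (k i j)" for i j unfolding k_def by (rule Cz_integrable[OF K])
  have cp: "continuous_on UNIV (corr (g i) (g' j))" "integrable lborel (corr (g i) (g' j))"
    "\<exists>B. \<forall>s. norm (corr (g i) (g' j) s) \<le> B"
    "ft (corr (g i) (g' j)) \<tau> = ft (\<lambda>t. of_real (g' j t)) \<tau> * cnj (ft (\<lambda>t. of_real (g i t)) \<tau>)"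
    if ij: "i < n" "j < n" for i j \<tau>
    using corr_props[of "g i" "g' j" "lo i" "hi i" "lo j" "hi j", OF gc(1)[OF ij(1)] gc(2)[OF ij(2)] gz(2)[OF ij(1)] gz(3)[OF ij(2)]]
    by auto
  have gm: "g i \<in> borel_measurable borel" "g' i \<in> borel_measurable borel" if "i < n" for i
    using gc[OF that] by (auto intro: borel_measurable_continuous_onI)
  have expand: "cinner (convop K (abs_l2 \<psi>)) (abs_l2 \<psi>') = (\<Sum>i<n. \<Sum>j<n. (LINT s|lebesgue. k i j s * corr (g i) (g' j) s))"
  proof -
    have kci: "integrable lebesgue (\<lambda>s. k i j s * corr (g i) (g' j) s)" if ij: "i < n" "j < n" for i j
    proof -
      obtain Bd where Bd: "\<And>s. norm (corr (g i) (g' j) s) \<le> Bd" using cp(3)[OF ij] by blast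
      have cm: "corr (g i) (g' j) \<in> borel_measurable lebesgue"
        by (rule measurable_lebesgue_continuous) (rule cp(1)[OF ij])
      show ?thesis
      proof (rule bochner_bound[OF integrable_mult_left[OF integrable_norm[OF ki[of i j]], of Bd]])
        show "(\<lambda>s. k i j s * corr (g i) (g' j) s) \<in> borel_measurable lebesgue"
          by (rule borel_measurable_times[OF borel_measurable_integrable[OF ki] cm])
        show "AE s in lebesgue. norm (k i j s * corr (g i) (g' j) s) \<le> norm (norm (k i j s) * Bd)"
          using Bd order_trans[OF norm_ge_zero Bd] by (auto intro!: AE_I2 mult_left_mono simp: norm_mult abs_mult)
      qed
    qed
    have "cinner (convop K (abs_l2 \<psi>)) (abs_l2 \<psi>') = (LINT s|lebesgue. (\<Sum>i<n. \<Sum>j<n. k i j s * corr (g i) (g' j) s))"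
      unfolding cinner_convop[OF K] set_lebesgue_integral_def
    proof (rule bochner_cong)
      fix s
      show "indicat_real {0..} s *\<^sub>R cinner (ptop (K s) (shiftop s (abs_l2 \<psi>))) (abs_l2 \<psi>') = (\<Sum>i<n. \<Sum>j<n. k i j s * corr (g i) (g' j) s)"
      proof (cases "s \<ge> 0")
        case False then show ?thesis by (simp add: k_def Cz_def)
      next
        case True
        have bK: "bounded_clinear_op (K s)" by (rule adm_bounded[OF K True])
        have Ks: "K s (\<Sum>i<n. c i *\<^sub>R x i) = (\<Sum>i<n. c i *\<^sub>R K s (x i))" for c
          by (simp add: linear_sum[OF bounded_linear.linear[OF bounded_clinear_opD(1)[OF bK]]] bounded_clinear_opD(4)[OF bK])
        have i1: "integrable lebesgue (\<lambda>t. complex_of_real (g i (t - s) * g' j t))" if ij: "i < n" "j < n" for i j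
        proof -
          have "continuous_on UNIV (\<lambda>t. complex_of_real (g i (t - s) * g' j t))"
            by (intro continuous_intros gc ij continuous_on_compose2[OF gc(1)[OF ij(1)]]) auto
          then have "integrable lborel (\<lambda>t. indicat_real {lo j..hi j} t *\<^sub>R complex_of_real (g i (t - s) * g' j t))"
            by (intro borel_integrable_compact) (auto intro: continuous_on_subset)
          moreover have "(\<lambda>t. indicat_real {lo j..hi j} t *\<^sub>R complex_of_real (g i (t - s) * g' j t)) = (\<lambda>t. complex_of_real (g i (t - s) * g' j t))"
            using gz(3)[OF ij(2)] by (auto simp: indicator_def)
          ultimately have "integrable lborel (\<lambda>t. complex_of_real (g i (t - s) * g' j t))" by simp
          then show ?thesis using gm ij by (subst integrable_completion) auto
        qed
        have c1: "(LINT t|lebesgue. complex_of_real (g i (t - s) * g' j t)) = corr (g i) (g' j) s" if ij: "i < n" "j < n" for i j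
        proof -
          have [measurable]: "g i \<in> borel_measurable borel" "g' j \<in> borel_measurable borel" using gm ij by auto
          show ?thesis unfolding corr_def by (rule integral_completion) measurable
        qed
        have "cinner (ptop (K s) (shiftop s (abs_l2 \<psi>))) (abs_l2 \<psi>') = (LINT t|lebesgue. cinner (K s (\<psi> (t - s))) (\<psi>' t))"
          unfolding shiftop_abs[OF \<psi>L] ptop_abs[OF bK L2_shift[OF \<psi>L]]
          by (rule cinner_abs_l2[OF L2_pt[OF bK L2_shift[OF \<psi>L]] \<psi>'L])
        also have "\<dots> = (LINT t|lebesgue. (\<Sum>i<n. \<Sum>j<n. k i j s * complex_of_real (g i (t - s) * g' j t)))"
        proof (rule bochner_cong)
          fix t
          show "cinner (K s (\<psi> (t - s))) (\<psi>' t) = (\<Sum>i<n. \<Sum>j<n. k i j s * complex_of_real (g i (t - s) * g' j t))"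
            unfolding \<psi>s \<psi>'s Ks cinner_sum_left cinner_sum_right using True
            by (subst sum.swap) (intro sum.cong refl, simp add: cinner_simps k_def Cz_def)
        qed
        also have "\<dots> = (\<Sum>i<n. (LINT t|lebesgue. (\<Sum>j<n. k i j s * complex_of_real (g i (t - s) * g' j t))))"
          by (rule Bochner_Integration.integral_sum) (use i1 in \<open>auto intro!: Bochner_Integration.integrable_sum integrable_mult_right simp del: of_real_mult\<close>)
        also have "\<dots> = (\<Sum>i<n. \<Sum>j<n. k i j s * corr (g i) (g' j) s)"
        proof (rule sum.cong[OF refl])
          fix i assume i: "i \<in> {..<n}"
          have "(LINT t|lebesgue. (\<Sum>j<n. k i j s * complex_of_real (g i (t - s) * g' j t))) = (\<Sum>j<n. (LINT t|lebesgue. k i j s * complex_of_real (g i (t - s) * g' j t)))"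
            by (rule Bochner_Integration.integral_sum) (use i1 i in \<open>auto intro!: integrable_mult_right simp del: of_real_mult\<close>)
          also have "\<dots> = (\<Sum>j<n. k i j s * corr (g i) (g' j) s)"
            unfolding integral_mult_right_zero using c1 i by (intro sum.cong) auto
          finally show "(LINT t|lebesgue. (\<Sum>j<n. k i j s * complex_of_real (g i (t - s) * g' j t))) = (\<Sum>j<n. k i j s * corr (g i) (g' j) s)" .
        qed
        finally show ?thesis using True by simp
      qed
    qed
    also have "\<dots> = (\<Sum>i<n. (LINT s|lebesgue. (\<Sum>j<n. k i j s * corr (g i) (g' j) s)))"
      by (rule Bochner_Integration.integral_sum) (auto intro!: Bochner_Integration.integrable_sum kci)
    also have "\<dots> = (\<Sum>i<n. \<Sum>j<n. (LINT s|lebesgue. k i j s * corr (g i) (g' j) s))"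
      by (intro sum.cong refl Bochner_Integration.integral_sum kci) auto
    finally show ?thesis .
  qed
  define J where "J \<eta> i j = (\<eta> / sqrt (2 * pi)) *\<^sub>R (LINT \<sigma>|lborel. std_normal_density \<sigma> *\<^sub>R
      ((flt (k i j) (\<eta> * \<sigma>)) * ft (corr (g i) (g' j)) (\<eta> * \<sigma>)))" for \<eta> i j
  have "(\<lambda>m. \<Sum>i<n. \<Sum>j<n. J (real (Suc m)) i j) \<longlonglongrightarrow> (\<Sum>i<n. \<Sum>j<n. (LINT s|lebesgue. k i j s * corr (g i) (g' j) s))"
  proof (intro tendsto_sum)
    fix i j assume ij: "i \<in> {..<n}" "j \<in> {..<n}"
    then have ij: "i < n" "j < n" by auto
    obtain Bd where Bd: "\<And>s. norm (corr (g i) (g' j) s) \<le> Bd" using cp(3)[OF ij] by blast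
    show "(\<lambda>m. J (real (Suc m)) i j) \<longlonglongrightarrow> (LINT s|lebesgue. k i j s * corr (g i) (g' j) s)"
      unfolding J_def
      by (rule gauss_parseval[OF ki cp(1)[OF ij] cp(2)[OF ij] Bd])
  qed
  then have lim: "(\<lambda>m. Re (\<Sum>i<n. \<Sum>j<n. J (real (Suc m)) i j)) \<longlonglongrightarrow> Re (cinner (convop K (abs_l2 \<psi>)) (abs_l2 \<psi>'))"
    unfolding expand by (rule tendsto_Re)
  have Jneg: "Re (\<Sum>i<n. \<Sum>j<n. J \<eta> i j) \<le> 0" if \<eta>: "\<eta> > 0" for \<eta>
  proof -
    define Q where "Q i j \<sigma> = std_normal_density \<sigma> *\<^sub>R ((flt (k i j) (\<eta> * \<sigma>)) * ft (corr (g i) (g' j)) (\<eta> * \<sigma>))" for i j \<sigma>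
    have Qi: "integrable lborel (Q i j)" if ij: "i < n" "j < n" for i j
      unfolding Q_def
      by (rule gauss_parseval_integrable[OF ki borel_measurable_continuous_onI[OF cp(1)[OF ij]] cp(2)[OF ij]])
    have "(\<Sum>i<n. \<Sum>j<n. J \<eta> i j) = (\<eta> / sqrt (2 * pi)) *\<^sub>R (\<Sum>i<n. \<Sum>j<n. (LINT \<sigma>|lborel. Q i j \<sigma>))"
      unfolding J_def Q_def scaleR_sum_right ..
    also have "(\<Sum>i<n. \<Sum>j<n. (LINT \<sigma>|lborel. Q i j \<sigma>)) = (\<Sum>i<n. (LINT \<sigma>|lborel. (\<Sum>j<n. Q i j \<sigma>)))"
      by (intro sum.cong refl Bochner_Integration.integral_sum[symmetric] Qi) auto
    also have "\<dots> = (LINT \<sigma>|lborel. (\<Sum>i<n. \<Sum>j<n. Q i j \<sigma>))"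
      by (rule Bochner_Integration.integral_sum[symmetric]) (auto intro!: Bochner_Integration.integrable_sum Qi)
    finally have "Re (\<Sum>i<n. \<Sum>j<n. J \<eta> i j) = (\<eta> / sqrt (2 * pi)) * Re (LINT \<sigma>|lborel. (\<Sum>i<n. \<Sum>j<n. Q i j \<sigma>))" by simp
    also have "Re (LINT \<sigma>|lborel. (\<Sum>i<n. \<Sum>j<n. Q i j \<sigma>)) = (LINT \<sigma>|lborel. Re (\<Sum>i<n. \<Sum>j<n. Q i j \<sigma>))"
      by (rule integral_Re[symmetric]) (auto intro!: Bochner_Integration.integrable_sum Qi)
    also have "(LINT \<sigma>|lborel. Re (\<Sum>i<n. \<Sum>j<n. Q i j \<sigma>)) \<le> 0"
    proof -
      have "Re (\<Sum>i<n. \<Sum>j<n. Q i j \<sigma>) \<le> 0" for \<sigma>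
      proof -
        define \<tau> where "\<tau> = \<eta> * \<sigma>"
        define G where "G i = ft (\<lambda>t. complex_of_real (g i t)) \<tau>" for i
        define \<xi> where "\<xi> = (\<Sum>i<n. cnj (G i) *\<^sub>C x i)"
        have ftc: "ft (corr (g i) (g' j)) \<tau> = \<i> * of_real \<tau> * G j * cnj (G i)" if ij: "i < n" "j < n" for i j
          unfolding cp(4)[OF ij]
          using ft_derivative[of "g j" "g' j" "lo j" "hi j" \<tau>, OF gd[OF ij(2)] gc[OF ij(2)] gz(2)[OF ij(2)] gz(3)[OF ij(2)]] gz(1)[OF ij(2)]
          by (simp add: G_def)
        have Cl: "Cz K s (\<Sum>i<n. c i *\<^sub>C x i) = (\<Sum>i<n. c i *\<^sub>C Cz K s (x i))" for s c
        proof (cases "s < 0")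
          case False
          then have bK: "bounded_clinear_op (K s)" by (intro adm_bounded[OF K]) simp
          show ?thesis using False
            by (simp add: Cz_def linear_sum[OF bounded_linear.linear[OF bounded_clinear_opD(1)[OF bK]]] bounded_clinear_opD(3)[OF bK])
        qed (simp add: Cz_def)
        have "(LINT s|lebesgue. cinner (Cz K s \<xi>) \<xi> * iexp (\<tau> * s)) = (LINT s|lebesgue. (\<Sum>i<n. \<Sum>j<n. (cnj (G i) * G j) * (k i j s * iexp (\<tau> * s))))"
        proof (rule bochner_cong)
          fix s
          show "cinner (Cz K s \<xi>) \<xi> * iexp (\<tau> * s) = (\<Sum>i<n. \<Sum>j<n. (cnj (G i) * G j) * (k i j s * iexp (\<tau> * s)))"
            unfolding \<xi>_def Cl cinner_sum_left cinner_sum_right sum_distrib_right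
            by (subst sum.swap) (intro sum.cong refl, simp add: cinner_simps k_def mult_ac)
        qed
        also have "\<dots> = (\<Sum>i<n. (LINT s|lebesgue. (\<Sum>j<n. (cnj (G i) * G j) * (k i j s * iexp (\<tau> * s)))))"
          by (rule Bochner_Integration.integral_sum) (intro Bochner_Integration.integrable_sum integrable_mult_right integrable_times_iexp ki)
        also have "\<dots> = (\<Sum>i<n. \<Sum>j<n. (cnj (G i) * G j) * (flt (k i j) \<tau>))"
          unfolding integral_mult_right_zero[symmetric]
          by (intro sum.cong refl Bochner_Integration.integral_sum integrable_mult_right integrable_times_iexp ki)
        finally have q: "(LINT s|lebesgue. cinner (Cz K s \<xi>) \<xi> * iexp (\<tau> * s)) = (\<Sum>i<n. \<Sum>j<n. (cnj (G i) * G j) * (flt (k i j) \<tau>))" .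
        have "(\<Sum>i<n. \<Sum>j<n. Q i j \<sigma>) = (\<Sum>i<n. \<Sum>j<n. (of_real (std_normal_density \<sigma>) * (\<i> * of_real \<tau>)) * ((cnj (G i) * G j) * (flt (k i j) \<tau>)))"
          unfolding Q_def \<tau>_def[symmetric] by (intro sum.cong refl) (simp add: ftc scaleR_conv_of_real mult_ac)
        also have "\<dots> = (of_real (std_normal_density \<sigma>) * (\<i> * of_real \<tau>)) * (LINT s|lebesgue. cinner (Cz K s \<xi>) \<xi> * iexp (\<tau> * s))"
          unfolding q sum_distrib_left ..
        finally have "Re (\<Sum>i<n. \<Sum>j<n. Q i j \<sigma>) = - std_normal_density \<sigma> * (\<tau> * Im (LINT s|lebesgue. cinner (Cz K s \<xi>) \<xi> * iexp (\<tau> * s)))"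
          by simp
        then show ?thesis using sp[unfolded sine_pos_def, rule_format, of \<tau> \<xi>] by (simp add: mult_nonneg_nonneg)
      qed
      then have "0 \<le> (LINT \<sigma>|lborel. - Re (\<Sum>i<n. \<Sum>j<n. Q i j \<sigma>))" by (intro integral_nonneg_AE AE_I2) simp
      then show ?thesis by simp
    qed
    finally show ?thesis using \<eta> by (simp add: divide_right_mono mult_left_mono)
  qed
  have "Re (cinner (convop K (abs_l2 \<psi>)) (abs_l2 \<psi>')) \<le> 0"
    by (rule LIMSEQ_le_const2[OF lim]) (intro exI allI impI Jneg, simp)
  then show ?thesis
    unfolding BA unfolding A cinner_diff_right using skew Re_cinner_commute[of "abs_l2 \<psi>'" "convop K (abs_l2 \<psi>)"] by simp
qed

lemma derivative_convolution_positive: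
  fixes K :: "real \<Rightarrow> 'a::chilbert \<Rightarrow> 'a" and z :: "'a l2"
  assumes K: "adm K" and sp: "sine_pos K" and eps: "\<epsilon> > 0" "1 + \<epsilon> * \<rho> > 0"
  shows "0 \<le> Re (cinner ((1/\<epsilon>) *\<^sub>R (z - Rop \<epsilon> \<rho> z) - \<rho> *\<^sub>R Rop \<epsilon> \<rho> z) (Rop \<epsilon> \<rho> z - convop K (Rop \<epsilon> \<rho> z)))"
proof -
  have z: "z \<in> closure {emb \<rho> (tsum xs) + \<epsilon> *\<^sub>R emb \<rho> (tsum (dl xs)) | xs. tests xs}"
    unfolding resolvent_range_dense[OF eps] by simp
  obtain X where X: "\<And>n. X n \<in> {emb \<rho> (tsum xs) + \<epsilon> *\<^sub>R emb \<rho> (tsum (dl xs)) | xs. tests xs}" "X \<longlonglongrightarrow> z"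
    using z unfolding closure_sequential by blast
  note R = bounded_linear.tendsto[OF bounded_clinear_opD(1)[OF Rop_clinear[OF eps]]]
  note T = bounded_linear.tendsto[OF bounded_clinear_opD(1)[OF convop_clinear[OF K]]]
  have lim: "(\<lambda>n. Re (cinner ((1/\<epsilon>) *\<^sub>R (X n - Rop \<epsilon> \<rho> (X n)) - \<rho> *\<^sub>R Rop \<epsilon> \<rho> (X n)) (Rop \<epsilon> \<rho> (X n) - convop K (Rop \<epsilon> \<rho> (X n))))) \<longlonglongrightarrow>
    Re (cinner ((1/\<epsilon>) *\<^sub>R (z - Rop \<epsilon> \<rho> z) - \<rho> *\<^sub>R Rop \<epsilon> \<rho> z) (Rop \<epsilon> \<rho> z - convop K (Rop \<epsilon> \<rho> z)))"
    by (intro tendsto_Re cinner.tendsto tendsto_diff tendsto_scaleR tendsto_const R T X(2))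
  show ?thesis
  proof (rule LIMSEQ_le_const[OF lim], intro exI allI impI)
    fix n
    obtain xs where xs: "X n = emb \<rho> (tsum xs) + \<epsilon> *\<^sub>R emb \<rho> (tsum (dl xs))" "tests xs" using X(1)[of n] by blast
    have r: "Rop \<epsilon> \<rho> (X n) = emb \<rho> (tsum xs)"
      using Rop_test_fn[OF eps test_fn_tsum[OF xs(2)]] by (simp add: xs(1) dvec_tsum[OF xs(2)])
    have "(1/\<epsilon>) *\<^sub>R (X n - Rop \<epsilon> \<rho> (X n)) = emb \<rho> (tsum (dl xs))" unfolding r using eps by (simp add: xs(1))
    then show "0 \<le> Re (cinner ((1/\<epsilon>) *\<^sub>R (X n - Rop \<epsilon> \<rho> (X n)) - \<rho> *\<^sub>R Rop \<epsilon> \<rho> (X n)) (Rop \<epsilon> \<rho> (X n) - convop K (Rop \<epsilon> \<rho> (X n))))"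
      using derivative_convolution_positive_core[OF K sp xs(2), of \<rho>] by (simp add: r)
  qed
qed

subsection \<open>Abstract solution theory\<close>

lemma fixpoint_related:
  fixes T1 T2 :: "'b::real_normed_vector \<Rightarrow> 'b"
  assumes k: "0 \<le> k" "k < 1"
    and c1: "\<And>x y. norm (T1 x - T1 y) \<le> k * norm (x - y)" and c2: "\<And>x y. norm (T2 x - T2 y) \<le> k * norm (x - y)"
    and fix1: "T1 x1 = x1" and fix2: "T2 x2 = x2"
    and zero: "Cm 0 0" and step: "\<And>x y. Cm x y \<Longrightarrow> Cm (T1 x) (T2 y)"
    and closed: "\<And>X Y x y. (\<And>n::nat. Cm (X n) (Y n)) \<Longrightarrow> X \<longlonglongrightarrow> x \<Longrightarrow> Y \<longlonglongrightarrow> y \<Longrightarrow> Cm x y"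
  shows "Cm x1 x2"
proof -
  have conv: "(\<lambda>n. (T ^^ n) 0) \<longlonglongrightarrow> x" if c: "\<And>x y. norm (T x - T y) \<le> k * norm (x - y)" and f: "T x = x" for T :: "'b \<Rightarrow> 'b" and x
  proof -
    have b: "norm ((T ^^ n) 0 - x) \<le> k ^ n * norm x" for n
    proof (induction n)
      case (Suc n)
      have "norm ((T ^^ Suc n) 0 - x) \<le> k * norm ((T ^^ n) 0 - x)" using c[of "(T ^^ n) 0" x] f by simp
      also have "\<dots> \<le> k * (k ^ n * norm x)" using Suc k by (intro mult_left_mono) auto
      finally show ?case by (simp add: mult.assoc)
    qed simp
    have "(\<lambda>n. k ^ n * norm x) \<longlonglongrightarrow> 0" using k by (intro tendsto_mult_left_zero LIMSEQ_realpow_zero) auto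
    then have "(\<lambda>n. (T ^^ n) 0 - x) \<longlonglongrightarrow> 0"
      using Lim_null_comparison[of "\<lambda>n. (T ^^ n) 0 - x" "\<lambda>n. k ^ n * norm x" sequentially] b by simp
    then show ?thesis by (rule LIM_zero_cancel)
  qed
  have "Cm ((T1 ^^ n) 0) ((T2 ^^ n) 0)" for n
    by (induction n) (auto intro: zero step)
  then show ?thesis by (rule closed[OF _ conv[OF c1 fix1] conv[OF c2 fix2]])
qed

text \<open>\<open>R \<epsilon>\<close> plays the role of \<open>(1 + \<epsilon> \<partial>)\<^sup>-\<^sup>1\<close>, \<open>P\<close> is the graph of \<open>A\<close> with resolvents \<open>J\<close>, and \<open>E\<close> is a
  dense set of smooth right-hand sides.\<close>

locale evolution =
  fixes K :: "'b::chilbert \<Rightarrow> 'b" and R :: "real \<Rightarrow> 'b \<Rightarrow> 'b" and P :: "'b \<Rightarrow> 'b \<Rightarrow> bool"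
    and J :: "real \<Rightarrow> 'b \<Rightarrow> 'b" and E :: "'b set" and \<rho> q c :: real
  assumes K: "bounded_linear K" and Kq: "\<And>u. norm (K u) \<le> q * norm u" and q: "0 \<le> q" "q < 1"
    and R: "\<And>\<epsilon>. \<epsilon> > 0 \<Longrightarrow> 1 + \<epsilon> * \<rho> > 0 \<Longrightarrow> bounded_linear (R \<epsilon>)"
    and Rn: "\<And>\<epsilon> u. \<epsilon> > 0 \<Longrightarrow> 1 + \<epsilon> * \<rho> > 0 \<Longrightarrow> norm (R \<epsilon> u) \<le> 1 / (1 + \<epsilon> * \<rho>) * norm u"
    and RK: "\<And>\<epsilon> u. \<epsilon> > 0 \<Longrightarrow> 1 + \<epsilon> * \<rho> > 0 \<Longrightarrow> R \<epsilon> (K u) = K (R \<epsilon> u)"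
    and RR: "\<And>\<epsilon> \<delta> u. \<epsilon> > 0 \<Longrightarrow> 1 + \<epsilon> * \<rho> > 0 \<Longrightarrow> \<delta> > 0 \<Longrightarrow> 1 + \<delta> * \<rho> > 0 \<Longrightarrow> R \<epsilon> (R \<delta> u) = R \<delta> (R \<epsilon> u)"
    and RP: "\<And>\<epsilon> u a. \<epsilon> > 0 \<Longrightarrow> 1 + \<epsilon> * \<rho> > 0 \<Longrightarrow> P u a \<Longrightarrow> P (R \<epsilon> u) (R \<epsilon> a)"
    and Rres: "\<And>\<epsilon> \<delta> z. \<epsilon> > 0 \<Longrightarrow> 1 + \<epsilon> * \<rho> > 0 \<Longrightarrow> \<delta> > 0 \<Longrightarrow> 1 + \<delta> * \<rho> > 0 \<Longrightarrow>
      R \<epsilon> z = R \<delta> (R \<epsilon> z + \<delta> *\<^sub>R ((1/\<epsilon>) *\<^sub>R (z - R \<epsilon> z)))"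
    and pos: "\<And>\<epsilon> z. \<epsilon> > 0 \<Longrightarrow> 1 + \<epsilon> * \<rho> > 0 \<Longrightarrow>
      0 \<le> Re (cinner ((1/\<epsilon>) *\<^sub>R (z - R \<epsilon> z) - \<rho> *\<^sub>R R \<epsilon> z) (R \<epsilon> z - K (R \<epsilon> z)))"
    and Jn: "\<And>t x y. t > 0 \<Longrightarrow> norm (J t x - J t y) \<le> norm (x - y)"
    and JP: "\<And>t g. t > 0 \<Longrightarrow> P (J t g) ((1/t) *\<^sub>R (g - J t g))"
    and Padd: "\<And>u a v b. P u a \<Longrightarrow> P v b \<Longrightarrow> P (u + v) (a + b)"
    and Pscale: "\<And>r u a. P u a \<Longrightarrow> P (r *\<^sub>R u) (r *\<^sub>R a)"
    and Pacc: "\<And>u a. P u a \<Longrightarrow> 0 \<le> Re (cinner a u)"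
    and Pclosed: "\<And>X Y u a. (\<And>n::nat. P (X n) (Y n)) \<Longrightarrow> X \<longlonglongrightarrow> u \<Longrightarrow> Y \<longlonglongrightarrow> a \<Longrightarrow> P u a"
    and P0: "\<And>a. P 0 a \<Longrightarrow> a = 0"
    and E: "\<And>f. f \<in> E \<Longrightarrow> \<exists>f'\<in>E. \<forall>\<epsilon>>0. 1 + \<epsilon> * \<rho> > 0 \<longrightarrow> f = R \<epsilon> (f + \<epsilon> *\<^sub>R f')" and Edense: "closure E = UNIV"
    and c: "max 0 (- \<rho>) / (1 - q) < c"
begin

abbreviation ok :: "real \<Rightarrow> bool" where "ok \<epsilon> \<equiv> \<epsilon> > 0 \<and> 1 + \<epsilon> * \<rho> > 0"

definition dgr :: "'b \<Rightarrow> 'b \<Rightarrow> bool" where "dgr w g \<longleftrightarrow> (\<forall>\<epsilon>. ok \<epsilon> \<longrightarrow> w = R \<epsilon> (w + \<epsilon> *\<^sub>R g))"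

definition evo :: "'b \<Rightarrow> 'b \<Rightarrow> bool" where
  "evo u f \<longleftrightarrow> (\<exists>w g a. u = w - K w \<and> dgr w g \<and> P u a \<and> f = g + c *\<^sub>R u + a)"

definition N :: "'b \<Rightarrow> 'b" where "N u = (THE w. u + K w = w)"

lemmas Klin = linear_add[OF bounded_linear.linear[OF K]] linear_diff[OF bounded_linear.linear[OF K]]
  linear_scale[OF bounded_linear.linear[OF K]] linear_0[OF bounded_linear.linear[OF K]]

lemma Rlin:
  assumes "ok \<epsilon>"
  shows "R \<epsilon> (x + y) = R \<epsilon> x + R \<epsilon> y" "R \<epsilon> (x - y) = R \<epsilon> x - R \<epsilon> y" "R \<epsilon> (r *\<^sub>R x) = r *\<^sub>R R \<epsilon> x" "R \<epsilon> 0 = 0"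
  using bounded_linear.linear[OF R] assms by (auto simp: linear_add linear_diff linear_scale linear_0)

lemma Pdiff: "P u a \<Longrightarrow> P v b \<Longrightarrow> P (u - v) (a - b)"
  using Padd[OF _ Pscale[of v b "-1"], of u a] by simp

lemma q1: "1 - q > 0" using q by simp

lemma N_fix: "u + K (N u) = N u"
proof -
  have "\<exists>!w. (\<lambda>w. u + K w) w = w"
    by (rule banach_fix_type[OF q]) (use Kq in \<open>auto simp: dist_norm Klin(2)[symmetric]\<close>)
  then show ?thesis unfolding N_def by (rule theI')
qed

lemma N_eqI: "w - K w = u \<Longrightarrow> N u = w"
proof -
  assume w: "w - K w = u"
  have "norm (N u - w) \<le> q * norm (N u - w)"
  proof -
    have "K (N u) = N u - u" "K w = w - u" using N_fix[of u] w by (auto simp: eq_diff_eq diff_eq_eq add.commute)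
    then have "N u - w = K (N u - w)" by (simp add: Klin)
    then show ?thesis using Kq[of "N u - w"] by simp
  qed
  then have "(1 - q) * norm (N u - w) \<le> 0" by (simp add: algebra_simps)
  then show ?thesis using q1 by (simp add: mult_le_0_iff)
qed

lemma N_id: "N u - K (N u) = u" using N_fix[of u] by (simp add: algebra_simps)

lemma N_diff: "N (u - v) = N u - N v"
proof (rule N_eqI)
  have "N u - N v - K (N u - N v) = (N u - K (N u)) - (N v - K (N v))" by (simp add: Klin)
  then show "N u - N v - K (N u - N v) = u - v" by (simp add: N_id)
qed

lemma N_scale: "N (r *\<^sub>R u) = r *\<^sub>R N u"
  using N_id[of u] by (intro N_eqI) (metis Klin(3) scaleR_diff_right)

lemma N_norm: "norm (N u) \<le> norm u / (1 - q)"
proof -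
  have "norm (N u) \<le> norm u + norm (K (N u))" using norm_triangle_ineq[of u "K (N u)"] N_fix[of u] by simp
  also have "\<dots> \<le> norm u + q * norm (N u)" using Kq by simp
  finally show ?thesis using q1 by (simp add: field_simps)
qed

lemma N_tendsto: "X \<longlonglongrightarrow> u \<Longrightarrow> (\<lambda>n. N (X n)) \<longlonglongrightarrow> N u"
proof -
  assume "X \<longlonglongrightarrow> u"
  then have "(\<lambda>n. norm (X n - u) / (1 - q)) \<longlonglongrightarrow> 0 / (1 - q)" by (intro tendsto_divide tendsto_norm_zero LIM_zero tendsto_const) (use q1 in auto)
  then have "(\<lambda>n. N (X n) - N u) \<longlonglongrightarrow> 0"
    using Lim_null_comparison[of "\<lambda>n. N (X n) - N u" "\<lambda>n. norm (X n - u) / (1 - q)" sequentially] N_norm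
    by (simp add: N_diff[symmetric])
  then show ?thesis by (rule LIM_zero_cancel)
qed

lemma RN: "ok \<epsilon> \<Longrightarrow> R \<epsilon> (N u) = N (R \<epsilon> u)"
proof -
  assume ok: "ok \<epsilon>"
  have "R \<epsilon> (N u) - K (R \<epsilon> (N u)) = R \<epsilon> (N u - K (N u))" using ok by (simp add: RK Rlin)
  then show ?thesis unfolding N_id by (intro N_eqI[symmetric])
qed

lemma Re_w_bounds: "0 \<le> Re (cinner w (w - K w))" "Re (cinner w (w - K w)) \<le> (norm (w - K w))\<^sup>2 / (1 - q)"
proof -
  have "Re (cinner w (K w)) \<le> norm w * (q * norm w)"
    by (rule order_trans[OF Re_cinner_le mult_left_mono[OF Kq norm_ge_zero]])
  then have "(1 - q) * (norm w)\<^sup>2 \<le> Re (cinner w (w - K w))"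
    by (simp add: cinner_diff_right Re_cinner_self power2_eq_square algebra_simps)
  then show "0 \<le> Re (cinner w (w - K w))" using q1 by (smt (verit) mult_nonneg_nonneg zero_le_power2)
  have "Re (cinner w (w - K w)) \<le> norm w * norm (w - K w)" by (rule Re_cinner_le)
  also have "\<dots> \<le> (norm (w - K w) / (1 - q)) * norm (w - K w)"
    using N_norm[of "w - K w"] N_eqI[of w "w - K w"] by (intro mult_right_mono) auto
  finally show "Re (cinner w (w - K w)) \<le> (norm (w - K w))\<^sup>2 / (1 - q)" by (simp add: power2_eq_square)
qed

definition \<kappa> :: real where "\<kappa> = (c - max 0 (- \<rho>) / (1 - q)) / 2"

lemma \<kappa>_pos: "\<kappa> > 0" using c by (simp add: \<kappa>_def)

definition good :: "real \<Rightarrow> bool" where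
  "good \<epsilon> \<longleftrightarrow> ok \<epsilon> \<and> 1 + \<epsilon> * \<rho> \<ge> 1/2 \<and> max 0 (- \<rho>) / (1 - q) / (1 + \<epsilon> * \<rho>)\<^sup>2 \<le> c - \<kappa>"

lemma good_ok: "good \<epsilon> \<Longrightarrow> ok \<epsilon>" by (simp add: good_def)

lemma good_eventually: "\<forall>\<^sub>F \<epsilon> in at_right 0. good \<epsilon>"
proof -
  have "((\<lambda>\<epsilon>. 1 + \<epsilon> * \<rho>) \<longlongrightarrow> 1 + 0 * \<rho>) (at_right 0)" by (intro tendsto_intros)
  then have t: "((\<lambda>\<epsilon>. 1 + \<epsilon> * \<rho>) \<longlongrightarrow> 1) (at_right 0)" by simp
  have "((\<lambda>\<epsilon>. max 0 (- \<rho>) / (1 - q) / (1 + \<epsilon> * \<rho>)\<^sup>2) \<longlongrightarrow> max 0 (- \<rho>) / (1 - q) / 1\<^sup>2) (at_right 0)"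
    by (intro tendsto_divide tendsto_power t tendsto_const) auto
  moreover have "max 0 (- \<rho>) / (1 - q) / 1\<^sup>2 < c - \<kappa>" using c by (simp add: \<kappa>_def field_simps)
  ultimately have "\<forall>\<^sub>F \<epsilon> in at_right 0. max 0 (- \<rho>) / (1 - q) / (1 + \<epsilon> * \<rho>)\<^sup>2 < c - \<kappa>" by (rule order_tendstoD)
  moreover have "\<forall>\<^sub>F \<epsilon> in at_right 0. 1/2 < 1 + \<epsilon> * \<rho>" by (rule order_tendstoD[OF t]) simp
  moreover have "\<forall>\<^sub>F \<epsilon> in at_right (0::real). 0 < \<epsilon>" by (simp add: eventually_at_right_less)
  ultimately show ?thesis by eventually_elim (auto simp: good_def)
qed

definition Dq :: "real \<Rightarrow> 'b \<Rightarrow> 'b" where "Dq \<epsilon> u = (1/\<epsilon>) *\<^sub>R (u - R \<epsilon> u)"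

definition M :: "real \<Rightarrow> 'b \<Rightarrow> 'b" where "M \<epsilon> u = N (Dq \<epsilon> u)"

lemma Dq_diff: "ok \<epsilon> \<Longrightarrow> Dq \<epsilon> (u - v) = Dq \<epsilon> u - Dq \<epsilon> v"
  by (simp add: Dq_def Rlin algebra_simps)

lemma M_diff: "ok \<epsilon> \<Longrightarrow> M \<epsilon> (u - v) = M \<epsilon> u - M \<epsilon> v"
  by (simp add: M_def Dq_diff N_diff)

lemma M_eq: "ok \<epsilon> \<Longrightarrow> M \<epsilon> u = Dq \<epsilon> (N u)"
  by (simp add: M_def Dq_def N_scale N_diff RN)

lemma Dq_norm: "ok \<epsilon> \<Longrightarrow> norm (Dq \<epsilon> u) \<le> (1/\<epsilon>) * (1 + 1 / (1 + \<epsilon> * \<rho>)) * norm u"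
proof -
  assume ok: "ok \<epsilon>"
  have "norm (u - R \<epsilon> u) \<le> norm u + 1 / (1 + \<epsilon> * \<rho>) * norm u"
    using norm_triangle_ineq4[of u "R \<epsilon> u"] Rn[of \<epsilon> u] ok by linarith
  then have "(1/\<epsilon>) * norm (u - R \<epsilon> u) \<le> (1/\<epsilon>) * (norm u + 1 / (1 + \<epsilon> * \<rho>) * norm u)"
    using ok by (intro mult_left_mono) auto
  moreover have "norm (Dq \<epsilon> u) = (1/\<epsilon>) * norm (u - R \<epsilon> u)" using ok by (simp add: Dq_def)
  moreover have "(1/\<epsilon>) * (norm u + 1 / (1 + \<epsilon> * \<rho>) * norm u) = (1/\<epsilon>) * (1 + 1 / (1 + \<epsilon> * \<rho>)) * norm u"
    by (simp add: distrib_left distrib_right)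
  ultimately show ?thesis by linarith
qed

lemma M_acc:
  assumes g: "good \<epsilon>"
  shows "\<kappa> * (norm u)\<^sup>2 \<le> Re (cinner (c *\<^sub>R u + M \<epsilon> u) u)"
proof -
  have ok: "ok \<epsilon>" using g by (rule good_ok)
  define w where "w = N u"
  define y where "y = R \<epsilon> w"
  define y' where "y' = (1/\<epsilon>) *\<^sub>R (w - R \<epsilon> w)"
  have My: "M \<epsilon> u = y'" using ok by (simp add: M_eq y'_def w_def Dq_def)
  have w: "w = y + \<epsilon> *\<^sub>R y'" using ok by (simp add: y_def y'_def)
  have "u = w - K w" by (simp add: w_def N_id)
  also have "\<dots> = (y - K y) + \<epsilon> *\<^sub>R (y' - K y')" unfolding w by (simp add: Klin algebra_simps)
  finally have u: "u = (y - K y) + \<epsilon> *\<^sub>R (y' - K y')" .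
  have Ru: "y - K y = R \<epsilon> u" using ok by (simp add: y_def w_def RK[symmetric] Rlin(2)[symmetric] N_id)
  have p: "0 \<le> Re (cinner (y' - \<rho> *\<^sub>R y) (y - K y))" using pos[of \<epsilon> w] ok by (simp add: y_def y'_def)
  have "Re (cinner y' u) = Re (cinner y' (y - K y)) + \<epsilon> * Re (cinner y' (y' - K y'))"
    by (subst u) (simp add: cinner_add_right cinner_scaleR_right)
  moreover have "Re (cinner y' (y - K y)) \<ge> \<rho> * Re (cinner y (y - K y))"
    using p by (simp add: cinner_diff_left cinner_scaleR_left)
  moreover have "\<epsilon> * Re (cinner y' (y' - K y')) \<ge> 0" using ok Re_w_bounds(1)[of y'] by simp
  ultimately have 1: "Re (cinner y' u) \<ge> \<rho> * Re (cinner y (y - K y))" by linarith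
  have 2: "\<rho> * Re (cinner y (y - K y)) \<ge> - (c - \<kappa>) * (norm u)\<^sup>2"
  proof (cases "\<rho> \<ge> 0")
    case True
    have "0 \<le> c - \<kappa>" using g True by (simp add: good_def)
    then have "(c - \<kappa>) * (norm u)\<^sup>2 \<ge> 0" by simp
    moreover have "0 \<le> \<rho> * Re (cinner y (y - K y))" using True Re_w_bounds(1)[of y] by simp
    ultimately show ?thesis unfolding mult_minus_left by linarith
  next
    case False
    have "Re (cinner y (y - K y)) \<le> (norm (R \<epsilon> u))\<^sup>2 / (1 - q)" using Re_w_bounds(2)[of y] by (simp add: Ru)
    also have "\<dots> \<le> (1 / (1 + \<epsilon> * \<rho>) * norm u)\<^sup>2 / (1 - q)"
      using Rn[of \<epsilon> u] ok q1 by (intro divide_right_mono power_mono) auto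
    finally have "(- \<rho>) * Re (cinner y (y - K y)) \<le> (- \<rho>) * ((1 / (1 + \<epsilon> * \<rho>) * norm u)\<^sup>2 / (1 - q))"
      using False by (intro mult_left_mono) auto
    also have "\<dots> = (max 0 (- \<rho>) / (1 - q) / (1 + \<epsilon> * \<rho>)\<^sup>2) * (norm u)\<^sup>2"
      using False by (simp add: power_mult_distrib power_divide)
    also have "\<dots> \<le> (c - \<kappa>) * (norm u)\<^sup>2" using g by (intro mult_right_mono) (auto simp: good_def)
    finally show ?thesis by (simp only: mult_minus_left minus_le_iff)
  qed
  have "Re (cinner (c *\<^sub>R u + M \<epsilon> u) u) = c * (norm u)\<^sup>2 + Re (cinner y' u)"
    unfolding My by (simp add: cinner_add_left cinner_scaleR_left Re_cinner_self)
  then show ?thesis using 1 2 by (simp add: algebra_simps)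
qed

definition step :: "real \<Rightarrow> real \<Rightarrow> 'b \<Rightarrow> 'b \<Rightarrow> 'b" where
  "step \<epsilon> t f u = J t (u - t *\<^sub>R (c *\<^sub>R u + M \<epsilon> u - f))"

lemma step_contraction:
  assumes g: "good \<epsilon>"
  obtains t0 where "t0 > 0" "\<And>t f u v. 0 < t \<Longrightarrow> t \<le> t0 \<Longrightarrow> norm (step \<epsilon> t f u - step \<epsilon> t f v) \<le> sqrt (1 - t * \<kappa>) * norm (u - v)"
    "\<And>t. 0 < t \<Longrightarrow> t \<le> t0 \<Longrightarrow> t * \<kappa> \<le> 1"
proof -
  have ok: "ok \<epsilon>" using g by (rule good_ok)
  define L where "L = \<bar>c\<bar> + (1/\<epsilon>) * (1 + 1 / (1 + \<epsilon> * \<rho>)) / (1 - q) + \<kappa> + 1"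
  have L1: "(1/\<epsilon>) * (1 + 1 / (1 + \<epsilon> * \<rho>)) / (1 - q) \<ge> 0" using ok q1 by simp
  have L: "L > 0" "L \<ge> \<kappa>" "L \<ge> 1" using L1 \<kappa>_pos unfolding L_def by linarith+
  have Bn: "norm (c *\<^sub>R d + M \<epsilon> d) \<le> L * norm d" for d
  proof -
    have "norm (M \<epsilon> d) \<le> norm (Dq \<epsilon> d) / (1 - q)" unfolding M_def by (rule N_norm)
    also have "\<dots> \<le> ((1/\<epsilon>) * (1 + 1 / (1 + \<epsilon> * \<rho>)) * norm d) / (1 - q)"
      using q1 Dq_norm[OF ok] by (intro divide_right_mono) auto
    finally have m: "norm (M \<epsilon> d) \<le> ((1/\<epsilon>) * (1 + 1 / (1 + \<epsilon> * \<rho>)) / (1 - q)) * norm d" by simp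
    have "norm (c *\<^sub>R d + M \<epsilon> d) \<le> \<bar>c\<bar> * norm d + norm (M \<epsilon> d)" using norm_triangle_ineq[of "c *\<^sub>R d"] by simp
    also have "\<dots> \<le> (\<bar>c\<bar> + (1/\<epsilon>) * (1 + 1 / (1 + \<epsilon> * \<rho>)) / (1 - q)) * norm d" unfolding distrib_right using m by linarith
    also have "\<dots> \<le> L * norm d" unfolding L_def using \<kappa>_pos by (intro mult_right_mono) auto
    finally show ?thesis .
  qed
  define t0 where "t0 = \<kappa> / L\<^sup>2"
  have t0: "t0 > 0" using \<kappa>_pos L by (simp add: t0_def)
  have tk: "t * \<kappa> \<le> 1" if t: "0 < t" "t \<le> t0" for t
  proof -
    have "t * \<kappa> \<le> t0 * \<kappa>" using t \<kappa>_pos by (intro mult_right_mono) auto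
    also have "\<dots> = (\<kappa> / L)\<^sup>2" by (simp add: t0_def power2_eq_square)
    also have "\<dots> \<le> 1" using L \<kappa>_pos by (simp add: power_le_one)
    finally show ?thesis .
  qed
  have "norm (step \<epsilon> t f u - step \<epsilon> t f v) \<le> sqrt (1 - t * \<kappa>) * norm (u - v)" if t: "0 < t" "t \<le> t0" for t f u v
  proof -
    define d where "d = u - v"
    define B where "B = c *\<^sub>R d + M \<epsilon> d"
    have "norm (step \<epsilon> t f u - step \<epsilon> t f v) \<le> norm ((u - t *\<^sub>R (c *\<^sub>R u + M \<epsilon> u - f)) - (v - t *\<^sub>R (c *\<^sub>R v + M \<epsilon> v - f)))"
      unfolding step_def by (rule Jn[OF t(1)])
    also have "(u - t *\<^sub>R (c *\<^sub>R u + M \<epsilon> u - f)) - (v - t *\<^sub>R (c *\<^sub>R v + M \<epsilon> v - f)) = d - t *\<^sub>R B"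
      by (simp add: d_def B_def M_diff[OF ok] algebra_simps)
    finally have 1: "norm (step \<epsilon> t f u - step \<epsilon> t f v) \<le> norm (d - t *\<^sub>R B)" .
    have "(norm (d - t *\<^sub>R B))\<^sup>2 = (norm d)\<^sup>2 - 2 * t * Re (cinner B d) + t\<^sup>2 * (norm B)\<^sup>2"
      unfolding norm_diff_sq using Re_cinner_commute[of B d] t by (simp add: cinner_scaleR_right power_mult_distrib)
    also have "\<dots> \<le> (norm d)\<^sup>2 - 2 * t * (\<kappa> * (norm d)\<^sup>2) + t\<^sup>2 * (L * norm d)\<^sup>2"
      using M_acc[OF g, of d] Bn[of d] t by (intro add_mono diff_left_mono mult_left_mono power_mono) (auto simp: B_def)
    also have "t\<^sup>2 * (L * norm d)\<^sup>2 \<le> t * \<kappa> * (norm d)\<^sup>2"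
    proof -
      have "t * L\<^sup>2 \<le> \<kappa>" using t(2) L by (simp add: t0_def field_simps)
      then have "t * (t * L\<^sup>2) \<le> t * \<kappa>" using t by (intro mult_left_mono) auto
      from mult_right_mono[OF this zero_le_power2[of "norm d"]] show ?thesis
        by (simp add: power2_eq_square mult_ac)
    qed
    finally have "(norm (d - t *\<^sub>R B))\<^sup>2 \<le> (1 - t * \<kappa>) * (norm d)\<^sup>2" by (simp add: algebra_simps)
    also have "\<dots> = (sqrt (1 - t * \<kappa>) * norm d)\<^sup>2" using tk[OF t] by (simp add: power_mult_distrib)
    finally have "norm (d - t *\<^sub>R B) \<le> sqrt (1 - t * \<kappa>) * norm d"
      by (rule power2_le_imp_le) (use tk[OF t] in simp)
    then show ?thesis using 1 by (simp add: d_def)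
  qed
  then show ?thesis using that t0 tk by blast
qed

lemma sol_bound:
  assumes g: "good \<epsilon>" and u: "P u (f - c *\<^sub>R u - M \<epsilon> u)"
  shows "norm u \<le> norm f / \<kappa>"
proof -
  have "0 \<le> Re (cinner (f - c *\<^sub>R u - M \<epsilon> u) u)" by (rule Pacc[OF u])
  then have "Re (cinner (c *\<^sub>R u + M \<epsilon> u) u) \<le> Re (cinner f u)" by (simp add: cinner_simps)
  with M_acc[OF g, of u] Re_cinner_le[of f u] have "\<kappa> * (norm u)\<^sup>2 \<le> norm f * norm u" by linarith
  then have "norm u * (\<kappa> * norm u) \<le> norm u * norm f" by (simp add: power2_eq_square mult_ac)
  then have "\<kappa> * norm u \<le> norm f" by (cases "norm u = 0") auto
  then show ?thesis using \<kappa>_pos by (simp add: field_simps)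
qed

lemma step_fix: "t > 0 \<Longrightarrow> step \<epsilon> t f u = u \<Longrightarrow> P u (f - c *\<^sub>R u - M \<epsilon> u)"
proof -
  assume t: "t > 0" and u: "step \<epsilon> t f u = u"
  have "P u ((1/t) *\<^sub>R ((u - t *\<^sub>R (c *\<^sub>R u + M \<epsilon> u - f)) - u))"
    using JP[OF t, of "u - t *\<^sub>R (c *\<^sub>R u + M \<epsilon> u - f)"] u unfolding step_def by simp
  then show ?thesis using t by (simp add: diff_diff_eq)
qed

lemma sol_exists:
  assumes g: "good \<epsilon>"
  shows "\<exists>!u. P u (f - c *\<^sub>R u - M \<epsilon> u)"
proof (rule ex_ex1I)
  obtain t0 where t0: "t0 > 0" "\<And>t f u v. 0 < t \<Longrightarrow> t \<le> t0 \<Longrightarrow> norm (step \<epsilon> t f u - step \<epsilon> t f v) \<le> sqrt (1 - t * \<kappa>) * norm (u - v)"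
    "\<And>t. 0 < t \<Longrightarrow> t \<le> t0 \<Longrightarrow> t * \<kappa> \<le> 1" using step_contraction[OF g] by metis
  have "\<exists>!u. step \<epsilon> t0 f u = u"
    by (rule banach_fix_type[of "sqrt (1 - t0 * \<kappa>)"]) (use t0 \<kappa>_pos in \<open>auto simp: dist_norm\<close>)
  then show "\<exists>u. P u (f - c *\<^sub>R u - M \<epsilon> u)" using step_fix[OF t0(1)] by blast
next
  fix u v assume u: "P u (f - c *\<^sub>R u - M \<epsilon> u)" and v: "P v (f - c *\<^sub>R v - M \<epsilon> v)"
  have "P (u - v) (0 - c *\<^sub>R (u - v) - M \<epsilon> (u - v))"
    using Pdiff[OF u v] by (simp add: M_diff[OF good_ok[OF g]] algebra_simps)
  from sol_bound[OF g this] show "u = v" by simp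
qed

definition sol :: "real \<Rightarrow> 'b \<Rightarrow> 'b" where "sol \<epsilon> f = (THE u. P u (f - c *\<^sub>R u - M \<epsilon> u))"

lemma sol: "good \<epsilon> \<Longrightarrow> P (sol \<epsilon> f) (f - c *\<^sub>R sol \<epsilon> f - M \<epsilon> (sol \<epsilon> f))"
  unfolding sol_def by (rule theI'[OF sol_exists])

lemma sol_eqI: "good \<epsilon> \<Longrightarrow> P u (f - c *\<^sub>R u - M \<epsilon> u) \<Longrightarrow> sol \<epsilon> f = u"
  using sol_exists[of \<epsilon> f] sol[of \<epsilon> f] by blast

lemma sol_diff: "good \<epsilon> \<Longrightarrow> sol \<epsilon> (f - h) = sol \<epsilon> f - sol \<epsilon> h"
proof (rule sol_eqI)
  assume g: "good \<epsilon>"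
  show "P (sol \<epsilon> f - sol \<epsilon> h) (f - h - c *\<^sub>R (sol \<epsilon> f - sol \<epsilon> h) - M \<epsilon> (sol \<epsilon> f - sol \<epsilon> h))"
    using Pdiff[OF sol[OF g, of f] sol[OF g, of h]] by (simp add: M_diff[OF good_ok[OF g]] algebra_simps)
qed

lemma sol_norm: "good \<epsilon> \<Longrightarrow> norm (sol \<epsilon> f) \<le> norm f / \<kappa>"
  by (rule sol_bound[OF _ sol])

lemma sol_step: "good \<epsilon> \<Longrightarrow> t > 0 \<Longrightarrow> step \<epsilon> t f u = u \<Longrightarrow> sol \<epsilon> f = u"
  by (rule sol_eqI[OF _ step_fix])

lemma R_Dq: "ok \<epsilon> \<Longrightarrow> ok \<delta> \<Longrightarrow> R \<delta> (Dq \<epsilon> u) = Dq \<epsilon> (R \<delta> u)"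
  by (simp add: Dq_def Rlin RR)

lemma sol_R: "good \<epsilon> \<Longrightarrow> ok \<delta> \<Longrightarrow> sol \<epsilon> (R \<delta> f) = R \<delta> (sol \<epsilon> f)"
proof (rule sol_eqI)
  assume g: "good \<epsilon>" and d: "ok \<delta>"
  have "P (R \<delta> (sol \<epsilon> f)) (R \<delta> (f - c *\<^sub>R sol \<epsilon> f - M \<epsilon> (sol \<epsilon> f)))" using d by (intro RP sol[OF g]) auto
  then show "P (R \<delta> (sol \<epsilon> f)) (R \<delta> f - c *\<^sub>R R \<delta> (sol \<epsilon> f) - M \<epsilon> (R \<delta> (sol \<epsilon> f)))"
    using d by (simp add: Rlin M_def RN[OF d] R_Dq[OF good_ok[OF g] d])
qed

lemma sol_scale: "good \<epsilon> \<Longrightarrow> sol \<epsilon> (r *\<^sub>R f) = r *\<^sub>R sol \<epsilon> f"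
proof (rule sol_eqI)
  assume g: "good \<epsilon>"
  have "M \<epsilon> (r *\<^sub>R u) = r *\<^sub>R M \<epsilon> u" for u
  proof -
    have "Dq \<epsilon> (r *\<^sub>R u) = r *\<^sub>R Dq \<epsilon> u" using good_ok[OF g] by (simp add: Dq_def Rlin algebra_simps)
    then show ?thesis by (simp add: M_def N_scale)
  qed
  then show "P (r *\<^sub>R sol \<epsilon> f) (r *\<^sub>R f - c *\<^sub>R r *\<^sub>R sol \<epsilon> f - M \<epsilon> (r *\<^sub>R sol \<epsilon> f))"
    using Pscale[OF sol[OF g, of f], of r] by (simp add: algebra_simps)
qed

lemma sol_Dq: "good \<epsilon> \<Longrightarrow> ok \<delta> \<Longrightarrow> sol \<epsilon> (Dq \<delta> f) = Dq \<delta> (sol \<epsilon> f)"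
  by (simp add: Dq_def sol_scale sol_diff sol_R)

lemma sol_cauchy_bound:
  assumes "good \<epsilon>" "good \<delta>"
  shows "norm (sol \<epsilon> f - sol \<delta> f) \<le> norm (Dq \<delta> f - Dq \<epsilon> f) / (\<kappa>\<^sup>2 * (1 - q))"
proof -
  note ok = good_ok[OF assms(1)] good_ok[OF assms(2)]
  define u v where "u = sol \<epsilon> f" and "v = sol \<delta> f"
  have "P (u - v) ((M \<delta> u - M \<epsilon> u) - c *\<^sub>R (u - v) - M \<delta> (u - v))"
    using Pdiff[OF sol[OF assms(1), of f] sol[OF assms(2), of f]]
    by (simp add: u_def v_def M_diff[OF ok(2)] algebra_simps)
  then have "norm (u - v) \<le> norm (M \<delta> u - M \<epsilon> u) / \<kappa>" by (rule sol_bound[OF assms(2)])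
  also have "M \<delta> u - M \<epsilon> u = N (Dq \<delta> u - Dq \<epsilon> u)" by (simp add: M_def N_diff)
  also have "Dq \<delta> u - Dq \<epsilon> u = sol \<epsilon> (Dq \<delta> f - Dq \<epsilon> f)"
    unfolding u_def by (simp add: sol_diff[OF assms(1)] sol_Dq[OF assms(1)] ok)
  also have "norm (N (sol \<epsilon> (Dq \<delta> f - Dq \<epsilon> f))) / \<kappa> \<le> (norm (Dq \<delta> f - Dq \<epsilon> f) / \<kappa> / (1 - q)) / \<kappa>"
    using \<kappa>_pos q1 by (intro divide_right_mono order_trans[OF N_norm] sol_norm[OF assms(1)]) auto
  finally show ?thesis by (simp add: u_def v_def power2_eq_square mult_ac)
qed


definition e :: "nat \<Rightarrow> real" where "e n = inverse (real (Suc n))"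

lemma good_e: "\<exists>n0. \<forall>n\<ge>n0. good (e n)"
proof -
  have "filterlim e (at_right 0) sequentially"
    unfolding e_def[abs_def] by (rule tendsto_imp_filterlim_at_right[OF LIMSEQ_inverse_real_of_nat]) simp
  from eventually_compose_filterlim[OF good_eventually this] show ?thesis by (simp add: eventually_sequentially)
qed

definition n0 :: nat where "n0 = (SOME n0. \<forall>n\<ge>n0. good (e n))"

lemma good_n0: "n \<ge> n0 \<Longrightarrow> good (e n)"
  using someI_ex[OF good_e] unfolding n0_def by blast

lemmas ok_n0 = good_ok[OF good_n0]

lemma R_le_2: "good \<epsilon> \<Longrightarrow> norm (R \<epsilon> x) \<le> 2 * norm x"
proof -
  assume g: "good \<epsilon>"
  then have "1 / (1 + \<epsilon> * \<rho>) \<le> 2" by (simp add: good_def field_simps)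
  then show ?thesis using Rn[of \<epsilon> x] good_ok[OF g] mult_right_mono[of "1 / (1 + \<epsilon> * \<rho>)" 2 "norm x"] by simp
qed

lemma E_approx: "r > 0 \<Longrightarrow> \<exists>h\<in>E. norm (x - h) < r"
  using Edense closure_approachable[of x E] by (auto simp: dist_norm norm_minus_commute)

lemma E_seq: obtains h where "\<And>n::nat. h n \<in> E" "h \<longlonglongrightarrow> f"
  using Edense closure_sequential[of f E] by auto

lemma R_tendsto: "(\<lambda>n. R (e n) x) \<longlonglongrightarrow> x"
proof (rule LIMSEQ_I)
  fix r :: real assume r: "r > 0"
  obtain h where h: "h \<in> E" "norm (x - h) < r / 4" using E_approx[of "r / 4" x] r by auto
  obtain h' where h': "\<And>\<epsilon>. ok \<epsilon> \<Longrightarrow> h = R \<epsilon> (h + \<epsilon> *\<^sub>R h')" using E[OF h(1)] by blast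
  have "(\<lambda>n. e n * (2 * norm h')) \<longlonglongrightarrow> 0"
    unfolding e_def by (intro tendsto_mult_left_zero LIMSEQ_inverse_real_of_nat)
  then obtain m where m: "\<And>n. n \<ge> m \<Longrightarrow> e n * (2 * norm h') < r / 4"
    using r order_tendstoD(2)[of _ 0 sequentially "r / 4"] by (force simp: eventually_sequentially)
  show "\<exists>no. \<forall>n\<ge>no. norm (R (e n) x - x) < r"
  proof (intro exI allI impI)
    fix n assume n: "n \<ge> max m n0"
    then have g: "good (e n)" and ok: "ok (e n)" using good_n0 ok_n0 by auto
    have "h = R (e n) h + e n *\<^sub>R R (e n) h'" using h'[OF ok] unfolding Rlin(1)[OF ok] Rlin(3)[OF ok] .
    then have "R (e n) x - x = R (e n) (x - h) - (x - h) - e n *\<^sub>R R (e n) h'"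
      unfolding Rlin(2)[OF ok] by (simp add: algebra_simps)
    then have "norm (R (e n) x - x) = norm (R (e n) (x - h) - (x - h) - e n *\<^sub>R R (e n) h')" by (rule arg_cong)
    moreover have "norm (R (e n) (x - h) - (x - h) - e n *\<^sub>R R (e n) h') \<le> norm (R (e n) (x - h)) + norm (x - h) + e n * norm (R (e n) h')"
      using ok norm_triangle_ineq4[of "R (e n) (x - h) - (x - h)" "e n *\<^sub>R R (e n) h'"] norm_triangle_ineq4[of "R (e n) (x - h)" "x - h"]
      by simp
    moreover have "e n * norm (R (e n) h') \<le> e n * (2 * norm h')" using ok R_le_2[OF g] by (intro mult_left_mono) auto
    ultimately show "norm (R (e n) x - x) < r" using R_le_2[OF g, of "x - h"] h(2) m[of n] n by auto
  qed
qed

lemma Dq_E: "ok \<epsilon> \<Longrightarrow> f = R \<epsilon> (f + \<epsilon> *\<^sub>R f') \<Longrightarrow> Dq \<epsilon> f = R \<epsilon> f'"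
proof -
  assume ok: "ok \<epsilon>" and f: "f = R \<epsilon> (f + \<epsilon> *\<^sub>R f')"
  have "f - R \<epsilon> f = \<epsilon> *\<^sub>R R \<epsilon> f'" using f ok by (metis Rlin(1,3) add_diff_cancel_left')
  then show ?thesis using ok by (simp add: Dq_def)
qed

lemma Dq_tendsto:
  assumes "dgr f f'" shows "(\<lambda>n. Dq (e n) f) \<longlonglongrightarrow> f'"
proof (rule Lim_transform_eventually[OF R_tendsto])
  show "\<forall>\<^sub>F n in sequentially. R (e n) f' = Dq (e n) f"
    using Dq_E ok_n0 assms unfolding dgr_def eventually_sequentially by metis
qed

lemma E_dgr: "f \<in> E \<Longrightarrow> \<exists>f'. dgr f f'"
  using E unfolding dgr_def by blast

lemma sol_Cauchy: "Cauchy (\<lambda>n. sol (e n) f)"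
proof (rule CauchyI)
  fix r :: real assume r: "r > 0"
  obtain h where h: "h \<in> E" "norm (f - h) < r * \<kappa> / 4" using E_approx[of "r * \<kappa> / 4" f] r \<kappa>_pos by auto
  obtain h' where "dgr h h'" using E_dgr[OF h(1)] by blast
  then have "Cauchy (\<lambda>n. Dq (e n) h)" by (intro LIMSEQ_imp_Cauchy Dq_tendsto)
  moreover have s: "r / 4 * (\<kappa>\<^sup>2 * (1 - q)) > 0" using r \<kappa>_pos q1 by simp
  ultimately obtain m where m: "\<And>i j. i \<ge> m \<Longrightarrow> j \<ge> m \<Longrightarrow> norm (Dq (e i) h - Dq (e j) h) < r / 4 * (\<kappa>\<^sup>2 * (1 - q))"
    using CauchyD by metis
  show "\<exists>M. \<forall>i\<ge>M. \<forall>j\<ge>M. norm (sol (e i) f - sol (e j) f) < r"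
  proof (intro exI allI impI)
    fix i j assume ij: "i \<ge> max m n0" "j \<ge> max m n0"
    then have g: "good (e i)" "good (e j)" using good_n0 by auto
    have d: "norm (sol \<epsilon> f - sol \<epsilon> h) < r / 4" if "good \<epsilon>" for \<epsilon>
    proof -
      have "norm (sol \<epsilon> f - sol \<epsilon> h) \<le> norm (f - h) / \<kappa>" using sol_norm[OF that, of "f - h"] by (simp add: sol_diff[OF that])
      also have "\<dots> < r / 4" using h(2) \<kappa>_pos by (simp add: field_simps)
      finally show ?thesis .
    qed
    have "norm (sol (e i) h - sol (e j) h) \<le> norm (Dq (e j) h - Dq (e i) h) / (\<kappa>\<^sup>2 * (1 - q))" by (rule sol_cauchy_bound[OF g])
    also have "\<dots> < r / 4" using m[of j i] ij \<kappa>_pos q1 by (simp add: pos_divide_less_eq)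
    finally have "norm (sol (e i) h - sol (e j) h) < r / 4" .
    moreover have "norm (sol (e i) f - sol (e j) f) = norm ( (sol (e i) f - sol (e i) h) + (sol (e i) h - sol (e j) h) - (sol (e j) f - sol (e j) h))" by simp
    ultimately show "norm (sol (e i) f - sol (e j) f) < r"
      using d[OF g(1)] d[OF g(2)] r
        norm_triangle_ineq4[of "(sol (e i) f - sol (e i) h) + (sol (e i) h - sol (e j) h)" "sol (e j) f - sol (e j) h"]
        norm_triangle_ineq[of "sol (e i) f - sol (e i) h" "sol (e i) h - sol (e j) h"]
      by linarith
  qed
qed

definition S :: "'b \<Rightarrow> 'b" where "S f = lim (\<lambda>n. sol (e n) f)"

lemma sol_tendsto: "(\<lambda>n. sol (e n) f) \<longlonglongrightarrow> S f"
  using sol_Cauchy unfolding S_def by (simp add: Cauchy_convergent_iff convergent_LIMSEQ_iff)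

lemma S_norm: "norm (S f) \<le> norm f / \<kappa>"
  by (rule LIMSEQ_le_const2[OF tendsto_norm[OF sol_tendsto]]) (use sol_norm[OF good_n0] in blast)

lemma S_diff: "S (f - h) = S f - S h"
proof (rule LIMSEQ_unique[OF sol_tendsto])
  show "(\<lambda>n. sol (e n) (f - h)) \<longlonglongrightarrow> S f - S h"
    by (rule Lim_transform_eventually[OF tendsto_diff[OF sol_tendsto sol_tendsto]])
       (use sol_diff[OF good_n0] in \<open>auto simp: eventually_sequentially intro!: exI[of _ n0]\<close>)
qed

lemma null_by_norm:
  fixes X :: "nat \<Rightarrow> 'b"
  assumes "\<And>n. n \<ge> n0 \<Longrightarrow> norm (X n) \<le> y n" "y \<longlonglongrightarrow> 0" shows "X \<longlonglongrightarrow> 0"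
  using Lim_null_comparison[of X y sequentially] assms by (auto simp: eventually_sequentially)

lemma S_tendsto: "X \<longlonglongrightarrow> f \<Longrightarrow> (\<lambda>n. S (X n)) \<longlonglongrightarrow> S f"
proof -
  assume "X \<longlonglongrightarrow> f"
  then have "(\<lambda>n. norm (X n - f) / \<kappa>) \<longlonglongrightarrow> 0 / \<kappa>" using \<kappa>_pos by (intro tendsto_divide tendsto_norm_zero LIM_zero tendsto_const) auto
  then have "(\<lambda>n. S (X n) - S f) \<longlonglongrightarrow> 0" by (intro null_by_norm) (auto simp: S_norm S_diff[symmetric])
  then show ?thesis by (rule LIM_zero_cancel)
qed

lemma R_continuous: "ok \<epsilon> \<Longrightarrow> X \<longlonglongrightarrow> x \<Longrightarrow> (\<lambda>n. R \<epsilon> (X n)) \<longlonglongrightarrow> R \<epsilon> x"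
  using bounded_linear.tendsto[OF R] by blast

lemma evo_S:
  assumes f: "f \<in> E" shows "evo (S f) f"
proof -
  obtain f' where f': "dgr f f'" using E_dgr[OF f] by blast
  define w where "w = N (S f)"
  define g where "g = N (S f')"
  define z where "z n = N (sol (e n) f)" for n
  have D: "Dq (e n) (z n) = M (e n) (sol (e n) f)" "M (e n) (sol (e n) f) = N (sol (e n) (Dq (e n) f))" if "n \<ge> n0" for n
  proof -
    show "Dq (e n) (z n) = M (e n) (sol (e n) f)" unfolding z_def by (rule M_eq[OF ok_n0[OF that], symmetric])
    show "M (e n) (sol (e n) f) = N (sol (e n) (Dq (e n) f))" unfolding M_def sol_Dq[OF good_n0[OF that] ok_n0[OF that]] ..
  qed
  have "(\<lambda>n. sol (e n) (Dq (e n) f) - sol (e n) f') \<longlonglongrightarrow> 0"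
  proof (rule null_by_norm)
    show "norm (sol (e n) (Dq (e n) f) - sol (e n) f') \<le> norm (Dq (e n) f - f') / \<kappa>" if "n \<ge> n0" for n
      using sol_norm[OF good_n0[OF that]] by (simp add: sol_diff[OF good_n0[OF that], symmetric])
    have "(\<lambda>n. norm (Dq (e n) f - f') / \<kappa>) \<longlonglongrightarrow> 0 / \<kappa>"
      using \<kappa>_pos by (intro tendsto_divide tendsto_norm_zero LIM_zero tendsto_const Dq_tendsto f') auto
    then show "(\<lambda>n. norm (Dq (e n) f - f') / \<kappa>) \<longlonglongrightarrow> 0" by simp
  qed
  from tendsto_add[OF this sol_tendsto[of f']] have "(\<lambda>n. sol (e n) (Dq (e n) f)) \<longlonglongrightarrow> S f'" by simp
  then have glim0: "(\<lambda>n. N (sol (e n) (Dq (e n) f))) \<longlonglongrightarrow> g" unfolding g_def by (rule N_tendsto)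
  have glim: "(\<lambda>n. M (e n) (sol (e n) f)) \<longlonglongrightarrow> g"
    by (rule Lim_transform_eventually[OF glim0]) (use D(2) in \<open>auto simp: eventually_sequentially intro!: exI[of _ n0]\<close>)
  have zlim: "z \<longlonglongrightarrow> w" unfolding z_def w_def by (rule N_tendsto[OF sol_tendsto])
  have "(\<lambda>n. R (e n) (z n) - R (e n) w) \<longlonglongrightarrow> 0"
  proof (rule null_by_norm)
    show "norm (R (e n) (z n) - R (e n) w) \<le> 2 * norm (z n - w)" if "n \<ge> n0" for n
      using R_le_2[OF good_n0[OF that], of "z n - w"] by (simp add: Rlin[OF ok_n0[OF that]])
    show "(\<lambda>n. 2 * norm (z n - w)) \<longlonglongrightarrow> 0" by (intro tendsto_mult_right_zero tendsto_norm_zero LIM_zero zlim)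
  qed
  from tendsto_add[OF this R_tendsto[of w]] have Rz: "(\<lambda>n. R (e n) (z n)) \<longlonglongrightarrow> w" by simp
  have dg: "dgr w g"
    unfolding dgr_def
  proof (intro allI impI)
    fix \<delta> assume d: "ok \<delta>"
    have "(\<lambda>n. R \<delta> (R (e n) (z n) + \<delta> *\<^sub>R M (e n) (sol (e n) f))) \<longlonglongrightarrow> R \<delta> (w + \<delta> *\<^sub>R g)"
      by (intro R_continuous d tendsto_add Rz tendsto_scaleR tendsto_const glim)
    moreover have "(\<lambda>n. R \<delta> (R (e n) (z n) + \<delta> *\<^sub>R M (e n) (sol (e n) f))) \<longlonglongrightarrow> w"
    proof (rule Lim_transform_eventually[OF Rz])
      show "\<forall>\<^sub>F n in sequentially. R (e n) (z n) = R \<delta> (R (e n) (z n) + \<delta> *\<^sub>R M (e n) (sol (e n) f))"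
        unfolding eventually_sequentially
      proof (intro exI allI impI)
        fix n assume n: "n \<ge> n0"
        show "R (e n) (z n) = R \<delta> (R (e n) (z n) + \<delta> *\<^sub>R M (e n) (sol (e n) f))"
          unfolding D(1)[OF n, symmetric] Dq_def using Rres[of "e n" \<delta> "z n"] ok_n0[OF n] d by blast
      qed
    qed
    ultimately show "w = R \<delta> (w + \<delta> *\<^sub>R g)" by (rule LIMSEQ_unique[rotated])
  qed
  have "P (S f) (f - c *\<^sub>R S f - g)"
  proof (rule Pclosed)
    show "P (sol (e (n + n0)) f) (f - c *\<^sub>R sol (e (n + n0)) f - M (e (n + n0)) (sol (e (n + n0)) f))" for n
      by (rule sol[OF good_n0]) simp
    show "(\<lambda>n. sol (e (n + n0)) f) \<longlonglongrightarrow> S f" by (rule LIMSEQ_ignore_initial_segment[OF sol_tendsto])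
    show "(\<lambda>n. f - c *\<^sub>R sol (e (n + n0)) f - M (e (n + n0)) (sol (e (n + n0)) f)) \<longlonglongrightarrow> f - c *\<^sub>R S f - g"
      by (intro tendsto_diff tendsto_const tendsto_scaleR LIMSEQ_ignore_initial_segment[OF sol_tendsto] LIMSEQ_ignore_initial_segment[OF glim])
  qed
  then show ?thesis unfolding evo_def using dg
    by (intro exI[of _ w] exI[of _ g] exI[of _ "f - c *\<^sub>R S f - g"]) (simp add: w_def N_id)
qed

lemma evo_bound:
  assumes "evo u f" shows "\<kappa> * norm u \<le> norm f"
proof -
  obtain w g a where w: "u = w - K w" "dgr w g" "P u a" "f = g + c *\<^sub>R u + a" using assms unfolding evo_def by blast
  define \<epsilon> where "\<epsilon> = e n0"
  have ok: "ok \<epsilon>" unfolding \<epsilon>_def by (rule ok_n0) simp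
  have Rw: "R \<epsilon> (w + \<epsilon> *\<^sub>R g) = w" using w(2) ok unfolding dgr_def by metis
  have "0 \<le> Re (cinner (g - \<rho> *\<^sub>R w) u)" using pos[of \<epsilon> "w + \<epsilon> *\<^sub>R g"] ok by (simp add: Rw w(1))
  then have 1: "\<rho> * Re (cinner w u) \<le> Re (cinner g u)" by (simp add: cinner_diff_left cinner_scaleR_left)
  have b: "0 \<le> Re (cinner w u)" "Re (cinner w u) \<le> (norm u)\<^sup>2 / (1 - q)" using Re_w_bounds[of w] by (simp_all add: w(1))
  have "max 0 (- \<rho>) / (1 - q) \<le> c - \<kappa>" using c by (simp add: \<kappa>_def field_simps)
  then have c': "max 0 (- \<rho>) / (1 - q) * (norm u)\<^sup>2 \<le> (c - \<kappa>) * (norm u)\<^sup>2" by (intro mult_right_mono) auto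
  have "- \<rho> * Re (cinner w u) \<le> max 0 (- \<rho>) * Re (cinner w u)" using b(1) by (intro mult_right_mono) auto
  also have "\<dots> \<le> max 0 (- \<rho>) * ((norm u)\<^sup>2 / (1 - q))" using b(2) by (intro mult_left_mono) auto
  finally have "- \<rho> * Re (cinner w u) \<le> max 0 (- \<rho>) / (1 - q) * (norm u)\<^sup>2" by simp
  with c' 1 have 2: "- ((c - \<kappa>) * (norm u)\<^sup>2) \<le> Re (cinner g u)" unfolding mult_minus_left by linarith
  have "Re (cinner f u) = Re (cinner g u) + c * (norm u)\<^sup>2 + Re (cinner a u)"
    unfolding w(4) by (simp add: cinner_add_left cinner_scaleR_left Re_cinner_self)
  with 2 Pacc[OF w(3)] have "\<kappa> * (norm u)\<^sup>2 \<le> Re (cinner f u)" by (simp add: algebra_simps)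
  with Re_cinner_le[of f u] have "norm u * (\<kappa> * norm u) \<le> norm u * norm f" by (simp add: power2_eq_square mult_ac)
  then show ?thesis by (cases "norm u = 0") auto
qed

lemma evo_diff: "evo u f \<Longrightarrow> evo v h \<Longrightarrow> evo (u - v) (f - h)"
proof -
  assume "evo u f" "evo v h"
  then obtain w g a w' g' a' where 1: "u = w - K w" "dgr w g" "P u a" "f = g + c *\<^sub>R u + a"
    and 2: "v = w' - K w'" "dgr w' g'" "P v a'" "h = g' + c *\<^sub>R v + a'" unfolding evo_def by blast
  have "dgr (w - w') (g - g')"
    unfolding dgr_def
  proof (intro allI impI)
    fix \<epsilon> assume ok: "ok \<epsilon>"
    have "w - w' = R \<epsilon> (w + \<epsilon> *\<^sub>R g) - R \<epsilon> (w' + \<epsilon> *\<^sub>R g')" using 1(2) 2(2) ok unfolding dgr_def by metis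
    also have "\<dots> = R \<epsilon> ((w - w') + \<epsilon> *\<^sub>R (g - g'))" using ok by (simp add: Rlin scaleR_diff_right)
    finally show "w - w' = R \<epsilon> ((w - w') + \<epsilon> *\<^sub>R (g - g'))" .
  qed
  moreover have "P (u - v) (a - a')" by (rule Pdiff[OF 1(3) 2(3)])
  moreover have "u - v = (w - w') - K (w - w')" by (simp add: 1(1) 2(1) Klin)
  moreover have "f - h = (g - g') + c *\<^sub>R (u - v) + (a - a')" by (simp add: 1(4) 2(4) algebra_simps)
  ultimately show ?thesis unfolding evo_def by blast
qed

lemma evo_imp_S:
  assumes "evo u f" shows "u = S f"
proof -
  obtain h where h: "\<And>n::nat. h n \<in> E" "h \<longlonglongrightarrow> f" using E_seq[of f] by blast
  have b: "\<kappa> * norm (u - S (h n)) \<le> norm (f - h n)" for n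
    by (rule evo_bound[OF evo_diff[OF assms evo_S[OF h(1)]]])
  have "\<kappa> * norm (u - S f) \<le> norm (f - f)"
    by (rule LIMSEQ_le[OF tendsto_mult[OF tendsto_const tendsto_norm[OF tendsto_diff[OF tendsto_const S_tendsto[OF h(2)]]]]
          tendsto_norm[OF tendsto_diff[OF tendsto_const h(2)]]]) (use b in blast)
  then show ?thesis using \<kappa>_pos by (simp add: mult_le_0_iff)
qed

lemma evo_closure: "(\<exists>X Y. (\<forall>n::nat. evo (X n) (Y n)) \<and> X \<longlonglongrightarrow> u \<and> Y \<longlonglongrightarrow> f) \<longleftrightarrow> u = S f"
proof
  assume "\<exists>X Y. (\<forall>n::nat. evo (X n) (Y n)) \<and> X \<longlonglongrightarrow> u \<and> Y \<longlonglongrightarrow> f"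
  then obtain X Y where XY: "\<And>n::nat. evo (X n) (Y n)" "X \<longlonglongrightarrow> u" "Y \<longlonglongrightarrow> f" by blast
  have "X n = S (Y n)" for n by (rule evo_imp_S[OF XY(1)])
  then have "X = (\<lambda>n. S (Y n))" by auto
  then show "u = S f" using XY(2) S_tendsto[OF XY(3)] LIMSEQ_unique by auto
next
  assume u: "u = S f"
  obtain h where h: "\<And>n::nat. h n \<in> E" "h \<longlonglongrightarrow> f" using E_seq[of f] by blast
  then show "\<exists>X Y. (\<forall>n::nat. evo (X n) (Y n)) \<and> X \<longlonglongrightarrow> u \<and> Y \<longlonglongrightarrow> f"
    unfolding u by (intro exI[of _ "\<lambda>n. S (h n)"] exI[of _ h] conjI allI evo_S S_tendsto)
qed

lemma S_inj:
  assumes "S f = 0" shows "f = 0"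
proof -
  obtain h where h: "\<And>n::nat. h n \<in> E" "h \<longlonglongrightarrow> f" using E_seq[of f] by blast
  have u0: "(\<lambda>n. S (h n)) \<longlonglongrightarrow> 0" using S_tendsto[OF h(2)] assms by simp
  have "\<exists>g a. dgr (N (S (h n))) g \<and> P (S (h n)) a \<and> h n = g + c *\<^sub>R S (h n) + a" for n
    using evo_S[OF h(1)[of n]] unfolding evo_def by (metis N_eqI)
  then obtain g a where ga: "\<And>n. dgr (N (S (h n))) (g n)" "\<And>n. P (S (h n)) (a n)" "\<And>n. h n = g n + c *\<^sub>R S (h n) + a n"
    by metis
  have w0: "(\<lambda>n. N (S (h n))) \<longlonglongrightarrow> 0" using N_tendsto[OF u0] N_eqI[of 0 0] by (simp add: Klin)
  have R0: "R \<delta> f = 0" if ok: "ok \<delta>" for \<delta>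
  proof (rule P0, rule Pclosed)
    have Rg: "R \<delta> (g n) = (1/\<delta>) *\<^sub>R (N (S (h n)) - R \<delta> (N (S (h n))))" for n
    proof -
      have "N (S (h n)) - R \<delta> (N (S (h n))) = \<delta> *\<^sub>R R \<delta> (g n)"
        using ga(1)[of n] ok unfolding dgr_def by (metis Rlin(1,3) add_diff_cancel_left')
      then show ?thesis using ok by simp
    qed
    show "P (R \<delta> (S (h n))) (R \<delta> (a n))" for n using RP[OF _ _ ga(2)] ok by blast
    show "(\<lambda>n. R \<delta> (S (h n))) \<longlonglongrightarrow> 0" using R_continuous[OF ok u0] ok by (simp add: Rlin)
    have "R \<delta> (a n) = R \<delta> (h n) - c *\<^sub>R R \<delta> (S (h n)) - (1/\<delta>) *\<^sub>R (N (S (h n)) - R \<delta> (N (S (h n))))" for n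
    proof -
      have "R \<delta> (h n) = R \<delta> (g n) + c *\<^sub>R R \<delta> (S (h n)) + R \<delta> (a n)"
        by (subst ga(3)) (use ok in \<open>simp add: Rlin\<close>)
      then show ?thesis unfolding Rg by simp
    qed
    moreover have "(\<lambda>n. R \<delta> (h n) - c *\<^sub>R R \<delta> (S (h n)) - (1/\<delta>) *\<^sub>R (N (S (h n)) - R \<delta> (N (S (h n)))))
        \<longlonglongrightarrow> R \<delta> f - c *\<^sub>R R \<delta> 0 - (1/\<delta>) *\<^sub>R (0 - R \<delta> 0)"
      by (intro tendsto_diff tendsto_scaleR tendsto_const R_continuous ok u0 w0 h(2))
    ultimately show "(\<lambda>n. R \<delta> (a n)) \<longlonglongrightarrow> R \<delta> f" using ok by (simp add: Rlin)
  qed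
  have "(\<lambda>n. R (e n) f) \<longlonglongrightarrow> 0"
    by (rule null_by_norm[where y = "\<lambda>n. 0"]) (use R0[OF ok_n0] in auto)
  then show ?thesis using R_tendsto[of f] LIMSEQ_unique by blast
qed

end

lemma evolution_related:
  fixes K1 K2 :: "'b::chilbert \<Rightarrow> 'b"
  assumes e1: "evolution K1 R1 P1 J1 E1 \<rho>1 q1 c" and e2: "evolution K2 R2 P2 J2 E2 \<rho>2 q2 c"
    and zero: "Cm 0 0" and add: "\<And>a b a' b'. Cm a b \<Longrightarrow> Cm a' b' \<Longrightarrow> Cm (a + a') (b + b')"
    and scale: "\<And>r a b. Cm a b \<Longrightarrow> Cm (r *\<^sub>R a) (r *\<^sub>R b)"
    and closed: "\<And>X Y x y. (\<And>n::nat. Cm (X n) (Y n)) \<Longrightarrow> X \<longlonglongrightarrow> x \<Longrightarrow> Y \<longlonglongrightarrow> y \<Longrightarrow> Cm x y"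
    and CK: "\<And>a b. Cm a b \<Longrightarrow> Cm (K1 a) (K2 b)"
    and CR: "\<And>\<epsilon> a b. \<epsilon> > 0 \<Longrightarrow> 1 + \<epsilon> * \<rho>1 > 0 \<Longrightarrow> 1 + \<epsilon> * \<rho>2 > 0 \<Longrightarrow> Cm a b \<Longrightarrow> Cm (R1 \<epsilon> a) (R2 \<epsilon> b)"
    and CJ: "\<And>t a b. t > 0 \<Longrightarrow> Cm a b \<Longrightarrow> Cm (J1 t a) (J2 t b)"
    and f: "Cm f1 f2"
  shows "Cm (evolution.S K1 R1 P1 c f1) (evolution.S K2 R2 P2 c f2)"
proof -
  interpret e1: evolution K1 R1 P1 J1 E1 \<rho>1 q1 c by (rule e1)
  interpret e2: evolution K2 R2 P2 J2 E2 \<rho>2 q2 c by (rule e2)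
  have diff: "Cm (a - a') (b - b')" if "Cm a b" "Cm a' b'" for a b a' b'
    using add[OF that(1) scale[OF that(2), of "-1"]] by simp
  have CN: "Cm (e1.N a) (e2.N b)" if ab: "Cm a b" for a b
  proof (rule fixpoint_related[of "max q1 q2" "\<lambda>w. a + K1 w" "\<lambda>w. b + K2 w" _ _ Cm, OF _ _ _ _ e1.N_fix e2.N_fix zero _ closed])
    show "0 \<le> max q1 q2" "max q1 q2 < 1" using e1.q e2.q by auto
    show "norm (a + K1 x - (a + K1 y)) \<le> max q1 q2 * norm (x - y)" for x y
      using e1.Kq[of "x - y"] mult_right_mono[of q1 "max q1 q2" "norm (x - y)"] by (simp add: e1.Klin)
    show "norm (b + K2 x - (b + K2 y)) \<le> max q1 q2 * norm (x - y)" for x y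
      using e2.Kq[of "x - y"] mult_right_mono[of q2 "max q1 q2" "norm (x - y)"] by (simp add: e2.Klin)
    show "Cm (a + K1 x) (b + K2 y)" if "Cm x y" for x y by (intro add ab CK that)
  qed
  have Csol: "Cm (e1.sol \<epsilon> f1) (e2.sol \<epsilon> f2)" if g: "e1.good \<epsilon>" "e2.good \<epsilon>" for \<epsilon>
  proof -
    obtain t1 where t1: "t1 > 0" "\<And>t f u v. 0 < t \<Longrightarrow> t \<le> t1 \<Longrightarrow> norm (e1.step \<epsilon> t f u - e1.step \<epsilon> t f v) \<le> sqrt (1 - t * e1.\<kappa>) * norm (u - v)"
      "\<And>t. 0 < t \<Longrightarrow> t \<le> t1 \<Longrightarrow> t * e1.\<kappa> \<le> 1" using e1.step_contraction[OF g(1)] by metis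
    obtain t2 where t2: "t2 > 0" "\<And>t f u v. 0 < t \<Longrightarrow> t \<le> t2 \<Longrightarrow> norm (e2.step \<epsilon> t f u - e2.step \<epsilon> t f v) \<le> sqrt (1 - t * e2.\<kappa>) * norm (u - v)"
      "\<And>t. 0 < t \<Longrightarrow> t \<le> t2 \<Longrightarrow> t * e2.\<kappa> \<le> 1" using e2.step_contraction[OF g(2)] by metis
    define t where "t = min t1 t2"
    have t: "0 < t" "t \<le> t1" "t \<le> t2" using t1(1) t2(1) by (auto simp: t_def)
    define k where "k = max (sqrt (1 - t * e1.\<kappa>)) (sqrt (1 - t * e2.\<kappa>))"
    have tk: "0 < t * e1.\<kappa>" "0 < t * e2.\<kappa>" using t(1) e1.\<kappa>_pos e2.\<kappa>_pos by simp_all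
    have k: "0 \<le> k" "k < 1" using tk t1(3)[OF t(1,2)] by (auto simp: k_def le_max_iff_disj)
    have c1: "norm (e1.step \<epsilon> t f1 x - e1.step \<epsilon> t f1 y) \<le> k * norm (x - y)" for x y
      by (rule order_trans[OF t1(2)[OF t(1,2)]]) (auto intro: mult_right_mono simp: k_def)
    have c2: "norm (e2.step \<epsilon> t f2 x - e2.step \<epsilon> t f2 y) \<le> k * norm (x - y)" for x y
      by (rule order_trans[OF t2(2)[OF t(1,3)]]) (auto intro: mult_right_mono simp: k_def)
    obtain x1 where x1: "e1.step \<epsilon> t f1 x1 = x1" using banach_fix_type[OF k, of "e1.step \<epsilon> t f1"] c1 by (auto simp: dist_norm)
    obtain x2 where x2: "e2.step \<epsilon> t f2 x2 = x2" using banach_fix_type[OF k, of "e2.step \<epsilon> t f2"] c2 by (auto simp: dist_norm)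
    have st: "Cm (e1.step \<epsilon> t f1 x) (e2.step \<epsilon> t f2 y)" if "Cm x y" for x y
      unfolding e1.step_def e2.step_def e1.M_def e2.M_def e1.Dq_def e2.Dq_def
      using e1.good_ok[OF g(1)] e2.good_ok[OF g(2)] by (intro CJ t(1) diff add scale CN CR that f) auto
    have "Cm x1 x2" by (rule fixpoint_related[OF k c1 c2 x1 x2 zero st closed])
    then show ?thesis using e1.sol_step[OF g(1) t(1) x1] e2.sol_step[OF g(2) t(1) x2] by simp
  qed
  define m where "m = max e1.n0 e2.n0"
  show ?thesis
  proof (rule closed)
    show "Cm (e1.sol (e1.e (n + m)) f1) (e2.sol (e1.e (n + m)) f2)" for n
      by (rule Csol[OF e1.good_n0 e2.good_n0]) (simp_all add: m_def)
    show "(\<lambda>n. e1.sol (e1.e (n + m)) f1) \<longlonglongrightarrow> e1.S f1" by (rule LIMSEQ_ignore_initial_segment[OF e1.sol_tendsto])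
    show "(\<lambda>n. e2.sol (e1.e (n + m)) f2) \<longlonglongrightarrow> e2.S f2"
      by (rule LIMSEQ_ignore_initial_segment[OF e2.sol_tendsto])
  qed
qed

lemma rep_l2_zero: "AE t in lebesgue. rep_l2 (0 :: 'b::chilbert l2) t = 0"
  using rep_l2_scaleR[of 0 "0 :: 'b l2"] by simp

subsection \<open>Resolvents of a maximal monotone linear operator\<close>

context
  fixes D :: "'a::chilbert set" and A :: "'a \<Rightarrow> 'a"
  assumes mm: "maximal_monotone_linear D A"
begin

lemma mm_lincomb: "x \<in> D \<Longrightarrow> y \<in> D \<Longrightarrow> a *\<^sub>C x + b *\<^sub>C y \<in> D" "x \<in> D \<Longrightarrow> y \<in> D \<Longrightarrow> A (a *\<^sub>C x + b *\<^sub>C y) = a *\<^sub>C A x + b *\<^sub>C A y"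
  using mm unfolding maximal_monotone_linear_def by blast+

lemma mm_zero: "0 \<in> D" "A 0 = 0"
  using mm mm_lincomb(2)[of 0 0 0 0] unfolding maximal_monotone_linear_def by auto

lemma mm_add: "x \<in> D \<Longrightarrow> y \<in> D \<Longrightarrow> x + y \<in> D" "x \<in> D \<Longrightarrow> y \<in> D \<Longrightarrow> A (x + y) = A x + A y"
  using mm_lincomb[of x y 1 1] by auto

lemma mm_cscale: "x \<in> D \<Longrightarrow> a *\<^sub>C x \<in> D" "x \<in> D \<Longrightarrow> A (a *\<^sub>C x) = a *\<^sub>C A x"
  using mm_lincomb[of x x a 0] by auto

lemma mm_scaleR: "x \<in> D \<Longrightarrow> r *\<^sub>R x \<in> D" "x \<in> D \<Longrightarrow> A (r *\<^sub>R x) = r *\<^sub>R A x"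
  using mm_cscale[of x "of_real r"] by (simp_all add: cscale_of_real)

lemma mm_diff: "x \<in> D \<Longrightarrow> y \<in> D \<Longrightarrow> x - y \<in> D" "x \<in> D \<Longrightarrow> y \<in> D \<Longrightarrow> A (x - y) = A x - A y"
  using mm_lincomb[of x y 1 "-1"] by (auto simp: cscale_minus_one)

lemma mm_monotone: "x \<in> D \<Longrightarrow> 0 \<le> Re (cinner (A x) x)"
proof -
  assume x: "x \<in> D"
  have "monotone_rel {(x, A x) | x. x \<in> D}" using mm unfolding maximal_monotone_linear_def by blast
  then have "0 \<le> Re (cinner (A x - A 0) (x - 0))" using x mm_zero(1) unfolding monotone_rel_def by blast
  then show ?thesis by (simp add: mm_zero)
qed

lemma mm_maximal:
  assumes "\<And>x. x \<in> D \<Longrightarrow> 0 \<le> Re (cinner (A x - v) (x - u))"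
  shows "u \<in> D \<and> v = A u"
proof -
  define B where "B = insert (u, v) {(x, A x) | x. x \<in> D}"
  have s: "0 \<le> Re (cinner (v - A x) (u - x))" if "x \<in> D" for x
  proof -
    have "cinner (v - A x) (u - x) = cinner (A x - v) (x - u)" by (simp add: cinner_simps)
    then show ?thesis using assms[OF that] by simp
  qed
  have "monotone_rel {(x, A x) | x. x \<in> D}" using mm unfolding maximal_monotone_linear_def by blast
  then have "monotone_rel B" using assms s unfolding monotone_rel_def B_def by auto
  then have "B = {(x, A x) | x. x \<in> D}" using mm unfolding maximal_monotone_linear_def B_def by blast
  then show ?thesis unfolding B_def by blast
qed

lemma mm_bounds:
  assumes "t > 0" "x \<in> D" shows "norm x \<le> norm (x + t *\<^sub>R A x)"
proof -
  have "norm (x + t *\<^sub>R A x) * norm x \<ge> Re (cinner (x + t *\<^sub>R A x) x)" by (rule Re_cinner_le)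
  moreover have "Re (cinner (x + t *\<^sub>R A x) x) = (norm x)\<^sup>2 + t * Re (cinner (A x) x)"
    by (simp add: cinner_add_left cinner_scaleR_left Re_cinner_self)
  moreover have "0 \<le> t * Re (cinner (A x) x)" using assms mm_monotone by simp
  ultimately have "norm x * norm x \<le> norm (x + t *\<^sub>R A x) * norm x" by (simp add: power2_eq_square)
  then show ?thesis by (cases "norm x = 0") auto
qed

lemma mm_range_closed:
  assumes t: "t > 0" shows "closed {x + t *\<^sub>R A x | x. x \<in> D}"
  unfolding closed_sequential_limits
proof (intro allI impI, elim conjE)
  fix Y y assume Y: "\<forall>n::nat. Y n \<in> {x + t *\<^sub>R A x | x. x \<in> D}" and lim: "Y \<longlonglongrightarrow> y"
  obtain X where X: "\<And>n. X n \<in> D" "\<And>n. Y n = X n + t *\<^sub>R A (X n)" using Y by (auto, metis)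
  have d: "norm (X m - X n) \<le> norm (Y m - Y n)" for m n
  proof -
    have "Y m - Y n = (X m - X n) + t *\<^sub>R A (X m - X n)" by (simp add: X mm_diff algebra_simps)
    then show ?thesis using mm_bounds[OF t mm_diff(1)[OF X(1) X(1)], of m n] by simp
  qed
  have "Cauchy X"
    by (rule CauchyI) (use CauchyD[OF LIMSEQ_imp_Cauchy[OF lim]] d in \<open>meson le_less_trans\<close>)
  then obtain x where x: "X \<longlonglongrightarrow> x" using Cauchy_convergent_iff convergent_def by blast
  define v where "v = (1/t) *\<^sub>R (y - x)"
  have AX: "A (X n) = (1/t) *\<^sub>R (Y n - X n)" for n using t by (simp add: X(2))
  have v: "(\<lambda>n. A (X n)) \<longlonglongrightarrow> v" unfolding AX v_def by (intro tendsto_intros lim x)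
  have "x \<in> D \<and> v = A x"
  proof (rule mm_maximal)
    fix z assume z: "z \<in> D"
    have l: "(\<lambda>n. Re (cinner (A z - A (X n)) (z - X n))) \<longlonglongrightarrow> Re (cinner (A z - v) (z - x))"
      by (intro tendsto_Re cinner.tendsto tendsto_diff tendsto_const v x)
    have "0 \<le> Re (cinner (A z - A (X n)) (z - X n))" for n
      using mm_monotone[OF mm_diff(1)[OF z X(1)]] by (simp add: mm_diff z X(1))
    then show "0 \<le> Re (cinner (A z - v) (z - x))" by (intro LIMSEQ_le_const[OF l]) blast
  qed
  moreover have "y = x + t *\<^sub>R v" using t by (simp add: v_def)
  ultimately show "y \<in> {x + t *\<^sub>R A x | x. x \<in> D}" by blast
qed

lemma mm_range:
  assumes t: "t > 0" shows "\<exists>x\<in>D. x + t *\<^sub>R A x = y"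
proof -
  define S where "S = {x + t *\<^sub>R A x | x. x \<in> D}"
  have "subspace S"
    unfolding subspace_def
  proof (intro conjI ballI allI)
    show "0 \<in> S" unfolding S_def using mm_zero by force
    fix a b assume "a \<in> S" "b \<in> S"
    then obtain x z where "x \<in> D" "z \<in> D" "a = x + t *\<^sub>R A x" "b = z + t *\<^sub>R A z" unfolding S_def by blast
    then show "a + b \<in> S" unfolding S_def by (intro CollectI exI[of _ "x + z"]) (simp add: mm_add scaleR_add_right)
  next
    fix r a assume "a \<in> S"
    then obtain x where "x \<in> D" "a = x + t *\<^sub>R A x" unfolding S_def by blast
    then show "r *\<^sub>R a \<in> S" unfolding S_def by (intro CollectI exI[of _ "r *\<^sub>R x"]) (simp add: mm_scaleR scaleR_add_right)
  qed
  moreover have "y = 0" if orth: "\<forall>s\<in>S. Re (cinner y s) = 0" for y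
  proof -
    have o: "Re (cinner y x) = - t * Re (cinner y (A x))" if "x \<in> D" for x
      using orth that unfolding S_def by (force simp: cinner_add_right cinner_scaleR_right)
    have "y \<in> D \<and> (1/t) *\<^sub>R y = A y"
    proof (rule mm_maximal)
      fix x assume x: "x \<in> D"
      have "Re (cinner (A x - (1/t) *\<^sub>R y) (x - y)) = Re (cinner (A x) x) + (norm y)\<^sup>2 / t"
        using o[OF x] t Re_cinner_commute[of y "A x"] by (simp add: cinner_simps Re_cinner_self)
      then show "0 \<le> Re (cinner (A x - (1/t) *\<^sub>R y) (x - y))" using mm_monotone[OF x] t by simp
    qed
    then have "Re (cinner y y) = - t * Re (cinner y ((1/t) *\<^sub>R y))" using o[of y] by metis
    then have "(norm y)\<^sup>2 = - ((norm y)\<^sup>2)" using t by (simp add: cinner_scaleR_right Re_cinner_self)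
    then show "y = 0" by simp
  qed
  ultimately have "closure S = UNIV" by (rule dense_by_orthogonality)
  then have "S = UNIV" using mm_range_closed[OF t] by (simp add: S_def closure_closed)
  then have "y \<in> S" by simp
  then show ?thesis unfolding S_def by blast
qed

definition res :: "real \<Rightarrow> 'a \<Rightarrow> 'a" where "res t y = (THE x. x \<in> D \<and> x + t *\<^sub>R A x = y)"

lemma res_eqI:
  assumes t: "t > 0" and x: "x \<in> D" shows "res t (x + t *\<^sub>R A x) = x"
  unfolding res_def
proof (rule the_equality)
  fix z assume z: "z \<in> D \<and> z + t *\<^sub>R A z = x + t *\<^sub>R A x"
  then have "(z - x) + t *\<^sub>R A (z - x) = 0" using x by (simp add: mm_diff algebra_simps)
  then show "z = x" using mm_bounds[OF t mm_diff(1)[of z x]] z x by simp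
qed (use x in simp)

lemma res: "t > 0 \<Longrightarrow> res t y \<in> D" "t > 0 \<Longrightarrow> res t y + t *\<^sub>R A (res t y) = y"
  using mm_range[of t y] res_eqI[of t] by auto

lemma res_nonexpansive: "t > 0 \<Longrightarrow> norm (res t y) \<le> norm y"
  using mm_bounds[of t "res t y"] res[of t y] by simp

lemma res_clinear: "t > 0 \<Longrightarrow> bounded_clinear_op (res t)"
proof (rule bounded_clinear_opI[where K = 1])
  assume t: "t > 0"
  show "res t (x + y) = res t x + res t y" for x y
    using res_eqI[OF t mm_add(1)[OF res(1)[OF t, of x] res(1)[OF t, of y]]] res[OF t, of x] res[OF t, of y]
    by (simp add: mm_add algebra_simps)
  show "res t (a *\<^sub>C x) = a *\<^sub>C res t x" for a x
    using res_eqI[OF t mm_cscale(1)[OF res(1)[OF t, of x], of a]] res[OF t, of x]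
    by (simp add: mm_cscale cscale_scaleR[symmetric] cscale_add_right[symmetric])
  show "norm (res t x) \<le> 1 * norm x" for x using res_nonexpansive[OF t] by simp
qed

lemma graph_iff_res: "x \<in> D \<and> b = A x \<longleftrightarrow> x = res 1 (x + b)"
proof
  assume "x \<in> D \<and> b = A x" then show "x = res 1 (x + b)" using res_eqI[of 1 x] by simp
next
  assume x: "x = res 1 (x + b)"
  then show "x \<in> D \<and> b = A x" using res[of 1 "x + b"] by auto
qed

definition pgr :: "'a l2 \<Rightarrow> 'a l2 \<Rightarrow> bool" where "pgr u a \<longleftrightarrow> u = ptop (res 1) (u + a)"

lemmas res1 = res_clinear[OF zero_less_one]

lemma pgr_iff: "pgr u a \<longleftrightarrow> (AE t in lebesgue. rep_l2 u t \<in> D \<and> rep_l2 a t = A (rep_l2 u t))"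
proof
  assume "pgr u a"
  then have p: "u = ptop (res 1) (u + a)" unfolding pgr_def .
  have "AE t in lebesgue. rep_l2 u t = res 1 (rep_l2 (u + a) t)" using rep_ptop[OF res1, of "u + a"] p by simp
  with rep_l2_add[of u a] show "AE t in lebesgue. rep_l2 u t \<in> D \<and> rep_l2 a t = A (rep_l2 u t)"
    unfolding graph_iff_res by eventually_elim simp
next
  assume r: "AE t in lebesgue. rep_l2 u t \<in> D \<and> rep_l2 a t = A (rep_l2 u t)"
  show "pgr u a" unfolding pgr_def
  proof (rule l2_eqI)
    show "AE t in lebesgue. rep_l2 u t = rep_l2 (ptop (res 1) (u + a)) t"
      using r[unfolded graph_iff_res] rep_l2_add[of u a] rep_ptop[OF res1, of "u + a"] by eventually_elim simp
  qed
qed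

lemma pgr_add: "pgr u a \<Longrightarrow> pgr v b \<Longrightarrow> pgr (u + v) (a + b)"
proof -
  assume "pgr u a" "pgr v b"
  then have p: "u = ptop (res 1) (u + a)" "v = ptop (res 1) (v + b)" unfolding pgr_def .
  have "ptop (res 1) ((u + v) + (a + b)) = ptop (res 1) ((u + a) + (v + b))" by (simp add: algebra_simps)
  also have "\<dots> = ptop (res 1) (u + a) + ptop (res 1) (v + b)" by (rule bounded_clinear_opD(2)[OF ptop_clinear[OF res1]])
  also have "\<dots> = u + v" by (rule arg_cong2[of _ _ _ _ "(+)", OF p(1)[symmetric] p(2)[symmetric]])
  finally show ?thesis unfolding pgr_def ..
qed

lemma pgr_scaleR: "pgr u a \<Longrightarrow> pgr (r *\<^sub>R u) (r *\<^sub>R a)"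
  unfolding pgr_def scaleR_add_right[symmetric] bounded_clinear_opD(4)[OF ptop_clinear[OF res1]] by simp

lemma pgr_closed:
  assumes "\<And>n::nat. pgr (X n) (Y n)" "X \<longlonglongrightarrow> u" "Y \<longlonglongrightarrow> a" shows "pgr u a"
  unfolding pgr_def
proof (rule LIMSEQ_unique[OF assms(2)])
  have "X n = ptop (res 1) (X n + Y n)" for n using assms(1) unfolding pgr_def .
  then have "X = (\<lambda>n. ptop (res 1) (X n + Y n))" by auto
  also have "\<dots> \<longlonglongrightarrow> ptop (res 1) (u + a)"
    by (intro bounded_linear.tendsto[OF bounded_clinear_opD(1)[OF ptop_clinear[OF res1]]] tendsto_add assms)
  finally show "X \<longlonglongrightarrow> ptop (res 1) (u + a)" .
qed

lemma pgr_zero: "pgr 0 a \<Longrightarrow> a = 0"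
proof (rule l2_eqI)
  assume "pgr 0 a"
  then show "AE t in lebesgue. rep_l2 a t = rep_l2 0 t"
    using rep_l2_zero[where 'b='a] unfolding pgr_iff by eventually_elim (simp add: mm_zero)
qed

lemma pgr_accretive: "pgr u a \<Longrightarrow> 0 \<le> Re (cinner a u)"
proof -
  assume p: "pgr u a"
  have "Re (cinner a u) = (LINT t|lebesgue. Re (cinner (rep_l2 a t) (rep_l2 u t)))"
    unfolding cinner_l2_rep by (rule integral_Re[OF L2_integrable_cinner[OF L2_rep L2_rep], symmetric])
  moreover have "AE t in lebesgue. 0 \<le> Re (cinner (rep_l2 a t) (rep_l2 u t))"
    using p[unfolded pgr_iff] by eventually_elim (simp add: mm_monotone)
  ultimately show ?thesis by (simp add: integral_nonneg_AE)
qed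

lemma pgr_res: "t > 0 \<Longrightarrow> pgr (ptop (res t) g) ((1/t) *\<^sub>R (g - ptop (res t) g))"
proof -
  assume t: "t > 0"
  show ?thesis unfolding pgr_iff
    using rep_ptop[OF res_clinear[OF t], of g] rep_l2_diff[of g "ptop (res t) g"] rep_l2_scaleR[of "1/t" "g - ptop (res t) g"]
  proof eventually_elim
    case (elim s)
    have "rep_l2 g s - res t (rep_l2 g s) = t *\<^sub>R A (res t (rep_l2 g s))"
      using res(2)[OF t, of "rep_l2 g s"] by (metis add_diff_cancel_left')
    then show ?case using elim res(1)[OF t, of "rep_l2 g s"] t by simp
  qed
qed

end

subsection \<open>The weighted kernels\<close>

lemma wker_wker: "wker k (wker l C) = wker (\<lambda>s. k s * l s) C"
  by (simp add: wker_def fun_eq_iff)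

lemma wker_exp: "wker (\<lambda>s. exp (\<delta> * s)) (expw \<rho> C) = expw (\<rho> - \<delta>) C"
  unfolding wker_wker exp_add[symmetric] by (simp add: algebra_simps)

lemma L2w_interpolate:
  assumes "f \<in> L2w a" "f \<in> L2w b" "a \<le> \<mu>" "\<mu> \<le> b" shows "f \<in> L2w \<mu>"
proof -
  define h where "h r t = norm (exp (- r * t) *\<^sub>R f t)" for r t
  have i: "integrable lebesgue (\<lambda>t. (h a t)\<^sup>2)" "integrable lebesgue (\<lambda>t. (h b t)\<^sup>2)"
    using assms(1,2) unfolding L2w_iff L2_def h_def by blast+
  have fm: "strongly_measurable f" using assms(1) by (simp add: L2w_def)
  have sm: "strongly_measurable (\<lambda>t. exp (- \<mu> * t) *\<^sub>R f t)"
    by (rule strongly_measurable_scaleR[OF exp_measurable_lebesgue fm])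
  have "integrable lebesgue (\<lambda>t. (h \<mu> t)\<^sup>2)"
  proof (rule bochner_bound[OF Bochner_Integration.integrable_add[OF i]])
    have "(\<lambda>t. Re (cinner (exp (- \<mu> * t) *\<^sub>R f t) (exp (- \<mu> * t) *\<^sub>R f t))) \<in> borel_measurable lebesgue"
      using strongly_measurable_cinner[OF sm sm] by measurable
    then show "(\<lambda>t. (h \<mu> t)\<^sup>2) \<in> borel_measurable lebesgue" unfolding Re_cinner_self h_def .
    show "AE t in lebesgue. norm ((h \<mu> t)\<^sup>2) \<le> norm ((h a t)\<^sup>2 + (h b t)\<^sup>2)"
    proof (rule AE_I2)
      fix t
      have "exp (- \<mu> * t) \<le> exp (- a * t) \<or> exp (- \<mu> * t) \<le> exp (- b * t)"
        using mult_right_mono[OF assms(3), of t] mult_right_mono_neg[OF assms(4), of t] by (cases "t \<ge> 0") auto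
      then have "h \<mu> t \<le> h a t \<or> h \<mu> t \<le> h b t"
        unfolding h_def norm_scaleR abs_exp_cancel by (meson mult_right_mono norm_ge_zero)
      then have "(h \<mu> t)\<^sup>2 \<le> (h a t)\<^sup>2 \<or> (h \<mu> t)\<^sup>2 \<le> (h b t)\<^sup>2"
        by (auto simp: h_def intro!: power_mono)
      then have "(h \<mu> t)\<^sup>2 \<le> (h a t)\<^sup>2 + (h b t)\<^sup>2"
        by (metis add.commute add_increasing2 zero_le_power2)
      then show "norm ((h \<mu> t)\<^sup>2) \<le> norm ((h a t)\<^sup>2 + (h b t)\<^sup>2)"
        by simp
    qed
  qed
  then show ?thesis unfolding L2w_iff L2_def h_def using sm by simp
qed

lemma resolvent_param: "\<exists>\<epsilon>::real. \<epsilon> > 0 \<and> 1 + \<epsilon> * \<rho> > 0"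
proof (intro exI conjI)
  show "0 < 1 / (1 + \<bar>\<rho>\<bar>)" by (simp add: add_pos_nonneg)
  have "1 + 1 / (1 + \<bar>\<rho>\<bar>) * \<rho> = (1 + \<bar>\<rho>\<bar> + \<rho>) / (1 + \<bar>\<rho>\<bar>)" by (simp add: field_simps)
  then show "0 < 1 + 1 / (1 + \<bar>\<rho>\<bar>) * \<rho>" by (simp add: add_pos_nonneg divide_pos_pos)
qed

lemma Rop_resolvent:
  fixes z :: "'a::chilbert l2"
  assumes e: "\<epsilon> > 0" "1 + \<epsilon> * \<rho> > 0" and d: "\<delta> > 0" "1 + \<delta> * \<rho> > 0"
  shows "Rop \<epsilon> \<rho> z = Rop \<delta> \<rho> (Rop \<epsilon> \<rho> z + \<delta> *\<^sub>R ((1/\<epsilon>) *\<^sub>R (z - Rop \<epsilon> \<rho> z)))"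
proof -
  define w g where "w = unemb \<rho> (Rop \<epsilon> \<rho> z)" and "g = unemb \<rho> ((1/\<epsilon>) *\<^sub>R (z - Rop \<epsilon> \<rho> z))"
  have "(w, g) \<in> deriv_graph \<rho>"
    unfolding deriv_graph_iff[OF e] w_def g_def using e by (simp add: unemb_L2w)
  then show ?thesis unfolding deriv_graph_iff[OF d] by (simp add: w_def g_def)
qed

definition smooth_data :: "real \<Rightarrow> 'a::chilbert l2 set" where
  "smooth_data \<rho> = {emb \<rho> (tsum xs) | xs. tests xs}"

lemma smooth_data_derivative:
  assumes "f \<in> smooth_data \<rho>"
  shows "\<exists>f'\<in>smooth_data \<rho>. \<forall>\<epsilon>>0. 1 + \<epsilon> * \<rho> > 0 \<longrightarrow> f = Rop \<epsilon> \<rho> (f + \<epsilon> *\<^sub>R f')"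
proof -
  obtain xs where xs: "f = emb \<rho> (tsum xs)" "tests xs" using assms unfolding smooth_data_def by blast
  have "emb \<rho> (tsum (dl xs)) \<in> smooth_data \<rho>" unfolding smooth_data_def using tests_dl[OF xs(2)] by blast
  moreover have "f = Rop \<epsilon> \<rho> (f + \<epsilon> *\<^sub>R emb \<rho> (tsum (dl xs)))" if "\<epsilon> > 0" "1 + \<epsilon> * \<rho> > 0" for \<epsilon>
    using Rop_test_fn[OF that test_fn_tsum[OF xs(2)]] by (simp add: xs(1) dvec_tsum[OF xs(2)])
  ultimately show ?thesis by blast
qed

lemma smooth_data_dense: "closure (smooth_data \<rho>) = (UNIV :: 'a::chilbert l2 set)"
proof -
  obtain \<epsilon> where e: "\<epsilon> > 0" "1 + \<epsilon> * \<rho> > 0" using resolvent_param by blast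
  have "{emb \<rho> (tsum xs) + \<epsilon> *\<^sub>R emb \<rho> (tsum (dl xs)) | xs. tests xs} \<subseteq> (smooth_data \<rho> :: 'a l2 set)"
  proof safe
    fix xs :: "((real \<Rightarrow> real) \<times> 'a) list" assume xs: "tests xs"
    define ys where "ys = xs @ map (\<lambda>p. (fst p, \<epsilon> *\<^sub>R snd p)) (dl xs)"
    have L: "tsum xs \<in> L2w \<rho>" "tsum (dl xs) \<in> L2w \<rho>" by (intro test_fn_L2w test_fn_tsum xs tests_dl)+
    have s: "tsum (map (\<lambda>p. (fst p, \<epsilon> *\<^sub>R snd p)) zs) t = \<epsilon> *\<^sub>R tsum zs t" for zs :: "((real \<Rightarrow> real) \<times> 'a) list" and t
      by (induction zs) (auto simp: tsum_def scaleR_add_right)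
    have ys: "tsum ys = (\<lambda>t. tsum xs t + \<epsilon> *\<^sub>R tsum (dl xs) t)"
      unfolding s[symmetric] by (rule ext) (simp add: ys_def tsum_def)
    have "emb \<rho> (tsum xs) + \<epsilon> *\<^sub>R emb \<rho> (tsum (dl xs)) = emb \<rho> (tsum ys)"
      unfolding ys emb_add[OF L(1) L2w_scaleR[OF L(2)]] emb_scaleR[OF L(2)] ..
    moreover have "tests ys" using xs tests_dl[OF xs] by (auto simp: ys_def tests_def)
    ultimately show "emb \<rho> (tsum xs) + \<epsilon> *\<^sub>R emb \<rho> (tsum (dl xs)) \<in> smooth_data \<rho>" unfolding smooth_data_def by blast
  qed
  from closure_mono[OF this] show ?thesis unfolding resolvent_range_dense[OF e] by blast
qed

lemma compat_Rop:
  fixes a b :: "'a::chilbert l2"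
  assumes e: "\<epsilon> > 0" "1 + \<epsilon> * \<rho> > 0" "1 + \<epsilon> * \<mu> > 0" and c: "compat (\<rho> - \<mu>) a b"
  shows "compat (\<rho> - \<mu>) (Rop \<epsilon> \<rho> a) (Rop \<epsilon> \<mu> b)"
proof -
  have w: "wker (\<lambda>s. exp ((\<rho> - \<mu>) * s)) (wker (rker \<epsilon> \<rho>) (\<lambda>s x. x :: 'a)) = wker (rker \<epsilon> \<mu>) (\<lambda>s x. x)"
  proof -
    have "exp ((\<rho> - \<mu>) * s) * rker \<epsilon> \<rho> s = rker \<epsilon> \<mu> s" for s
    proof -
      have "exp ((\<rho> - \<mu>) * s) * exp (- (1/\<epsilon> + \<rho>) * s) = exp (- (1/\<epsilon> + \<mu>) * s)"
        unfolding exp_add[symmetric] by (simp add: algebra_simps)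
      then show ?thesis unfolding rker_def by simp
    qed
    then show ?thesis unfolding wker_wker by simp
  qed
  show ?thesis
    using compat_convop[OF c adm_rker[OF e(1,2)]] adm_rker[OF e(1,3), where 'a='a] unfolding w Rop_def by blast
qed

lemma compat_emb: "f \<in> L2w \<rho> \<Longrightarrow> f \<in> L2w \<mu> \<Longrightarrow> compat (\<rho> - \<mu>) (emb \<rho> f) (emb \<mu> f)"
proof -
  assume f: "f \<in> L2w \<rho>" "f \<in> L2w \<mu>"
  show ?thesis unfolding compat_def using rep_emb[OF f(1)] rep_emb[OF f(2)]
  proof eventually_elim
    case (elim t)
    have "exp (- \<mu> * t) = exp ((\<rho> - \<mu>) * t) * exp (- \<rho> * t)" unfolding exp_add[symmetric] by (simp add: algebra_simps)
    then show ?case unfolding elim by simp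
  qed
qed

lemma compat_emb_L2w:
  assumes u: "u \<in> L2w \<rho>" and c: "compat (\<rho> - \<mu>) (emb \<rho> u) v" shows "u \<in> L2w \<mu>"
proof (rule L2w_cong_AE[OF unemb_L2w[of \<mu> v]])
  show "AE t in lebesgue. unemb \<mu> v t = u t"
    using c[unfolded compat_def] rep_emb[OF u]
  proof eventually_elim
    case (elim t)
    have "exp (\<mu> * t) * (exp ((\<rho> - \<mu>) * t) * exp (- \<rho> * t)) = 1" unfolding exp_add[symmetric] by (simp add: algebra_simps)
    then show ?case unfolding unemb_def elim scaleR_scaleR by simp
  qed
qed


lemma cinner_Im_op:
  assumes T: "bounded_clinear_op T" shows "cinner (Im_op T x) (x::'b::chilbert) = of_real (Im (cinner (T x) x))"
proof -
  have "cinner (adjoint_op T x) x = cnj (cinner (T x) x)"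
    by (subst cinner_commute) (simp add: adjoint_op_eq[OF T])
  then have "cinner (Im_op T x) x = (1 / (2 * \<i>)) * (cinner (T x) x - cnj (cinner (T x) x))"
    unfolding Im_op_def cinner_cscale_left cinner_diff_left by simp
  also have "\<dots> = of_real (Im (cinner (T x) x))" by (simp add: complex_diff_cnj, simp add: complex_eq_iff)
  finally show ?thesis .
qed

context
  fixes C :: "real \<Rightarrow> 'a::chilbert \<Rightarrow> 'a" and \<nu>0 :: real
  assumes Cb0: "\<forall>s\<ge>0. bounded_clinear_op (C s)"
    and Cw: "\<And>x y. set_borel_measurable lebesgue {0..} (\<lambda>s. cinner (C s x) y)"
    and Cn: "set_borel_measurable lebesgue {0..} (\<lambda>s. onorm (C s))"
    and Ci: "(\<integral>\<^sup>+ s\<in>{0..}. ennreal (onorm (C s) * exp (\<nu>0 * s)) \<partial>lebesgue) < 1"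
begin

lemmas Cb = Cb0[rule_format]

lemma kernel_nn_integral_mono:
  assumes "\<beta> \<le> \<beta>'"
  shows "(\<integral>\<^sup>+ s\<in>{0..}. ennreal (onorm (C s) * exp (\<beta> * s)) \<partial>lebesgue) \<le> (\<integral>\<^sup>+ s\<in>{0..}. ennreal (onorm (C s) * exp (\<beta>' * s)) \<partial>lebesgue)"
proof (rule nn_integral_mono)
  fix s
  show "ennreal (onorm (C s) * exp (\<beta> * s)) * indicator {0..} s \<le> ennreal (onorm (C s) * exp (\<beta>' * s)) * indicator {0..} s"
    using onorm_nonneg_clinear[OF Cb, of s] mult_right_mono[OF assms, of s]
    by (cases "s \<ge> 0") (auto intro!: ennreal_leI mult_left_mono)
qed

lemma kernel_measurable: "(\<lambda>s. indicat_real {0..} s *\<^sub>R (onorm (C s) * exp (\<beta> * s))) \<in> borel_measurable lebesgue"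
proof -
  have "(\<lambda>s. (indicat_real {0..} s *\<^sub>R onorm (C s)) * exp (\<beta> * s)) \<in> borel_measurable lebesgue"
    using Cn unfolding set_borel_measurable_def by (rule borel_measurable_times[OF _ exp_measurable_lebesgue])
  then show ?thesis by (simp add: mult.assoc)
qed

lemma kernel_nn_integral_eq:
  "(\<integral>\<^sup>+ s. ennreal (indicat_real {0..} s *\<^sub>R (onorm (C s) * exp (\<beta> * s))) \<partial>lebesgue) = (\<integral>\<^sup>+ s\<in>{0..}. ennreal (onorm (C s) * exp (\<beta> * s)) \<partial>lebesgue)"
  by (rule nn_integral_cong) (simp split: split_indicator)

lemma kernel_nonneg: "0 \<le> indicat_real {0..} s *\<^sub>R (onorm (C s) * exp (\<beta> * s))"
  using onorm_nonneg_clinear[OF Cb, of s] by (simp split: split_indicator)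

lemma kernel_set_integrable:
  assumes "\<beta> \<le> \<nu>0" shows "set_integrable lebesgue {0..} (\<lambda>s. onorm (C s) * exp (\<beta> * s))"
  unfolding set_integrable_def
proof (rule integrableI_bounded[OF kernel_measurable])
  have "(\<integral>\<^sup>+ s. ennreal (norm (indicat_real {0..} s *\<^sub>R (onorm (C s) * exp (\<beta> * s)))) \<partial>lebesgue)
      = (\<integral>\<^sup>+ s\<in>{0..}. ennreal (onorm (C s) * exp (\<beta> * s)) \<partial>lebesgue)"
    unfolding kernel_nn_integral_eq[symmetric] real_norm_def abs_of_nonneg[OF kernel_nonneg] ..
  also have "\<dots> < 1" by (rule le_less_trans[OF kernel_nn_integral_mono[OF assms] Ci])
  also have "1 < (\<infinity>::ennreal)" by simp
  finally show "(\<integral>\<^sup>+ s. ennreal (norm (indicat_real {0..} s *\<^sub>R (onorm (C s) * exp (\<beta> * s)))) \<partial>lebesgue) < \<infinity>" .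
qed

lemma adm_exp:
  assumes "- \<nu>0 \<le> \<rho>" shows "adm (expw \<rho> C)"
proof (rule adm_wkerI[OF Cb Cw exp_measurable_lebesgue])
  have "- \<rho> \<le> \<nu>0" using assms by simp
  from kernel_set_integrable[OF this] show "set_integrable lebesgue {0..} (\<lambda>s. \<bar>exp (- \<rho> * s)\<bar> * onorm (C s))"
    unfolding abs_exp_cancel mult.commute[of "exp _"] .
qed

lemma kint_exp:
  assumes "- \<nu>0 \<le> \<rho>"
  shows "kint (expw \<rho> C) = enn2real (\<integral>\<^sup>+ s\<in>{0..}. ennreal (onorm (C s) * exp (- \<rho> * s)) \<partial>lebesgue)"
proof -
  have "kint (expw \<rho> C) = (LINT s|lebesgue. indicat_real {0..} s *\<^sub>R (onorm (C s) * exp (- \<rho> * s)))"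
    unfolding kint_def set_lebesgue_integral_def
  proof (rule bochner_cong)
    fix s
    show "indicat_real {0..} s *\<^sub>R onorm (expw \<rho> C s) = indicat_real {0..} s *\<^sub>R (onorm (C s) * exp (- \<rho> * s))"
      using onorm_wker[of C s "\<lambda>s. exp (- \<rho> * s)", OF Cb] by (cases "s \<ge> 0") (simp_all add: mult.commute)
  qed
  also have "\<dots> = enn2real (\<integral>\<^sup>+ s. ennreal (indicat_real {0..} s *\<^sub>R (onorm (C s) * exp (- \<rho> * s))) \<partial>lebesgue)"
    by (rule integral_eq_nn_integral[OF kernel_measurable]) (simp only: kernel_nonneg AE_I2)
  finally show ?thesis unfolding kernel_nn_integral_eq .
qed

lemma kint_exp_mono:
  assumes "- \<nu>0 \<le> \<rho>" "\<rho> \<le> \<rho>'"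
  shows "kint (expw \<rho>' C) \<le> kint (expw \<rho> C)" "kint (expw \<rho> C) < 1"
proof -
  have 1: "(\<integral>\<^sup>+ s\<in>{0..}. ennreal (onorm (C s) * exp (- \<rho> * s)) \<partial>lebesgue) < 1"
    by (rule le_less_trans[OF kernel_nn_integral_mono Ci]) (use assms in simp)
  have 2: "- \<nu>0 \<le> \<rho>'" using assms by simp
  show "kint (expw \<rho>' C) \<le> kint (expw \<rho> C)"
    unfolding kint_exp[OF 2] kint_exp[OF assms(1)]
  proof (rule enn2real_mono)
    show "(\<integral>\<^sup>+ s\<in>{0..}. ennreal (onorm (C s) * exp (- \<rho>' * s)) \<partial>lebesgue) \<le> (\<integral>\<^sup>+ s\<in>{0..}. ennreal (onorm (C s) * exp (- \<rho> * s)) \<partial>lebesgue)"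
      by (rule kernel_nn_integral_mono) (use assms in simp)
    show "(\<integral>\<^sup>+ s\<in>{0..}. ennreal (onorm (C s) * exp (- \<rho> * s)) \<partial>lebesgue) < top"
      using 1 by (rule less_trans) simp
  qed
  have "enn2real X < 1" if "X < 1" for X :: ennreal
    using that by (cases X) (auto simp: ennreal_less_one_iff)
  then show "kint (expw \<rho> C) < 1" unfolding kint_exp[OF assms(1)] using 1 .
qed

abbreviation "K0 \<equiv> expw (- \<nu>0) C"

lemma Chat_cinner:
  fixes t :: real
  defines "z \<equiv> complex_of_real t + \<i> * complex_of_real \<nu>0"
  shows "cinner (Chat C z x) y = of_real (1 / sqrt (2 * pi)) * (LINT s|lebesgue. cinner (Cz K0 s x) y * iexp (- t * s))"
    and "norm (Chat C z x) \<le> 1 / sqrt (2 * pi) * kint K0 * norm x"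
proof -
  have K0: "adm K0" by (rule adm_exp) simp
  define g where "g s = exp (- \<i> * complex_of_real s * z) *\<^sub>C C s x" for s
  have g: "g s = iexp (- t * s) *\<^sub>C K0 s x" for s
  proof -
    have "- \<i> * complex_of_real s * z = \<i> * complex_of_real (- t * s) + complex_of_real (\<nu>0 * s)"
      by (simp add: z_def algebra_simps)
    then have "exp (- \<i> * complex_of_real s * z) = iexp (- t * s) * complex_of_real (exp (\<nu>0 * s))"
      by (simp only: exp_add exp_of_real)
    then show ?thesis unfolding g_def wker_def by (simp add: cscale_cscale[symmetric] cscale_of_real)
  qed
  have gc: "cinner (g s) y = iexp (- t * s) * cinner (K0 s x) y" for s y unfolding g by (rule cinner_cscale_left)
  have meas: "set_borel_measurable lebesgue {0..} (\<lambda>s. cinner (g s) y)" for y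
  proof -
    have "(\<lambda>s. iexp (- t * s) * (indicat_real {0..} s *\<^sub>R cinner (K0 s x) y)) \<in> borel_measurable lebesgue"
      using K0 unfolding adm_def set_borel_measurable_def by (intro borel_measurable_times[OF iexp_lebesgue]) blast
    then show ?thesis unfolding set_borel_measurable_def gc mult_scaleR_right .
  qed
  have k: "set_integrable lebesgue {0..} (\<lambda>s. onorm (K0 s) * norm x)"
    using K0 unfolding adm_def by (intro set_integrable_mult_left) blast
  have bd: "AE s in lebesgue. s \<in> {0..} \<longrightarrow> norm (g s) \<le> onorm (K0 s) * norm x"
    unfolding g norm_cscale using bounded_clinear_op_onorm[OF adm_bounded[OF K0]] by (intro AE_I2) (simp add: norm_exp_i_times)
  have Ch: "Chat C z x = (1 / complex_of_real (sqrt (2 * pi))) *\<^sub>C weak_integral {0..} g"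
    unfolding Chat_def g_def ..
  have "cinner (weak_integral {0..} g) y = (LINT s|lebesgue. cinner (Cz K0 s x) y * iexp (- t * s))"
    unfolding weak_integral(2)[OF meas k bd] set_lebesgue_integral_def gc
    by (rule Bochner_Integration.integral_cong) (simp_all add: Cz_def mult.commute)
  then show "cinner (Chat C z x) y = of_real (1 / sqrt (2 * pi)) * (LINT s|lebesgue. cinner (Cz K0 s x) y * iexp (- t * s))"
    unfolding Ch cinner_cscale_left by simp
  have "norm (weak_integral {0..} g) \<le> kint K0 * norm x"
    using weak_integral(3)[OF meas k bd] unfolding kint_def by simp
  then show "norm (Chat C z x) \<le> 1 / sqrt (2 * pi) * kint K0 * norm x"
    unfolding Ch norm_cscale by (simp add: norm_divide divide_right_mono)
qed

lemma Chat_clinear: "bounded_clinear_op (Chat C (complex_of_real t + \<i> * complex_of_real \<nu>0))"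
proof (rule bounded_clinear_opI[OF _ _ Chat_cinner(2)])
  let ?T = "Chat C (complex_of_real t + \<i> * complex_of_real \<nu>0)"
  have K0: "adm K0" by (rule adm_exp) simp
  note i = integrable_times_iexp[OF Cz_integrable[OF K0]]
  have Cz: "Cz K0 s (x + y) = Cz K0 s x + Cz K0 s y" "Cz K0 s (a *\<^sub>C x) = a *\<^sub>C Cz K0 s x" for s x y a
    using bounded_clinear_opD[OF adm_bounded[OF K0, of s]] unfolding Cz_def by (cases "s < 0", simp, simp)+
  show "?T (x + y) = ?T x + ?T y" for x y
    by (rule cinner_eqI) (simp only: cinner_add_left Chat_cinner Cz distrib_right Bochner_Integration.integral_add[OF i i] distrib_left)
  show "?T (a *\<^sub>C x) = a *\<^sub>C ?T x" for a x
    by (rule cinner_eqI, simp only: cinner_cscale_left Chat_cinner Cz mult.assoc integral_mult_right_zero, rule mult.left_commute)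
qed

lemma sine_pos_K0:
  assumes Im: "\<forall>t::real. nonpos_op (\<lambda>x. t *\<^sub>R Im_op (Chat C (complex_of_real t + \<i> * complex_of_real \<nu>0)) x)"
  shows "sine_pos K0"
  unfolding sine_pos_def
proof (intro allI)
  fix \<tau> x
  let ?T = "Chat C (complex_of_real (- \<tau>) + \<i> * complex_of_real \<nu>0)"
  let ?I = "LINT s|lebesgue. cinner (Cz K0 s x) x * iexp (\<tau> * s)"
  have "cinner ((- \<tau>) *\<^sub>R Im_op ?T x) x \<le> 0" using Im unfolding nonpos_op_def by blast
  moreover have "cinner ((- \<tau>) *\<^sub>R Im_op ?T x) x = of_real (- \<tau> * Im (cinner (?T x) x))"
    unfolding cinner_scaleR_left cinner_Im_op[OF Chat_clinear] of_real_mult ..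
  ultimately have "- \<tau> * Im (cinner (?T x) x) \<le> 0" by (simp add: less_eq_complex_def)
  moreover have "Im (cinner (?T x) x) = 1 / sqrt (2 * pi) * Im ?I"
  proof -
    have *: "Im (of_real r * w) = r * Im w" for r w by simp
    show ?thesis unfolding Chat_cinner(1) minus_minus by (rule *)
  qed
  ultimately have "0 \<le> 1 / sqrt (2 * pi) * (\<tau> * Im ?I)" by (simp only: mult.left_commute)
  moreover have "0 \<le> b" if "0 \<le> a * b" "0 < a" for a b :: real using that by (simp add: zero_le_mult_iff)
  moreover have "0 < 1 / sqrt (2 * pi)" by simp
  ultimately show "0 \<le> \<tau> * Im ?I" by blast
qed

end

subsection \<open>Solving the evolution equation in the weighted spaces\<close>

context
  fixes D :: "'h::chilbert set" and A :: "'h \<Rightarrow> 'h" and C :: "real \<Rightarrow> 'h \<Rightarrow> 'h" and c \<nu>0 \<nu>1 :: real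
  assumes A: "maximal_monotone_linear D A"
    and Cb: "\<forall>s\<ge>0. bounded_clinear_op (C s)"
    and Cw: "\<And>x y. set_borel_measurable lebesgue {0..} (\<lambda>s. cinner (C s x) y)"
    and Cn: "set_borel_measurable lebesgue {0..} (\<lambda>s. onorm (C s))"
    and Ci: "(\<integral>\<^sup>+ s\<in>{0..}. ennreal (onorm (C s) * exp (\<nu>0 * s)) \<partial>lebesgue) < 1"
    and sa: "AE s in lebesgue. s \<ge> 0 \<longrightarrow> selfadjoint_op (C s)"
    and Im_cond: "\<forall>t::real. nonpos_op (\<lambda>x. t *\<^sub>R Im_op (Chat C (complex_of_real t + \<i> * complex_of_real \<nu>0)) x)"
    and \<nu>1: "0 < \<nu>1" "\<nu>1 \<le> \<nu>0"
    and \<nu>1_c: "\<nu>1 / (1 - enn2real (\<integral>\<^sup>+ s\<in>{0..}. ennreal (onorm (C s) * exp (\<nu>1 * s)) \<partial>lebesgue)) \<le> c"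
begin

lemmas adm_C = adm_exp[OF Cb Cw Cn Ci]

abbreviation Kop :: "real \<Rightarrow> 'h l2 \<Rightarrow> 'h l2" where "Kop \<rho> \<equiv> convop (expw \<rho> C)"

definition q :: real where "q = kint (expw (- \<nu>1) C)"

lemma sine_pos_weighted:
  assumes "- \<nu>1 < \<rho>" shows "sine_pos (expw \<rho> C)"
proof (cases "\<rho> = - \<nu>0")
  case True then show ?thesis using sine_pos_K0[OF Cb Cw Cn Ci Im_cond] by simp
next
  case False
  let ?K0 = "expw (- \<nu>0) C"
  have eq: "expw (\<rho> + \<nu>0) ?K0 = expw \<rho> C"
    using wker_exp[of "- (\<rho> + \<nu>0)" "- \<nu>0" C] by simp
  have sa0: "AE s in lebesgue. s \<ge> 0 \<longrightarrow> selfadjoint_op (?K0 s)"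
    using sa by eventually_elim (simp add: selfadjoint_op_def wker_def cinner_scaleR_left cinner_scaleR_right)
  have "sine_pos (expw (\<rho> + \<nu>0) ?K0)"
  proof (rule sine_pos_damped[OF _ sa0 sine_pos_K0[OF Cb Cw Cn Ci Im_cond]])
    show "adm ?K0" by (rule adm_C) simp
    show "\<rho> + \<nu>0 > 0" using assms \<nu>1 by simp
    show "adm (expw (\<rho> + \<nu>0) ?K0)" unfolding eq by (rule adm_C) (use assms \<nu>1 in simp)
  qed
  then show ?thesis unfolding eq .
qed

lemma evolution_weighted:
  assumes \<rho>: "- \<nu>1 < \<rho>"
  shows "evolution (Kop \<rho>) (\<lambda>\<epsilon>. Rop \<epsilon> \<rho>) (pgr D A) (\<lambda>t. ptop (res D A t)) (smooth_data \<rho>) \<rho> q c"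
proof -
  have K: "adm (expw \<rho> C)" by (rule adm_C) (use \<rho> \<nu>1 in simp)
  have K1: "adm (expw (- \<nu>1) C)" by (rule adm_C) (use \<nu>1 in simp)
  have \<nu>1': "- \<nu>0 \<le> - \<nu>1" "- \<nu>1 \<le> \<rho>" using \<rho> \<nu>1 by simp_all
  have q: "0 \<le> q" "q < 1" "kint (expw \<rho> C) \<le> q"
    unfolding q_def using kint_nonneg[OF K1] kint_exp_mono[OF Cb Cw Cn Ci \<nu>1'] by auto
  have qc: "\<nu>1 / (1 - q) \<le> c"
    using \<nu>1_c kint_exp[OF Cb Cw Cn Ci \<nu>1'(1)] unfolding q_def by simp
  show ?thesis
  proof (rule evolution.intro)
    show "bounded_linear (Kop \<rho>)" by (rule bounded_clinear_opD(1)[OF convop_clinear[OF K]])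
    show "norm (Kop \<rho> u) \<le> q * norm u" for u
      by (rule order_trans[OF norm_convop_le[OF K] mult_right_mono[OF q(3) norm_ge_zero]])
    show "0 \<le> q" "q < 1" by (fact q)+
    show "max 0 (- \<rho>) / (1 - q) < c"
    proof -
      have "max 0 (- \<rho>) / (1 - q) < \<nu>1 / (1 - q)" using \<rho> \<nu>1 q by (intro divide_strict_right_mono) auto
      then show ?thesis using qc by simp
    qed
    show "norm (ptop (res D A t) x - ptop (res D A t) y) \<le> norm (x - y)" if t: "t > 0" for t x y
      using norm_ptop_le[OF res_clinear[OF A t], of 1 "x - y"] res_nonexpansive[OF A t]
      by (simp add: bounded_clinear_opD[OF ptop_clinear[OF res_clinear[OF A t]]])
    show "pgr D A (ptop (res D A t) g) ((1/t) *\<^sub>R (g - ptop (res D A t) g))" if "t > 0" for t g by (rule pgr_res[OF A that])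
    show "pgr D A (u + v) (a + b)" if "pgr D A u a" "pgr D A v b" for u v a b by (rule pgr_add[OF A that])
    show "pgr D A (r *\<^sub>R u) (r *\<^sub>R a)" if "pgr D A u a" for r u a by (rule pgr_scaleR[OF A that])
    show "0 \<le> Re (cinner a u)" if "pgr D A u a" for u a by (rule pgr_accretive[OF A that])
    show "pgr D A u a" if "\<And>n::nat. pgr D A (X n) (Y n)" "X \<longlonglongrightarrow> u" "Y \<longlonglongrightarrow> a" for X Y u a by (rule pgr_closed[OF A that])
    show "a = 0" if "pgr D A 0 a" for a by (rule pgr_zero[OF A that])
    show "\<exists>f'\<in>smooth_data \<rho>. \<forall>\<epsilon>>0. 1 + \<epsilon> * \<rho> > 0 \<longrightarrow> f = Rop \<epsilon> \<rho> (f + \<epsilon> *\<^sub>R f')" if "f \<in> smooth_data \<rho>" for f :: "'h l2"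
      by (rule smooth_data_derivative[OF that])
    show "closure (smooth_data \<rho>) = (UNIV :: 'h l2 set)" by (rule smooth_data_dense)
    fix \<epsilon> assume e: "\<epsilon> > 0" "1 + \<epsilon> * \<rho> > 0"
    show "bounded_linear (Rop \<epsilon> \<rho> :: 'h l2 \<Rightarrow> _)" by (rule bounded_clinear_opD(1)[OF Rop_clinear[OF e]])
    show "norm (Rop \<epsilon> \<rho> u) \<le> 1 / (1 + \<epsilon> * \<rho>) * norm u" for u :: "'h l2" by (rule norm_Rop_le[OF e])
    show "Rop \<epsilon> \<rho> (Kop \<rho> u) = Kop \<rho> (Rop \<epsilon> \<rho> u)" for u unfolding Rop_def by (rule scalar_convop_commute[OF adm_rker[OF e] K])
    show "pgr D A (Rop \<epsilon> \<rho> u) (Rop \<epsilon> \<rho> a)" if "pgr D A u a" for u a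
    proof -
      have "Rop \<epsilon> \<rho> u = Rop \<epsilon> \<rho> (ptop (res D A 1) (u + a))" using that unfolding pgr_def[OF A] by (rule arg_cong)
      also have "\<dots> = ptop (res D A 1) (Rop \<epsilon> \<rho> (u + a))"
        unfolding Rop_def by (rule scalar_convop_commute_ptop[OF adm_rker[OF e] res1[OF A], symmetric])
      finally show ?thesis unfolding pgr_def[OF A] bounded_clinear_opD(2)[OF Rop_clinear[OF e]] .
    qed
    show "0 \<le> Re (cinner ((1/\<epsilon>) *\<^sub>R (z - Rop \<epsilon> \<rho> z) - \<rho> *\<^sub>R Rop \<epsilon> \<rho> z) (Rop \<epsilon> \<rho> z - Kop \<rho> (Rop \<epsilon> \<rho> z)))" for z
      by (rule derivative_convolution_positive[OF K sine_pos_weighted[OF \<rho>] e])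
    fix \<delta> assume d: "\<delta> > 0" "1 + \<delta> * \<rho> > 0"
    show "Rop \<epsilon> \<rho> (Rop \<delta> \<rho> u) = Rop \<delta> \<rho> (Rop \<epsilon> \<rho> u)" for u :: "'h l2"
      unfolding Rop_def by (rule scalar_convop_commute[OF adm_rker[OF e] adm_rker[OF d]])
    show "Rop \<epsilon> \<rho> z = Rop \<delta> \<rho> (Rop \<epsilon> \<rho> z + \<delta> *\<^sub>R ((1/\<epsilon>) *\<^sub>R (z - Rop \<epsilon> \<rho> z)))" for z :: "'h l2"
      by (rule Rop_resolvent[OF e d])
  qed
qed

abbreviation Sop :: "real \<Rightarrow> 'h l2 \<Rightarrow> 'h l2" where
  "Sop \<rho> \<equiv> evolution.S (Kop \<rho>) (\<lambda>\<epsilon>. Rop \<epsilon> \<rho>) (pgr D A) c"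

lemma pointwise_graph_iff: "(u, a) \<in> pointwise_graph \<rho> D A \<longleftrightarrow> u \<in> L2w \<rho> \<and> a \<in> L2w \<rho> \<and> pgr D A (emb \<rho> u) (emb \<rho> a)"
proof -
  have "(AE t in lebesgue. u t \<in> D \<and> a t = A (u t)) \<longleftrightarrow> pgr D A (emb \<rho> u) (emb \<rho> a)" if u: "u \<in> L2w \<rho>" and a: "a \<in> L2w \<rho>"
  proof -
    have *: "exp r *\<^sub>R x \<in> D \<and> exp r *\<^sub>R y = A (exp r *\<^sub>R x) \<longleftrightarrow> x \<in> D \<and> y = A x" for r :: real and x y
    proof
      assume x: "exp r *\<^sub>R x \<in> D \<and> exp r *\<^sub>R y = A (exp r *\<^sub>R x)"
      then have "x \<in> D" using mm_scaleR(1)[OF A, of "exp r *\<^sub>R x" "inverse (exp r)"] by simp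
      then show "x \<in> D \<and> y = A x" using x by (simp add: mm_scaleR[OF A])
    qed (simp add: mm_scaleR[OF A])
    have "pgr D A (emb \<rho> u) (emb \<rho> a) \<longleftrightarrow> (AE t in lebesgue. exp (- \<rho> * t) *\<^sub>R u t \<in> D \<and> exp (- \<rho> * t) *\<^sub>R a t = A (exp (- \<rho> * t) *\<^sub>R u t))"
      unfolding pgr_iff[OF A]
    proof
      assume "AE t in lebesgue. rep_l2 (emb \<rho> u) t \<in> D \<and> rep_l2 (emb \<rho> a) t = A (rep_l2 (emb \<rho> u) t)"
      then show "AE t in lebesgue. exp (- \<rho> * t) *\<^sub>R u t \<in> D \<and> exp (- \<rho> * t) *\<^sub>R a t = A (exp (- \<rho> * t) *\<^sub>R u t)"
        using rep_emb[OF u] rep_emb[OF a] by eventually_elim simp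
    next
      assume "AE t in lebesgue. exp (- \<rho> * t) *\<^sub>R u t \<in> D \<and> exp (- \<rho> * t) *\<^sub>R a t = A (exp (- \<rho> * t) *\<^sub>R u t)"
      then show "AE t in lebesgue. rep_l2 (emb \<rho> u) t \<in> D \<and> rep_l2 (emb \<rho> a) t = A (rep_l2 (emb \<rho> u) t)"
        using rep_emb[OF u] rep_emb[OF a] by eventually_elim simp
    qed
    then show ?thesis unfolding * by simp
  qed
  then show ?thesis unfolding pointwise_graph_def by auto
qed

lemma gclosure_evo_graph_iff:
  assumes \<rho>: "- \<nu>1 < \<rho>"
  shows "(u, f) \<in> gclosure \<rho> (evo_graph \<rho> C c D A) \<longleftrightarrow> u \<in> L2w \<rho> \<and> f \<in> L2w \<rho> \<and> emb \<rho> u = Sop \<rho> (emb \<rho> f)"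
proof -
  interpret e: evolution "Kop \<rho>" "\<lambda>\<epsilon>. Rop \<epsilon> \<rho>" "pgr D A" "\<lambda>t. ptop (res D A t)" "smooth_data \<rho>" \<rho> q c
    by (rule evolution_weighted[OF \<rho>])
  have K: "adm (expw \<rho> C)" by (rule adm_C) (use \<rho> \<nu>1 in simp)
  have "adm (wker (\<lambda>s. exp (- 0 * s)) C)" by (rule adm_C) (use \<nu>1 in simp)
  then have C0: "adm C" by (simp add: wker_def)
  have deriv: "(w, g) \<in> deriv_graph \<rho> \<longleftrightarrow> w \<in> L2w \<rho> \<and> g \<in> L2w \<rho> \<and> e.dgr (emb \<rho> w) (emb \<rho> g)" for w g
    unfolding e.dgr_def using deriv_graph_iff[of _ \<rho> w g] resolvent_param[of \<rho>] by blast
  have evoI: "e.evo (emb \<rho> (fst p)) (emb \<rho> (snd p))" if "p \<in> evo_graph \<rho> C c D A" for p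
  proof -
    obtain u g a where p: "p = (u, \<lambda>t. g t + c *\<^sub>R u t + a t)" and ug: "(u, g) \<in> dconv_graph \<rho> C" and ua: "(u, a) \<in> pointwise_graph \<rho> D A"
      using \<open>p \<in> _\<close> unfolding evo_graph_def by blast
    obtain w v where wv: "(w, v) \<in> conv_graph \<rho> C" "u = (\<lambda>t. w t - v t)" "(w, g) \<in> deriv_graph \<rho>"
      using ug unfolding dconv_graph_def by blast
    have L: "w \<in> L2w \<rho>" "v \<in> L2w \<rho>" "g \<in> L2w \<rho>" "u \<in> L2w \<rho>" "a \<in> L2w \<rho>"
      using wv(1,3) ua unfolding conv_graph_iff[OF C0 K] deriv pointwise_graph_iff by auto
    have "emb \<rho> u = emb \<rho> w - Kop \<rho> (emb \<rho> w)"
      using wv(1) unfolding conv_graph_iff[OF C0 K] wv(2) emb_diff[OF L(1,2)] by simp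
    moreover have "emb \<rho> (\<lambda>t. g t + c *\<^sub>R u t + a t) = emb \<rho> g + c *\<^sub>R emb \<rho> u + emb \<rho> a"
      using L by (simp add: emb_add emb_scaleR L2w_add L2w_scaleR)
    ultimately show ?thesis
      using wv(3) ua unfolding p fst_conv snd_conv e.evo_def deriv pointwise_graph_iff by blast
  qed
  have evoE: "\<exists>p. p \<in> evo_graph \<rho> C c D A \<and> fst p \<in> L2w \<rho> \<and> snd p \<in> L2w \<rho> \<and> emb \<rho> (fst p) = x \<and> emb \<rho> (snd p) = y"
    if xy: "e.evo x y" for x y
  proof -
    obtain w g a where w: "x = w - Kop \<rho> w" "e.dgr w g" "pgr D A x a" "y = g + c *\<^sub>R x + a"
      using xy unfolding e.evo_def by blast
    define w' v' g' a' where "w' = unemb \<rho> w" and "v' = unemb \<rho> (Kop \<rho> w)" and "g' = unemb \<rho> g" and "a' = unemb \<rho> a"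
    define u' where "u' = (\<lambda>t. w' t - v' t)"
    have L: "w' \<in> L2w \<rho>" "v' \<in> L2w \<rho>" "g' \<in> L2w \<rho>" "a' \<in> L2w \<rho>"
      by (simp_all add: w'_def v'_def g'_def a'_def unemb_L2w)
    have em: "emb \<rho> w' = w" "emb \<rho> v' = Kop \<rho> w" "emb \<rho> g' = g" "emb \<rho> a' = a"
      by (simp_all add: w'_def v'_def g'_def a'_def)
    have u': "u' \<in> L2w \<rho>" "emb \<rho> u' = x" unfolding u'_def by (simp_all add: L2w_diff emb_diff L em w(1))
    have "(w', v') \<in> conv_graph \<rho> C" unfolding conv_graph_iff[OF C0 K] by (simp add: L em)
    moreover have "(w', g') \<in> deriv_graph \<rho>" unfolding deriv by (simp add: L em w(2))
    ultimately have "(u', g') \<in> dconv_graph \<rho> C" unfolding dconv_graph_def u'_def by blast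
    moreover have "(u', a') \<in> pointwise_graph \<rho> D A" unfolding pointwise_graph_iff by (simp add: L em u' w(3))
    ultimately have "(u', \<lambda>t. g' t + c *\<^sub>R u' t + a' t) \<in> evo_graph \<rho> C c D A" unfolding evo_graph_def by blast
    moreover have "(\<lambda>t. g' t + c *\<^sub>R u' t + a' t) \<in> L2w \<rho>" "emb \<rho> (\<lambda>t. g' t + c *\<^sub>R u' t + a' t) = y"
      using L u' by (simp_all add: emb_add emb_scaleR L2w_add L2w_scaleR em w(4))
    ultimately show ?thesis using u' by (intro exI[of _ "(u', \<lambda>t. g' t + c *\<^sub>R u' t + a' t)"]) simp
  qed
  show ?thesis unfolding gclosure_iff e.evo_closure[symmetric]
  proof (intro conj_cong refl)
    show "(\<exists>s. (\<forall>n. s n \<in> evo_graph \<rho> C c D A \<and> fst (s n) \<in> L2w \<rho> \<and> snd (s n) \<in> L2w \<rho>) \<and>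
          (\<lambda>n. emb \<rho> (fst (s n))) \<longlonglongrightarrow> emb \<rho> u \<and> (\<lambda>n. emb \<rho> (snd (s n))) \<longlonglongrightarrow> emb \<rho> f) \<longleftrightarrow>
        (\<exists>X Y. (\<forall>n::nat. e.evo (X n) (Y n)) \<and> X \<longlonglongrightarrow> emb \<rho> u \<and> Y \<longlonglongrightarrow> emb \<rho> f)" (is "?l \<longleftrightarrow> ?r")
    proof
      assume ?l
      then obtain s where s: "\<And>n. s n \<in> evo_graph \<rho> C c D A" "(\<lambda>n. emb \<rho> (fst (s n))) \<longlonglongrightarrow> emb \<rho> u" "(\<lambda>n. emb \<rho> (snd (s n))) \<longlonglongrightarrow> emb \<rho> f"
        by blast
      then show ?r
        by (intro exI[of _ "\<lambda>n. emb \<rho> (fst (s n))"] exI[of _ "\<lambda>n. emb \<rho> (snd (s n))"] conjI allI evoI)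
    next
      assume ?r
      then obtain X Y where XY: "\<And>n::nat. e.evo (X n) (Y n)" "X \<longlonglongrightarrow> emb \<rho> u" "Y \<longlonglongrightarrow> emb \<rho> f" by blast
      have "\<forall>n. \<exists>p. p \<in> evo_graph \<rho> C c D A \<and> fst p \<in> L2w \<rho> \<and> snd p \<in> L2w \<rho> \<and> emb \<rho> (fst p) = X n \<and> emb \<rho> (snd p) = Y n"
        using evoE[OF XY(1)] by blast
      from choice[OF this] obtain s where s: "\<And>n. s n \<in> evo_graph \<rho> C c D A \<and> fst (s n) \<in> L2w \<rho> \<and> snd (s n) \<in> L2w \<rho> \<and>
          emb \<rho> (fst (s n)) = X n \<and> emb \<rho> (snd (s n)) = Y n" by blast
      then show ?l using XY(2,3) by (intro exI[of _ s]) simp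
    qed
  qed
qed

lemma Sop_compat:
  assumes "- \<nu>1 < \<rho>" "- \<nu>1 < \<mu>" "compat (\<rho> - \<mu>) a b"
  shows "compat (\<rho> - \<mu>) (Sop \<rho> a) (Sop \<mu> b)"
proof (rule evolution_related[OF evolution_weighted[OF assms(1)] evolution_weighted[OF assms(2)]])
  have K: "adm (expw \<rho> C)" "adm (expw \<mu> C)"
    by (rule adm_C, use assms \<nu>1 in simp)+
  have eq: "wker (\<lambda>s. exp ((\<rho> - \<mu>) * s)) (expw \<rho> C) = expw \<mu> C"
    unfolding wker_exp by simp
  show "compat (\<rho> - \<mu>) (0 :: 'h l2) 0"
    unfolding compat_def using rep_l2_zero[where 'b='h] by eventually_elim simp
  show "compat (\<rho> - \<mu>) (Kop \<rho> x) (Kop \<mu> y)" if "compat (\<rho> - \<mu>) x y" for x y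
    using compat_convop[OF that K(1)] K(2) unfolding eq by blast
  show "compat (\<rho> - \<mu>) (ptop (res D A t) x) (ptop (res D A t) y)" if "t > 0" "compat (\<rho> - \<mu>) x y" for t x y
    by (rule compat_ptop[OF that(2) res_clinear[OF A that(1)]])
qed (auto intro: compat_add compat_scaleR compat_lim compat_Rop assms(3))

lemma evolution_stable:
  assumes \<rho>: "\<rho> > 0"
  shows "boundedly_invertible_graph \<rho> (gclosure \<rho> (evo_graph \<rho> C c D A))"
    and "exp_stable_graph \<rho> (gclosure \<rho> (evo_graph \<rho> C c D A)) \<nu>1"
proof -
  let ?G = "gclosure \<rho> (evo_graph \<rho> C c D A)"
  have \<rho>': "- \<nu>1 < \<rho>" using \<rho> \<nu>1 by simp
  interpret e: evolution "Kop \<rho>" "\<lambda>\<epsilon>. Rop \<epsilon> \<rho>" "pgr D A" "\<lambda>t. ptop (res D A t)" "smooth_data \<rho>" \<rho> q c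
    by (rule evolution_weighted[OF \<rho>'])
  note G = gclosure_evo_graph_iff[OF \<rho>']
  show "boundedly_invertible_graph \<rho> ?G"
    unfolding boundedly_invertible_graph_def
  proof (intro conjI allI impI ballI)
    fix u f f' assume "(u, f) \<in> ?G \<and> (u, f') \<in> ?G"
    then have L: "f \<in> L2w \<rho>" "f' \<in> L2w \<rho>" and S: "e.S (emb \<rho> f) = e.S (emb \<rho> f')" unfolding G by auto
    have "emb \<rho> f - emb \<rho> f' = 0" by (rule e.S_inj) (simp only: e.S_diff S diff_self)
    then show "nrm \<rho> (\<lambda>t. f t - f' t) = 0" by (simp add: nrm_eq L2w_diff emb_diff L)
  next
    fix f :: "real \<Rightarrow> 'h" assume "f \<in> L2w \<rho>"
    then show "\<exists>u. (u, f) \<in> ?G"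
      by (intro exI[of _ "unemb \<rho> (Sop \<rho> (emb \<rho> f))"]) (simp add: G unemb_L2w)
  next
    show "\<exists>K. \<forall>(u, f)\<in>?G. nrm \<rho> u \<le> K * nrm \<rho> f"
    proof (intro exI ballI, clarify)
      fix u f assume "(u, f) \<in> ?G"
      then show "nrm \<rho> u \<le> (1 / e.\<kappa>) * nrm \<rho> f" unfolding G using e.S_norm[of "emb \<rho> f"] by (simp add: nrm_eq)
    qed
  qed
  show "exp_stable_graph \<rho> ?G \<nu>1"
    unfolding exp_stable_graph_def
  proof (intro allI impI, elim conjE)
    fix \<nu> f u \<mu>
    assume \<nu>: "0 \<le> \<nu>" "\<nu> < \<nu>1" and f: "f \<in> L2w (- \<nu>)" "f \<in> L2w \<rho>" and uf: "(u, f) \<in> ?G"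
      and \<mu>: "- \<nu> < \<mu>" "\<mu> \<le> \<rho>"
    have f\<mu>: "f \<in> L2w \<mu>" by (rule L2w_interpolate[OF f]) (use \<mu> in auto)
    have \<mu>': "- \<nu>1 < \<mu>" using \<nu> \<mu> by simp
    have u: "u \<in> L2w \<rho>" "emb \<rho> u = Sop \<rho> (emb \<rho> f)" using uf unfolding G by auto
    show "u \<in> L2w \<mu>"
      by (rule compat_emb_L2w[OF u(1)], unfold u(2), rule Sop_compat[OF \<rho>' \<mu>' compat_emb[OF f(2) f\<mu>]])
  qed
qed

end

theorem theorem4p8:
  fixes D :: "'h::chilbert set" and A :: "'h \<Rightarrow> 'h"
    and C :: "real \<Rightarrow> 'h \<Rightarrow> 'h"
    and c \<nu>0 \<nu>1 :: real
  assumes A: "maximal_monotone_linear D A"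
    and c: "c > 0"
    and C_bounded: "\<forall>t\<ge>0. bounded_clinear_op (C t)"
    and C_weak_meas: "\<forall>x y. set_borel_measurable lebesgue {0..} (\<lambda>t. cinner (C t x) y)"
    and C_norm_meas: "set_borel_measurable lebesgue {0..} (\<lambda>t. onorm (C t))"
    and \<nu>0: "\<nu>0 > 0"
    and C_int: "(\<integral>\<^sup>+ t\<in>{0..}. ennreal (onorm (C t) * exp (\<nu>0 * t)) \<partial>lebesgue) < 1"
    and sa: "AE t in lebesgue. t \<ge> 0 \<longrightarrow> selfadjoint_op (C t)"
    and comm: "AE p in lborel \<Otimes>\<^sub>M lborel. fst p \<ge> 0 \<longrightarrow> snd p \<ge> 0 \<longrightarrow>
                 C (fst p) \<circ> C (snd p) = C (snd p) \<circ> C (fst p)"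
    and Im_cond: "\<forall>t::real. nonpos_op (\<lambda>x. t *\<^sub>R Im_op (Chat C (complex_of_real t + \<i> * complex_of_real \<nu>0)) x)"
    and \<nu>1: "0 < \<nu>1" "\<nu>1 \<le> \<nu>0"
    and \<nu>1_c: "\<nu>1 / (1 - enn2real (\<integral>\<^sup>+ s\<in>{0..}. ennreal (onorm (C s) * exp (\<nu>1 * s)) \<partial>lebesgue)) \<le> c"
  shows "\<forall>\<rho>>0. boundedly_invertible_graph \<rho> (gclosure \<rho> (evo_graph \<rho> C c D A))
              \<and> exp_stable_graph \<rho> (gclosure \<rho> (evo_graph \<rho> C c D A)) \<nu>1"
  using evolution_stable[OF A C_bounded C_weak_meas[rule_format] C_norm_meas C_int sa Im_cond \<nu>1 \<nu>1_c] by blast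

end
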